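(* Let $\mathfrak{g}$ be a bounded and degree-wise finite-dimensional cochain complex over a field $\mathbb{K}$ of characteristic $0$, let $n\in\mathbb{Z}$, and let $A=\mathrm{Sym}(\mathfrak{g}^\ast[-1])$. Via the identification $\pi\leftrightarrow\{\pi^{(m,l)}\}$ described in the context (i.e. $\Phi(\pi)=\sum_{m,l}s^{mn+l}\pi^{(m,l)}$), the datum of an $n$-shifted Poisson structure on the free CDGA $A$ is equivalent to a family of maps $$\Big\{\pi^{(m,l)}\in\underline{\mathrm{hom}}^-_{\pm}\big(\mathfrak{g}^{\otimes l},\mathfrak{g}^{\otimes m}\big)^{(1-m)n+2-l}~:~m\geq 2,~l\geq 0\Big\}$$ which, for every fixed $m\geq 2$, is bounded in $l$ (i.e. only finitely many $\pi^{(m,l)}$ are non-zero) and which satisfies $$(-1)^{(m-1)n+l-1}\,\partial\pi^{(m,l)}+\sum_{\substack{m_1,m_2\geq 2\\ m_1+m_2-1=m}}~\sum_{\substack{l_1,l_2\geq 0\\ l_1+l_2-1=l}}(-1)^{((1-m_1)n+2-l_1)((m_2-1)n+l_2-1)}\,(-1)^{n(m_2-1)(l_1-1)}~\pi^{(m_1,l_1)}\star\pi^{(m_2,l_2)}=0$$ for all $m\geq 2$ and $l\geq 0$.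
   Context: **Conventions.** $\mathbb{K}$ is a field of characteristic $0$. Cochain complexes $V=(V^i,\mathrm{d})_{i\in\mathbb{Z}}$ have differentials of degree $+1$; the tensor product carries $\mathrm{d}(v\otimes w)=\mathrm{d}v\otimes w+(-1)^{|v|}v\otimes\mathrm{d}w$ and the symmetric braiding $\gamma(v\otimes w)=(-1)^{|v||w|}w\otimes v$. $\underline{\mathrm{hom}}(V,W)^i=\prod_j\mathrm{Hom}(V^j,W^{j+i})$ with $\partial L=\mathrm{d}_WL-(-1)^{|L|}L\,\mathrm{d}_V$. The shift is $V[n]^i=V^{i+n}$, $\mathrm{d}_{V[n]}=(-1)^n\mathrm{d}_V$; elements of $V[n]$ are written $s^{-n}v$, where $s^{-n}$ has degree $-n$, $s^{-n}s^{-m}=s^{-n-m}$, and Koszul signs arise when moving $s$ past elements; in particular $Q\,(s^{-n-1}T)=(-1)^{|Q|(n+1)}s^{-n-1}(QT)$. **Polyvectors.** For a commutative differential graded algebra (CDGA) $A$, $\mathbb{T}_A\subseteq\underline{\mathrm{hom}}(A,A)$ is the complex of derivations, $D(aa')=(Da)a'+(-1)^{|D||a|}a(Da')$, an $A$-dg-module via $(aD)(a')=a\,D(a')$, with Lie bracket $[D,D']=DD'-(-1)^{|D||D'|}D'D$. The CDGA of $n$-shifted polyvectors is $\mathrm{Pol}(A,n)=\mathrm{Sym}_A(\mathbb{T}_A[-n-1])=\bigoplus_{m\geq0}\mathrm{Sym}_A^m(\mathbb{T}_A[-n-1])$, where $m$ is called the weight; its completion is $\widehat{\mathrm{Pol}}(A,n)=\prod_{m\geq0}\mathrm{Sym}^m_A(\mathbb{T}_A[-n-1])$.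 The Schouten–Nijenhuis bracket $[\![\cdot,\cdot]\!]$ is the degree $0$ Lie bracket on $\mathrm{Pol}(A,n)[n+1]$ determined by $[\![s^{-n-1}a,s^{-n-1}a']\!]=0$, $[\![s^{-n-1}s^{n+1}D,s^{-n-1}a]\!]=(-1)^{|D|(n+1)}s^{-n-1}D(a)$, $[\![s^{-n-1}s^{n+1}D,s^{-n-1}s^{n+1}D']\!]=s^{-n-1}s^{n+1}[D,D']$ for $a,a'\in A$, $D,D'\in\mathbb{T}_A$, by (graded) antisymmetry, and by $[\![s^{-n-1}P,s^{-n-1}QR]\!]=[\![s^{-n-1}P,s^{-n-1}Q]\!]R+(-1)^{|P||Q|}Q[\![s^{-n-1}P,s^{-n-1}R]\!]$. It lowers total weight by $1$ and extends weight-wise to $\widehat{\mathrm{Pol}}(A,n)[n+1]$. An $n$-shifted Poisson structure on $A$ is an element $\pi=\sum_{m\geq2}\pi^{(m)}\in\widehat{\mathrm{Pol}}(A,n)^{n+2}$ of degree $n+2$ and weight $\geq2$ with $\partial(s^{-n-1}\pi)+\frac12[\![s^{-n-1}\pi,s^{-n-1}\pi]\!]=0$. **Free case.** $\mathfrak{g}$ is a bounded, degree-wise finite-dimensional cochain complex, $\mathfrak{g}^\ast=\underline{\mathrm{hom}}(\mathfrak{g},\mathbb{K})$, with pairing $\langle\theta,x\rangle$. For $A=\mathrm{Sym}(\mathfrak{g}^\ast[-1])$ one has $\mathbb{T}_A\cong A\otimes\mathfrak{g}[1]$, where $s^{-1}x\in\mathfrak{g}[1]$ is the derivation with $s^{-1}x(s\theta)=\langle\theta,x\rangle$.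 Hence, with $s^nx:=s^{n+1}s^{-1}x$, $\mathrm{Pol}(A,n)\cong\mathrm{Sym}(\mathfrak{g}[-n])\otimes\mathrm{Sym}(\mathfrak{g}^\ast[-1])=\bigoplus_{m,l\geq0}\mathrm{Pol}^{m,l}$ with $\mathrm{Pol}^{m,l}=\mathrm{Sym}^m(\mathfrak{g}[-n])\otimes\mathrm{Sym}^l(\mathfrak{g}^\ast[-1])$, and $\widehat{\mathrm{Pol}}(A,n)=\prod_{m}\bigoplus_{l}\mathrm{Pol}^{m,l}$. **Polyvectors as maps.** For a permutation $\sigma\in S_k$ let $\gamma_\sigma(y_1\otimes\cdots\otimes y_k)=\pm\,y_{\sigma(1)}\otimes\cdots\otimes y_{\sigma(k)}$ with $\pm$ the Koszul sign of $\gamma$, and let $|\sigma|\in\mathbb{Z}_2$ be its signature. $\underline{\mathrm{hom}}^-_\pm(\mathfrak{g}^{\otimes l},\mathfrak{g}^{\otimes m})\subseteq\underline{\mathrm{hom}}(\mathfrak{g}^{\otimes l},\mathfrak{g}^{\otimes m})$ is the subcomplex of those $L$ with $L\gamma_\sigma=(-1)^{|\sigma|}L$ for all $\sigma\in S_l$ and $\gamma_\rho L=(-1)^{|\rho|n}L$ for all $\rho\in S_m$. There is a cochain isomorphism $\Phi:\mathrm{Pol}(A,n)\to\bigoplus_{m,l}\underline{\mathrm{hom}}^-_\pm(\mathfrak{g}^{\otimes l},\mathfrak{g}^{\otimes m})[-mn-l]$, $$\Phi(s^nx_1\cdots s^nx_m\,s\theta_1\cdots s\theta_l)=(-1)^{\sum_k|x_k|((m-k)n+l)}(-1)^{\sum_j|\theta_j|(l-j)}\,s^{mn+l}L_B,$$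 $$L_B(y_1,\dots,y_l)=\sum_{\sigma\in S_l}\sum_{\rho\in S_m}(-1)^{|x_1\cdots x_m|^\rho_\pm}(-1)^{|\theta_1\cdots\theta_l|^\sigma_-}(-1)^{|y_1\cdots y_l|^{\mathrm{rev}}_+}\,x_{\rho(1)}\otimes\cdots\otimes x_{\rho(m)}\prod_{j=1}^l\langle\theta_{\sigma(j)},y_j\rangle.$$ Here $(-1)^{|v_1\cdots v_k|^\rho_{+}}$ (resp. $(-1)^{|v_1\cdots v_k|^\rho_-}$) is the sign with $v_1\cdots v_k=(\text{sign})\,v_{\rho(1)}\cdots v_{\rho(k)}$ in the graded symmetric (resp. exterior) power; $\pm$ means $+$ for $n$ even and $-$ for $n$ odd; $\mathrm{rev}$ is the order-reversing permutation. $\Phi$ extends weight-wise to the completion (with $\prod_m\bigoplus_l$). **The operation $\star$.** $\mathrm{Sh}(p,q)$ is the set of $\sigma\in S_{p+q}$ with $\sigma(1)<\cdots<\sigma(p)$ and $\sigma(p+1)<\cdots<\sigma(p+q)$. For $\rho\in S_k$ let $\hat\gamma_\rho$ move the $i$-th tensor factor to position $\rho(i)$ (i.e. $\hat\gamma_\rho=\gamma_{\rho^{-1}}$, with Koszul signs). For $L\in\underline{\mathrm{hom}}^-_\pm(\mathfrak{g}^{\otimes l},\mathfrak{g}^{\otimes m})$ and $L'\in\underline{\mathrm{hom}}^-_\pm(\mathfrak{g}^{\otimes l'},\mathfrak{g}^{\otimes m'})$ set $$L\star L'=\sum_{\sigma\in\mathrm{Sh}(l-1,l')}\sum_{\rho\in\mathrm{Sh}(m,m'-1)}(-1)^{|\sigma|}(-1)^{|\rho|n}~\hat\gamma_\rho\circ\big(L\otimes\mathrm{id}^{\otimes(m'-1)}\big)\circ\big(\mathrm{id}^{\otimes(l-1)}\otimes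 L'\big)\circ\gamma_\sigma,$$ a map $\mathfrak{g}^{\otimes(l+l'-1)}\to\mathfrak{g}^{\otimes(m+m'-1)}$, where the first output of $L'$ is fed into the last input of $L$ and $(\mathrm{id}^{\otimes(l-1)}\otimes L')$ carries the Koszul sign of moving $L'$ past the first $l-1$ arguments; $L\star L':=0$ if $l=0$ or $m'=0$. *)

theory Defs
  imports
    Complex_Main
    "HOL-Library.Poly_Mapping"
    "HOL-Library.Function_Algebras"
    "HOL-Combinatorics.Permutations"
begin

section \<open>Cochain complexes\<close>

text \<open>
  A cochain complex is a family of subspaces V^i of one ambient vector space with maps
  d^i : V^i \<rightarrow> V^{i+1}.  No independence of the subspaces is assumed, and only homogeneous elements
  are used: wherever the degree of an element matters, it is passed along with the element.
\<close>

record ('k, 'v) cplx =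
  grade :: "int \<Rightarrow> 'v set"
  scl :: "'k \<Rightarrow> 'v \<Rightarrow> 'v"
  dif :: "int \<Rightarrow> 'v \<Rightarrow> 'v"

record ('k, 'a) dga = "('k, 'a) cplx" +
  mul :: "'a \<Rightarrow> 'a \<Rightarrow> 'a"
  aone :: "'a"

text \<open>In a dg-module, \<open>act M i a x\<close> is the product of a, of degree i, with x.\<close>

record ('k, 'a, 'm) dgmod = "('k, 'm) cplx" +
  act :: "int \<Rightarrow> 'a \<Rightarrow> 'm \<Rightarrow> 'm"

abbreviation sg :: "int \<Rightarrow> 'k::field" where
  "sg i \<equiv> (- 1) powi i"

definition linear_on ::
    "('k, 'v::ab_group_add, 'y) cplx_scheme \<Rightarrow> 'v set \<Rightarrow> ('k, 'w::ab_group_add, 'z) cplx_scheme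
      \<Rightarrow> ('v \<Rightarrow> 'w) \<Rightarrow> bool" where
  "linear_on V S W f \<longleftrightarrow>
     (\<forall>x\<in>S. \<forall>y\<in>S. f (x + y) = f x + f y) \<and> (\<forall>c. \<forall>x\<in>S. f (scl V c x) = scl W c (f x))"

definition cochain_complex :: "('k::field, 'v::ab_group_add) cplx \<Rightarrow> bool" where
  "cochain_complex V \<longleftrightarrow>
     vector_space (scl V) \<and>
     (\<forall>i. module.subspace (scl V) (grade V i)) \<and>
     (\<forall>i. linear_on V (grade V i) V (dif V i)) \<and>
     (\<forall>i. \<forall>x\<in>grade V i. dif V i x \<in> grade V (i + 1) \<and> dif V (i + 1) (dif V i x) = 0)"

definition bounded_cplx :: "('k, 'v::zero) cplx \<Rightarrow> bool" where
  "bounded_cplx V \<longleftrightarrow> (\<exists>N. \<forall>i. \<bar>i\<bar> > N \<longrightarrow> grade V i = {0})"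

definition degreewise_finite_dim :: "('k::field, 'v::ab_group_add) cplx \<Rightarrow> bool" where
  "degreewise_finite_dim V \<longleftrightarrow> (\<forall>i. \<exists>B. finite B \<and> grade V i = module.span (scl V) B)"

text \<open>
  The element s^{-n} v of V[n] is represented by v itself, placed in degree |v| - n.
\<close>

definition shift :: "int \<Rightarrow> ('k::field, 'v, 'z) cplx_scheme \<Rightarrow> ('k, 'v) cplx" where
  "shift n V =
     \<lparr>grade = (\<lambda>i. grade V (i + n)), scl = scl V, dif = (\<lambda>i x. scl V (sg n) (dif V (i + n) x))\<rparr>"

text \<open>The sign in the action comes from a s^{-n} x = (-1)^{|a| n} s^{-n} (a x).\<close>

definition shift_mod ::
    "int \<Rightarrow> ('k::field, 'a, 'm) dgmod \<Rightarrow> ('k, 'a, 'm) dgmod" where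
  "shift_mod n M =
     cplx.extend (shift n M) \<lparr>act = (\<lambda>i a x. scl M (sg (i * n)) (act M i a x))\<rparr>"

text \<open>
  An element of degree i of the internal hom is a family of linear maps L j : V^j \<rightarrow> W^{j+i}; each L j is
  extended by 0 to the ambient type, so that equality of families is equality of functions.
\<close>

definition hom_cplx ::
    "('k::field, 'v::ab_group_add, 'y) cplx_scheme \<Rightarrow> ('k, 'w::ab_group_add, 'z) cplx_scheme
      \<Rightarrow> ('k, int \<Rightarrow> 'v \<Rightarrow> 'w) cplx" where
  "hom_cplx V W =
     \<lparr>grade = (\<lambda>i. {L. \<forall>j. L j ` grade V j \<subseteq> grade W (j + i) \<and> linear_on V (grade V j) W (L j)
                         \<and> (\<forall>x. x \<notin> grade V j \<longrightarrow> L j x = 0)}),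
      scl = (\<lambda>c L j x. scl W c (L j x)),
      dif = (\<lambda>i L j x. if x \<in> grade V j
                       then dif W (j + i) (L j x) - scl W (sg i) (L (j + 1) (dif V j x)) else 0)\<rparr>"

definition ground :: "('k::field, 'k) dga" where
  "ground = \<lparr>grade = (\<lambda>i. if i = 0 then UNIV else {0}), scl = (*), dif = (\<lambda>_ _. 0),
             mul = (*), aone = 1\<rparr>"

definition dual :: "('k::field, 'v::ab_group_add) cplx \<Rightarrow> ('k, 'k, int \<Rightarrow> 'v \<Rightarrow> 'k) dgmod" where
  "dual V = cplx.extend (hom_cplx V ground) \<lparr>act = (\<lambda>i. scl (hom_cplx V ground))\<rparr>"

section \<open>Algebras given by generators and relations\<close>

text \<open>
  The free associative unital algebra on a set of generators consists of the finitely supported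
  functions on words.
\<close>

definition fscl :: "'k::field \<Rightarrow> ('w \<Rightarrow>\<^sub>0 'k) \<Rightarrow> ('w \<Rightarrow>\<^sub>0 'k)" where
  "fscl c p = Poly_Mapping.map ((*) c) p"

text \<open>The linear extension of a map defined on words.\<close>

definition flin :: "('w \<Rightarrow> ('u \<Rightarrow>\<^sub>0 'k)) \<Rightarrow> ('w \<Rightarrow>\<^sub>0 'k::field) \<Rightarrow> ('u \<Rightarrow>\<^sub>0 'k)" where
  "flin F p = (\<Sum>w\<in>Poly_Mapping.keys p. fscl (Poly_Mapping.lookup p w) (F w))"

abbreviation word :: "'x list \<Rightarrow> ('x list \<Rightarrow>\<^sub>0 'k::field)" where
  "word w \<equiv> Poly_Mapping.single w 1"

definition fmul :: "('x list \<Rightarrow>\<^sub>0 'k::field) \<Rightarrow> ('x list \<Rightarrow>\<^sub>0 'k) \<Rightarrow> ('x list \<Rightarrow>\<^sub>0 'k)" where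
  "fmul p q = flin (\<lambda>u. flin (\<lambda>v. word (u @ v)) q) p"

definition rel_ideal :: "'x set \<Rightarrow> ('x list \<Rightarrow>\<^sub>0 'k::field) set \<Rightarrow> ('x list \<Rightarrow>\<^sub>0 'k) set" where
  "rel_ideal G R = module.span fscl
     {fmul (word u) (fmul r (word v)) | u r v. u \<in> lists G \<and> r \<in> R \<and> v \<in> lists G}"

text \<open>
  The quotient by a subspace U is realised as a linear complement of U: \<open>quot U\<close> is a chosen linear
  projection with kernel U, and \<open>quot U p\<close> is the class of p.  Thus \<open>quot U p = quot U q\<close> holds iff
  p - q lies in U, and addition and scalar multiplication of classes are those of the ambient
  space of finitely supported functions.
\<close>

definition quot :: "('w \<Rightarrow>\<^sub>0 'k::field) set \<Rightarrow> ('w \<Rightarrow>\<^sub>0 'k) \<Rightarrow> ('w \<Rightarrow>\<^sub>0 'k)" where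
  "quot U = (SOME f. Vector_Spaces.linear fscl fscl f \<and> (\<forall>p. f p - p \<in> U) \<and> (\<forall>p\<in>U. f p = 0))"

definition wdeg :: "('x \<Rightarrow> int) \<Rightarrow> 'x list \<Rightarrow> int" where
  "wdeg \<delta> w = (\<Sum>x\<leftarrow>w. \<delta> x)"

text \<open>The graded Leibniz rule for the differential of a word.\<close>

definition dword :: "('x \<Rightarrow> int) \<Rightarrow> ('x \<Rightarrow> 'x) \<Rightarrow> 'x list \<Rightarrow> ('x list \<Rightarrow>\<^sub>0 'k::field)" where
  "dword \<delta> d w = (\<Sum>k<length w. fscl (sg (wdeg \<delta> (take k w))) (word (w[k := d (w ! k)])))"

section \<open>Symmetric algebras\<close>

text \<open>
  Sym_A(M) is presented by the homogeneous elements a of A (\<open>Coef i a\<close>) and x of M (\<open>Vec i x\<close>), where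
  i is the degree, subject to linearity, to the product and unit of A, to the module structure of M
  and to graded commutativity.  The relation x x = 0 for x of odd degree follows in characteristic 0.
\<close>

datatype ('a, 'm) sgen = Coef int 'a | Vec int 'm

primrec sdeg :: "('a, 'm) sgen \<Rightarrow> int" where
  "sdeg (Coef i a) = i"
| "sdeg (Vec i x) = i"

primrec swt :: "('a, 'm) sgen \<Rightarrow> nat" where
  "swt (Coef i a) = 0"
| "swt (Vec i x) = 1"

primrec sdif :: "('k, 'a) dga \<Rightarrow> ('k, 'a, 'm) dgmod \<Rightarrow> ('a, 'm) sgen \<Rightarrow> ('a, 'm) sgen" where
  "sdif A M (Coef i a) = Coef (i + 1) (dif A i a)"
| "sdif A M (Vec i x) = Vec (i + 1) (dif M i x)"

definition sym_gens :: "('k, 'a) dga \<Rightarrow> ('k, 'a, 'm) dgmod \<Rightarrow> ('a, 'm) sgen set" where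
  "sym_gens A M = {Coef i a | i a. a \<in> grade A i} \<union> {Vec i x | i x. x \<in> grade M i}"

inductive_set sym_rels ::
    "('k::field, 'a::ab_group_add) dga \<Rightarrow> ('k, 'a, 'm::ab_group_add) dgmod
      \<Rightarrow> (('a, 'm) sgen list \<Rightarrow>\<^sub>0 'k) set"
  for A :: "('k, 'a) dga" and M :: "('k, 'a, 'm) dgmod" where
  coef_add: "a \<in> grade A i \<Longrightarrow> b \<in> grade A i \<Longrightarrow>
    word [Coef i (a + b)] - word [Coef i a] - word [Coef i b] \<in> sym_rels A M"
| coef_scl: "a \<in> grade A i \<Longrightarrow>
    word [Coef i (scl A c a)] - fscl c (word [Coef i a]) \<in> sym_rels A M"
| coef_mul: "a \<in> grade A i \<Longrightarrow> b \<in> grade A j \<Longrightarrow>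
    word [Coef i a, Coef j b] - word [Coef (i + j) (mul A a b)] \<in> sym_rels A M"
| coef_one: "word [Coef 0 (aone A)] - word [] \<in> sym_rels A M"
| vec_add: "x \<in> grade M i \<Longrightarrow> y \<in> grade M i \<Longrightarrow>
    word [Vec i (x + y)] - word [Vec i x] - word [Vec i y] \<in> sym_rels A M"
| vec_scl: "x \<in> grade M i \<Longrightarrow>
    word [Vec i (scl M c x)] - fscl c (word [Vec i x]) \<in> sym_rels A M"
| vec_act: "a \<in> grade A i \<Longrightarrow> x \<in> grade M j \<Longrightarrow>
    word [Coef i a, Vec j x] - word [Vec (i + j) (act M i a x)] \<in> sym_rels A M"
| commute: "u \<in> sym_gens A M \<Longrightarrow> v \<in> sym_gens A M \<Longrightarrow>
    word [u, v] - fscl (sg (sdeg u * sdeg v)) (word [v, u]) \<in> sym_rels A M"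

definition sym_class ::
    "('k::field, 'a::ab_group_add) dga \<Rightarrow> ('k, 'a, 'm::ab_group_add) dgmod
      \<Rightarrow> (('a, 'm) sgen list \<Rightarrow>\<^sub>0 'k) \<Rightarrow> (('a, 'm) sgen list \<Rightarrow>\<^sub>0 'k)" where
  "sym_class A M = quot (rel_ideal (sym_gens A M) (sym_rels A M))"

definition Sym ::
    "('k::field, 'a::ab_group_add) dga \<Rightarrow> ('k, 'a, 'm::ab_group_add) dgmod
      \<Rightarrow> ('k, ('a, 'm) sgen list \<Rightarrow>\<^sub>0 'k) dga" where
  "Sym A M =
     \<lparr>grade = (\<lambda>i. sym_class A M ` {p. \<forall>w\<in>Poly_Mapping.keys p.
                  w \<in> lists (sym_gens A M) \<and> wdeg sdeg w = i}),
      scl = fscl,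
      dif = (\<lambda>i p. sym_class A M (flin (dword sdeg (sdif A M)) p)),
      mul = (\<lambda>p q. sym_class A M (fmul p q)),
      aone = sym_class A M (word [])\<rparr>"

text \<open>The degree i part of the weight m component Sym^m_A(M).\<close>

definition Sym_wt ::
    "('k::field, 'a::ab_group_add) dga \<Rightarrow> ('k, 'a, 'm::ab_group_add) dgmod \<Rightarrow> nat \<Rightarrow> int
      \<Rightarrow> (('a, 'm) sgen list \<Rightarrow>\<^sub>0 'k) set" where
  "Sym_wt A M m i = sym_class A M ` {p. \<forall>w\<in>Poly_Mapping.keys p.
     w \<in> lists (sym_gens A M) \<and> wdeg sdeg w = i \<and> (\<Sum>x\<leftarrow>w. swt x) = m}"

definition coef_in ::
    "('k::field, 'a::ab_group_add) dga \<Rightarrow> ('k, 'a, 'm::ab_group_add) dgmod \<Rightarrow> int \<Rightarrow> 'a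
      \<Rightarrow> (('a, 'm) sgen list \<Rightarrow>\<^sub>0 'k)" where
  "coef_in A M i a = sym_class A M (word [Coef i a])"

definition vec_in ::
    "('k::field, 'a::ab_group_add) dga \<Rightarrow> ('k, 'a, 'm::ab_group_add) dgmod \<Rightarrow> int \<Rightarrow> 'm
      \<Rightarrow> (('a, 'm) sgen list \<Rightarrow>\<^sub>0 'k)" where
  "vec_in A M i x = sym_class A M (word [Vec i x])"

section \<open>Shifted polyvectors and Poisson structures\<close>

definition Der :: "('k::field, 'a::ab_group_add) dga \<Rightarrow> ('k, 'a, int \<Rightarrow> 'a \<Rightarrow> 'a) dgmod" where
  "Der A =
     \<lparr>grade = (\<lambda>i. {D \<in> grade (hom_cplx A A) i. \<forall>j k. \<forall>a\<in>grade A j. \<forall>b\<in>grade A k.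
                D (j + k) (mul A a b) = mul A (D j a) b + scl A (sg (i * j)) (mul A a (D k b))}),
      scl = scl (hom_cplx A A),
      dif = dif (hom_cplx A A),
      act = (\<lambda>i a D k b. if b \<in> grade A k then mul A a (D k b) else 0)\<rparr>"

definition der_bracket ::
    "('k::field, 'a::ab_group_add) dga \<Rightarrow> int \<Rightarrow> int \<Rightarrow> (int \<Rightarrow> 'a \<Rightarrow> 'a) \<Rightarrow> (int \<Rightarrow> 'a \<Rightarrow> 'a)
      \<Rightarrow> (int \<Rightarrow> 'a \<Rightarrow> 'a)" where
  "der_bracket A i j D D' = (\<lambda>k a. if a \<in> grade A k
     then D (k + j) (D' k a) - scl A (sg (i * j)) (D' (k + i) (D k a)) else 0)"

abbreviation shifted_Der ::
    "('k::field, 'a::ab_group_add) dga \<Rightarrow> int \<Rightarrow> ('k, 'a, int \<Rightarrow> 'a \<Rightarrow> 'a) dgmod" where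
  "shifted_Der A n \<equiv> shift_mod (- n - 1) (Der A)"

type_synonym ('a, 'k) pol = "('a, int \<Rightarrow> 'a \<Rightarrow> 'a) sgen list \<Rightarrow>\<^sub>0 'k"

definition Pol :: "('k::field, 'a::ab_group_add) dga \<Rightarrow> int \<Rightarrow> ('k, ('a, 'k) pol) dga" where
  "Pol A n = Sym A (shifted_Der A n)"

definition Pol_wt :: "('k::field, 'a::ab_group_add) dga \<Rightarrow> int \<Rightarrow> nat \<Rightarrow> int \<Rightarrow> ('a, 'k) pol set" where
  "Pol_wt A n m i = Sym_wt A (shifted_Der A n) m i"

definition pol_fun ::
    "('k::field, 'a::ab_group_add) dga \<Rightarrow> int \<Rightarrow> int \<Rightarrow> 'a \<Rightarrow> ('a, 'k) pol" where
  "pol_fun A n i a = coef_in A (shifted_Der A n) i a"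

text \<open>The polyvector s^{n+1} D of a derivation D of degree i; its degree is i + n + 1.\<close>

definition pol_der ::
    "('k::field, 'a::ab_group_add) dga \<Rightarrow> int \<Rightarrow> int \<Rightarrow> (int \<Rightarrow> 'a \<Rightarrow> 'a) \<Rightarrow> ('a, 'k) pol" where
  "pol_der A n i D = vec_in A (shifted_Der A n) (i + n + 1) D"

text \<open>
  \<open>br P Q\<close> stands for the T with [[s^{-n-1} P, s^{-n-1} Q]] = s^{-n-1} T.  In the Leibniz rule the sign
  (-1)^{|P||Q|} is multiplied by (-1)^{|Q|(n+1)}, from Q (s^{-n-1} T) = (-1)^{|Q|(n+1)} s^{-n-1} (Q T);
  antisymmetry refers to the degrees |P| - n - 1 and |Q| - n - 1 of s^{-n-1} P and s^{-n-1} Q.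
  The listed properties determine the bracket on all homogeneous elements, so that
  the Jacobi identity is a consequence of them and is not listed.
\<close>

definition is_schouten ::
    "('k::field, 'a::ab_group_add) dga \<Rightarrow> int \<Rightarrow> (('a, 'k) pol \<Rightarrow> ('a, 'k) pol \<Rightarrow> ('a, 'k) pol)
      \<Rightarrow> bool" where
  "is_schouten A n br \<longleftrightarrow>
     (\<forall>i j. \<forall>P\<in>grade (Pol A n) i. \<forall>Q\<in>grade (Pol A n) j.
        br P Q \<in> grade (Pol A n) (i + j - n - 1)) \<and>
     (\<forall>i j. \<forall>P\<in>grade (Pol A n) i. linear_on (Pol A n) (grade (Pol A n) j) (Pol A n) (br P)) \<and>
     (\<forall>i j. \<forall>Q\<in>grade (Pol A n) j.
        linear_on (Pol A n) (grade (Pol A n) i) (Pol A n) (\<lambda>P. br P Q)) \<and>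
     (\<forall>i j. \<forall>P\<in>grade (Pol A n) i. \<forall>Q\<in>grade (Pol A n) j.
        br P Q = - scl (Pol A n) (sg ((i - n - 1) * (j - n - 1))) (br Q P)) \<and>
     (\<forall>i j k. \<forall>P\<in>grade (Pol A n) i. \<forall>Q\<in>grade (Pol A n) j. \<forall>R\<in>grade (Pol A n) k.
        br P (mul (Pol A n) Q R) =
          mul (Pol A n) (br P Q) R
          + scl (Pol A n) (sg (i * j) * sg (j * (n + 1))) (mul (Pol A n) Q (br P R))) \<and>
     (\<forall>i j. \<forall>a\<in>grade A i. \<forall>a'\<in>grade A j. br (pol_fun A n i a) (pol_fun A n j a') = 0) \<and>
     (\<forall>i j. \<forall>D\<in>grade (Der A) i. \<forall>a\<in>grade A j.
        br (pol_der A n i D) (pol_fun A n j a) =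
          scl (Pol A n) (sg (i * (n + 1))) (pol_fun A n (i + j) (D j a))) \<and>
     (\<forall>i j. \<forall>D\<in>grade (Der A) i. \<forall>D'\<in>grade (Der A) j.
        br (pol_der A n i D) (pol_der A n j D') = pol_der A n (i + j) (der_bracket A i j D D'))"

definition schouten ::
    "('k::field, 'a::ab_group_add) dga \<Rightarrow> int \<Rightarrow> ('a, 'k) pol \<Rightarrow> ('a, 'k) pol \<Rightarrow> ('a, 'k) pol" where
  "schouten A n = (SOME br. is_schouten A n br)"

text \<open>
  An element of degree n + 2 of the completion is the family of its weight components.  The
  Maurer-Cartan equation is an equation in the shift by n + 1, where s^{-n-1} \<pi> has degree 1, and is
  stated weight by weight: the bracket lowers the total weight by 1.
\<close>

definition poisson_structures ::
    "('k::field, 'a::ab_group_add) dga \<Rightarrow> int \<Rightarrow> (nat \<Rightarrow> ('a, 'k) pol) set" where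
  "poisson_structures A n =
     {\<pi>. (\<forall>m. \<pi> m \<in> Pol_wt A n m (n + 2)) \<and> (\<forall>m<2. \<pi> m = 0) \<and>
         (\<forall>m. dif (shift (n + 1) (Pol A n)) 1 (\<pi> m)
              + scl (Pol A n) (1 / 2)
                  (\<Sum>(m1, m2)\<in>{(m1, m2). m1 + m2 = m + 1}. schouten A n (\<pi> m1) (\<pi> m2)) = 0)}"

section \<open>Tensor powers\<close>

text \<open>Generators of the tensor algebra are the homogeneous elements, tagged with their degree.\<close>

definition tens_gens :: "('k, 'v) cplx \<Rightarrow> (int \<times> 'v) set" where
  "tens_gens V = {(i, x). x \<in> grade V i}"

inductive_set tens_rels ::
    "('k::field, 'v::ab_group_add) cplx \<Rightarrow> ((int \<times> 'v) list \<Rightarrow>\<^sub>0 'k) set"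
  for V :: "('k, 'v) cplx" where
  "x \<in> grade V i \<Longrightarrow> y \<in> grade V i \<Longrightarrow>
    word [(i, x + y)] - word [(i, x)] - word [(i, y)] \<in> tens_rels V"
| "x \<in> grade V i \<Longrightarrow> word [(i, scl V c x)] - fscl c (word [(i, x)]) \<in> tens_rels V"

definition tens_class ::
    "('k::field, 'v::ab_group_add) cplx \<Rightarrow> ((int \<times> 'v) list \<Rightarrow>\<^sub>0 'k)
      \<Rightarrow> ((int \<times> 'v) list \<Rightarrow>\<^sub>0 'k)" where
  "tens_class V = quot (rel_ideal (tens_gens V) (tens_rels V))"

abbreviation tdeg :: "(int \<times> 'v) list \<Rightarrow> int" where
  "tdeg \<equiv> wdeg fst"

text \<open>The k-th tensor power of V.\<close>

definition Tens ::
    "('k::field, 'v::ab_group_add) cplx \<Rightarrow> nat \<Rightarrow> ('k, (int \<times> 'v) list \<Rightarrow>\<^sub>0 'k) cplx" where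
  "Tens V k =
     \<lparr>grade = (\<lambda>i. tens_class V ` {p. \<forall>w\<in>Poly_Mapping.keys p.
                  w \<in> lists (tens_gens V) \<and> tdeg w = i \<and> length w = k}),
      scl = fscl,
      dif = (\<lambda>i p. tens_class V (flin (dword fst (\<lambda>(i, x). (i + 1, dif V i x))) p))\<rparr>"

definition pure_tens ::
    "('k::field, 'v::ab_group_add) cplx \<Rightarrow> (int \<times> 'v) list \<Rightarrow> ((int \<times> 'v) list \<Rightarrow>\<^sub>0 'k)" where
  "pure_tens V w = tens_class V (word w)"

text \<open>
  An element of a tensor power is a linear combination of words, which represents the same
  combination of pure tensors.  Hence \<open>tlin k F\<close> is, on the k-th tensor power, the linear map with
  value \<open>F w\<close> on the pure tensor of w, for every F that is multilinear on words of length k.  Words of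
  other lengths, which a representative may contain, must not contribute: the part of a
  representative formed by them lies in the ideal of relations.

  Tensor factors and the positions they occupy are numbered from 0.
\<close>

definition tlin :: "nat \<Rightarrow> ('x list \<Rightarrow> ('u \<Rightarrow>\<^sub>0 'k)) \<Rightarrow> ('x list \<Rightarrow>\<^sub>0 'k::field) \<Rightarrow> ('u \<Rightarrow>\<^sub>0 'k)" where
  "tlin k F = flin (\<lambda>w. if length w = k then F w else 0)"

definition koszul :: "int list \<Rightarrow> (nat \<Rightarrow> nat) \<Rightarrow> 'k::field" where
  "koszul ds \<sigma> = (\<Prod>(i, j)\<in>{(i, j). i < j \<and> j < length ds \<and> \<sigma> j < \<sigma> i}. sg (ds ! \<sigma> i * ds ! \<sigma> j))"

definition braid ::
    "('k::field, 'v::ab_group_add) cplx \<Rightarrow> nat \<Rightarrow> (nat \<Rightarrow> nat) \<Rightarrow> ((int \<times> 'v) list \<Rightarrow>\<^sub>0 'k)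
      \<Rightarrow> ((int \<times> 'v) list \<Rightarrow>\<^sub>0 'k)" where
  "braid V k \<sigma> = tlin k (\<lambda>w. fscl (koszul (map fst w) \<sigma>) (pure_tens V (permute_list \<sigma> w)))"

abbreviation perm_sgn :: "(nat \<Rightarrow> nat) \<Rightarrow> 'k::field" where
  "perm_sgn \<sigma> \<equiv> of_int (sign \<sigma>)"

text \<open>\<open>homl V m l\<close> is the complex of maps from the l-th to the m-th tensor power.\<close>

abbreviation homl ::
    "('k::field, 'v::ab_group_add) cplx \<Rightarrow> nat \<Rightarrow> nat
      \<Rightarrow> ('k, int \<Rightarrow> ((int \<times> 'v) list \<Rightarrow>\<^sub>0 'k) \<Rightarrow> ((int \<times> 'v) list \<Rightarrow>\<^sub>0 'k)) cplx" where
  "homl V m l \<equiv> hom_cplx (Tens V l) (Tens V m)"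

definition hom_sym ::
    "('k::field, 'v::ab_group_add) cplx \<Rightarrow> int \<Rightarrow> nat \<Rightarrow> nat \<Rightarrow> int
      \<Rightarrow> (int \<Rightarrow> ((int \<times> 'v) list \<Rightarrow>\<^sub>0 'k) \<Rightarrow> ((int \<times> 'v) list \<Rightarrow>\<^sub>0 'k)) set" where
  "hom_sym V n m l e =
     {L \<in> grade (homl V m l) e.
        (\<forall>\<sigma>. \<sigma> permutes {..<l} \<longrightarrow>
           (\<forall>j. \<forall>t\<in>grade (Tens V l) j. L j (braid V l \<sigma> t) = fscl (perm_sgn \<sigma>) (L j t))) \<and>
        (\<forall>\<rho>. \<rho> permutes {..<m} \<longrightarrow>
           (\<forall>j. \<forall>t\<in>grade (Tens V l) j.
              braid V m \<rho> (L j t) = fscl (perm_sgn \<rho> powi n) (L j t)))}"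

text \<open>
  \<open>tens_map V p q F e F'\<close> is the tensor product of F, acting on the first p factors, and of F', which
  has degree e and acts on the last q factors.
\<close>

definition tens_map ::
    "('k::field, 'v::ab_group_add) cplx \<Rightarrow> nat \<Rightarrow> nat
      \<Rightarrow> (int \<Rightarrow> ((int \<times> 'v) list \<Rightarrow>\<^sub>0 'k) \<Rightarrow> ((int \<times> 'v) list \<Rightarrow>\<^sub>0 'k)) \<Rightarrow> int
      \<Rightarrow> (int \<Rightarrow> ((int \<times> 'v) list \<Rightarrow>\<^sub>0 'k) \<Rightarrow> ((int \<times> 'v) list \<Rightarrow>\<^sub>0 'k))
      \<Rightarrow> ((int \<times> 'v) list \<Rightarrow>\<^sub>0 'k) \<Rightarrow> ((int \<times> 'v) list \<Rightarrow>\<^sub>0 'k)" where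
  "tens_map V p q F e F' = tlin (p + q) (\<lambda>w.
     fscl (sg (e * tdeg (take p w)))
       (tens_class V (fmul (F (tdeg (take p w)) (pure_tens V (take p w)))
                           (F' (tdeg (drop p w)) (pure_tens V (drop p w))))))"

definition shuffles :: "nat \<Rightarrow> nat \<Rightarrow> (nat \<Rightarrow> nat) set" where
  "shuffles p q =
     {\<sigma>. \<sigma> permutes {..<p + q} \<and> strict_mono_on {..<p} \<sigma> \<and> strict_mono_on {p..<p + q} \<sigma>}"

text \<open>
  \<open>star V n m l m' l' e L L'\<close> is the map L \<open>\<star>\<close> L', where L has l inputs and m outputs and L' has l' inputs,
  m' outputs and degree e.
\<close>

definition star ::
    "('k::field, 'v::ab_group_add) cplx \<Rightarrow> int \<Rightarrow> nat \<Rightarrow> nat \<Rightarrow> nat \<Rightarrow> nat \<Rightarrow> int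
      \<Rightarrow> (int \<Rightarrow> ((int \<times> 'v) list \<Rightarrow>\<^sub>0 'k) \<Rightarrow> ((int \<times> 'v) list \<Rightarrow>\<^sub>0 'k))
      \<Rightarrow> (int \<Rightarrow> ((int \<times> 'v) list \<Rightarrow>\<^sub>0 'k) \<Rightarrow> ((int \<times> 'v) list \<Rightarrow>\<^sub>0 'k))
      \<Rightarrow> (int \<Rightarrow> ((int \<times> 'v) list \<Rightarrow>\<^sub>0 'k) \<Rightarrow> ((int \<times> 'v) list \<Rightarrow>\<^sub>0 'k))" where
  "star V n m l m' l' e L L' =
     (if l = 0 \<or> m' = 0 then 0
      else (\<lambda>j t. if t \<in> grade (Tens V (l + l' - 1)) j
        then \<Sum>\<sigma>\<in>shuffles (l - 1) l'. \<Sum>\<rho>\<in>shuffles m (m' - 1).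
          fscl (perm_sgn \<sigma> * perm_sgn \<rho> powi n)
            (braid V (m + m' - 1) (inv \<rho>)
              (tens_map V l (m' - 1) L 0 (\<lambda>_ t. t)
                (tens_map V (l - 1) l' (\<lambda>_ t. t) e L'
                  (braid V (l + l' - 1) \<sigma> t))))
        else 0))"

section \<open>The free case\<close>

type_synonym ('v, 'k) free_el = "('k, int \<Rightarrow> 'v \<Rightarrow> 'k) sgen list \<Rightarrow>\<^sub>0 'k"

definition free_cdga ::
    "('k::field, 'v::ab_group_add) cplx \<Rightarrow> ('k, ('v, 'k) free_el) dga" where
  "free_cdga V = Sym ground (shift_mod (- 1) (dual V))"

text \<open>The generator s \<theta> for \<theta> in the dual of V, of degree j; its degree is j + 1.\<close>

definition susp :: "('k::field, 'v::ab_group_add) cplx \<Rightarrow> int \<Rightarrow> (int \<Rightarrow> 'v \<Rightarrow> 'k) \<Rightarrow> ('v, 'k) free_el" where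
  "susp V j \<theta> = vec_in ground (shift_mod (- 1) (dual V)) (j + 1) \<theta>"

text \<open>
  The derivation s^{-1} x with s^{-1} x (s \<theta>) = <\<theta>, x>, for x in V^i.  The pairing <\<theta>, x> is \<open>\<theta> i x\<close>.
\<close>

definition desusp_der ::
    "('k::field, 'v::ab_group_add) cplx \<Rightarrow> int \<Rightarrow> 'v
      \<Rightarrow> (int \<Rightarrow> ('v, 'k) free_el \<Rightarrow> ('v, 'k) free_el)" where
  "desusp_der V i x = (THE D. D \<in> grade (Der (free_cdga V)) (i - 1) \<and>
     (\<forall>j. \<forall>\<theta>\<in>grade (dual V) j.
        D (j + 1) (susp V j \<theta>) = scl (free_cdga V) (\<theta> i x) (aone (free_cdga V))))"

text \<open>
  The polyvector s^n x_1 ... s^n x_m s \<theta>_1 ... s \<theta>_l, where s^n x = s^{n+1} s^{-1} x.  The x_k and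
  \<theta>_j are given together with their degrees.
\<close>

definition pol_monomial ::
    "('k::field, 'v::ab_group_add) cplx \<Rightarrow> int \<Rightarrow> (int \<times> 'v) list \<Rightarrow> (int \<times> (int \<Rightarrow> 'v \<Rightarrow> 'k)) list
      \<Rightarrow> (('v, 'k) free_el, 'k) pol" where
  "pol_monomial V n xs \<theta>s =
     foldr (mul (Pol (free_cdga V) n))
       (map (\<lambda>(i, x). pol_der (free_cdga V) n (i - 1) (desusp_der V i x)) xs
        @ map (\<lambda>(j, \<theta>). pol_fun (free_cdga V) n (j + 1) (susp V j \<theta>)) \<theta>s)
       (aone (Pol (free_cdga V) n))"

text \<open>
  The sign of a permutation is multiplied with the Koszul sign in a graded exterior power.  The
  permutation \<open>\<lambda>i. l - 1 - i\<close> of positions is rev.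
\<close>

definition L_B ::
    "('k::field, 'v::ab_group_add) cplx \<Rightarrow> int \<Rightarrow> (int \<times> 'v) list \<Rightarrow> (int \<times> (int \<Rightarrow> 'v \<Rightarrow> 'k)) list
      \<Rightarrow> (int \<Rightarrow> ((int \<times> 'v) list \<Rightarrow>\<^sub>0 'k) \<Rightarrow> ((int \<times> 'v) list \<Rightarrow>\<^sub>0 'k))" where
  "L_B V n xs \<theta>s = (\<lambda>j t. if t \<in> grade (Tens V (length \<theta>s)) j
     then tlin (length \<theta>s) (\<lambda>ys.
       \<Sum>\<sigma> | \<sigma> permutes {..<length \<theta>s}. \<Sum>\<rho> | \<rho> permutes {..<length xs}.
         fscl ((koszul (map fst xs) \<rho> * (if even n then 1 else perm_sgn \<rho>))
               * (koszul (map fst \<theta>s) \<sigma> * perm_sgn \<sigma>)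
               * koszul (map fst ys) (\<lambda>i. length \<theta>s - 1 - i)
               * (\<Prod>k<length \<theta>s. snd (\<theta>s ! \<sigma> k) (fst (ys ! k)) (snd (ys ! k))))
           (pure_tens V (permute_list \<rho> xs))) t
     else 0)"

text \<open>
  \<open>\<Phi> m l\<close> is the component of \<open>\<Phi>\<close> from weight m to maps with l inputs and m outputs.  Its value s^{mn+l} L
  is represented by L.  The exponents use k + 1 and j + 1 as the positions counted from 1.
\<close>

definition is_Phi ::
    "('k::field, 'v::ab_group_add) cplx \<Rightarrow> int
      \<Rightarrow> (nat \<Rightarrow> nat \<Rightarrow> (('v, 'k) free_el, 'k) pol
           \<Rightarrow> (int \<Rightarrow> ((int \<times> 'v) list \<Rightarrow>\<^sub>0 'k) \<Rightarrow> ((int \<times> 'v) list \<Rightarrow>\<^sub>0 'k))) \<Rightarrow> bool" where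
  "is_Phi V n \<Phi> \<longleftrightarrow>
     (\<forall>m l i. linear_on (Pol (free_cdga V) n) (Pol_wt (free_cdga V) n m i) (homl V m l) (\<Phi> m l)) \<and>
     (\<forall>xs \<theta>s l. set xs \<subseteq> tens_gens V \<longrightarrow>
        set \<theta>s \<subseteq> {(j, \<theta>). \<theta> \<in> grade (dual V) j} \<longrightarrow>
        \<Phi> (length xs) l (pol_monomial V n xs \<theta>s) =
          (if l = length \<theta>s
           then scl (homl V (length xs) l)
             (sg (\<Sum>k<length xs. fst (xs ! k) * (int (length xs - (k + 1)) * n + int l))
              * sg (\<Sum>j<l. fst (\<theta>s ! j) * int (l - (j + 1))))
             (L_B V n xs \<theta>s)
           else 0))"

definition Phi ::
    "('k::field, 'v::ab_group_add) cplx \<Rightarrow> int \<Rightarrow> nat \<Rightarrow> nat \<Rightarrow> (('v, 'k) free_el, 'k) pol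
      \<Rightarrow> (int \<Rightarrow> ((int \<times> 'v) list \<Rightarrow>\<^sub>0 'k) \<Rightarrow> ((int \<times> 'v) list \<Rightarrow>\<^sub>0 'k))" where
  "Phi V n = (SOME \<Phi>. is_Phi V n \<Phi>)"

text \<open>A family indexed by m \<ge> 2 and l \<ge> 0 is extended by 0 to m < 2.\<close>

definition poisson_families ::
    "('k::field, 'v::ab_group_add) cplx \<Rightarrow> int
      \<Rightarrow> (nat \<Rightarrow> nat \<Rightarrow> int \<Rightarrow> ((int \<times> 'v) list \<Rightarrow>\<^sub>0 'k) \<Rightarrow> ((int \<times> 'v) list \<Rightarrow>\<^sub>0 'k)) set" where
  "poisson_families V n =
     {\<pi>. (\<forall>m<2. \<forall>l. \<pi> m l = 0) \<and>
         (\<forall>m\<ge>2. \<forall>l. \<pi> m l \<in> hom_sym V n m l ((1 - int m) * n + 2 - int l)) \<and>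
         (\<forall>m\<ge>2. finite {l. \<pi> m l \<noteq> 0}) \<and>
         (\<forall>m\<ge>2. \<forall>l.
            scl (homl V m l) (sg ((int m - 1) * n + int l - 1))
              (dif (homl V m l) ((1 - int m) * n + 2 - int l) (\<pi> m l))
            + (\<Sum>(m1, m2)\<in>{(m1, m2). 2 \<le> m1 \<and> 2 \<le> m2 \<and> m1 + m2 = m + 1}.
                \<Sum>(l1, l2)\<in>{(l1, l2). l1 + l2 = l + 1}.
                  scl (homl V m l)
                    (sg (((1 - int m1) * n + 2 - int l1) * ((int m2 - 1) * n + int l2 - 1))
                     * sg (n * (int m2 - 1) * (int l1 - 1)))
                    (star V n m1 l1 m2 l2 ((1 - int m2) * n + 2 - int l2) (\<pi> m1 l1) (\<pi> m2 l2)))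
            = 0)}"

end

theory Submission imports Defs begin

text \<open>
 Both sides of the correspondence are put in coordinates, where a polyvector becomes a function on
 words and the Maurer-Cartan equation becomes an identity between values of such functions.

 Fix a homogeneous basis B of \<open>\<gg>\<close>. It is finite, as \<open>\<gg>\<close> is bounded and degreewise finite-dimensional.
 Each b in B gives two letters: a coordinate \<open>Inr b\<close> of degree 1 - |b|, from the dual basis of
 \<open>\<gg>*[-1]\<close>, and \<open>Inl b\<close> of degree |b| + n, from the conjugate direction in \<open>\<gg>[-n]\<close>.
 In characteristic 0 a graded symmetric algebra on finitely many letters is the algebra of graded
 symmetric functions on words, with the signed shuffle product \<open>sh\<close>: a product of k generators
 goes to the signed sum of its rearrangements, and Euler's identity (\<open>euler_class\<close>) shows that
 f \<open>\<mapsto>\<close> SUM f(u)/k! u is the inverse. The locale \<open>sym_model\<close> proves this for Sym_A(M), and it is used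
 twice: for A = Sym(\<open>\<gg>*[-1]\<close>) with the letters \<open>Inr b\<close>, and for Pol(A, n) with all letters. For the
 second use, derivations of A are identified with families of coefficients (\<open>der_formula\<close>).

 In this model removing the first or the last letter of a word is a derivation. Hence the
 differential of Pol(A, n) is an explicit derivation \<open>dC\<close> (\<open>PP_dif\<close>), and the Schouten bracket is the
 Poisson bracket \<open>pb\<close> of the conjugate letters: \<open>pb\<close> has the defining properties, and these determine
 the bracket by induction on products of generators (\<open>schouten\<close>).

 A graded map between tensor powers of \<open>\<gg>\<close> is given by its matrix \<open>mat\<close>, indexed by words in B.
 In these terms \<open>\<Phi>\<close> is evaluation at the sorted words, first the letters \<open>Inl\<close> and then the letters
 \<open>Inr\<close>, times the sign \<open>sgnf\<close> (\<open>Phi_Phimap\<close>). A symmetric function is determined by its values at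
 sorted words, and these may be prescribed subject to symmetry in the \<open>Inl\<close> and in the \<open>Inr\<close> letters;
 with \<open>sgnf\<close> this is precisely the symmetry of \<open>hom_sym\<close>. So \<open>\<Phi>\<close> is bijective in each weight
 (\<open>Phimap_inj\<close>, \<open>Phimap_surj\<close>).

 It remains to compare the equations. The differential goes to the differential up to sign
 (\<open>mat_dif\<close>). On elements of degree n + 2 the bracket is \<open>half f g + half g f\<close>, which cancels the factor
 1/2. Evaluating \<open>half\<close> at a sorted word distributes the \<open>Inl\<close> and the \<open>Inr\<close> letters by shuffles over
 both factors, which is the double sum over shuffles in the definition of star (\<open>half_star\<close>).
\<close>

section \<open>Signs\<close>

definition eps :: "int => 'k::field" where
 "eps i = sg i"

lemma eps_if: "eps i = (if even i then 1 else - 1)"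
 by (simp add: eps_def power_int_minus_left)

lemma eps_0 [simp]: "eps 0 = 1"
 by (simp add: eps_if)

lemma eps_mult: "eps i*eps j = eps (i+j)"
 by (auto simp: eps_if)

lemma eps_mult_left: "eps i*(eps j*x) = eps (i+j)*x"
 by (auto simp: eps_if)

lemma eps_add: "eps (i+j) = eps i*eps j" and eps_diff: "eps (i - j) = eps i*eps j"
 and eps_neg [simp]: "eps (- i) = eps i"
 by (auto simp: eps_if)

lemma eps_cong: "even i = even j ==> eps i = eps j"
 by (simp add: eps_if)

lemma eps_self [simp]: "eps i*eps i = 1" "eps i*(eps i*x) = x"
 by (auto simp: eps_if)

lemma eps_nonzero [simp]: "eps i ~= 0"
 by (simp add: eps_if)

lemma minus_eps: "- eps i = eps (i+1)"
 by (simp add: eps_if)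

lemma wdeg_simps [simp]:
 "wdeg deg [] = 0" "wdeg deg (x#w) = deg x+wdeg deg w" "wdeg deg (u@w) = wdeg deg u+wdeg deg w"
 by (simp_all add: wdeg_def)

lemma sg_eps: "sg i = eps i"
 by (simp add: eps_def)

abbreviation perm where "perm == permute_list"
abbreviation keys where "keys \<equiv> Poly_Mapping.keys"
abbreviation lookup where "lookup \<equiv> Poly_Mapping.lookup"

section \<open>Linear algebra of finitely supported functions\<close>

lemma lookup_fscl [simp]: "lookup (fscl c p) w = c*lookup p w"
 by (simp add: fscl_def Poly_Mapping.map.rep_eq when_def)

interpretation fv: vector_space fscl
 by unfold_locales (auto intro!: poly_mapping_eqI simp: lookup_add algebra_simps)

lemma flin_superset:
 assumes "finite S" "keys p <= S"
 shows "flin F p = (SUM w:S. fscl (lookup p w) (F w))"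
 unfolding flin_def using assms by (intro sum.mono_neutral_left) (auto simp: in_keys_iff)

lemma flin_add [simp]: "flin F (p+q) = flin F p+flin F q"
proof -
 let ?S = "keys p \<union> keys q"
 have k: "keys (p+q) <= ?S" by (rule Poly_Mapping.keys_add)
 show ?thesis
  by (subst (1 2 3) flin_superset[where S = ?S])
    (use k in \<open>auto simp: lookup_add fv.scale_left_distrib sum.distrib\<close>)
qed

lemma flin_fscl [simp]: "flin F (fscl c p) = fscl c (flin F p)"
proof -
 have k: "keys (fscl c p) <= keys p" by (auto simp: in_keys_iff)
 show ?thesis
  by (subst (1 2) flin_superset[where S = "keys p"])
    (use k in \<open>auto simp: fv.scale_sum_right\<close>)
qed

lemma flin_single [simp]: "flin F (Poly_Mapping.single w c) = fscl c (F w)"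
 by (cases "c = 0") (auto simp: flin_def)

lemma flin_0 [simp]: "flin F 0 = 0"
 by (simp add: flin_def)

lemma flin_uminus [simp]: "flin F (- p) = - flin F p"
 using flin_add[of F p "- p"] by (simp add: eq_neg_iff_add_eq_0 add.commute)

lemma flin_diff [simp]: "flin F (p - q) = flin F p - flin F q"
 using flin_add[of F p "- q"] by simp

lemma flin_sum: "flin F (sum g S) = (SUM s:S. flin F (g s))"
 by (induction S rule: infinite_finite_induct) auto

lemma flin_cong:
 "(!!w. w \<in> keys p ==> F w = G w) ==> flin F p = flin G p"
 by (simp add: flin_def)

lemma flin_fun_add: "flin (%w. F w+G w) p = flin F p+flin G p"
 by (simp add: flin_def fv.scale_right_distrib sum.distrib)

lemma flin_fun_fscl: "flin (%w. fscl c (F w)) p = fscl c (flin F p)"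
 by (simp add: flin_def fv.scale_sum_right mult.commute)

lemma pm_expand: "(p :: 'x list \<Rightarrow>\<^sub>0 'k::field) = (SUM w:keys p. fscl (lookup p w) (word w))"
proof -
 have "fscl c (word w) = Poly_Mapping.single w c" for c :: 'k and w :: "'x list"
  by (rule poly_mapping_eqI) (simp add: lookup_single when_def)
 thus ?thesis
  by (intro poly_mapping_eqI) (auto simp: lookup_sum lookup_single when_def in_keys_iff)
qed


lemma pm_induct [consumes 1, case_names zero add]:
 fixes p :: "'x list \<Rightarrow>\<^sub>0 'k::field"
 assumes "keys p <= S"
  and z: "P 0"
  and s: "!!c w q. w \<in> S ==> P q ==> P (fscl c (word w)+q)"
 shows "P p"
proof -
 have "P (SUM w:T. fscl (lookup p w) (word w))" if "finite T" "T <= S" for T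
  using that by (induction T) (auto intro: z s)
 from this[OF _ assms(1)] show ?thesis using pm_expand[of p] by simp
qed

lemmas pm_induct_all = pm_induct[OF subset_UNIV, simplified, case_names zero add]

lemma keys_fscl: "keys (fscl c p) <= keys p"
 by (auto simp: in_keys_iff)

lemma keys_fscl_word: "keys (fscl c (word w)) <= {w}"
 by (auto simp: in_keys_iff lookup_single when_def split: if_splits)

lemma keys_sum_subset:
 "(!!s. s \<in> S ==> keys (g s) <= T) ==> keys (sum g S) <= T"
proof (induction S rule: infinite_finite_induct)
 case (insert x S)
 thus ?case using Poly_Mapping.keys_add[of "g x" "sum g S"] by auto
qed auto

lemma keys_flin_subset:
 assumes "!!w. w \<in> keys p ==> keys (F w) <= T"
 shows "keys (flin F p) <= T"
 unfolding flin_def by (rule keys_sum_subset) (use assms keys_fscl in fastforce)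

lemma keys_diff_subset:
 fixes p q :: "'w \<Rightarrow>\<^sub>0 'k::ab_group_add"
 assumes "keys p <= S" "keys q <= S" shows "keys (p - q) <= S"
proof
 fix x assume "x \<in> keys (p - q)"
 hence "lookup p x ~= 0 \<or> lookup q x ~= 0" by (auto simp: in_keys_iff lookup_minus)
 thus "x \<in> S" using assms by (auto simp: in_keys_iff subset_iff)
qed

lemma keys_add_subset: "keys p <= S ==> keys q <= S ==>
  keys (p+q) <= S"
 using Poly_Mapping.keys_add[of p q] by auto

text \<open>Linear extension with values in a space of functions.\<close>

definition fext :: "('w => 'u => 'k::field) => ('w \<Rightarrow>\<^sub>0 'k) => 'u => 'k" where
 "fext F p u = (SUM w:keys p. lookup p w*F w u)"

lemma fext_superset:
 assumes "finite S" "keys p <= S"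
 shows "fext F p u = (SUM w:S. lookup p w*F w u)"
 unfolding fext_def using assms by (intro sum.mono_neutral_left) (auto simp: in_keys_iff)

lemma fext_add [simp]: "fext F (p+q) u = fext F p u+fext F q u"
proof -
 let ?S = "keys p \<union> keys q"
 have k: "keys (p+q) <= ?S" by (rule Poly_Mapping.keys_add)
 show ?thesis
  by (subst (1 2 3) fext_superset[where S = ?S])
    (use k in \<open>auto simp: lookup_add algebra_simps sum.distrib\<close>)
qed

lemma fext_fscl [simp]: "fext F (fscl c p) u = c*fext F p u"
proof -
 have k: "keys (fscl c p) <= keys p" by (rule keys_fscl)
 show ?thesis
  by (subst (1 2) fext_superset[where S = "keys p"])
    (use k in \<open>auto simp: sum_distrib_left mult.assoc\<close>)
qed

lemma fext_single [simp]: "fext F (Poly_Mapping.single w c) u = c*F w u"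
 by (cases "c = 0") (auto simp: fext_def)

lemma fext_0 [simp]: "fext F 0 u = 0"
 by (simp add: fext_def)

lemma fext_uminus [simp]: "fext F (- p) u = - fext F p u"
 using fext_add[of F p "- p"] by (simp add: eq_neg_iff_add_eq_0 add.commute)

lemma fext_diff [simp]: "fext F (p - q) u = fext F p u - fext F q u"
 using fext_add[of F p "- q"] by simp

lemma fext_sum: "fext F (sum g S) u = (SUM s:S. fext F (g s) u)"
 by (induction S rule: infinite_finite_induct) auto

lemma fext_flin: "fext F (flin G p) u = fext (%w. fext F (G w)) p u"
 by (simp add: flin_def fext_sum) (simp add: fext_def)

section \<open>Free algebras and their quotients\<close>

lemma fmul_word_word [simp]: "fmul (word u) (word v) = word (u@v)"
 by (simp add: fmul_def)

lemma fmul_add_left [simp]: "fmul (p+q) r = fmul p r+fmul q r"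
 by (simp add: fmul_def)

lemma fmul_add_right [simp]: "fmul r (p+q) = fmul r p+fmul r q"
 by (simp add: fmul_def flin_fun_add)

lemma fmul_fscl_left [simp]: "fmul (fscl c p) r = fscl c (fmul p r)"
 by (simp add: fmul_def)

lemma fmul_fscl_right [simp]: "fmul r (fscl c p) = fscl c (fmul r p)"
 by (simp add: fmul_def flin_fun_fscl)

lemma fmul_0 [simp]: "fmul 0 r = 0" "fmul r 0 = 0"
 by (simp_all add: fmul_def flin_def)

lemma fmul_diff_left [simp]: "fmul (p - q) r = fmul p r - fmul q r"
 by (simp add: fmul_def)

lemma fmul_diff_right [simp]: "fmul r (p - q) = fmul r p - fmul r q"
 using fmul_add_right[of r "p - q" q] by (simp add: eq_diff_eq)

lemma fmul_sum_right: "fmul r (sum g S) = (SUM s:S. fmul r (g s))"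
 by (induction S rule: infinite_finite_induct) auto

lemma fmul_sum_left: "fmul (sum g S) r = (SUM s:S. fmul (g s) r)"
 by (induction S rule: infinite_finite_induct) auto

lemma fmul_assoc: "fmul (fmul p q) r = fmul p (fmul q r)"
proof (induction p rule: pm_induct_all)
 case (add a u p)
 have "fmul (fmul (word u) q) r = fmul (word u) (fmul q r)"
 proof (induction q rule: pm_induct_all)
  case (add b v q)
  have "fmul (word (u@v)) r = fmul (word u) (fmul (word v) r)"
   by (induction r rule: pm_induct_all) auto
  with add show ?case by simp
 qed auto
 with add show ?case by simp
qed auto

lemma fmul_one [simp]: "fmul (word []) p = p" "fmul p (word []) = p"
proof -
 show "fmul (word []) p = p"
  by (induction p rule: pm_induct_all) auto
 show "fmul p (word []) = p"
  by (induction p rule: pm_induct_all) auto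
qed

lemma keys_fmul:
 assumes "keys p <= S" "keys q <= T"
  and "!!u v. u \<in> S ==> v \<in> T ==> u@v \<in> W"
 shows "keys (fmul p q) <= W"
 unfolding fmul_def by (intro keys_flin_subset) (use assms in auto)

lemma subspace_rel_ideal: "fv.subspace (rel_ideal G R)"
 unfolding rel_ideal_def by (rule fv.subspace_span)

lemmas rel_ideal_add = fv.subspace_add[OF subspace_rel_ideal]
 and rel_ideal_diff = fv.subspace_diff[OF subspace_rel_ideal]
 and rel_ideal_fscl = fv.subspace_scale[OF subspace_rel_ideal]
 and rel_ideal_0 = fv.subspace_0[OF subspace_rel_ideal]
 and rel_ideal_sum = fv.subspace_sum[OF subspace_rel_ideal]

lemma rel_ideal_induct [consumes 1, case_names zero add]:
 assumes "p \<in> rel_ideal G R" and "P 0"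
  and "!!c u r v q. u \<in> lists G ==> r \<in> R ==> v \<in> lists G ==> P q ==>
      P (fscl c (fmul (word u) (fmul r (word v)))+q)"
 shows "P p"
 using assms(1) unfolding rel_ideal_def
 by (induction rule: fv.span_induct_alt) (use assms(2,3) in blast)+

lemma rel_idealI: "r \<in> R ==> r \<in> rel_ideal G R"
 unfolding rel_ideal_def by (intro fv.span_base CollectI exI[of _ "[]"] exI[of _ r]) auto

lemma rel_ideal_gen: "u \<in> lists G ==> r \<in> R ==> v \<in> lists G ==>
  fmul (word u) (fmul r (word v)) \<in> rel_ideal G R"
 unfolding rel_ideal_def by (rule fv.span_base) blast

lemma rel_ideal_word_left:
 assumes "p \<in> rel_ideal G R" "u \<in> lists G" shows "fmul (word u) p \<in> rel_ideal G R"
 using assms(1)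
proof (induction rule: rel_ideal_induct)
 case (add c u' r v q)
 have "fmul (word u) (fmul (word u') (fmul r (word v))) = fmul (word (u@u')) (fmul r (word v))"
  by (simp flip: fmul_assoc)
 moreover have "... \<in> rel_ideal G R"
  by (rule rel_ideal_gen) (use add assms in \<open>simp_all del: in_lists_conv_set\<close>)
 ultimately show ?case using add by (auto intro: rel_ideal_add rel_ideal_fscl)
qed (simp add: rel_ideal_0)

lemma rel_ideal_word_right:
 assumes "p \<in> rel_ideal G R" "w \<in> lists G" shows "fmul p (word w) \<in> rel_ideal G R"
 using assms(1)
proof (induction rule: rel_ideal_induct)
 case (add c u r v q)
 have "fmul (fmul (word u) (fmul r (word v))) (word w) = fmul (word u) (fmul r (word (v@w)))"
  by (simp add: fmul_assoc)
 moreover have "... \<in> rel_ideal G R"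
  by (rule rel_ideal_gen) (use add assms in \<open>simp_all del: in_lists_conv_set\<close>)
 ultimately show ?case using add by (auto intro: rel_ideal_add rel_ideal_fscl)
qed (simp add: rel_ideal_0)

lemma rel_ideal_left:
 assumes "p \<in> rel_ideal G R" "keys q <= lists G" shows "fmul q p \<in> rel_ideal G R"
 using assms(2)
 by (induction rule: pm_induct)
   (auto intro: rel_ideal_0 rel_ideal_add rel_ideal_fscl rel_ideal_word_left[OF assms(1)])

lemma rel_ideal_right:
 assumes "p \<in> rel_ideal G R" "keys q <= lists G" shows "fmul p q \<in> rel_ideal G R"
 using assms(2)
 by (induction rule: pm_induct)
   (auto intro: rel_ideal_0 rel_ideal_add rel_ideal_fscl rel_ideal_word_right[OF assms(1)])

lemma keys_rel_ideal:
 assumes "p \<in> rel_ideal G R" "!!r. r \<in> R ==> keys r <= lists G"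
 shows "keys p <= lists G"
 using assms(1)
proof (induction rule: rel_ideal_induct)
 case (add c u r v q)
 have "keys (fmul (word u) (fmul r (word v))) <= lists G"
  by (intro keys_fmul[where S = "lists G" and T = "lists G"]) (use add assms in auto)
 thus ?case using add by (intro keys_add_subset subset_trans[OF keys_fscl])
qed auto

lemma quot_props:
 assumes "fv.subspace U"
 shows "Vector_Spaces.linear fscl fscl (quot U)" "quot U p - p \<in> U" "p \<in> U ==> quot U p = 0"
proof -
 interpret vp: vector_space_pair "fscl :: 'k::field => ('w \<Rightarrow>\<^sub>0 'k) => _" "fscl :: 'k => ('w \<Rightarrow>\<^sub>0 'k) => _"
  by unfold_locales
 obtain B where B: "B <= U" "fv.independent B" "U <= fv.span B"
  using fv.maximal_independent_subset[of U] by blast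
 obtain C where C: "B <= C" "C <= UNIV" "fv.independent C" "UNIV <= fv.span C"
  by (rule fv.maximal_independent_subset_extend[OF subset_UNIV B(2)])
 obtain f where f: "Vector_Spaces.linear fscl fscl f" "ALL x:C. f x = (if x \<in> B then 0 else x)"
  using vp.linear_independent_extend[OF C(3), of "%x. if x \<in> B then 0 else x"] by blast
 interpret f: Vector_Spaces.linear fscl fscl f by (rule f)
 have 1: "f p - p \<in> U" for p
 proof -
  have "p \<in> fv.span C" using C(4) by blast
  thus ?thesis
  proof (induction rule: fv.span_induct_alt)
   case base show ?case using fv.subspace_0[OF assms] by (simp add: f.zero)
  next
   case (step c x y)
   have "f x - x \<in> U"
    using step f(2) B(1) fv.subspace_neg[OF assms, of x] fv.subspace_0[OF assms] by auto
   hence "fscl c (f x - x)+(f y - y) \<in> U"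
    by (intro fv.subspace_add[OF assms] fv.subspace_scale[OF assms] step)
   thus ?case by (simp add: f.add f.scale fv.scale_right_diff_distrib algebra_simps)
  qed
 qed
 have 2: "f p = 0" if "p \<in> U" for p
 proof -
  have "p \<in> fv.span B" using that B by blast
  thus ?thesis
   by (induction rule: fv.span_induct_alt) (use f(2) B(1) C(1) in \<open>auto simp: f.zero f.add f.scale\<close>)
 qed
 have "EX f. Vector_Spaces.linear fscl fscl f & (ALL p. f p - p \<in> U) & (ALL p:U. f p = 0)"
  using f(1) 1 2 by blast
 from someI_ex[OF this]
 show "Vector_Spaces.linear fscl fscl (quot U)" "quot U p - p \<in> U" "p \<in> U ==> quot U p = 0"
  unfolding quot_def by blast+
qed

lemma
 assumes "fv.subspace U"
 shows quot_add: "quot U (p+q) = quot U p+quot U q"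
  and quot_fscl: "quot U (fscl c p) = fscl c (quot U p)"
  and quot_diff: "quot U (p - q) = quot U p - quot U q"
  and quot_zero: "quot U 0 = 0"
  and quot_sum: "quot U (sum g S) = (SUM s:S. quot U (g s))"
proof -
 interpret l: Vector_Spaces.linear fscl fscl "quot U" by (rule quot_props[OF assms])
 show "quot U (p+q) = quot U p+quot U q" by (rule l.add)
 show "quot U (fscl c p) = fscl c (quot U p)" by (rule l.scale)
 show "quot U (p - q) = quot U p - quot U q" by (rule l.diff)
 show "quot U 0 = 0" by (rule l.zero)
 show "quot U (sum g S) = (SUM s:S. quot U (g s))" by (rule l.sum)
qed

lemma quot_eq_iff:
 assumes "fv.subspace U" shows "quot U p = quot U q \<longleftrightarrow> p - q \<in> U"
proof
 assume e: "quot U p = quot U q"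
 have "(quot U q - q) - (quot U p - p) \<in> U"
  by (intro fv.subspace_diff[OF assms] quot_props[OF assms])
 thus "p - q \<in> U" using e by simp
next
 assume "p - q \<in> U"
 hence "quot U (p - q) = 0" by (rule quot_props[OF assms])
 thus "quot U p = quot U q" by (simp add: quot_diff[OF assms])
qed

lemma quot_quot:
 assumes "fv.subspace U" shows "quot U (quot U p) = quot U p"
 using quot_props(2)[OF assms, of p] by (simp add: quot_eq_iff[OF assms])

section \<open>The signed shuffle algebra\<close>

text \<open>
 The product of f and g at w sums over the ways to split w into a subword u for f and a subword v
 for g; the Koszul sign is that of rearranging w as u v. A letter that goes to g passes what remains
 of u.
\<close>

fun sh :: "('x => int) => ('x list => 'k::field) => ('x list => 'k) => 'x list => 'k" where
 "sh deg f g [] = f []*g []"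
| "sh deg f g (x#w) = sh deg (%u. f (x#u)) g w
  +sh deg (%u. eps (deg x*wdeg deg u)*f u) (%u. g (x#u)) w"

definition shone :: "'x list => 'k::field" where
 "shone w = (if w = [] then 1 else 0)"

lemma shone_simps [simp]: "shone [] = 1" "shone (x#w) = 0"
 by (simp_all add: shone_def)

lemma sh_add_left: "sh deg (%w. f w+f' w) g w = sh deg f g w+sh deg f' g w"
 by (induction w arbitrary: f f' g) (simp_all add: algebra_simps)

lemma sh_add_right: "sh deg f (%w. g w+g' w) w = sh deg f g w+sh deg f g' w"
 by (induction w arbitrary: f g g') (simp_all add: algebra_simps)

lemma sh_scale_left: "sh deg (%w. c*f w) g w = c*sh deg f g w"
proof (induction w arbitrary: f g)
 case (Cons x w)
 have "(%u. eps (deg x*wdeg deg u)*(c*f u)) = (%u. c*(eps (deg x*wdeg deg u)*f u))"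
  by (simp add: ac_simps)
 with Cons show ?case by (simp add: algebra_simps)
qed simp

lemma sh_scale_right: "sh deg f (%w. c*g w) w = c*sh deg f g w"
 by (induction w arbitrary: f g) (simp_all add: algebra_simps)

lemma sh_zero [simp]: "sh deg (%w. 0) g w = 0" "sh deg f (%w. 0) w = 0"
 using sh_scale_left[of deg 0 "%w. 0" g w] sh_scale_right[of deg f 0 "%w. 0" w] by simp_all

lemma sh_sum_left: "sh deg (%w. SUM i:I. f i w) g w = (SUM i:I. sh deg (f i) g w)"
 by (induction I rule: infinite_finite_induct) (simp_all add: sh_add_left)

lemma sh_sum_right: "sh deg f (%w. SUM i:I. g i w) w = (SUM i:I. sh deg f (g i) w)"
 by (induction I rule: infinite_finite_induct) (simp_all add: sh_add_right)

lemma sh_twist: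
 "sh deg (%u. eps (c*wdeg deg u)*f u) (%u. eps (c*wdeg deg u)*g u) w
   = eps (c*wdeg deg w)*sh deg f g w"
proof (induction w arbitrary: f g)
 case (Cons x w)
 have 1: "(%u. eps (c*(deg x+wdeg deg u))*f (x#u))
   = (%u. eps (c*deg x)*(eps (c*wdeg deg u)*f (x#u)))" for f
  by (simp add: eps_mult_left distrib_left)
 have 2: "(%u. eps (deg x*wdeg deg u)*(eps (c*wdeg deg u)*f u))
   = (%u. eps (c*wdeg deg u)*(eps (deg x*wdeg deg u)*f u))"
  by (simp add: ac_simps)
 show ?case
  by (simp only: sh.simps wdeg_simps 1 2 sh_scale_left sh_scale_right Cons)
    (simp add: eps_add algebra_simps)
qed simp

lemma sh_assoc: "sh deg (sh deg f g) h w = sh deg f (sh deg g h) w"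
proof (induction w arbitrary: f g h)
 case (Cons x w)
 show ?case
  by (simp add: sh_add_left sh_add_right Cons flip: sh_twist)
qed simp

lemma sh_one_left [simp]:
 fixes g :: "'x list => 'k::field" shows "sh deg shone g w = g w"
proof (induction w arbitrary: g)
 case (Cons x w)
 have "(%u. eps (deg x*wdeg deg u)*shone u) = (shone :: 'x list => 'k)"
  by (auto simp: shone_def fun_eq_iff)
 with Cons show ?case by simp
qed simp

lemma sh_one_right [simp]: "sh deg f shone w = f w"
 by (induction w arbitrary: f) simp_all


definition homog :: "('x => int) => int => ('x list => 'k::field) set" where
 "homog deg i = {f. ALL w. f w ~= 0 --> wdeg deg w = i}"

lemma homogD: "f \<in> homog deg i ==> wdeg deg w ~= i ==> f w = 0"
 by (auto simp: homog_def)

lemma homog_left_shift: "f \<in> homog deg i ==> (%u. f (x#u)) \<in> homog deg (i - deg x)"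
 by (force simp: homog_def)

lemma homog_right_shift: "f \<in> homog deg i ==> (%u. f (u@[x])) \<in> homog deg (i - deg x)"
 by (force simp: homog_def)

lemma homog_twist: "f \<in> homog deg i ==> eps (c*wdeg deg u)*f u = eps (c*i)*f u"
 by (cases "wdeg deg u = i") (auto simp: homogD)

lemma sh_comm:
 assumes "f \<in> homog deg i" "g \<in> homog deg j"
 shows "sh deg f g w = eps (i*j)*sh deg g f w"
 using assms
proof (induction w arbitrary: f g i j)
 case Nil
 show ?case
 proof (cases "i = 0 & j = 0")
  case False
  hence "f []*g [] = 0" using Nil homogD[of f deg i "[]"] homogD[of g deg j "[]"] by auto
  thus ?thesis by (simp add: mult.commute)
 qed simp
next
 case (Cons x w)
 let ?f = "%u. f (x#u)" and ?g = "%u. g (x#u)"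
 have "sh deg ?f g w = eps ((i - deg x)*j)*sh deg g ?f w"
  by (intro Cons.IH homog_left_shift Cons.prems)
 moreover have "sh deg f ?g w = eps (i*(j - deg x))*sh deg ?g f w"
  by (intro Cons.IH homog_left_shift Cons.prems)
 moreover have "eps (deg x*i+i*(j - deg x)) = (eps (i*j) :: 'b)"
  "eps (i*j+deg x*j) = (eps ((i - deg x)*j) :: 'b)"
  by (intro eps_cong; force)+
 ultimately show ?case
  by (simp add: homog_twist[OF Cons.prems(1)] homog_twist[OF Cons.prems(2)] sh_scale_left
    eps_mult_left eps_mult distrib_left)
qed

lemma sh_homog:
 assumes "f \<in> homog deg i" "g \<in> homog deg j" shows "sh deg f g \<in> homog deg (i+j)"
proof -
 have "sh deg f g w = 0" if "wdeg deg w ~= i+j" for w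
  using assms that
 proof (induction w arbitrary: f g i j)
  case Nil
  hence "f [] = 0 \<or> g [] = 0" using homogD[of f deg i "[]"] homogD[of g deg j "[]"] by fastforce
  thus ?case by auto
 next
  case (Cons x w)
  have "sh deg (%u. f (x#u)) g w = 0"
   by (rule Cons.IH[OF homog_left_shift Cons.prems(2)]) (use Cons.prems in auto)
  moreover have "sh deg f (%u. g (x#u)) w = 0"
   by (rule Cons.IH[OF Cons.prems(1) homog_left_shift]) (use Cons.prems in auto)
  ultimately show ?case by (simp add: homog_twist[OF Cons.prems(1)] sh_scale_left)
 qed
 thus ?thesis unfolding homog_def by blast
qed

text \<open>The right shift is a derivation acting from the right.\<close>

lemma sh_snoc: "sh deg f g (w@[x]) = sh deg f (%u. g (u@[x])) w
  +sh deg (%u. f (u@[x])) (%u. eps (deg x*wdeg deg u)*g u) w"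
proof (induction w arbitrary: f g)
 case (Cons y w)
 have 1: "(%u. eps (deg y*(wdeg deg u+deg x))*f (u@[x]))
   = (%u. eps (deg y*deg x)*(eps (deg y*wdeg deg u)*f (u@[x])))"
  and 2: "(%u. eps (deg x*(deg y+wdeg deg u))*g (y#u))
   = (%u. eps (deg y*deg x)*(eps (deg x*wdeg deg u)*g (y#u)))"
  by (simp_all add: eps_add algebra_simps)
 show ?case
  by (simp add: Cons 1 2 sh_scale_left sh_scale_right)
qed simp

section \<open>Functions with the symmetry of a graded symmetric algebra\<close>

definition swapsym :: "('x => int) => ('x list => 'k::field) set" where
 "swapsym deg = {f. ALL u x y v. f (u@x#y#v) = eps (deg x*deg y)*f (u@y#x#v)}"

lemma swapsymI: "(!!u x y v. f (u@x#y#v) = eps (deg x*deg y)*f (u@y#x#v)) ==> f \<in> swapsym deg"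
 unfolding swapsym_def by blast

lemma swapsymD: "f \<in> swapsym deg ==> f (u@x#y#v) = eps (deg x*deg y)*f (u@y#x#v)"
 unfolding swapsym_def by blast

lemma swapsymD0: "f \<in> swapsym deg ==> f (x#y#v) = eps (deg x*deg y)*f (y#x#v)"
 using swapsymD[of f deg "[]" x y v] by simp

lemma swapsym_left_shift:
 assumes "f \<in> swapsym deg" shows "(%u. f (z#u)) \<in> swapsym deg"
proof (rule swapsymI, goal_cases)
 case (1 u x y v)
 show ?case
  using swapsymD[OF assms, of "z#u" x y v] by simp
qed

lemma swapsym_right_shift:
 assumes "f \<in> swapsym deg" shows "(%u. f (u@[z])) \<in> swapsym deg"
proof (rule swapsymI, goal_cases)
 case (1 u x y v)
 show ?case
  using swapsymD[OF assms, of u x y "v@[z]"] by simp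
qed

lemma swapsym_twist:
 assumes f: "f \<in> swapsym deg" shows "(%u. eps (c*wdeg deg u)*f u) \<in> swapsym deg"
proof (rule swapsymI, goal_cases)
 case (1 u x y v)
 show ?case
  by (subst swapsymD[OF f]) (simp add: algebra_simps)
qed

lemma swapsym_add:
 assumes "f \<in> swapsym deg" "g \<in> swapsym deg" shows "(%u. f u+g u) \<in> swapsym deg"
proof (rule swapsymI, goal_cases)
 case (1 u x y v)
 show ?case
  by (subst swapsymD[OF assms(1)], subst swapsymD[OF assms(2)]) (simp add: distrib_left)
qed

lemma swapsym_scale:
 assumes "f \<in> swapsym deg" shows "(%u. c*f u) \<in> swapsym deg"
proof (rule swapsymI, goal_cases)
 case (1 u x y v)
 show ?case
  by (subst swapsymD[OF assms]) simp
qed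

lemma swapsym_zero: "(%u. 0) \<in> swapsym deg"
 by (simp add: swapsym_def)

lemma swapsym_one: "shone \<in> swapsym deg"
 by (simp add: swapsym_def shone_def)

lemma swapsym_sh:
 assumes "f \<in> swapsym deg" "g \<in> swapsym deg" shows "sh deg f g \<in> swapsym deg"
proof -
 have "sh deg f g (u@x#y#v) = eps (deg x*deg y)*sh deg f g (u@y#x#v)" for u x y v
  using assms
 proof (induction u arbitrary: f g)
  case Nil
  have a: "(%u. f (x#y#u)) = (%u. eps (deg x*deg y)*f (y#x#u))"
   and b: "(%u. g (x#y#u)) = (%u. eps (deg x*deg y)*g (y#x#u))"
   by (rule ext, rule swapsymD0, fact)+
  have c: "(%u. eps (deg a*(deg b+wdeg deg u))*f (b#u))
    = (%u. eps (deg a*deg b)*(eps (deg a*wdeg deg u)*f (b#u)))" for a b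
   by (simp add: eps_mult_left distrib_left)
  have d: "(%u. eps (deg y*wdeg deg u)*(eps (deg x*wdeg deg u)*f u))
    = (%u. eps (deg x*wdeg deg u)*(eps (deg y*wdeg deg u)*f u))"
   by (simp add: ac_simps)
  show ?case
   by (simp only: append_Nil sh.simps wdeg_simps a b c d sh_scale_left sh_scale_right)
     (simp add: algebra_simps)
 next
  case (Cons z u)
  show ?case
   by (simp add: Cons.IH swapsym_left_shift swapsym_twist Cons.prems distrib_left)
 qed
 thus ?thesis unfolding swapsym_def by blast
qed

lemma swapsym_to_front:
 assumes "f \<in> swapsym deg"
 shows "f (u@x#v) = eps (deg x*wdeg deg u)*f (x#u@v)"
 using assms
proof (induction u arbitrary: f)
 case (Cons y u)
 have "f ((y#u)@x#v) = eps (deg x*wdeg deg u)*f (y#x#u@v)"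
  using Cons.IH[OF swapsym_left_shift[OF Cons.prems]] by simp
 also have "f (y#x#u@v) = eps (deg y*deg x)*f (x#y#u@v)"
  by (rule swapsymD0[OF Cons.prems])
 finally show ?case by (simp add: eps_mult_left distrib_left algebra_simps)
qed simp

section \<open>Products of linear functions\<close>


definition lin :: "('x => 'k::field) => 'x list => 'k" where
 "lin h w = (case w of [x] => h x | _ => 0)"

lemma lin_simps [simp]: "lin h [] = 0" "lin h [x] = h x" "lin h (x#y#w) = 0"
 by (simp_all add: lin_def)

lemma lin_Cons: "lin h (x#w) = h x*shone w"
 by (cases w) (simp_all add: shone_def)

lemma lin_nonzero: "lin h w ~= 0 \<longleftrightarrow> (EX x. w = [x] & h x ~= 0)"
 by (cases w rule: remdups_adj.cases) auto

lemma swapsym_lin: "lin h \<in> swapsym deg"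
proof -
 have "lin h (u@x#y#v) = 0" for u x y v
  by (cases u) (auto simp: lin_def split: list.split)
 thus ?thesis by (simp add: swapsym_def)
qed

lemma sh_lin:
 assumes "!!x. h x ~= 0 ==> deg x = i"
 shows "sh deg (lin h) g w = (SUM j<length w. h (w ! j)*eps (i*wdeg deg (take j w))
     *g (take j w@drop (Suc j) w))"
proof (induction w arbitrary: g)
 case (Cons x w)
 have 1: "(%u. lin h (x#u)) = (%u. h x*shone u)" by (simp add: lin_Cons)
 have 2: "(%u. eps (deg x*wdeg deg u)*lin h u) = (%u. eps (deg x*i)*lin h u)"
 proof
  fix u show "eps (deg x*wdeg deg u)*lin h u = eps (deg x*i)*lin h u"
   using assms by (cases "lin h u = 0") (auto simp: lin_nonzero)
 qed
 show ?case
  by (simp add: 1 2 sh_scale_left Cons sum.lessThan_Suc_shift sum_distrib_left del: sum.lessThan_Suc)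
    (intro sum.cong refl, simp add: eps_add algebra_simps)
qed simp

text \<open>Each entry of the list is a linear function together with its degree.\<close>

definition linprod :: "('x => int) => (int \<times> ('x => 'k::field)) list => 'x list => 'k" where
 "linprod deg hs = foldr (%(i, h). sh deg (lin h)) hs shone"

lemma linprod_simps [simp]:
 "linprod deg [] = shone" "linprod deg ((i, h)#hs) = sh deg (lin h) (linprod deg hs)"
 by (simp_all add: linprod_def)

definition lhomog :: "('x => int) => (int \<times> ('x => 'k::field)) list => bool" where
 "lhomog deg hs \<longleftrightarrow> (ALL (i, h):set hs. ALL x. h x ~= 0 --> deg x = i)"

abbreviation drop_at :: "nat => 'a list => 'a list" where
 "drop_at j w \<equiv> take j w@drop (Suc j) w"

lemma linprod_Cons:
 assumes "lhomog deg hs"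
 shows "linprod deg hs (x#u) = (SUM j<length hs. snd (hs ! j) x*eps (deg x*wdeg fst (take j hs))
     *linprod deg (drop_at j hs) u)"
 using assms
proof (induction hs arbitrary: u)
 case Nil
 thus ?case by (simp add: shone_def)
next
 case (Cons a hs)
 obtain i h where a: "a = (i, h)" by (cases a)
 have h: "h x ~= 0 ==> deg x = i" for x using Cons.prems a by (force simp: lhomog_def)
 have hs: "lhomog deg hs" using Cons.prems by (simp add: lhomog_def)
 have 1: "(%u. lin h (x#u)) = (%u. h x*shone u)" by (simp add: lin_Cons)
 have 2: "(%u. eps (deg x*wdeg deg u)*lin h u) = (%u. eps (deg x*i)*lin h u)"
 proof
  fix u show "eps (deg x*wdeg deg u)*lin h u = eps (deg x*i)*lin h u"
   using h by (cases "lin h u = 0") (auto simp: lin_nonzero)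
 qed
 have 3: "(%u. linprod deg hs (x#u)) = (%u. SUM j<length hs. (snd (hs ! j) x*eps (deg x*wdeg fst (take j hs)))
     *linprod deg (drop_at j hs) u)"
  using Cons.IH[OF hs] by simp
 show ?case
  by (simp add: a 1 2 3 sh_scale_left sh_scale_right sh_sum_right sum.lessThan_Suc_shift
     sum_distrib_left del: sum.lessThan_Suc)
    (intro sum.cong refl, simp add: eps_add algebra_simps)
qed

lemma linprod_length: "linprod deg hs w ~= 0 ==> lhomog deg hs ==> length w = length hs"
proof (induction w arbitrary: hs)
 case Nil
 thus ?case by (cases hs) (auto simp: shone_def)
next
 case (Cons x w)
 have "EX j<length hs. linprod deg (drop_at j hs) w ~= 0"
 proof (rule ccontr)
  assume "\<not> ?thesis"
  hence "linprod deg hs (x#w) = 0" unfolding linprod_Cons[OF Cons.prems(2)] by (intro sum.neutral) auto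
  with Cons.prems show False by simp
 qed
 then obtain j where j: "j < length hs" "linprod deg (drop_at j hs) w ~= 0" by blast
 have "lhomog deg (drop_at j hs)" using Cons.prems(2)
  by (auto simp: lhomog_def dest: in_set_takeD in_set_dropD)
 with Cons.IH j show ?case by fastforce
qed

lemma swapsym_linprod: "linprod deg hs \<in> swapsym deg"
proof (induction hs)
 case (Cons a hs)
 thus ?case by (cases a) (simp add: swapsym_sh swapsym_lin)
qed (simp add: swapsym_one)


definition letter :: "'x => 'x => 'k::field" where
 "letter x y = (if y = x then 1 else 0)"

definition monomial :: "('x => int) => 'x list => 'x list => 'k::field" where
 "monomial deg u = linprod deg (map (%x. (deg x, letter x)) u)"

lemma monomial_simps [simp]:
 "monomial deg [] = shone" "monomial deg (x#u) = sh deg (lin (letter x)) (monomial deg u)"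
 by (simp_all add: monomial_def)

lemma swapsym_monomial: "monomial deg u \<in> swapsym deg"
 unfolding monomial_def by (rule swapsym_linprod)

lemma monomial_Cons_left:
 "monomial deg (x#u) w = (SUM j<length w. letter x (w ! j)*eps (deg x*wdeg deg (take j w))
   *monomial deg u (drop_at j w))"
 unfolding monomial_simps by (rule sh_lin) (simp add: letter_def split: if_splits)

lemma wdeg_map: "wdeg deg (map f w) = wdeg (%x. deg (f x)) w"
 by (simp add: wdeg_def comp_def)

lemma monomial_Cons_right:
 "monomial deg v (x#u) = (SUM j<length v. letter (v ! j) x*eps (deg x*wdeg deg (take j v))
   *monomial deg (drop_at j v) u)"
proof -
 have l: "lhomog deg (map (%x. (deg x, letter x)) v)"
  by (auto simp: lhomog_def letter_def split: if_splits)
 show ?thesis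
  unfolding monomial_def linprod_Cons[OF l]
  by (auto intro!: sum.cong simp: take_map drop_map wdeg_map)
qed

lemma sh_nonzero:
 assumes "sh deg f g w ~= 0"
 shows "EX u v. f u ~= 0 & g v ~= 0 & mset w = mset u+mset v"
 using assms
proof (induction w arbitrary: f g)
 case Nil
 thus ?case by (intro exI[of _ "[]"]) auto
next
 case (Cons x w)
 from Cons.prems consider "sh deg (%u. f (x#u)) g w ~= 0"
  | "sh deg (%u. eps (deg x*wdeg deg u)*f u) (%u. g (x#u)) w ~= 0" by fastforce
 thus ?case
 proof cases
  case 1
  from Cons.IH[OF this] obtain u v where "f (x#u) ~= 0" "g v ~= 0" "mset w = mset u+mset v" by blast
  thus ?thesis by (intro exI[of _ "x#u"] exI[of _ v]) auto
 next
  case 2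
  from Cons.IH[OF this] obtain u v where "f u ~= 0" "g (x#v) ~= 0" "mset w = mset u+mset v" by auto
  thus ?thesis by (intro exI[of _ u] exI[of _ "x#v"]) auto
 qed
qed

text \<open>
 Symmetric functions of bounded length on words in the letters X: the model of the symmetric
 algebra on generators X.
\<close>

definition Symf :: "('x => int) => 'x set => ('x list => 'k::field) set" where
 "Symf deg X = {f \<in> swapsym deg. (ALL w. f w ~= 0 --> set w <= X) & (EX K. ALL w. f w ~= 0 --> length w <= K)}"

definition wthom :: "('x => nat) => nat => ('x list => 'k::field) set" where
 "wthom wt m = {f. ALL w. f w ~= 0 --> (SUM x<-w. wt x) = m}"

lemma SymfI: "f \<in> swapsym deg ==> (!!w. f w ~= 0 ==> set w <= X) ==> (!!w. f w ~= 0 ==> length w <= K)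
  ==> f \<in> Symf deg X"
 unfolding Symf_def by blast

lemma Symf_swapsym: "f \<in> Symf deg X ==> f \<in> swapsym deg"
 and Symf_supp: "f \<in> Symf deg X ==> f w ~= 0 ==> set w <= X"
 unfolding Symf_def by blast+

lemma Symf_bound: "f \<in> Symf deg X ==> EX K. ALL w. f w ~= 0 --> length w <= K"
 unfolding Symf_def by blast

lemma Symf_sh:
 assumes f: "f \<in> Symf deg X" and g: "g \<in> Symf deg X" shows "sh deg f g \<in> Symf deg X"
proof -
 obtain K L where K: "ALL w. f w ~= 0 --> length w <= K" "ALL w. g w ~= 0 --> length w <= L"
  using Symf_bound[OF f] Symf_bound[OF g] by blast
 show ?thesis
 proof (rule SymfI[where K = "K+L"])
  show "sh deg f g \<in> swapsym deg" by (intro swapsym_sh Symf_swapsym[OF f] Symf_swapsym[OF g])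
  fix w assume "sh deg f g w ~= 0"
  then obtain u v where uv: "f u ~= 0" "g v ~= 0" "mset w = mset u+mset v" using sh_nonzero by blast
  from uv(3) have "set w = set u \<union> set v" by (metis set_mset_mset set_mset_union)
  thus "set w <= X" using Symf_supp[OF f uv(1)] Symf_supp[OF g uv(2)] by blast
  from uv(3) have "length w = length u+length v" by (metis size_mset size_union)
  thus "length w <= K+L" using K uv by fastforce
 qed
qed

lemma wthom_sh: "f \<in> wthom wt m ==> g \<in> wthom wt m' ==> sh deg f g \<in> wthom wt (m+m')"
 unfolding wthom_def
proof safe
 fix w assume *: "ALL w. f w ~= 0 --> (SUM x<-w. wt x) = m" "ALL w. g w ~= 0 --> (SUM x<-w. wt x) = m'" "sh deg f g w ~= 0"
 then obtain u v where uv: "f u ~= 0" "g v ~= 0" "mset w = mset u+mset v" using sh_nonzero by blast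
 have "(SUM x<-w. wt x) = sum_mset (image_mset wt (mset w))" by (simp flip: sum_mset_sum_list)
 also have "... = (SUM x<-u. wt x)+(SUM x<-v. wt x)"
  unfolding uv(3) by (simp flip: sum_mset_sum_list)
 also have "... = m+m'" using * uv by simp
 finally show "(SUM x<-w. wt x) = m+m'" .
qed

lemma Symf_add:
 assumes f: "f \<in> Symf deg X" and g: "g \<in> Symf deg X" shows "(%w. f w+g w) \<in> Symf deg X"
proof -
 obtain K L where K: "ALL w. f w ~= 0 --> length w <= K" "ALL w. g w ~= 0 --> length w <= L"
  using Symf_bound[OF f] Symf_bound[OF g] by blast
 show ?thesis
 proof (rule SymfI[where K = "max K L"])
  show "(%w. f w+g w) \<in> swapsym deg" by (intro swapsym_add Symf_swapsym[OF f] Symf_swapsym[OF g])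
  fix w assume "f w+g w ~= 0"
  hence "f w ~= 0 \<or> g w ~= 0" by auto
  thus "set w <= X" "length w <= max K L"
   using Symf_supp[OF f, of w] Symf_supp[OF g, of w] K by (auto simp: le_max_iff_disj)
 qed
qed

lemma Symf_scale:
 assumes f: "f \<in> Symf deg X" shows "(%w. c*f w) \<in> Symf deg X"
proof -
 obtain K where K: "!!w. f w ~= 0 ==> length w <= K" using Symf_bound[OF f] by blast
 show ?thesis
  by (rule SymfI[where K = K])
    (simp_all add: K swapsym_scale[OF Symf_swapsym[OF f]] Symf_supp[OF f])
qed

lemma Symf_zero: "(%w. 0) \<in> Symf deg X"
 by (rule SymfI) (auto intro: swapsym_zero)

lemma Symf_sum: "(!!i. i \<in> I ==> f i \<in> Symf deg X) ==> (%u. SUM i:I. f i u) \<in> Symf deg X"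
 by (induction I rule: infinite_finite_induct) (auto intro: Symf_zero Symf_add)

lemma Symf_one: "shone \<in> Symf deg X"
 by (rule SymfI[where K = 0]) (auto intro: swapsym_one simp: shone_def split: if_splits)

lemma Symf_lin: "(!!x. h x ~= 0 ==> x \<in> X) ==> lin h \<in> Symf deg X"
 by (rule SymfI[where K = 1]) (auto intro: swapsym_lin simp: lin_nonzero)

lemma Symf_monomial: "set u <= X ==> monomial deg u \<in> Symf deg X"
proof (induction u)
 case (Cons x u)
 show ?case unfolding monomial_simps
  by (intro Symf_sh Symf_lin Cons.IH) (use Cons.prems in \<open>auto simp: letter_def split: if_splits\<close>)
qed (simp add: Symf_one)

lemma Symf_left_shift:
 assumes f: "f \<in> Symf deg X" shows "(%u. f (x#u)) \<in> Symf deg X"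
proof -
 obtain K where K: "!!w. f w ~= 0 ==> length w <= K" using Symf_bound[OF f] by blast
 have "length w <= K" if "f (x#w) ~= 0" for w using K[OF that] by simp
 moreover have "set w <= X" if "f (x#w) ~= 0" for w using Symf_supp[OF f that] by simp
 ultimately show ?thesis
  by (rule SymfI[OF swapsym_left_shift[OF Symf_swapsym[OF f]], rotated])
qed

lemma Symf_right_shift:
 assumes f: "f \<in> Symf deg X" shows "(%u. f (u@[x])) \<in> Symf deg X"
proof -
 obtain K where K: "!!w. f w ~= 0 ==> length w <= K" using Symf_bound[OF f] by blast
 have "length w <= K" if "f (w@[x]) ~= 0" for w using K[OF that] by simp
 moreover have "set w <= X" if "f (w@[x]) ~= 0" for w using Symf_supp[OF f that] by simp
 ultimately show ?thesis
  by (rule SymfI[OF swapsym_right_shift[OF Symf_swapsym[OF f]], rotated])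
qed

lemma homog_add:
 assumes "f \<in> homog deg i" "g \<in> homog deg i" shows "(%w. f w+g w) \<in> homog deg i"
proof -
 have "wdeg deg w = i" if "f w+g w ~= 0" for w
  using that assms by (cases "f w = 0") (auto simp: homog_def)
 thus ?thesis by (simp add: homog_def)
qed

lemma homog_scale: "f \<in> homog deg i ==> (%w. c*f w) \<in> homog deg i"
 unfolding homog_def by auto

lemma homog_zero: "(%w. 0) \<in> homog deg i"
 by (simp add: homog_def)

lemma homog_sum: "(!!k. k \<in> I ==> f k \<in> homog deg i) ==> (%u. SUM k:I. f k u) \<in> homog deg i"
 by (induction I rule: infinite_finite_induct) (auto intro: homog_zero homog_add)

lemma homog_one: "shone \<in> homog deg 0"
 by (simp add: homog_def shone_def)

lemma homog_lin: "(!!x. h x ~= 0 ==> deg x = i) ==> lin h \<in> homog deg i"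
 by (auto simp: homog_def lin_nonzero)

definition words :: "'x set => nat => 'x list set" where
 "words X k = {u. set u <= X & length u = k}"

lemma finite_words: "finite X ==> finite (words X k)"
 unfolding words_def by (rule finite_lists_length_eq)

lemma words_0 [simp]: "words X 0 = {[]}"
 by (auto simp: words_def)

lemma sum_words_Suc:
 assumes "finite X"
 shows "(SUM u:words X (Suc k). F u) = (SUM x:X. SUM u:words X k. F (x#u))"
proof -
 have "words X (Suc k) = (%(x, u). x#u) ` (X \<times> words X k)"
  by (auto simp: words_def image_iff length_Suc_conv)
 moreover have "inj_on (%(x, u). x#u) (X \<times> words X k)" by (auto simp: inj_on_def)
 ultimately show ?thesis by (simp add: sum.reindex sum.cartesian_product case_prod_unfold)
qed


section \<open>Permutations and Koszul signs\<close>

lemma koszul_eps: "koszul ds si = (PROD (i, j):{(i, j). i < j & j < length ds & si j < si i}. eps (ds ! si i*ds ! si j))"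
 by (simp add: koszul_def sg_eps)

lemma permutes_injI:
 assumes "finite S" "!!x. x \<in> S ==> p x \<in> S" "inj_on p S" "!!x. x \<notin> S ==> p x = x"
 shows "p permutes S"
 by (rule bij_imp_permutes)
   (use assms endo_inj_surj[of S p] in \<open>auto simp: bij_betw_def image_subset_iff\<close>)

text \<open>A permutation of k + 1 entries is given by its first value r and a permutation \<open>ta\<close> of k entries;
 inductions over permutations use this decomposition.\<close>

definition cons_perm :: "nat => (nat => nat) => nat => nat" where
 "cons_perm r ta i = (case i of 0 => r | Suc j => if ta j < r then ta j else Suc (ta j))"

lemma cons_perm_simps [simp]:
 "cons_perm r ta 0 = r" "cons_perm r ta (Suc j) = (if ta j < r then ta j else Suc (ta j))"
 by (simp_all add: cons_perm_def)

lemma permutes_cons_perm: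
 assumes "ta permutes {..<k}" "r <= k" shows "cons_perm r ta permutes {..<Suc k}"
proof (rule permutes_injI)
 have inn: "ta j < k \<longleftrightarrow> j < k" for j using permutes_in_image[OF assms(1), of j] by simp
 fix x assume "x \<in> {..<Suc k}"
 thus "cons_perm r ta x \<in> {..<Suc k}" using assms(2) inn[of "x - 1"] by (cases x) auto
next
 show "inj_on (cons_perm r ta) {..<Suc k}"
 proof (rule inj_onI)
  fix x y assume "cons_perm r ta x = cons_perm r ta y"
  thus "x = y" using permutes_inj[OF assms(1)]
   by (cases x; cases y) (auto split: if_splits dest: injD)
 qed
next
 fix x assume x: "x \<notin> {..<Suc k}"
 then obtain j where j: "x = Suc j" "j >= k" by (cases x) auto
 thus "cons_perm r ta x = x" using permutes_not_in[OF assms(1), of j] assms(2) by simp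
qed simp

lemma cons_perm_inj:
 assumes "cons_perm r ta = cons_perm r' ta'" shows "r = r' & ta = ta'"
proof -
 have r: "r = r'" using fun_cong[OF assms, of 0] by simp
 have "ta j = ta' j" for j using fun_cong[OF assms, of "Suc j"] r by (auto split: if_splits)
 with r show ?thesis by auto
qed

lemma permutes_Suc_eq:
 "{si. si permutes {..<Suc k}} = (%(r, ta). cons_perm r ta) ` ({..<Suc k} \<times> {ta. ta permutes {..<k}})"
proof (rule sym, rule card_subset_eq)
 show "finite {si. si permutes {..<Suc k}}" by (rule finite_permutations) simp
 show "(%(r, ta). cons_perm r ta) ` ({..<Suc k} \<times> {ta. ta permutes {..<k}}) <= {si. si permutes {..<Suc k}}"
  using permutes_cons_perm by auto
 have "inj_on (%(r, ta). cons_perm r ta) ({..<Suc k} \<times> {ta. ta permutes {..<k}})"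
  by (auto simp: inj_on_def dest: cons_perm_inj)
 hence "card ((%(r, ta). cons_perm r ta) ` ({..<Suc k} \<times> {ta. ta permutes {..<k}})) = Suc k*fact k"
  by (simp add: card_image card_cartesian_product card_permutations)
 thus "card ((%(r, ta). cons_perm r ta) ` ({..<Suc k} \<times> {ta. ta permutes {..<k}}))
   = card {si. si permutes {..<Suc k}}"
  by (simp add: card_permutations[OF _ finite_lessThan])
qed

lemma permutes_SucE:
 assumes "si permutes {..<Suc k}"
 obtains r ta where "si = cons_perm r ta" "r <= k" "ta permutes {..<k}"
proof -
 have "si \<in> {si. si permutes {..<Suc k}}" using assms by simp
 thus ?thesis unfolding permutes_Suc_eq using that by auto
qed

lemma sum_permutes_Suc:
 "(SUM si | si permutes {..<Suc k}. F si) = (SUM r<Suc k. SUM ta | ta permutes {..<k}. F (cons_perm r ta))"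
proof -
 have "inj_on (%(r, ta). cons_perm r ta) ({..<Suc k} \<times> {ta. ta permutes {..<k}})"
  by (auto simp: inj_on_def dest: cons_perm_inj)
 thus ?thesis unfolding permutes_Suc_eq
  by (simp add: sum.reindex sum.cartesian_product case_prod_unfold del: sum.lessThan_Suc)
qed

lemma nth_drop_at:
 assumes "r < length w" "j < length w - 1"
 shows "drop_at r w ! j = w ! (if j < r then j else Suc j)"
 using assms by (auto simp: nth_append min_def)

lemma permute_cons_perm:
 assumes "length w = Suc k" "r <= k" "ta permutes {..<k}"
 shows "perm (cons_perm r ta) w = w ! r#perm ta (drop_at r w)"
proof (rule nth_equalityI)
 show "length (perm (cons_perm r ta) w) = length (w ! r#perm ta (drop_at r w))"
  using assms by (simp add: permute_list_def)
 fix i assume i: "i < length (perm (cons_perm r ta) w)"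
 have inn: "ta j < k \<longleftrightarrow> j < k" for j using permutes_in_image[OF assms(3), of j] by simp
 show "perm (cons_perm r ta) w ! i = (w ! r#perm ta (drop_at r w)) ! i"
 proof (cases i)
  case 0
  thus ?thesis using assms i by (simp add: permute_list_def del: upt_Suc)
 next
  case (Suc j)
  hence j: "j < k" using i assms by (simp add: permute_list_def)
  have "(w ! r#perm ta (drop_at r w)) ! i = drop_at r w ! ta j"
   using j Suc assms by (simp add: permute_list_def)
  also have "... = w ! (if ta j < r then ta j else Suc (ta j))"
   by (rule nth_drop_at) (use assms j inn in auto)
  finally show ?thesis using Suc j assms by (simp add: permute_list_def del: upt_Suc)
 qed
qed

lemma sum_list_take_nth: "r <= length ds ==> (SUM p<r. ds ! p) = sum_list (take r ds)"
 by (simp add: sum_list_sum_nth lessThan_atLeast0)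

lemma prod_eps: "(PROD p:P. eps (c*f p)) = eps (c*(SUM p:P. f p))"
 by (induction P rule: infinite_finite_induct) (simp_all add: eps_add distrib_left)

text \<open>
 The entry r moves to the front past the first r entries, and \<open>ta\<close> permutes the rest.
\<close>

lemma koszul_cons_perm:
 assumes "length ds = Suc k" "r <= k" "ta permutes {..<k}"
 shows "koszul ds (cons_perm r ta) = eps (ds ! r*sum_list (take r ds))*koszul (drop_at r ds) ta"
proof -
 have inn: "ta j < k \<longleftrightarrow> j < k" for j using permutes_in_image[OF assms(3), of j] by simp
 let ?si = "cons_perm r ta"
 let ?f = "%(i, j). eps (ds ! ?si i*ds ! ?si j) :: 'a"
 let ?I = "{(i, j). i < j & j < length ds & ?si j < ?si i}"
 let ?J = "{(i, j). i < j & j < k & ta j < ta i}"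
 have fin: "finite ?J" by (rule finite_subset[of _ "{..<k} \<times> {..<k}"]) auto
 have I: "?I = (%j. (0, Suc j)) ` {j. j < k & ta j < r} \<union> (%(i, j). (Suc i, Suc j)) ` ?J"
 proof (intro equalityI subsetI)
  fix p assume "p \<in> ?I"
  then obtain i j where p: "p = (i, j)" "i < j" "j < Suc k" "?si j < ?si i" using assms(1) by auto
  then obtain j' where j': "j = Suc j'" by (cases j) auto
  show "p \<in> (%j. (0, Suc j)) ` {j. j < k & ta j < r} \<union> (%(i, j). (Suc i, Suc j)) ` ?J"
   using p j' by (cases i) (auto simp: image_iff split: if_splits)
 next
  fix p assume "p \<in> (%j. (0, Suc j)) ` {j. j < k & ta j < r} \<union> (%(i, j). (Suc i, Suc j)) ` ?J"
  thus "p \<in> ?I" using assms(1) by auto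
 qed
 have "prod ?f ?I = prod ?f ((%j. (0, Suc j)) ` {j. j < k & ta j < r})*prod ?f ((%(i, j). (Suc i, Suc j)) ` ?J)"
  unfolding I by (rule prod.union_disjoint) (use fin in auto)
 also have "prod ?f ((%j. (0, Suc j)) ` {j. j < k & ta j < r}) = (PROD j:{j. j < k & ta j < r}. eps (ds ! r*ds ! ta j))"
  by (subst prod.reindex) (auto simp: inj_on_def)
 also have "... = (PROD p:{..<r}. eps (ds ! r*ds ! p))"
 proof (rule prod.reindex_bij_betw)
  have "ta ` {j. j < k & ta j < r} = {..<r}"
  proof (intro equalityI subsetI)
   fix p assume p: "p \<in> {..<r}"
   hence "p \<in> ta ` {..<k}" using assms permutes_image[OF assms(3)] by simp
   thus "p \<in> ta ` {j. j < k & ta j < r}" using p by auto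
  qed auto
  thus "bij_betw ta {j. j < k & ta j < r} {..<r}"
   using permutes_inj_on[OF assms(3)] by (simp add: bij_betw_def inj_on_subset)
 qed
 also have "... = eps (ds ! r*sum_list (take r ds))"
  using assms by (simp add: prod_eps sum_list_take_nth)
 also have "prod ?f ((%(i, j). (Suc i, Suc j)) ` ?J) = koszul (drop_at r ds) ta"
 proof -
  have n: "ds ! (if ta i < r then ta i else Suc (ta i)) = drop_at r ds ! ta i" if "i < k" for i
   using nth_drop_at[of r ds "ta i"] assms that inn by simp
  have "prod ?f ((%(i, j). (Suc i, Suc j)) ` ?J) = (PROD (i, j):?J. eps (drop_at r ds ! ta i*drop_at r ds ! ta j))"
   by (subst prod.reindex) (auto simp: inj_on_def n intro!: prod.cong simp del: if_split)
  moreover have "length (drop_at r ds) = k" using assms by simp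
  ultimately show ?thesis unfolding koszul_eps by simp
 qed
 finally show ?thesis unfolding koszul_eps .
qed

lemma koszul_Nil [simp]: "koszul [] si = 1"
 by (simp add: koszul_def)

lemma permutes_0 [simp]: "{si. si permutes {..<0::nat}} = {id}"
 by auto

text \<open>The signature is found by writing a permutation as one that fixes 0 times a cycle.\<close>

definition lift_perm :: "(nat => nat) => nat => nat" where
 "lift_perm ta i = (case i of 0 => 0 | Suc j => Suc (ta j))"

definition cycle_perm :: "nat => nat => nat" where
 "cycle_perm r i = (if i = 0 then r else if i <= r then i - 1 else i)"

lemma cons_perm_comp: "cons_perm r ta = cycle_perm r \<circ> lift_perm ta"
 by (auto simp: fun_eq_iff cons_perm_def cycle_perm_def lift_perm_def split: nat.splits)

lemma cycle_perm_Suc: "cycle_perm (Suc r) = transpose r (Suc r) \<circ> cycle_perm r"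
 by (auto simp: fun_eq_iff cycle_perm_def transpose_def)

lemma cycle_perm: "permutation (cycle_perm r) & sign (cycle_perm r) = (- 1) ^ r"
proof (induction r)
 case 0
 have "cycle_perm 0 = id" by (auto simp: fun_eq_iff cycle_perm_def)
 thus ?case by simp
next
 case (Suc r)
 have t: "permutation (transpose r (Suc r))" by (rule permutation_swap_id)
 have c: "permutation (cycle_perm r)" using Suc by simp
 show ?case
  unfolding cycle_perm_Suc sign_compose[OF t c]
  using Suc permutation_compose[OF t c] by (simp only: sign_swap_id) simp
qed

lemma lift_perm:
 assumes "ta permutes {..<k::nat}" shows "permutation (lift_perm ta) & sign (lift_perm ta) = sign ta"
proof -
 have "swapidseq n (lift_perm p)" if "swapidseq n p" for n p
  using that
 proof (induction n p rule: swapidseq.induct)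
  case id
  have "lift_perm id = id" by (auto simp: fun_eq_iff lift_perm_def split: nat.splits)
  thus ?case using swapidseq.id by (simp only:)
 next
  case (comp_Suc n p a b)
  have "lift_perm (transpose a b \<circ> p) = transpose (Suc a) (Suc b) \<circ> lift_perm p"
   by (auto simp: fun_eq_iff lift_perm_def transpose_def split: nat.splits)
  moreover have "swapidseq (Suc n) (transpose (Suc a) (Suc b) \<circ> lift_perm p)"
   by (rule swapidseq.comp_Suc) (use comp_Suc in auto)
  ultimately show ?case by (simp only:)
 qed
 moreover obtain n where n: "swapidseq n ta"
  using assms permutation_permutes[of ta] unfolding permutation_def by blast
 ultimately have l: "swapidseq n (lift_perm ta)" by blast
 have "evenperm (lift_perm ta) = evenperm ta"
  using evenperm_unique[OF n refl] evenperm_unique[OF l refl] by simp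
 with l show ?thesis by (auto simp: sign_def permutation_def)
qed

lemma perm_sgn_cons:
 assumes "ta permutes {..<k::nat}"
 shows "(perm_sgn (cons_perm r ta) :: 'k::field) = eps (int r)*perm_sgn ta"
proof -
 have "sign (cons_perm r ta) = (- 1) ^ r*sign ta"
  unfolding cons_perm_comp using cycle_perm[of r] lift_perm[OF assms] by (metis sign_compose)
 thus ?thesis by (simp add: eps_if minus_one_power_iff)
qed

text \<open>
 \<open>pre_sign c ds\<close> is the sign of moving shifts of degree c past elements of degrees ds, as in
 s^c x_1 ... s^c x_m = \<plusminus> s^{mc} x_1 ... x_m.
\<close>

primrec pre_sign :: "int => int list => 'k::field" where
 "pre_sign c [] = 1"
| "pre_sign c (d#ds) = eps (c*d*int (length ds))*pre_sign c ds"

lemma pre_sign_append: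
 "pre_sign c (u@v) = eps (c*sum_list u*int (length v))*pre_sign c u*pre_sign c v"
 by (induction u) (simp_all add: eps_add algebra_simps)

lemma pre_sign_self [simp]: "pre_sign c ds*pre_sign c ds = 1" "pre_sign c ds*(pre_sign c ds*x) = x"
proof -
 show "pre_sign c ds*pre_sign c ds = 1" by (induction ds) (simp_all add: algebra_simps)
 thus "pre_sign c ds*(pre_sign c ds*x) = x" by (metis mult.assoc mult_1)
qed

lemma pre_sign_explicit:
 "pre_sign c ds = eps (SUM k<length ds. ds ! k*(int (length ds - (k+1))*c))"
proof (induction ds)
 case (Cons d ds)
 show ?case
  by (simp add: Cons sum.lessThan_Suc_shift eps_add del: sum.lessThan_Suc) (simp add: ac_simps)
qed simp

lemma pre_sign_drop_at:
 assumes "r < length ds"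
 shows "pre_sign c ds = eps (c*(ds ! r*int (length ds - Suc r)+sum_list (take r ds)))*pre_sign c (drop_at r ds)"
proof -
 have ds: "ds = take r ds@ds ! r#drop (Suc r) ds" by (rule id_take_nth_drop[OF assms])
 have "int (length ds - r) = 1+int (length ds - Suc r)" using assms by simp
 thus ?thesis
 proof -
  have "pre_sign c ds = (pre_sign c (take r ds@ds ! r#drop (Suc r) ds) :: 'a)" using ds by simp
  also have "... = eps (c*sum_list (take r ds)*int (length ds - r)+c*ds ! r*int (length ds - Suc r)
    +c*sum_list (take r ds)*int (length ds - Suc r))*pre_sign c (drop_at r ds)"
   by (simp add: pre_sign_append eps_add Suc_diff_Suc assms)
  also have "eps (c*sum_list (take r ds)*int (length ds - r)+c*ds ! r*int (length ds - Suc r)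
    +c*sum_list (take r ds)*int (length ds - Suc r))
    = (eps (c*(ds ! r*int (length ds - Suc r)+sum_list (take r ds))) :: 'a)"
   unfolding \<open>int (length ds - r) = 1 + int (length ds - Suc r)\<close> by (rule eps_cong) auto
  finally show ?thesis .
 qed
qed

lemma perm_sgn_cases: "(perm_sgn si :: 'k::field) = 1 \<or> (perm_sgn si :: 'k) = - 1"
 by (auto simp: sign_def)

lemma eps_powi: "(eps r :: 'k::field) powi c = eps (r*c)"
 by (auto simp: eps_if power_int_minus_left)

text \<open>
 An inversion of the entries d, e contributes (d+c)(e+c) = de + c(d+e) + cc; the middle terms add up
 to the change of \<open>pre_sign\<close>, the last ones to a power of the signature. This rule
 turns symmetric into exterior powers.
\<close>

lemma koszul_shift:
 assumes "si permutes {..<length ds}"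
 shows "(koszul (map (%d. d+c) ds) si :: 'k::field)
  = koszul ds si*perm_sgn si powi c*pre_sign c ds*pre_sign c (perm si ds)"
 using assms
proof (induction "length ds" arbitrary: ds si)
 case 0
 thus ?case by simp
next
 case (Suc k)
 obtain r ta where si: "si = cons_perm r ta" "r <= k" "ta permutes {..<k}"
  using Suc.prems Suc.hyps(2) permutes_SucE[of si k] by metis
 have l: "length ds = Suc k" using Suc.hyps by simp
 have ld: "length (drop_at r ds) = k" using l si by simp
 have rl: "r < length ds" using l si by simp
 have s: "sum_list (take r (map (%d. d+c) ds)) = sum_list (take r ds)+int r*c"
  using rl by (induction r arbitrary: ds) (auto simp: take_Cons' algebra_simps Suc_diff_Suc take_Suc_conv_app_nth)
 have md: "drop_at r (map (%d. d+c) ds) = map (%d. d+c) (drop_at r ds)"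
  by (simp add: take_map drop_map)
 have "(koszul (map (%d. d+c) ds) si :: 'k) = eps ((ds ! r+c)*(sum_list (take r ds)+int r*c))
   *(koszul (drop_at r ds) ta*perm_sgn ta powi c*pre_sign c (drop_at r ds)*pre_sign c (perm ta (drop_at r ds)))"
  unfolding si(1) using koszul_cons_perm[of "map (%d. d+c) ds" k r ta, where ?'a = 'k] l si rl
   Suc.hyps(1)[of "drop_at r ds" ta] ld by (simp add: s md mult.assoc del: take_map drop_map map_append)
 also have "(koszul (drop_at r ds) ta :: 'k) = eps (ds ! r*sum_list (take r ds))*koszul ds si"
  unfolding si(1) koszul_cons_perm[OF l si(2,3)] by simp
 also have "(perm_sgn ta :: 'k) powi c = eps (int r*c)*perm_sgn si powi c"
  unfolding si(1) perm_sgn_cons[OF si(3)] power_int_mult_distrib eps_powi by simp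
 also have "(pre_sign c (drop_at r ds) :: 'k) = eps (c*(ds ! r*int (length ds - Suc r)+sum_list (take r ds)))*pre_sign c ds"
  unfolding pre_sign_drop_at[OF rl] by simp
 also have "(pre_sign c (perm ta (drop_at r ds)) :: 'k) = eps (c*ds ! r*int k)*pre_sign c (perm si ds)"
  unfolding si(1) permute_cons_perm[OF l si(2,3)] using ld by simp
 also have "int (length ds - Suc r) = int k - int r" using l si by simp
 finally have e: "(koszul (map (%d. d+c) ds) si :: 'k)
   = eps ((ds ! r+c)*(sum_list (take r ds)+int r*c)+ds ! r*sum_list (take r ds)+int r*c
    +c*(ds ! r*(int k - int r)+sum_list (take r ds))+c*ds ! r*int k)
   *(koszul ds si*perm_sgn si powi c*pre_sign c ds*pre_sign c (perm si ds))"
  by (simp add: eps_add)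
 have "eps ((ds ! r+c)*(sum_list (take r ds)+int r*c)+ds ! r*sum_list (take r ds)+int r*c
    +c*(ds ! r*(int k - int r)+sum_list (take r ds))+c*ds ! r*int k) = (1 :: 'k)"
  unfolding eps_if by auto
 with e show ?case by simp
qed

lemma koszul_self [simp]: "koszul ds si*koszul ds si = 1" "koszul ds si*(koszul ds si*x) = x"
proof -
 show "koszul ds si*koszul ds si = 1"
  unfolding koszul_eps prod.distrib[symmetric] by (intro prod.neutral) auto
 thus "koszul ds si*(koszul ds si*x) = x" by (metis mult.assoc mult_1)
qed

text \<open>
 Symmetry under adjacent swaps gives symmetry under all permutations, as the entries can be moved to
 the front one by one.
\<close>

lemma swapsym_permute:
 assumes "f \<in> swapsym deg" "si permutes {..<length w}"
 shows "(f (perm si w) :: 'k::field) = koszul (map deg w) si*f w"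
 using assms
proof (induction "length w" arbitrary: w si f)
 case 0
 thus ?case by (simp add: permute_list_def)
next
 case (Suc k)
 obtain r ta where si: "si = cons_perm r ta" "r <= k" "ta permutes {..<k}"
  using Suc.prems Suc.hyps(2) permutes_SucE[of si k] by metis
 have l: "length w = Suc k" and ld: "length (drop_at r w) = k" using Suc.hyps si by simp_all
 have rl: "r < length w" using l si by simp
 have "f (perm si w) = f (w ! r#perm ta (drop_at r w))"
  unfolding si(1) permute_cons_perm[OF l si(2,3)] ..
 also have "... = koszul (map deg (drop_at r w)) ta*f (w ! r#drop_at r w)"
  using Suc.hyps(1)[of "drop_at r w" "%u. f (w ! r#u)" ta] ld si(3) swapsym_left_shift[OF Suc.prems(1)]
  by (simp del: map_append)
 also have "f (w ! r#drop_at r w) = eps (deg (w ! r)*wdeg deg (take r w))*f w"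
  using swapsym_to_front[OF Suc.prems(1), of "take r w" "w ! r" "drop (Suc r) w"]
  unfolding id_take_nth_drop[OF rl, symmetric] by simp
 also have "koszul (map deg (drop_at r w)) ta*(eps (deg (w ! r)*wdeg deg (take r w))*f w) = koszul (map deg w) si*f w"
  unfolding si(1) using koszul_cons_perm[of "map deg w" k r ta, where ?'a = 'k] l si rl
  by (simp add: take_map drop_map wdeg_def)
 finally show ?case .
qed

lemma permute_inv:
 assumes "si permutes {..<length w}"
 shows "perm si (perm (inv si) w) = w" (is ?P1) "perm (inv si) (perm si w) = w" (is ?P2)
proof -
 have i: "inv si permutes {..<length w}" by (rule permutes_inv[OF assms])
 have "perm si (perm (inv si) w) = perm (inv si \<circ> si) w"
  by (rule permute_list_compose[symmetric, OF assms])
 thus ?P1 by (simp add: permutes_inv_o(2)[OF assms])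
 have "perm (inv si) (perm si w) = perm (si \<circ> inv si) w"
  by (rule permute_list_compose[symmetric, OF i])
 thus ?P2 by (simp add: permutes_inv_o(1)[OF assms])
qed

lemma permute_lists: "w \<in> lists A ==> si permutes {..<length w} ==> perm si w \<in> lists A"
 using set_permute_list[of si w] by (simp add: lists_eq_set)

lemma permute_words: "w \<in> words A k ==> si permutes {..<k} ==> perm si w \<in> words A k"
 using set_permute_list[of si w] by (auto simp: words_def)

lemma wdeg_permute:
 assumes "si permutes {..<length w}" shows "wdeg d (perm si w) = wdeg d w"
 using mset_permute_list[OF assms] unfolding wdeg_def by (metis mset_map sum_mset_sum_list)

text \<open>
 A sign rule for Koszul signs is an identity between values of one symmetric function with distinct
 letters, such as a product of generators.
\<close>

lemma monomial_self: "distinct w ==> monomial deg w w = (1 :: 'k::field)"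
proof (induction w)
 case (Cons x w)
 have "letter x (w ! j) = (0 :: 'k)" if "j < length w" for j
  using Cons.prems that by (auto simp: letter_def)
 thus ?case unfolding monomial_Cons_left using Cons
  by (simp add: sum.lessThan_Suc_shift letter_def del: sum.lessThan_Suc)
qed simp

lemma koszul_witness:
 obtains f :: "nat list => 'k::field" where "f \<in> swapsym ((!) ds)" "f [0..<length ds] = 1"
 by (rule that[OF swapsym_monomial monomial_self]) simp

lemma koszul_inv:
 assumes s: "si permutes {..<length ds}"
 shows "koszul (perm si ds) (inv si) = (koszul ds si :: 'k::field)"
proof -
 let ?w = "[0..<length ds]" and ?k = "koszul (perm si ds) (inv si) :: 'k"
 obtain f :: "nat list => 'k" where f: "f \<in> swapsym ((!) ds)" "f ?w = 1" by (rule koszul_witness)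
 have "f ?w = f (perm (inv si) (perm si ?w))" using permute_inv(2)[of si ?w] s by simp
 also have "... = ?k*(koszul ds si*f ?w)"
  using swapsym_permute[OF f(1), of si ?w] swapsym_permute[OF f(1), of "inv si" "perm si ?w"] s permutes_inv[OF s]
  by (simp add: permute_list_map[symmetric] map_nth)
 finally show ?thesis using f(2) by (metis koszul_self(1) mult.assoc mult_1 mult_1_right)
qed

text \<open>
 By induction on w: the first letter of w is read by one of the factors, and moving this factor to
 the front gives the Koszul sign.
\<close>

lemma linprod_permutes:
 fixes hs :: "(int \<times> ('x => 'k::field)) list"
 assumes "lhomog deg hs" "length w = length hs"
 shows "linprod deg hs w = (SUM si | si permutes {..<length hs}.
      koszul (map fst hs) si*(PROD k<length hs. snd (hs ! si k) (w ! k)))"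
 using assms
proof (induction w arbitrary: hs)
 case Nil
 thus ?case by simp
next
 case (Cons x w)
 then obtain k where k: "length hs = Suc k" "length w = k" by (cases hs) auto
 have dh: "lhomog deg (drop_at r hs)" for r using Cons.prems(1)
  by (auto simp: lhomog_def dest: in_set_takeD in_set_dropD)
 have "(SUM si | si permutes {..<Suc k}. koszul (map fst hs) si*(PROD i<Suc k. snd (hs ! si i) ((x#w) ! i)))
   = (SUM r<Suc k. SUM ta | ta permutes {..<k}. snd (hs ! r) x*eps (fst (hs ! r)*wdeg fst (take r hs))
     *(koszul (map fst (drop_at r hs)) ta*(PROD i<k. snd (drop_at r hs ! ta i) (w ! i))))"
  unfolding sum_permutes_Suc
 proof (intro sum.cong refl, goal_cases)
  case (1 r ta)
  note r = 1(1) and t = 1(2)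
  from 1 have r': "r <= k" "r < length hs" and t': "ta permutes {..<k}" using k by auto
  have inn: "ta j < k \<longleftrightarrow> j < k" for j using permutes_in_image[OF t', of j] by simp
  have n: "hs ! (if ta i < r then ta i else Suc (ta i)) = drop_at r hs ! ta i" if "i < k" for i
   using nth_drop_at[of r hs "ta i"] k r' that inn by simp
  have p: "(PROD i<Suc k. snd (hs ! cons_perm r ta i) ((x#w) ! i)) = snd (hs ! r) x*(PROD i<k. snd (drop_at r hs ! ta i) (w ! i))"
   unfolding prod.lessThan_Suc_shift by (auto simp: n intro!: prod.cong simp del: if_split)
  show ?case
   unfolding p using koszul_cons_perm[of "map fst hs" k r ta, where ?'a = 'k] k r' t'
   by (simp add: take_map drop_map wdeg_def)
 qed
 also have "... = (SUM r<Suc k. snd (hs ! r) x*eps (deg x*wdeg fst (take r hs))*linprod deg (drop_at r hs) w)"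
 proof (intro sum.cong refl, goal_cases)
  case (1 r)
  hence r: "r < length hs" using k by simp
  have d: "snd (hs ! r) x*eps (fst (hs ! r)*wdeg fst (take r hs)) = snd (hs ! r) x*eps (deg x*wdeg fst (take r hs))"
  proof (cases "snd (hs ! r) x = 0")
   case False
   have "hs ! r \<in> set hs" using r by simp
   with Cons.prems(1) False have "deg x = fst (hs ! r)" unfolding lhomog_def by (auto simp: case_prod_unfold)
   thus ?thesis by simp
  qed simp
  have "length (drop_at r hs) = k" using r k by simp
  thus ?case
   unfolding d using Cons.IH[OF dh, of r] k by (simp add: sum_distrib_left)
 qed
 also have "... = linprod deg hs (x#w)" unfolding linprod_Cons[OF Cons.prems(1)] k(1) ..
 finally show ?case using k by simp
qed

lemma prod_letter:
 assumes "inj h" "length u = length w" "si permutes {..<length w}"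
 shows "(PROD i<length w. letter (h (u ! si i)) (h (w ! i))) = (if u = perm (inv si) w then 1 else (0 :: 'k::field))"
proof -
 have "(ALL i<length w. w ! i = u ! si i) \<longleftrightarrow> w = perm si u"
 proof
  assume h: "ALL i<length w. w ! i = u ! si i"
  show "w = perm si u"
   by (rule nth_equalityI) (use h assms(2,3) in \<open>simp_all add: permute_list_nth\<close>)
 next
  assume h: "w = perm si u"
  have "perm si u ! i = u ! si i" if "i < length w" for i
   using permute_list_nth[of si u i] assms(2,3) that by simp
  with h show "ALL i<length w. w ! i = u ! si i" by metis
 qed
 also have "... \<longleftrightarrow> u = perm (inv si) w"
  using permute_inv(2)[of si u] permute_inv(1)[of si w] assms(2,3) by auto
 finally have *: "(ALL i<length w. w ! i = u ! si i) \<longleftrightarrow> u = perm (inv si) w" .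
 show ?thesis
 proof (cases "ALL i<length w. w ! i = u ! si i")
  case True
  thus ?thesis using * by (simp add: letter_def)
 next
  case False
  then obtain i where "i < length w" "w ! i ~= u ! si i" by blast
  hence "(PROD i<length w. letter (h (u ! si i)) (h (w ! i))) = (0 :: 'k)"
   by (intro prod_zero) (auto simp: letter_def inj_eq[OF assms(1)])
  thus ?thesis using * False by simp
 qed
qed

text \<open>
 The monomials are, up to the factor k!, a reproducing kernel on symmetric functions: this is
 Euler's identity for homogeneous polynomials. The map h selects a kind of letters, so that
 the identity applies to \<open>Inl\<close> and to \<open>Inr\<close> separately.
\<close>

lemma monomial_sum:
 fixes c :: "'a list => 'k::field_char_0"
 assumes h: "inj h" and X: "finite X" and w: "w \<in> words X k"
  and c: "!!si. si permutes {..<k} ==> c (perm si w) = koszul (map (%x. deg (h x)) w) si*c w"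
 shows "(SUM u:words X k. c u*monomial deg (map h u) (map h w)) = fact k*c w"
proof -
 have lw: "length w = k" using w by (simp add: words_def)
 have m: "monomial deg (map h u) (map h w) = (SUM si | si permutes {..<k}.
   koszul (map (%x. deg (h x)) u) si*(if u = perm (inv si) w then 1 else 0 :: 'k))" if u: "u \<in> words X k" for u
 proof -
  have lu: "length u = k" using u by (simp add: words_def)
  have l: "lhomog deg (map (%x. (deg x, letter x :: _ => 'k)) (map h u))" by (auto simp: lhomog_def letter_def split: if_splits)
  have "monomial deg (map h u) (map h w) = (SUM si | si permutes {..<k}.
    koszul (map (%x. deg (h x)) u) si*(PROD i<k. letter (h (u ! si i)) (h (w ! i)) :: 'k))"
   unfolding monomial_def using lu lw
  proof (subst linprod_permutes[OF l], goal_cases)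
   case 2
   show ?case using lu lw
   proof (simp add: comp_def, intro sum.cong refl, goal_cases)
    case (1 si)
    hence "si i < k" if "i < k" for i using permutes_in_image[of si "{..<k}" i] that by simp
    thus ?case using lu lw by simp
   qed
  qed simp
  also have "... = (SUM si | si permutes {..<k}.
   koszul (map (%x. deg (h x)) u) si*(if u = perm (inv si) w then 1 else 0 :: 'k))"
  proof (intro sum.cong refl, goal_cases)
   case (1 si)
   thus ?case using prod_letter[OF h, of u w si, where ?'k = 'k] lu lw by simp
  qed
  finally show ?thesis .
 qed
 have "(SUM u:words X k. c u*monomial deg (map h u) (map h w))
   = (SUM si | si permutes {..<k}. SUM u:words X k. if u = perm (inv si) w then c u*koszul (map (%x. deg (h x)) u) si else 0)"
  unfolding sum.swap[of _ "words X k"]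
  by (intro sum.cong refl) (simp add: m sum_distrib_left, intro sum.cong refl, simp)
 also have "... = (SUM si | si permutes {..<k}. c w)"
 proof (intro sum.cong refl, goal_cases)
  case (1 si)
  hence s: "si permutes {..<k}" "inv si permutes {..<k}" using permutes_inv by auto
  let ?ds = "map (%x. deg (h x)) w"
  have i: "perm (inv si) w \<in> words X k"
   using w s(2) set_permute_list[of "inv si" w] by (auto simp: words_def)
  have "koszul (map (%x. deg (h x)) (perm (inv si) w)) si = (koszul ?ds (inv si) :: 'k)"
   using koszul_inv[of "inv si" ?ds] s lw by (simp add: permute_list_map permutes_inv_inv)
  thus ?case
   using i finite_words[OF X] by (simp add: c[OF s(2)] mult.commute)
 qed
 also have "... = fact k*c w" by (simp add: card_permutations)
 finally show ?thesis .
qed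

section \<open>Shuffle permutations\<close>

text \<open>A shuffle is decomposed by the position p of its value 0: as the first entry goes to one of two
 blocks, p is the beginning of a block.\<close>

definition ins_perm :: "nat => (nat => nat) => nat => nat" where
 "ins_perm p ta i = (if i < p then Suc (ta i) else if i = p then 0 else Suc (ta (i - 1)))"

lemma ins_perm_0: "ins_perm 0 ta = cons_perm 0 ta"
 by (auto simp: fun_eq_iff ins_perm_def cons_perm_def split: nat.splits)

lemma permutes_ins_perm:
 assumes "ta permutes {..<k}" "p <= k" shows "ins_perm p ta permutes {..<Suc k}"
proof (rule permutes_injI)
 have inn: "ta j < k \<longleftrightarrow> j < k" for j using permutes_in_image[OF assms(1), of j] by simp
 fix x assume "x \<in> {..<Suc k}"
 thus "ins_perm p ta x \<in> {..<Suc k}" using assms(2) inn[of x] inn[of "x - 1"] by (auto simp: ins_perm_def)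
next
 show "inj_on (ins_perm p ta) {..<Suc k}"
 proof (rule inj_onI)
  fix x y assume "ins_perm p ta x = ins_perm p ta y"
  thus "x = y" using permutes_inj[OF assms(1)]
   by (auto simp: ins_perm_def split: if_splits dest!: injD)
 qed
next
 fix x assume "x \<notin> {..<Suc k}"
 thus "ins_perm p ta x = x" using permutes_not_in[OF assms(1), of "x - 1"] assms(2) by (auto simp: ins_perm_def)
qed simp

lemma ins_perm_inj: "ins_perm p ta = ins_perm p ta' ==> ta = ta'"
proof
 fix i assume e: "ins_perm p ta = ins_perm p ta'"
 show "ta i = ta' i"
  using fun_cong[OF e, of i] fun_cong[OF e, of "Suc i"] by (auto simp: ins_perm_def split: if_splits)
qed

lemma permute_ins_perm:
 assumes "length w = k" "p <= k" "ta permutes {..<k}"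
 shows "perm (ins_perm p ta) (x#w) = take p (perm ta w)@x#drop p (perm ta w)"
proof (rule nth_equalityI)
 show "length (perm (ins_perm p ta) (x#w)) = length (take p (perm ta w)@x#drop p (perm ta w))"
  using assms by (simp add: permute_list_def)
 fix i assume "i < length (perm (ins_perm p ta) (x#w))"
 hence i: "i < Suc k" using assms by (simp add: permute_list_def)
 show "perm (ins_perm p ta) (x#w) ! i = (take p (perm ta w)@x#drop p (perm ta w)) ! i"
  using i assms by (auto simp: permute_list_def ins_perm_def nth_append nth_Cons' min_def simp del: upt_Suc)
qed

lemma koszul_ins_perm:
 assumes "length ds = k" "p <= k" "ta permutes {..<k}"
 shows "koszul (d#ds) (ins_perm p ta) = (eps (d*sum_list (take p (perm ta ds)))*koszul ds ta :: 'k::field)"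
proof -
 let ?v = "map Suc [0..<k]" and ?D = "d#ds"
 have w: "[0..<length ?D] = 0#?v" using assms(1) upt_conv_Cons[of 0 "Suc k"] map_Suc_upt[of 0 k] by simp
 have m: "map ((!) ?D) ?v = ds" using assms(1) using map_nth[of ds] by (simp add: comp_def)
 have mp: "map ((!) ?D) (perm ta ?v) = perm ta ds"
  using permute_list_map[of ta ?v "(!) ?D"] assms(3) m by simp
 obtain f :: "nat list => 'k" where f: "f \<in> swapsym ((!) ?D)" "f (0#?v) = 1" using koszul_witness[of ?D] unfolding w .
 have ip: "ins_perm p ta permutes {..<length (0#?v)}" using permutes_ins_perm[OF assms(3,2)] by simp
 have "koszul ?D (ins_perm p ta) = f (perm (ins_perm p ta) (0#?v))"
  unfolding swapsym_permute[OF f(1) ip] f(2) using m by simp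
 also have "... = eps (d*wdeg ((!) ?D) (take p (perm ta ?v)))*f (0#perm ta ?v)"
  unfolding permute_ins_perm[OF _ assms(2,3), of ?v, simplified] swapsym_to_front[OF f(1)] by simp
 also have "f (0#perm ta ?v) = koszul ds ta"
  using swapsym_permute[OF swapsym_left_shift[OF f(1)], of ta ?v] assms(3) m f(2) by simp
 also have "wdeg ((!) ?D) (take p (perm ta ?v)) = sum_list (take p (perm ta ds))"
  unfolding wdeg_def take_map[symmetric] mp ..
 finally show ?thesis .
qed

lemma shufflesI: "si permutes {..<p+q} ==> (!!i j. i < j ==> j < p ==> si i < si j)
  ==> (!!i j. p <= i ==> i < j ==> j < p+q ==> si i < si j) ==> si \<in> shuffles p q"
 by (auto simp: shuffles_def intro!: strict_mono_onI)

lemma shufflesD: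
 assumes "si \<in> shuffles p q"
 shows "si permutes {..<p+q}" "i < j ==> j < p ==> si i < si j"
  "p <= i ==> i < j ==> j < p+q ==> si i < si j"
 using assms by (auto simp: shuffles_def strict_mono_on_def)

lemma finite_shuffles: "finite (shuffles p q)"
 by (rule finite_subset[of _ "{si. si permutes {..<p+q}}"]) (auto simp: shuffles_def finite_permutations)

lemma shuffles_split:
 assumes "p+q = Suc n"
 shows "shuffles p q = (if p > 0 then cons_perm 0 ` shuffles (p - 1) q else {})
   \<union> (if q > 0 then ins_perm p ` shuffles p (q - 1) else {})"
proof (intro equalityI subsetI)
 fix si assume si: "si \<in> shuffles p q"
 have pm: "si permutes {..<Suc n}" using shufflesD(1)[OF si] assms by simp
 obtain i where i: "si i = 0" "i < Suc n" using permutes_image[OF pm]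
  by (metis (no_types, lifting) imageE lessThan_iff zero_less_Suc)
 have ip: "i = 0 & p > 0 \<or> i = p & q > 0"
 proof (cases "i < p")
  case True
  thus ?thesis using shufflesD(2)[OF si, of 0 i] i by (cases "i = 0") auto
 next
  case False
  thus ?thesis using shufflesD(3)[OF si, of p i] i assms by (cases "i = p") auto
 qed
 define ta where "ta j = si (if j < i then j else Suc j) - 1" for j
 have nz: "si j ~= 0" if "j ~= i" for j using that i permutes_inj[OF pm] by (metis injD)
 have sita: "si (if j < i then j else Suc j) = Suc (ta j)" for j
  unfolding ta_def using nz[of "if j < i then j else Suc j"] by auto
 have inn: "si j < Suc n \<longleftrightarrow> j < Suc n" for j using permutes_in_image[OF pm, of j] by simp
 have tp: "ta permutes {..<n}"
 proof (rule permutes_injI)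
  fix x assume "x \<in> {..<n}"
  thus "ta x \<in> {..<n}" using sita[of x] inn[of "if x < i then x else Suc x"] by (auto split: if_splits)
 next
  show "inj_on ta {..<n}"
  proof (rule inj_onI)
   fix x y assume "ta x = ta y"
   hence "si (if x < i then x else Suc x) = si (if y < i then y else Suc y)" unfolding sita by simp
   hence "(if x < i then x else Suc x) = (if y < i then y else Suc y)"
    by (rule permutes_inj[OF pm, THEN injD])
   thus "x = y" by (auto split: if_splits)
  qed
 next
  fix x assume "x \<notin> {..<n}"
  thus "ta x = x" using i permutes_not_in[OF pm, of "Suc x"] by (simp add: ta_def)
 qed simp
 have e: "si = ins_perm i ta"
 proof
  fix j show "si j = ins_perm i ta j"
   using sita[of j] sita[of "j - 1"] i by (auto simp: ins_perm_def split: if_splits)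
 qed
 have mono: "ta a < ta b" if "si (if a < i then a else Suc a) < si (if b < i then b else Suc b)" for a b
  using that unfolding sita by simp
 from ip show "si \<in> (if p > 0 then cons_perm 0 ` shuffles (p - 1) q else {})
   \<union> (if q > 0 then ins_perm p ` shuffles p (q - 1) else {})"
 proof
  assume c: "i = 0 & p > 0"
  have "ta \<in> shuffles (p - 1) q"
   by (rule shufflesI) (use tp assms c shufflesD[OF si] in \<open>auto intro!: mono\<close>)
  thus ?thesis using c e ins_perm_0 by auto
 next
  assume c: "i = p & q > 0"
  have "ta \<in> shuffles p (q - 1)"
   by (rule shufflesI) (use tp assms c shufflesD[OF si] in \<open>auto intro!: mono\<close>)
  thus ?thesis using c e by auto
 qed
next
 fix si assume "si \<in> (if p > 0 then cons_perm 0 ` shuffles (p - 1) q else {})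
   \<union> (if q > 0 then ins_perm p ` shuffles p (q - 1) else {})"
 then consider ta where "p > 0" "si = ins_perm 0 ta" "ta \<in> shuffles (p - 1) q"
  | ta where "q > 0" "si = ins_perm p ta" "ta \<in> shuffles p (q - 1)"
  by (auto simp: ins_perm_0 split: if_splits)
 thus "si \<in> shuffles p q"
 proof cases
  case (1 ta)
  have "ins_perm 0 ta permutes {..<Suc n}"
   by (rule permutes_ins_perm) (use shufflesD(1)[OF 1(3)] 1(1) assms in auto)
  moreover have "ins_perm 0 ta i < ins_perm 0 ta j" if "i < j" "j < p" for i j
   using that 1(1) shufflesD(2)[OF 1(3), of "i - 1" "j - 1"] by (auto simp: ins_perm_def)
  moreover have "ins_perm 0 ta i < ins_perm 0 ta j" if "p <= i" "i < j" "j < p+q" for i j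
   using that 1(1) shufflesD(3)[OF 1(3), of "i - 1" "j - 1"] by (auto simp: ins_perm_def)
  ultimately show ?thesis unfolding 1(2) using assms by (intro shufflesI) auto
 next
  case (2 ta)
  have "ins_perm p ta permutes {..<Suc n}"
   by (rule permutes_ins_perm) (use shufflesD(1)[OF 2(3)] 2(1) assms in auto)
  moreover have "ins_perm p ta i < ins_perm p ta j" if "i < j" "j < p" for i j
   using that shufflesD(2)[OF 2(3), of i j] by (auto simp: ins_perm_def)
  moreover have "ins_perm p ta i < ins_perm p ta j" if "p <= i" "i < j" "j < p+q" for i j
   using that 2(1) shufflesD(3)[OF 2(3), of "i - 1" "j - 1"] by (auto simp: ins_perm_def)
  ultimately show ?thesis unfolding 2(2) using assms by (intro shufflesI) auto
 qed
qed

lemma sum_shuffles: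
 assumes "p+q = Suc n"
 shows "(SUM si:shuffles p q. F si) = (if p > 0 then SUM ta:shuffles (p - 1) q. F (cons_perm 0 ta) else 0)
  +(if q > 0 then SUM ta:shuffles p (q - 1). F (ins_perm p ta) else 0)"
proof -
 have d: "cons_perm 0 ` shuffles (p - 1) q \<inter> ins_perm p ` shuffles p (q - 1) = {}" if "p > 0"
 proof -
  have "cons_perm 0 ta 0 ~= ins_perm p ta' 0" for ta ta' using that by (simp add: ins_perm_def)
  thus ?thesis by (metis (no_types, lifting) Int_emptyI imageE)
 qed
 have "inj_on (cons_perm 0) (shuffles (p - 1) q)" by (auto simp: inj_on_def dest: cons_perm_inj)
 moreover have "inj_on (ins_perm p) (shuffles p (q - 1))" by (auto simp: inj_on_def dest: ins_perm_inj)
 ultimately show ?thesis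
  unfolding shuffles_split[OF assms]
  using d by (auto simp: sum.union_disjoint finite_shuffles sum.reindex)
qed

lemma shuffles_0: "shuffles 0 0 = {id}"
 by (auto simp: shuffles_def)

text \<open>The shuffle product evaluated on a concatenation: the letters of u are distributed first.\<close>

lemma sh_shuffles:
 fixes F G :: "'x list => 'k::field"
 shows
 "sh deg F G (u@v) = (SUM p<=length u. SUM si:shuffles p (length u - p).
   koszul (map deg u) si*sh deg (%v. eps (wdeg deg (drop p (perm si u))*wdeg deg v)
    *F (take p (perm si u)@v)) (%v. G (drop p (perm si u)@v)) v)"
proof (induction u arbitrary: F G)
 case Nil
 show ?case by (simp add: shuffles_0)
next
 case (Cons x u)
 let ?k = "length u"
 let ?T = "%p si. koszul (map deg (x#u)) si*sh deg (%v. eps (wdeg deg (drop p (perm si (x#u)))*wdeg deg v)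
    *F (take p (perm si (x#u))@v)) (%v. G (drop p (perm si (x#u))@v)) v"
 have pm: "si permutes {..<?k}" if "si \<in> shuffles p (?k - p)" "p <= ?k" for si p
  using shufflesD(1)[OF that(1)] that(2) by simp
 have len: "length (perm si u) = ?k" for si by (simp add: permute_list_def)
 have A: "?T (Suc p) (cons_perm 0 si) = koszul (map deg u) si
    *sh deg (%v. eps (wdeg deg (drop p (perm si u))*wdeg deg v)
    *F (x#take p (perm si u)@v)) (%v. G (drop p (perm si u)@v)) v"
  if "si \<in> shuffles p (?k - p)" "p <= ?k" for p si
  using koszul_cons_perm[of "map deg (x#u)" ?k 0 si, where ?'a = 'k] pm[OF that]
   permute_cons_perm[of "x#u" ?k 0 si] by simp
 have B: "?T p (ins_perm p si) = koszul (map deg u) si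
    *sh deg (%v. eps (wdeg deg (drop p (perm si u))*wdeg deg v)
    *(eps (deg x*wdeg deg (take p (perm si u)@v))*F (take p (perm si u)@v)))
     (%v. G (x#drop p (perm si u)@v)) v"
  if "si \<in> shuffles p (?k - p)" "p <= ?k" for p si
 proof -
  have k: "koszul (map deg (x#u)) (ins_perm p si) = eps (deg x*wdeg deg (take p (perm si u)))*(koszul (map deg u) si :: 'k)"
   using koszul_ins_perm[of "map deg u" ?k p si "deg x", where ?'k = 'k] pm[OF that] that(2)
   by (simp add: wdeg_def permute_list_map take_map)
  have l: "perm (ins_perm p si) (x#u) = take p (perm si u)@x#drop p (perm si u)"
   by (rule permute_ins_perm[OF refl that(2) pm[OF that]])
  have t: "take p (perm (ins_perm p si) (x#u)) = take p (perm si u)"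
   "drop p (perm (ins_perm p si) (x#u)) = x#drop p (perm si u)"
   unfolding l using that(2) len by simp_all
  have f: "(%v. eps (wdeg deg (x#drop p (perm si u))*wdeg deg v)*F (take p (perm si u)@v))
    = (%v. eps (deg x*wdeg deg (take p (perm si u)))*(eps (wdeg deg (drop p (perm si u))*wdeg deg v)
    *(eps (deg x*wdeg deg (take p (perm si u)@v))*F (take p (perm si u)@v))))"
   by (simp add: eps_add algebra_simps)
  show ?thesis unfolding k t f sh_scale_left by simp
 qed
 have "(SUM p<=length (x#u). SUM si:shuffles p (length (x#u) - p). ?T p si)
   = (SUM p<=Suc ?k. (if p > 0 then SUM ta:shuffles (p - 1) (Suc ?k - p). ?T p (cons_perm 0 ta) else 0)
     +(if Suc ?k - p > 0 then SUM ta:shuffles p (Suc ?k - p - 1). ?T p (ins_perm p ta) else 0))"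
  by (intro sum.cong) (simp_all add: sum_shuffles[where n = ?k] del: list.map)
 also have "... = (SUM p<=?k. SUM ta:shuffles p (?k - p). ?T (Suc p) (cons_perm 0 ta))
   +(SUM p<=?k. SUM ta:shuffles p (?k - p). ?T p (ins_perm p ta))"
  unfolding sum.distrib
 proof (intro arg_cong2[where f = "(+)"])
  show "(SUM p<=Suc ?k. if p > 0 then SUM ta:shuffles (p - 1) (Suc ?k - p). ?T p (cons_perm 0 ta) else 0)
    = (SUM p<=?k. SUM ta:shuffles p (?k - p). ?T (Suc p) (cons_perm 0 ta))"
   by (subst sum.atMost_Suc_shift) (simp del: list.map)
  show "(SUM p<=Suc ?k. if Suc ?k - p > 0 then SUM ta:shuffles p (Suc ?k - p - 1). ?T p (ins_perm p ta) else 0)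
    = (SUM p<=?k. SUM ta:shuffles p (?k - p). ?T p (ins_perm p ta))"
   by (subst sum.atMost_Suc) (auto intro!: sum.cong simp del: list.map)
 qed
 also have "... = sh deg F G ((x#u)@v)"
  unfolding append_Cons sh.simps Cons.IH
  by (intro arg_cong2[where f = "(+)"] sum.cong refl) (simp_all only: A B atMost_iff append_Cons)
 finally show ?case by simp
qed

section \<open>Symmetric algebras as shuffle algebras\<close>

declare in_lists_conv_set [simp del]



primrec evw :: "('x => int) => ('g => 'x list => 'k::field) => 'g list => 'x list => 'k" where
 "evw deg \<phi> [] = shone"
| "evw deg \<phi> (g#w) = sh deg (\<phi> g) (evw deg \<phi> w)"

lemma evw_append: "evw deg \<phi> (u@v) = sh deg (evw deg \<phi> u) (evw deg \<phi> v)"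
proof (induction u)
 case (Cons g u)
 show ?case unfolding append_Cons evw.simps Cons by (rule ext) (simp add: sh_assoc)
qed (simp add: fun_eq_iff)

definition ev :: "('x => int) => ('g => 'x list => 'k::field) => ('g list \<Rightarrow>\<^sub>0 'k) => 'x list => 'k" where
 "ev deg \<phi> p = fext (evw deg \<phi>) p"

lemma ev_simps [simp]:
 "ev deg \<phi> (p+q) u = ev deg \<phi> p u+ev deg \<phi> q u"
 "ev deg \<phi> (p - q) u = ev deg \<phi> p u - ev deg \<phi> q u"
 "ev deg \<phi> (- p) u = - ev deg \<phi> p u"
 "ev deg \<phi> (fscl c p) u = c*ev deg \<phi> p u"
 "ev deg \<phi> 0 u = 0"
 "ev deg \<phi> (word w) = evw deg \<phi> w"
 by (simp_all add: ev_def fun_eq_iff)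

lemma ev_sum: "ev deg \<phi> (sum g S) u = (SUM s:S. ev deg \<phi> (g s) u)"
 by (simp add: ev_def fext_sum)

lemma ev_fun [simp]:
 "ev deg \<phi> (p+q) = (%u. ev deg \<phi> p u+ev deg \<phi> q u)"
 "ev deg \<phi> (fscl c p) = (%u. c*ev deg \<phi> p u)"
 "ev deg \<phi> 0 = (%u. 0)"
 by (simp_all add: fun_eq_iff)

lemma ev_fmul: "ev deg \<phi> (fmul p q) = sh deg (ev deg \<phi> p) (ev deg \<phi> q)"
proof (induction p rule: pm_induct_all)
 case (add c u p)
 have "ev deg \<phi> (fmul (word u) q) = sh deg (evw deg \<phi> u) (ev deg \<phi> q)"
  by (induction q rule: pm_induct_all)
    (simp_all add: evw_append sh_add_right sh_scale_right fun_eq_iff)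
 with add show ?case by (simp add: sh_add_left sh_scale_left fun_eq_iff)
qed (simp add: fun_eq_iff)

definition comb :: "('x => 'g) => ('x list \<Rightarrow>\<^sub>0 'k) => ('g list \<Rightarrow>\<^sub>0 'k::field)" where
 "comb gen = flin (%u. word (map gen u))"

text \<open>
 Suppose that a map \<phi> on the generators of Sym_A(M) respects the relations, and that finitely many
 generators, one for each letter, suffice to generate the algebra and are sent to the letters.
 Then \<phi> identifies Sym_A(M) with the symmetric functions on words of letters.
\<close>

locale sym_model =
 fixes A :: "('k::field_char_0, 'a::ab_group_add) dga" and M :: "('k, 'a, 'm::ab_group_add) dgmod"
  and deg :: "'x => int" and wt :: "'x => nat" and X :: "'x set" and gen :: "'x => ('a, 'm) sgen"
  and \<phi> :: "('a, 'm) sgen => 'x list => 'k"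
 assumes finX: "finite X"
  and gen: "x \<in> X ==> gen x \<in> sym_gens A M"
   "x \<in> X ==> sdeg (gen x) = deg x" "x \<in> X ==> swt (gen x) = wt x"
   "x \<in> X ==> \<phi> (gen x) = lin (letter x)"
  and \<phi>_Symf: "g \<in> sym_gens A M ==> \<phi> g \<in> Symf deg X"
  and \<phi>_homog: "g \<in> sym_gens A M ==> \<phi> g \<in> homog deg (sdeg g)"
  and \<phi>_wthom: "g \<in> sym_gens A M ==> \<phi> g \<in> wthom wt (swt g)"
  and \<phi>_rel: "r \<in> sym_rels A M ==> ev deg \<phi> r = (%w. 0)"
  and rels_closed: "r \<in> sym_rels A M ==> keys r <= lists (sym_gens A M)"
  and generated: "g \<in> sym_gens A M ==>
   EX q. keys q <= lists X & word [g] - comb gen q \<in> rel_ideal (sym_gens A M) (sym_rels A M)"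
begin

abbreviation "G \<equiv> sym_gens A M"
abbreviation "U \<equiv> rel_ideal G (sym_rels A M)"
abbreviation "cl \<equiv> sym_class A M"
abbreviation "E \<equiv> ev deg \<phi>"
abbreviation "W u \<equiv> word (map gen u)"

lemma cl_eq_iff: "cl p = cl q \<longleftrightarrow> p - q \<in> U"
 unfolding sym_class_def by (rule quot_eq_iff[OF subspace_rel_ideal])

lemma cl_add [simp]: "cl (p+q) = cl p+cl q"
 unfolding sym_class_def by (rule quot_add[OF subspace_rel_ideal])

lemma cl_diff [simp]: "cl (p - q) = cl p - cl q"
 unfolding sym_class_def by (rule quot_diff[OF subspace_rel_ideal])

lemma cl_fscl [simp]: "cl (fscl c p) = fscl c (cl p)"
 unfolding sym_class_def by (rule quot_fscl[OF subspace_rel_ideal])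

lemma cl_0 [simp]: "cl 0 = 0"
 unfolding sym_class_def by (rule quot_zero[OF subspace_rel_ideal])

lemma cl_sum: "cl (sum g S) = (SUM s:S. cl (g s))"
 unfolding sym_class_def by (rule quot_sum[OF subspace_rel_ideal])

lemma cl_cl [simp]: "cl (cl p) = cl p"
 unfolding sym_class_def by (rule quot_quot[OF subspace_rel_ideal])

lemma keys_cl: "keys p <= lists G ==> keys (cl p) <= lists G"
proof -
 assume p: "keys p <= lists G"
 have "cl p - p \<in> U" using cl_eq_iff[of "cl p" p] by simp
 hence "keys (cl p - p) <= lists G" by (rule keys_rel_ideal) (rule rels_closed)
 from keys_add_subset[OF this p] show ?thesis by simp
qed

lemma cl_fmul_cong:
 assumes "keys p <= lists G" "keys q' <= lists G" "cl p = cl p'" "cl q = cl q'"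
 shows "cl (fmul p q) = cl (fmul p' q')"
proof -
 have "fmul p (q - q') \<in> U" by (rule rel_ideal_left) (use assms cl_eq_iff in auto)
 moreover have "fmul (p - p') q' \<in> U" by (rule rel_ideal_right) (use assms cl_eq_iff in auto)
 ultimately have "fmul p (q - q')+fmul (p - p') q' \<in> U" by (rule rel_ideal_add)
 thus ?thesis by (simp add: cl_eq_iff)
qed

lemma E_U: "p \<in> U ==> E p = (%w. 0)"
proof (induction rule: rel_ideal_induct)
 case (add c u r v q)
 have "E (fmul (word u) (fmul r (word v))) w = 0" for w
 proof -
  have "sh deg (E r) (evw deg \<phi> v) = (%w. 0)" by (simp add: \<phi>_rel[OF add(2)] fun_eq_iff)
  thus ?thesis by (simp add: ev_fmul)
 qed
 with add show ?case by (simp add: fun_eq_iff)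
qed simp

lemma E_cl [simp]: "E (cl p) = E p"
 using E_U[of "cl p - p"] cl_eq_iff[of "cl p" p] by (auto simp: fun_eq_iff)

lemma map_gen [simp]: "set u <= X ==> map gen u \<in> lists G"
 using gen(1) by (induction u) auto

lemma gen_in [simp]: "x \<in> X ==> gen x \<in> G"
 by (rule gen(1))

lemma lists_X [simp]: "u \<in> lists X \<longleftrightarrow> set u <= X"
 by (auto simp: lists_eq_set)

lemma cl_comb: "cl (comb gen q) = (SUM u:keys q. fscl (lookup q u) (cl (W u)))"
 by (simp add: comb_def flin_def cl_sum)

lemma keys_comb: "keys q <= lists X ==> keys (comb gen q) <= lists G"
 unfolding comb_def by (rule keys_flin_subset) (use lists_X map_gen in fastforce)

lemma word_normal: "w \<in> lists G ==> EX q. keys q <= lists X & cl (word w) = cl (comb gen q)"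
proof (induction w)
 case Nil
 show ?case by (intro exI[of _ "word []"]) (simp add: comb_def)
next
 case (Cons g w)
 from Cons obtain q where q: "keys q <= lists X" "cl (word w) = cl (comb gen q)" by auto
 from generated[of g] Cons obtain r where r: "keys r <= lists X" "cl (word [g]) = cl (comb gen r)"
  by (auto simp: cl_eq_iff)
 have "cl (fmul (word [g]) (word w)) = cl (fmul (comb gen r) (comb gen q))"
  by (rule cl_fmul_cong) (use Cons.prems q r keys_comb[OF r(1)] keys_comb[OF q(1)] in auto)
 moreover have "fmul (comb gen r) (comb gen q) = comb gen (fmul r q)"
 proof (induction r rule: pm_induct_all)
  case (add c u r)
  have "fmul (comb gen (word u)) (comb gen q) = comb gen (fmul (word u) q)"
   by (induction q rule: pm_induct_all) (simp_all add: comb_def)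
  with add show ?case by (simp add: comb_def)
 qed (simp add: comb_def)
 moreover have "keys (fmul r q) <= lists X" by (rule keys_fmul[OF r(1) q(1)]) simp
 ultimately show ?case by auto
qed

lemma normal: "keys p <= lists G ==> EX q. keys q <= lists X & cl p = cl (comb gen q)"
proof (induction rule: pm_induct)
 case zero
 show ?case by (intro exI[of _ 0]) (simp add: comb_def)
next
 case (add c w p)
 then obtain q where q: "keys q <= lists X" "cl p = cl (comb gen q)" by blast
 obtain r where r: "keys r <= lists X" "cl (word w) = cl (comb gen r)" using word_normal[OF add(1)] by blast
 have "cl (fscl c (word w)+p) = cl (comb gen (fscl c r+q))" by (simp add: q r comb_def)
 moreover have "keys (fscl c r+q) <= lists X"
  by (intro keys_add_subset subset_trans[OF keys_fscl] q r)
 ultimately show ?case by blast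
qed

lemma cl_cong_left: "w \<in> lists G ==> keys q' <= lists G ==> cl q = cl q' ==> cl (fmul (word w) q) = cl (fmul (word w) q')"
 by (rule cl_fmul_cong) auto

lemma cl_to_front:
 assumes "x \<in> X" "set u <= X" "set v <= X"
 shows "cl (W (u@x#v)) = fscl (eps (deg x*wdeg deg u)) (cl (W (x#u@v)))"
 using assms(2)
proof (induction u)
 case (Cons y u)
 have y: "y \<in> X" "set u <= X" using Cons.prems by auto
 have "cl (W ((y#u)@x#v)) = cl (fmul (word [gen y]) (W (u@x#v)))" by simp
 also have "... = cl (fmul (word [gen y]) (fscl (eps (deg x*wdeg deg u)) (W (x#u@v))))"
  by (rule cl_cong_left)
    (use Cons.IH[OF y(2)] y assms in \<open>simp_all add: subset_trans[OF keys_fscl_word]\<close>)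
 also have "... = fscl (eps (deg x*wdeg deg u)) (cl (fmul (word [gen y, gen x]) (W (u@v))))" by simp
 also have "cl (fmul (word [gen y, gen x]) (W (u@v)))
   = cl (fmul (fscl (eps (deg y*deg x)) (word [gen x, gen y])) (W (u@v)))"
 proof (rule cl_fmul_cong)
  have "word [gen y, gen x] - fscl (sg (sdeg (gen y)*sdeg (gen x))) (word [gen x, gen y]) \<in> U"
   by (rule rel_idealI) (rule sym_rels.commute; rule gen; fact)
  thus "cl (word [gen y, gen x]) = cl (fscl (eps (deg y*deg x)) (word [gen x, gen y]))"
   using gen(2) y assms by (simp add: cl_eq_iff sg_eps del: cl_fscl)
 qed (use y assms in simp_all)
 finally show ?case by (simp add: eps_mult distrib_left ac_simps)
qed simp

text \<open>
 Euler's identity in the algebra: replacing a product of generators by the sum of its signed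
 rearrangements multiplies it by k!. The induction splits off the first letter of u, which stands at
 some place j of v.
\<close>

lemma euler_class:
 assumes "v \<in> words X k"
 shows "(SUM u:words X k. fscl (monomial deg v u) (cl (W u))) = fscl (fact k) (cl (W v))"
 using assms
proof (induction k arbitrary: v)
 case (Suc k)
 have len: "length v = Suc k" and set: "set v <= X" using Suc.prems by (auto simp: words_def)
 have dr: "drop_at j v \<in> words X k" if "j < Suc k" for j
  using that len set by (auto simp: words_def dest!: in_set_takeD in_set_dropD)
 have mv: "(SUM u:words X k. fscl (monomial deg (drop_at j v) u) (cl (W (x#u))))
   = fscl (fact k) (cl (W (x#drop_at j v)))" if x: "x \<in> X" and j: "j < Suc k" for x j
 proof -
  have k1: "keys (SUM u:words X k. fscl (monomial deg (drop_at j v) u) (W u)) <= lists G"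
   by (rule keys_sum_subset, rule subset_trans[OF keys_fscl_word]) (simp add: words_def)
  have k2: "keys (fscl (fact k) (W (drop_at j v))) <= lists G"
   by (rule subset_trans[OF keys_fscl_word]) (use dr[OF j] in \<open>simp add: words_def del: map_append\<close>)
  have "(SUM u:words X k. fscl (monomial deg (drop_at j v) u) (cl (W (x#u))))
    = cl (fmul (word [gen x]) (SUM u:words X k. fscl (monomial deg (drop_at j v) u) (W u)))"
   by (simp add: cl_sum fmul_sum_right)
  also have "... = cl (fmul (word [gen x]) (fscl (fact k) (W (drop_at j v))))"
   by (rule cl_cong_left[OF _ k2]) (use x Suc.IH[OF dr[OF j]] in \<open>simp_all add: cl_sum del: map_append\<close>)
  finally show ?thesis by simp
 qed
 have "(SUM u:words X (Suc k). fscl (monomial deg v u) (cl (W u)))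
   = (SUM x:X. SUM u:words X k. SUM j<Suc k. fscl (letter (v ! j) x*eps (deg x*wdeg deg (take j v)))
     (fscl (monomial deg (drop_at j v) u) (cl (W (x#u)))))"
  by (simp only: sum_words_Suc[OF finX] monomial_Cons_right len fv.scale_sum_left fv.scale_scale)
 also have "... = (SUM x:X. SUM j<Suc k. SUM u:words X k. fscl (letter (v ! j) x*eps (deg x*wdeg deg (take j v)))
     (fscl (monomial deg (drop_at j v) u) (cl (W (x#u)))))"
  by (rule sum.cong[OF refl], rule sum.swap)
 also have "... = (SUM j<Suc k. SUM x:X. SUM u:words X k. fscl (letter (v ! j) x*eps (deg x*wdeg deg (take j v)))
     (fscl (monomial deg (drop_at j v) u) (cl (W (x#u)))))"
  by (rule sum.swap)
 also have "... = (SUM j<Suc k. SUM x:X. if x = v ! j then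
     fscl (eps (deg x*wdeg deg (take j v))) (fscl (fact k) (cl (W (x#drop_at j v)))) else 0)"
  unfolding fv.scale_sum_right[symmetric]
  by (intro sum.cong refl) (auto simp: mv letter_def simp del: fv.scale_scale map_append list.map)
 also have "... = (SUM j<Suc k. fscl (fact k) (cl (W v)))"
 proof (intro sum.cong refl, goal_cases)
  case (1 j)
  note j = 1(1)
  from 1 have vj: "v ! j \<in> X" using len set by (metis lessThan_iff nth_mem subsetD)
  have "cl (W v) = fscl (eps (deg (v ! j)*wdeg deg (take j v))) (cl (W (v ! j#drop_at j v)))"
  proof -
   have st: "set (take j v) <= X" "set (drop (Suc j) v) <= X"
    using set by (auto dest: in_set_takeD in_set_dropD)
   have "v = take j v@v ! j#drop (Suc j) v" using j len by (intro id_take_nth_drop) simp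
   thus ?thesis using cl_to_front[OF vj st] by metis
  qed
  thus ?case
   using finX vj by (simp add: mult.commute)
 qed
 also have "... = fscl (fact (Suc k)) (cl (W v))"
  by (intro poly_mapping_eqI) (simp add: lookup_add lookup_sum algebra_simps del: sum.lessThan_Suc)
 finally show ?case .
qed simp

text \<open>The inverse of evaluation, on functions that vanish on words longer than K: a word of length k has
 k! rearrangements, which all give the same summand when f is symmetric.\<close>

definition lift :: "nat => ('x list => 'k) => (('a, 'm) sgen list \<Rightarrow>\<^sub>0 'k)" where
 "lift K f = (SUM k<=K. SUM u:words X k. fscl (f u / fact k) (W u))"

lemma evw_W: "set u <= X ==> evw deg \<phi> (map gen u) = monomial deg u"
 by (induction u) (simp_all add: gen)

lemma monomial_length: "(monomial deg u w :: 'k) ~= 0 ==> length w = length u"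
proof -
 have l: "lhomog deg (map (%x. (deg x, letter x :: 'x => 'k)) u)"
  by (auto simp: lhomog_def letter_def split: if_splits)
 assume "(monomial deg u w :: 'k) ~= 0"
 thus ?thesis unfolding monomial_def using linprod_length[OF _ l] by auto
qed

text \<open>
 An element is the class of a combination q of words of letters, because the letters generate the
 algebra; on q, evaluation followed by \<open>lift\<close> is Euler's identity. So evaluation is
 injective on classes.
\<close>

lemma cl_lift:
 assumes "keys p <= lists G"
 shows "EX K. cl p = cl (lift K (E p)) & (ALL w. E p w ~= 0 --> length w <= K)"
proof -
 obtain q where q: "keys q <= lists X" "cl p = cl (comb gen q)" using normal[OF assms] by blast
 define K where "K = Max (insert 0 (length ` keys q))"
 have K: "length u <= K" if "u \<in> keys q" for u
  unfolding K_def using that by (intro Max_ge) auto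
 have Ep: "E p w = (SUM v:keys q. lookup q v*monomial deg v w)" for w
 proof -
  have "E p w = E (comb gen q) w" using E_cl[of p] E_cl[of "comb gen q"] q(2) by simp
  also have "... = (SUM v:keys q. lookup q v*evw deg \<phi> (map gen v) w)"
   by (simp add: comb_def ev_def fext_flin) (simp add: fext_def)
  also have "... = (SUM v:keys q. lookup q v*monomial deg v w)"
  proof (intro sum.cong refl, goal_cases)
   case (1 v)
   hence "set v <= X" using q(1) lists_X by blast
   thus ?case by (simp add: evw_W)
  qed
  finally show ?thesis .
 qed
 have "cl (lift K (E p)) = (SUM v:keys q. fscl (lookup q v)
     (SUM k<=K. SUM u:words X k. fscl (monomial deg v u / fact k) (cl (W u))))"
 proof -
  have "cl (SUM k<=K. SUM u:words X k. fscl ((SUM v:keys q. lookup q v*monomial deg v u) / fact k) (W u))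
    = (SUM k<=K. SUM u:words X k. SUM v:keys q. fscl (lookup q v) (fscl (monomial deg v u / fact k) (cl (W u))))"
   by (simp add: cl_sum sum_divide_distrib fv.scale_sum_left)
  also have "... = (SUM k<=K. SUM v:keys q. SUM u:words X k. fscl (lookup q v) (fscl (monomial deg v u / fact k) (cl (W u))))"
   by (rule sum.cong[OF refl], rule sum.swap)
  also have "... = (SUM v:keys q. SUM k<=K. SUM u:words X k. fscl (lookup q v) (fscl (monomial deg v u / fact k) (cl (W u))))"
   by (rule sum.swap)
  finally show ?thesis unfolding lift_def Ep by (simp only: fv.scale_sum_right)
 qed
 also have "... = (SUM v:keys q. fscl (lookup q v) (cl (W v)))"
 proof (intro sum.cong refl arg_cong[of _ _ "fscl _"], goal_cases)
  case (1 v)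
  note v = 1(1)
  have vw: "v \<in> words X (length v)" using q(1) v lists_X by (fastforce simp: words_def)
  have "(SUM k<=K. SUM u:words X k. fscl (monomial deg v u / fact k) (cl (W u)))
    = (SUM k<=K. if k = length v then cl (W v) else 0)"
  proof (intro sum.cong refl)
   fix k
   have "(SUM u:words X k. fscl (monomial deg v u / fact k) (cl (W u)))
     = fscl (1 / fact k) (SUM u:words X k. fscl (monomial deg v u) (cl (W u)))"
    by (simp add: fv.scale_sum_right)
   also have "... = (if k = length v then cl (W v) else 0)"
   proof (cases "k = length v")
    case True
    thus ?thesis using euler_class[OF vw] by simp
   next
    case False
    hence "monomial deg v u = (0::'k)" if "u \<in> words X k" for u
     using that monomial_length[of v u] by (auto simp: words_def)
    thus ?thesis using False by (simp cong: sum.cong_simp)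
   qed
   finally show "(SUM u:words X k. fscl (monomial deg v u / fact k) (cl (W u)))
     = (if k = length v then cl (W v) else 0)" .
  qed
  thus ?case
   using K[OF v] by simp
 qed
 also have "... = cl p" by (simp add: q(2) cl_comb)
 finally have 1: "cl p = cl (lift K (E p))" by simp
 have "length w <= K" if nz: "E p w ~= 0" for w
 proof -
  from nz have "EX v:keys q. lookup q v*monomial deg v w ~= 0"
   unfolding Ep by (meson sum.neutral)
  then obtain v where "v \<in> keys q" "(monomial deg v w :: 'k) ~= 0" by (metis mult_zero_right)
  thus ?thesis using K monomial_length by metis
 qed
 with 1 show ?thesis by blast
qed

lemma E_lift:
 assumes f: "f \<in> Symf deg X" and K: "!!w. f w ~= 0 ==> length w <= K"
 shows "E (lift K f) = f"
proof
 fix w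
 have z: "monomial deg u w = (0::'k)" if "u \<in> words X k" "\<not> (set w <= X & k = length w)" for u k
 proof (rule ccontr)
  assume nz: "monomial deg u w ~= (0::'k)"
  have "set u <= X" "k = length u" using that(1) by (auto simp: words_def)
  thus False using that(2) monomial_length[OF nz] Symf_supp[OF Symf_monomial nz] by auto
 qed
 have "E (lift K f) w = (SUM k<=K. (SUM u:words X k. f u*monomial deg u w) / fact k)"
  unfolding lift_def ev_sum sum_divide_distrib
  by (intro sum.cong refl) (auto simp: evw_W words_def)
 also have "... = (SUM k<=K. if k = length w then f w else 0)"
 proof (intro sum.cong refl, goal_cases)
  case (1 k)
  show ?case
  proof (cases "set w <= X & k = length w")
   case True
   hence "w \<in> words X k" by (auto simp: words_def)
   from monomial_sum[OF inj_on_id2 finX this, of f deg] swapsym_permute[OF Symf_swapsym[OF f], of _ w] True show ?thesis by simp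
  next
   case False
   have "(SUM u:words X k. f u*monomial deg u w) = 0"
    by (intro sum.neutral ballI) (use z False in simp)
   moreover have "f w = 0" if "k = length w" using that False Symf_supp[OF f, of w] by blast
   ultimately show ?thesis by simp
  qed
 qed
 also have "... = f w" using K[of w] by auto
 finally show "E (lift K f) w = f w" .
qed

lemma keys_lift: "keys (lift K f) <= {map gen u | u. set u <= X & f u ~= 0}"
 unfolding lift_def
proof (intro keys_sum_subset, goal_cases)
 case (1 k u)
 thus ?case
  using keys_fscl_word[of "f u / fact k" "map gen u"] by (cases "f u = 0") (auto simp: words_def)
qed

lemma E_Symf: "keys p <= lists G ==> E p \<in> Symf deg X"
proof (induction rule: pm_induct)
 case (add c w q)
 have "evw deg \<phi> w \<in> Symf deg X" using add(1)
  by (induction w) (auto intro: Symf_one Symf_sh \<phi>_Symf)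
 thus ?case using add by (auto intro: Symf_add Symf_scale)
qed (simp add: Symf_zero)

lemma E_homog: "keys p <= {w \<in> lists G. wdeg sdeg w = i} ==> E p \<in> homog deg i"
proof (induction rule: pm_induct)
 case (add c w q)
 have "w \<in> lists G ==> evw deg \<phi> w \<in> homog deg (wdeg sdeg w)"
  by (induction w) (auto intro: homog_one sh_homog \<phi>_homog)
 thus ?case using add by (auto intro: homog_add homog_scale)
qed (simp add: homog_zero)

lemma E_wthom: "keys p <= {w \<in> lists G. (SUM x<-w. swt x) = m} ==> E p \<in> wthom wt m"
proof (induction rule: pm_induct)
 case (add c w q)
 have w: "w \<in> lists G ==> evw deg \<phi> w \<in> wthom wt (SUM x<-w. swt x)"
 proof (induction w)
  case (Cons g w)
  thus ?case using wthom_sh[OF \<phi>_wthom[of g], of "evw deg \<phi> w" "SUM x<-w. swt x"] by simp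
 qed (simp add: wthom_def shone_def)
 show ?case unfolding wthom_def
 proof safe
  fix u assume "E (fscl c (word w)+q) u ~= 0"
  hence "evw deg \<phi> w u ~= 0 \<or> E q u ~= 0" by auto
  thus "(SUM x<-u. wt x) = m" using add w by (auto simp: wthom_def)
 qed
qed (simp add: wthom_def)

lemma cl_eqI:
 assumes "keys p <= lists G" "keys q <= lists G" "E p = E q" shows "cl p = cl q"
proof -
 have k: "keys (p - q) <= lists G" by (rule keys_diff_subset[OF assms(1,2)])
 have "E (p - q) = (%w. 0)" using assms(3) by (simp add: fun_eq_iff)
 hence "cl (p - q) = 0" using cl_lift[OF k] by (auto simp: lift_def)
 thus ?thesis by simp
qed


lemma gradeE:
 assumes "P \<in> grade (Sym A M) i"
 shows "P = cl P" "keys P <= lists G" "E P \<in> Symf deg X" "E P \<in> homog deg i"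
proof -
 from assms obtain p where p: "P = cl p" "keys p <= {w \<in> lists G. wdeg sdeg w = i}"
  by (auto simp: Sym_def)
 have k: "keys p <= lists G" using p(2) by blast
 show "P = cl P" "keys P <= lists G" using p(1) keys_cl[OF k] by simp_all
 show "E P \<in> Symf deg X" "E P \<in> homog deg i" using p(1) E_Symf[OF k] E_homog[OF p(2)] by simp_all
qed

lemma gradeI:
 assumes k: "keys p <= lists G" and "E p \<in> homog deg i" shows "cl p \<in> grade (Sym A M) i"
proof -
 obtain K where K: "cl p = cl (lift K (E p))" using cl_lift[OF k] by blast
 have d: "wdeg sdeg (map gen u) = wdeg deg u" if "set u <= X" for u
  using that by (induction u) (simp_all add: gen)
 have "ALL w:keys (lift K (E p)). w \<in> lists G & wdeg sdeg w = i"
 proof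
  fix w assume "w \<in> keys (lift K (E p))"
  then obtain u where u: "w = map gen u" "set u <= X" "E p u ~= 0" using keys_lift by blast
  thus "w \<in> lists G & wdeg sdeg w = i" using assms(2) d[OF u(2)] by (auto simp: homog_def)
 qed
 thus ?thesis unfolding K Sym_def by auto
qed

lemma grade_eqI:
 assumes "P \<in> grade (Sym A M) i" "Q \<in> grade (Sym A M) j" "E P = E Q" shows "P = Q"
 using cl_eqI[of P Q] gradeE[OF assms(1)] gradeE[OF assms(2)] assms(3) by metis

lemma grade_surj:
 assumes "f \<in> Symf deg X" "f \<in> homog deg i" shows "EX P:grade (Sym A M) i. E P = f"
proof -
 obtain K where K: "!!w. f w ~= 0 ==> length w <= K" using Symf_bound[OF assms(1)] by blast
 have e: "E (lift K f) = f" by (rule E_lift[OF assms(1) K])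
 have k: "keys (lift K f) <= lists G" using keys_lift[of K f] map_gen by blast
 show ?thesis
  by (rule bexI[of _ "cl (lift K f)"]) (use e gradeI[OF k] assms(2) in simp_all)
qed

text \<open>
 Evaluation preserves weights, and a function of weight m is lifted to words of weight m.
\<close>

lemma Sym_wt_eq: "Sym_wt A M m i = {P \<in> grade (Sym A M) i. E P \<in> wthom wt m}"
proof (intro equalityI subsetI)
 fix P assume "P \<in> Sym_wt A M m i"
 then obtain p where p: "P = cl p" "ALL w:keys p. w \<in> lists G & wdeg sdeg w = i & (SUM x<-w. swt x) = m"
  unfolding Sym_wt_def by blast
 have "E P \<in> wthom wt m" using E_wthom[of p m] p by auto
 moreover have "P \<in> grade (Sym A M) i" using p by (auto simp: Sym_def)
 ultimately show "P \<in> {P \<in> grade (Sym A M) i. E P \<in> wthom wt m}" by blast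
next
 fix P assume P: "P \<in> {P \<in> grade (Sym A M) i. E P \<in> wthom wt m}"
 hence g: "P \<in> grade (Sym A M) i" and m: "E P \<in> wthom wt m" by auto
 note P' = gradeE[OF g]
 obtain K where K: "cl P = cl (lift K (E P))" using cl_lift[OF P'(2)] by blast
 have d: "wdeg sdeg (map gen u) = wdeg deg u" "(SUM x<-map gen u. swt x) = (SUM x<-u. wt x)" if "set u <= X" for u
  using that by (induction u) (simp_all add: gen)
 have "ALL w:keys (lift K (E P)). w \<in> lists G & wdeg sdeg w = i & (SUM x<-w. swt x) = m"
 proof
  fix w assume "w \<in> keys (lift K (E P))"
  then obtain u where u: "w = map gen u" "set u <= X" "E P u ~= 0" using keys_lift by blast
  thus "w \<in> lists G & wdeg sdeg w = i & (SUM x<-w. swt x) = m"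
   using P'(4) m d[OF u(2)] map_gen[OF u(2)] unfolding homog_def wthom_def u(1) by blast
 qed
 hence "cl (lift K (E P)) \<in> Sym_wt A M m i" unfolding Sym_wt_def by blast
 thus "P \<in> Sym_wt A M m i" using K P'(1) by simp
qed

lemma E_mul:
 assumes "P \<in> grade (Sym A M) i" "Q \<in> grade (Sym A M) j"
 shows "E (mul (Sym A M) P Q) = sh deg (E P) (E Q)" (is ?P1) "mul (Sym A M) P Q \<in> grade (Sym A M) (i+j)" (is ?P2)
proof -
 have m: "mul (Sym A M) P Q = cl (fmul P Q)" by (simp add: Sym_def)
 have k: "keys (fmul P Q) <= lists G"
  by (rule keys_fmul[OF gradeE(2)[OF assms(1)] gradeE(2)[OF assms(2)]]) simp
 show ?P1 by (simp add: m ev_fmul)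
 show ?P2 unfolding m
  by (rule gradeI[OF k]) (simp add: ev_fmul sh_homog gradeE(4)[OF assms(1)] gradeE(4)[OF assms(2)])
qed

lemma E_aone: "E (aone (Sym A M)) = shone" "aone (Sym A M) \<in> grade (Sym A M) 0"
proof -
 have m: "aone (Sym A M) = cl (word [])" by (simp add: Sym_def)
 show "E (aone (Sym A M)) = shone" by (simp add: m)
 show "aone (Sym A M) \<in> grade (Sym A M) 0" unfolding m
  by (rule gradeI) (simp_all add: homog_one)
qed

lemma grade_add: "P \<in> grade (Sym A M) i ==> Q \<in> grade (Sym A M) i ==> P+Q \<in> grade (Sym A M) i"
 using gradeI[of "P+Q" i] gradeE(2,4)[of P i] gradeE(2,4)[of Q i] gradeE(1)[of P i, symmetric]
  gradeE(1)[of Q i, symmetric] by (simp add: keys_add_subset homog_add)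

lemma grade_fscl: "P \<in> grade (Sym A M) i ==> fscl c P \<in> grade (Sym A M) i"
 using gradeI[of "fscl c P" i] gradeE(2,4)[of P i] gradeE(1)[of P i, symmetric] by (simp add: subset_trans[OF keys_fscl] homog_scale)

lemma grade_0: "0 \<in> grade (Sym A M) i"
 using gradeI[of 0 i] by (simp add: homog_zero)

lemma grade_sum: "(!!s. s \<in> S ==> P s \<in> grade (Sym A M) i) ==> sum P S \<in> grade (Sym A M) i"
 by (induction S rule: infinite_finite_induct) (auto intro: grade_0 grade_add)

lemma gen_class:
 assumes "g \<in> G" shows "cl (word [g]) \<in> grade (Sym A M) (sdeg g)" (is ?P1) "E (cl (word [g])) = \<phi> g"
proof -
 show e: "E (cl (word [g])) = \<phi> g" by (simp add: fun_eq_iff)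
 show ?P1
  by (rule gradeI) (use assms e \<phi>_homog in simp_all)
qed

text \<open>
 Induction over the algebra: an additive property of homogeneous elements holds if it holds for 1
 and is inherited from P to the products of the generators with P.
\<close>

lemma grade_induct:
 assumes P: "P \<in> grade (Sym A M) i"
  and one: "Pr 0 (aone (Sym A M))"
  and mult: "!!x j Q. x \<in> X ==> Q \<in> grade (Sym A M) j ==> Pr j Q ==>
   Pr (deg x+j) (mul (Sym A M) (cl (word [gen x])) Q)"
  and zero: "!!j. Pr j 0"
  and add: "!!j c Q R. Q \<in> grade (Sym A M) j ==> R \<in> grade (Sym A M) j ==> Pr j Q ==> Pr j R
   ==> Pr j (fscl c Q+R)"
 shows "Pr i P"
proof -
 have w: "Pr (wdeg deg u) (cl (W u)) & cl (W u) \<in> grade (Sym A M) (wdeg deg u)" if "set u <= X" for u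
  using that
 proof (induction u)
  case Nil
  show ?case using one E_aone(2) by (simp add: Sym_def)
 next
  case (Cons x u)
  have x: "x \<in> X" using Cons.prems by simp
  have IH: "Pr (wdeg deg u) (cl (W u))" "cl (W u) \<in> grade (Sym A M) (wdeg deg u)" using Cons by auto
  have "cl (W (x#u)) = cl (fmul (word [gen x]) (W u))" by simp
  also have "... = cl (fmul (cl (word [gen x])) (cl (W u)))"
   by (rule cl_fmul_cong) (use Cons.prems x in \<open>simp_all add: keys_cl\<close>)
  also have "... = mul (Sym A M) (cl (word [gen x])) (cl (W u))" by (simp add: Sym_def)
  finally have e: "cl (W (x#u)) = mul (Sym A M) (cl (word [gen x])) (cl (W u))" .
  have gx: "cl (word [gen x]) \<in> grade (Sym A M) (deg x)" using gen_class[OF gen(1)[OF x]] gen(2)[OF x] by simp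
  show ?case unfolding e using mult[OF x IH(2,1)] E_mul(2)[OF gx IH(2)] by simp
 qed
 obtain K where K: "P = cl (lift K (E P))" using cl_lift[OF gradeE(2)[OF P]] gradeE(1)[OF P] by metis
 have s: "Pr i (SUM u:S. fscl (E P u / fact (length u)) (cl (W u))) &
   (SUM u:S. fscl (E P u / fact (length u)) (cl (W u))) \<in> grade (Sym A M) i"
  if "finite S" "S <= lists X" for S
  using that
 proof (induction S)
  case (insert u S)
  let ?R = "SUM u:S. fscl (E P u / fact (length u)) (cl (W u))"
  have R: "Pr i ?R" "?R \<in> grade (Sym A M) i" using insert by auto
  show ?case
  proof (cases "E P u = 0")
   case False
   hence "wdeg deg u = i" using gradeE(4)[OF P] by (auto simp: homog_def)
   hence u: "Pr i (cl (W u))" "cl (W u) \<in> grade (Sym A M) i" using w[of u] insert.prems by auto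
   show ?thesis using add[OF u(2) R(2) u(1) R(1)] grade_add[OF grade_fscl[OF u(2)] R(2)] insert.hyps by simp
  qed (use R insert.hyps in simp)
 qed (simp add: zero grade_0)
 have "P = (SUM k<=K. SUM u:words X k. fscl (E P u / fact k) (cl (W u)))"
  by (subst K) (simp add: lift_def cl_sum)
 also have "... = (SUM k<=K. SUM u:words X k. fscl (E P u / fact (length u)) (cl (W u)))"
  by (intro sum.cong refl) (simp add: words_def)
 also have "... = (SUM u:(\<Union>k\<in>{..K}. words X k). fscl (E P u / fact (length u)) (cl (W u)))"
  by (rule sum.UNION_disjoint[symmetric]) (auto simp: finite_words[OF finX], auto simp: words_def)
 finally show ?thesis
  using s[of "\<Union>k\<in>{..K}. words X k"] finite_words[OF finX] by (auto simp: words_def)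
qed

end

context sym_model
begin

definition inv_E :: "int => ('x list => 'k) => (('a, 'm) sgen list \<Rightarrow>\<^sub>0 'k)" where
 "inv_E i f = (THE P. P \<in> grade (Sym A M) i & E P = f)"

lemma inv_E:
 assumes "f \<in> Symf deg X" "f \<in> homog deg i"
 shows "inv_E i f \<in> grade (Sym A M) i" "E (inv_E i f) = f"
proof -
 have "EX! P. P \<in> grade (Sym A M) i & E P = f"
  using grade_surj[OF assms] grade_eqI by blast
 from theI'[OF this] show "inv_E i f \<in> grade (Sym A M) i" "E (inv_E i f) = f"
  unfolding inv_E_def by blast+
qed

end

lemma sh_one_right_fun [simp]: "sh deg f shone = f"
 by (rule ext) simp

section \<open>Spaces of graded maps\<close>

definition gspace :: "('k::field, 'v::ab_group_add, 'z) cplx_scheme => bool" where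
 "gspace W \<longleftrightarrow> vector_space (scl W) & (ALL i. module.subspace (scl W) (grade W i))"

lemma sum_fun_apply2: "sum f S x y = (SUM s:S. f s x y)"
 by (induction S rule: infinite_finite_induct) simp_all

lemma
 assumes "gspace W"
 shows gspace_add: "x \<in> grade W i ==> y \<in> grade W i ==> x+y \<in> grade W i"
  and gspace_scl: "x \<in> grade W i ==> scl W c x \<in> grade W i"
  and gspace_0: "0 \<in> grade W i"
  and gspace_distrib: "scl W c (x+y) = scl W c x+scl W c y"
  and gspace_scl_scl: "scl W c (scl W d x) = scl W (c*d) x"
  and gspace_scl_0: "scl W c 0 = 0"
proof -
 interpret vector_space "scl W" using assms by (simp add: gspace_def)
 have s: "subspace (grade W i)" for i using assms by (simp add: gspace_def)
 show "x \<in> grade W i ==> y \<in> grade W i ==> x+y \<in> grade W i" by (rule subspace_add[OF s])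
 show "x \<in> grade W i ==> scl W c x \<in> grade W i" by (rule subspace_scale[OF s])
 show "0 \<in> grade W i" by (rule subspace_0[OF s])
 show "scl W c (x+y) = scl W c x+scl W c y" by (rule scale_right_distrib)
 show "scl W c (scl W d x) = scl W (c*d) x" by simp
 show "scl W c 0 = 0" by simp
qed

lemma hom_gradeD:
 assumes "L \<in> grade (hom_cplx V W) i"
 shows "x \<in> grade V j ==> L j x \<in> grade W (j+i)" "linear_on V (grade V j) W (L j)"
  "x \<notin> grade V j ==> L j x = 0"
  "x \<in> grade V j ==> y \<in> grade V j ==> L j (x+y) = L j x+L j y"
  "x \<in> grade V j ==> L j (scl V c x) = scl W c (L j x)"
 using assms by (auto simp: hom_cplx_def linear_on_def image_subset_iff)

lemma hom_gradeI:
 assumes "!!j x. x \<in> grade V j ==> L j x \<in> grade W (j+i)"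
  and "!!j x y. x \<in> grade V j ==> y \<in> grade V j ==> L j (x+y) = L j x+L j y"
  and "!!j c x. x \<in> grade V j ==> L j (scl V c x) = scl W c (L j x)"
  and "!!j x. x \<notin> grade V j ==> L j x = 0"
 shows "L \<in> grade (hom_cplx V W) i"
 using assms by (auto simp: hom_cplx_def linear_on_def)

lemma hom_scl: "scl (hom_cplx V W) c L = (%j x. scl W c (L j x))"
 by (simp add: hom_cplx_def)

lemma hom_add:
 assumes "gspace W" "L \<in> grade (hom_cplx V W) i" "L' \<in> grade (hom_cplx V W) i"
 shows "L+L' \<in> grade (hom_cplx V W) i"
 by (rule hom_gradeI)
   (simp_all add: hom_gradeD[OF assms(2)] hom_gradeD[OF assms(3)] gspace_add[OF assms(1)]
    gspace_distrib[OF assms(1)] add_ac)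

lemma hom_scale:
 assumes "gspace W" "L \<in> grade (hom_cplx V W) i"
 shows "scl (hom_cplx V W) c L \<in> grade (hom_cplx V W) i"
 unfolding hom_scl
 by (rule hom_gradeI)
   (simp_all add: hom_gradeD[OF assms(2)] gspace_scl[OF assms(1)] gspace_scl_0[OF assms(1)]
    gspace_distrib[OF assms(1)] gspace_scl_scl[OF assms(1)] mult.commute)

lemma hom_zero:
 assumes "gspace W" shows "0 \<in> grade (hom_cplx V W) i"
 by (rule hom_gradeI) (simp_all add: gspace_0[OF assms] gspace_scl_0[OF assms])

lemma gspace_ground: "gspace (ground :: ('k::field, 'k) dga)"
proof -
 interpret v: vector_space "(*) :: 'k => 'k => 'k" by unfold_locales (simp_all add: algebra_simps)
 show ?thesis by (auto simp: gspace_def ground_def v.vector_space_axioms v.subspace_def)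
qed

lemma sym_gensI [simp]: "Coef i a \<in> sym_gens A M \<longleftrightarrow> a \<in> grade A i" "Vec i x \<in> sym_gens A M \<longleftrightarrow> x \<in> grade M i"
 by (auto simp: sym_gens_def)

lemma sym_rels_closed:
 assumes "!!i a b. a \<in> grade A i ==> b \<in> grade A i ==> a+b \<in> grade A i"
  "!!i a c. a \<in> grade A i ==> scl A c a \<in> grade A i"
  "!!i j a b. a \<in> grade A i ==> b \<in> grade A j ==> mul A a b \<in> grade A (i+j)"
  "aone A \<in> grade A 0"
  "!!i x y. x \<in> grade M i ==> y \<in> grade M i ==> x+y \<in> grade M i"
  "!!i x c. x \<in> grade M i ==> scl M c x \<in> grade M i"
  "!!i j a x. a \<in> grade A i ==> x \<in> grade M j ==> act M i a x \<in> grade M (i+j)"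
  and r: "r \<in> sym_rels A M"
 shows "keys r <= lists (sym_gens A M)"
proof -
 have w: "keys (word w) <= lists (sym_gens A M)" if "w \<in> lists (sym_gens A M)" for w using that by simp
 have f: "keys (fscl c (word w)) <= lists (sym_gens A M)" if "w \<in> lists (sym_gens A M)" for w c
  by (rule subset_trans[OF keys_fscl_word]) (use that in simp)
 from r show ?thesis
 proof cases
  case (coef_add a i b) show ?thesis unfolding coef_add(1)
   by (intro keys_diff_subset w f) (simp_all add: assms coef_add(2-))
 next
  case (coef_scl a i c) show ?thesis unfolding coef_scl(1)
   by (intro keys_diff_subset w f) (simp_all add: assms coef_scl(2-))
 next
  case (coef_mul a i b j) show ?thesis unfolding coef_mul(1)
   by (intro keys_diff_subset w f) (simp_all add: assms coef_mul(2-))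
 next
  case coef_one show ?thesis unfolding coef_one(1)
   by (intro keys_diff_subset w f) (simp_all add: assms)
 next
  case (vec_add x i y) show ?thesis unfolding vec_add(1)
   by (intro keys_diff_subset w f) (simp_all add: assms vec_add(2-))
 next
  case (vec_scl x i c) show ?thesis unfolding vec_scl(1)
   by (intro keys_diff_subset w f) (simp_all add: assms vec_scl(2-))
 next
  case (vec_act a i x j) show ?thesis unfolding vec_act(1)
   by (intro keys_diff_subset w f) (simp_all add: assms vec_act(2-))
 next
  case (commute u v) show ?thesis unfolding commute(1)
   by (intro keys_diff_subset w f) (simp_all add: commute(2-))
 qed
qed

section \<open>Homogeneous bases\<close>

type_synonym 'v lbl = "(int \<times> 'v)+(int \<times> 'v)"

locale fin_cplx =
 fixes V :: "('k::field_char_0, 'v::ab_group_add) cplx" and n :: int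
 assumes cc: "cochain_complex V" and bd: "bounded_cplx V" and fd: "degreewise_finite_dim V"
begin

lemma vector_space_V: "vector_space (scl V)"
 using cc by (simp add: cochain_complex_def)

sublocale vs: vector_space "scl V"
 by (rule vector_space_V)

lemma gspace_V: "gspace V"
 using cc by (simp add: cochain_complex_def gspace_def)

definition Bs :: "int => 'v set" where
 "Bs i = (SOME S. finite S & vs.independent S & vs.span S = grade V i)"

lemma Bs: "finite (Bs i)" "vs.independent (Bs i)" "vs.span (Bs i) = grade V i"
proof -
 obtain S where S: "finite S" "grade V i = vs.span S" using fd by (auto simp: degreewise_finite_dim_def)
 obtain T where T: "T <= S" "vs.independent T" "S <= vs.span T"
  using vs.maximal_independent_subset[of S] by blast
 have "vs.span T = grade V i"
  unfolding S(2) using vs.span_mono[OF T(1)] vs.span_minimal[OF T(3) vs.subspace_span] by (rule subset_antisym)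
 hence "EX S. finite S & vs.independent S & vs.span S = grade V i"
  using T finite_subset[OF T(1) S(1)] by blast
 from someI_ex[OF this] show "finite (Bs i)" "vs.independent (Bs i)" "vs.span (Bs i) = grade V i"
  unfolding Bs_def by blast+
qed

definition B :: "(int \<times> 'v) set" where
 "B = {(i, b). b \<in> Bs i}"

lemma B_grade: "b \<in> B ==> snd b \<in> grade V (fst b)"
 using vs.span_base[of "snd b" "Bs (fst b)"] by (auto simp: B_def Bs(3))

lemma finite_B: "finite B"
proof -
 obtain N where N: "!!i. \<bar>i\<bar> > N ==> grade V i = {0}" using bd by (auto simp: bounded_cplx_def)
 have "Bs i = {}" if "\<bar>i\<bar> > N" for i
 proof -
  have "Bs i <= {0}" using vs.span_superset[of "Bs i"] Bs(3)[of i] N[OF that] by simp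
  moreover have "0 \<notin> Bs i" using Bs(2)[of i] vs.dependent_zero by blast
  ultimately show ?thesis by blast
 qed
 hence "B <= Sigma {-N..N} Bs" unfolding B_def by (auto simp: abs_le_iff not_less[symmetric])
 thus ?thesis by (rule finite_subset) (auto intro: Bs)
qed

text \<open>The pair g is a degree with an element of that degree.\<close>

definition co :: "int \<times> 'v => int \<times> 'v => 'k" where
 "co g b = (if fst b = fst g & b \<in> B then vs.representation (Bs (fst g)) (snd g) (snd b) else 0)"

lemma co_nonzero: "co g b ~= 0 ==> fst b = fst g & b \<in> B"
 by (auto simp: co_def split: if_splits)

lemma co_zero: "fst b ~= fst g ==> co g b = 0"
 by (auto simp: co_def)

lemma co_basis: "b \<in> B ==> co b c = (if c = b then 1 else 0)"
 using vs.representation_basis[OF Bs(2), of "snd b" "fst b"]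
 by (cases b; cases c) (auto simp: co_def B_def)

lemma co_add: "x \<in> grade V i ==> y \<in> grade V i ==> co (i, x+y) b = co (i, x) b+co (i, y) b"
 using vs.representation_add[OF Bs(2), of y i x] by (simp add: co_def Bs(3))

lemma co_scl: "x \<in> grade V i ==> co (i, scl V c x) b = c*co (i, x) b"
 using vs.representation_scale[OF Bs(2), of x i c] by (simp add: co_def Bs(3))

lemma sum_B: "(!!b. b \<in> B ==> fst b ~= i ==> f b = 0) ==> (SUM b:B. f b) = (SUM b:Bs i. f (i, b))"
proof -
 assume z: "!!b. b \<in> B ==> fst b ~= i ==> f b = 0"
 have "(SUM b:B. f b) = (SUM b:Pair i ` Bs i. f b)"
  by (rule sum.mono_neutral_right) (use finite_B in \<open>auto simp: B_def intro!: z\<close>)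
 also have "... = (SUM b:Bs i. f (i, b))" by (subst sum.reindex) (auto simp: inj_on_def)
 finally show ?thesis .
qed

lemma co_expand: "x \<in> grade V i ==> (SUM b:B. scl V (co (i, x) b) (snd b)) = x"
proof -
 assume x: "x \<in> grade V i"
 have "(SUM b:B. scl V (co (i, x) b) (snd b)) = (SUM b:Bs i. scl V (co (i, x) (i, b)) b)"
  by (subst sum_B[of i]) (auto simp: co_zero)
 also have "... = (SUM b:Bs i. scl V (vs.representation (Bs i) x b) b)"
  by (intro sum.cong refl) (simp add: co_def B_def)
 also have "... = x" by (rule vs.sum_representation_eq) (use Bs x in auto)
 finally show ?thesis .
qed


lemma linear_expand:
 assumes x: "x \<in> grade V i"
  and add: "!!y z. y \<in> grade V i ==> z \<in> grade V i ==> f (y+z) = f y+(f z :: 'k)"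
  and scl: "!!c y. y \<in> grade V i ==> f (scl V c y) = c*f y"
 shows "f x = (SUM b:B. co (i, x) b*f (snd b))"
proof -
 have f0: "f 0 = 0" using scl[OF gspace_0[OF gspace_V], of 0] by simp
 have "f (SUM b:S. scl V (co (i, x) b) (snd b)) = (SUM b:S. co (i, x) b*f (snd b))
   & (SUM b:S. scl V (co (i, x) b) (snd b)) \<in> grade V i" if "finite S" "S <= B" for S
  using that
 proof (induction S)
  case empty
  show ?case using gspace_0[OF gspace_V] f0 by simp
 next
  case (insert b S)
  have b: "scl V (co (i, x) b) (snd b) \<in> grade V i & f (scl V (co (i, x) b) (snd b)) = co (i, x) b*f (snd b)"
  proof (cases "fst b = i")
   case True
   thus ?thesis using scl B_grade[of b] insert.prems gspace_scl[OF gspace_V] by auto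
  next
   case False
   thus ?thesis using f0 gspace_0[OF gspace_V] by (simp add: co_zero)
  qed
  thus ?case using insert add gspace_add[OF gspace_V] by simp
 qed
 from this[OF finite_B subset_refl] co_expand[OF x] show ?thesis by simp
qed

section \<open>The free algebra\<close>

definition deg :: "'v lbl => int" where
 "deg x = (case x of Inl b => fst b+n | Inr b => 1 - fst b)"

lemma deg_simps [simp]: "deg (Inl b) = fst b+n" "deg (Inr b) = 1 - fst b"
 by (simp_all add: deg_def)

definition dualvec :: "int \<times> 'v => int => 'v => 'k" where
 "dualvec b j x = (if x \<in> grade V j then co (j, x) b else 0)"

lemma dual_simps: "grade (dual V) = grade (hom_cplx V ground)" "scl (dual V) = scl (hom_cplx V ground)"
 "dif (dual V) = dif (hom_cplx V ground)" "act (dual V) i = scl (hom_cplx V ground)"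
 by (simp_all add: dual_def cplx.defs dgmod.defs)

lemma shift_mod_simps [simp]:
 "grade (shift_mod k M) i = grade M (i+k)" "scl (shift_mod k M) = scl M"
 "act (shift_mod k M) i a x = scl M (sg (i*k)) (act M i a x)"
 "dif (shift_mod k M) i x = scl M (sg k) (dif M (i+k) x)"
 by (simp_all add: shift_mod_def shift_def cplx.defs dgmod.defs)

lemma dual_scl: "scl (dual V) c \<theta> = (%j x. c*\<theta> j x)"
 by (simp add: dual_simps hom_scl) (simp add: ground_def)

lemma ground_simps [simp]: "scl ground = (*)" "mul ground = (*)" "aone ground = 1" "dif ground i x = 0"
 "grade ground i = (if i = 0 then UNIV else {0})"
 by (simp_all add: ground_def)

lemma dual_gradeD:
 assumes "\<theta> \<in> grade (dual V) j"
 shows "x \<in> grade V i ==> i+j ~= 0 ==> \<theta> i x = 0"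
  "x \<in> grade V i ==> y \<in> grade V i ==> \<theta> i (x+y) = \<theta> i x+\<theta> i y"
  "x \<in> grade V i ==> \<theta> i (scl V c x) = c*\<theta> i x" "x \<notin> grade V i ==> \<theta> i x = 0"
proof -
 note h = hom_gradeD[OF assms[unfolded dual_simps]]
 show "x \<in> grade V i ==> i+j ~= 0 ==> \<theta> i x = 0" using h(1)[of x i] by simp
 show "x \<in> grade V i ==> y \<in> grade V i ==> \<theta> i (x+y) = \<theta> i x+\<theta> i y" by (rule h(4))
 show "x \<in> grade V i ==> \<theta> i (scl V c x) = c*\<theta> i x" using h(5)[of x i c] by simp
 show "x \<notin> grade V i ==> \<theta> i x = 0" by (rule h(3))
qed

lemma dualvec_grade: "b \<in> B ==> dualvec b \<in> grade (dual V) (- fst b)"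
 unfolding dual_simps
 by (rule hom_gradeI)
   (auto simp: dualvec_def co_add co_scl co_zero gspace_add[OF gspace_V] gspace_scl[OF gspace_V])

lemma dual_expand:
 assumes "\<theta> \<in> grade (dual V) j" "x \<in> grade V i"
 shows "\<theta> i x = (SUM b:B. co (i, x) b*\<theta> (fst b) (snd b))"
proof -
 have "\<theta> i x = (SUM b:B. co (i, x) b*\<theta> i (snd b))"
  by (rule linear_expand[OF assms(2)]) (simp_all add: dual_gradeD[OF assms(1)])
 also have "... = (SUM b:B. co (i, x) b*\<theta> (fst b) (snd b))"
  by (intro sum.cong refl) (metis co_zero fst_conv mult_zero_left)
 finally show ?thesis .
qed

lemma dual_basis:
 assumes "\<theta> \<in> grade (dual V) j"
 shows "\<theta> = (SUM b:B. scl (dual V) (\<theta> (fst b) (snd b)) (dualvec b))"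
proof (intro ext, goal_cases)
 case (1 i x)
 show ?case
  by (cases "x \<in> grade V i")
    (simp_all add: sum_fun_apply2 dual_scl dualvec_def dual_expand[OF assms, of x i] dual_gradeD[OF assms] mult.commute)
qed

abbreviation XA :: "'v lbl set" where
 "XA \<equiv> Inr ` B"

abbreviation dfun :: "(int => 'v => 'k) => 'v lbl => 'k" where
 "dfun \<theta> \<equiv> case_sum (%b. 0) (%b. if b \<in> B then \<theta> (fst b) (snd b) else 0)"

primrec \<phi>A :: "('k, int => 'v => 'k) sgen => 'v lbl list => 'k" where
 "\<phi>A (Coef i c) = (%w. c*shone w)"
| "\<phi>A (Vec i \<theta>) = lin (dfun \<theta>)"

definition genA :: "'v lbl => ('k, int => 'v => 'k) sgen" where
 "genA x = (case x of Inl b => Vec (1 - fst b) (dualvec b) | Inr b => Vec (1 - fst b) (dualvec b))"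

abbreviation dualM :: "('k, 'k, int => 'v => 'k) dgmod" where
 "dualM \<equiv> shift_mod (- 1) (dual V)"

lemma dual_closed:
 "\<theta> \<in> grade (dual V) j ==> \<theta>' \<in> grade (dual V) j ==> \<theta>+\<theta>' \<in> grade (dual V) j"
 "\<theta> \<in> grade (dual V) j ==> scl (dual V) c \<theta> \<in> grade (dual V) j"
 "0 \<in> grade (dual V) j"
 unfolding dual_simps using hom_add[OF gspace_ground] hom_scale[OF gspace_ground] hom_zero[OF gspace_ground]
 by blast+

lemma dfun_nonzero:
 assumes "\<theta> \<in> grade (dual V) (i - 1)" "dfun \<theta> x ~= 0"
 shows "x \<in> XA & deg x = i"
proof -
 obtain b where b: "x = Inr b" "b \<in> B" "\<theta> (fst b) (snd b) ~= 0"
  using assms(2) by (cases x) (auto split: if_splits)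
 have "fst b+(i - 1) = 0" using dual_gradeD(1)[OF assms(1) B_grade[OF b(2)]] b(3) by blast
 thus ?thesis using b by simp
qed

lemma sym_gens_cases:
 assumes "g \<in> sym_gens A M"
 obtains i a where "g = Coef i a" "a \<in> grade A i" | i x where "g = Vec i x" "x \<in> grade M i"
 using assms by (auto simp: sym_gens_def)

lemma cl_word_sum:
 assumes "fv.subspace U" and zero: "word [v 0] \<in> U"
  and add: "!!x y. x \<in> S ==> y \<in> S ==> word [v (x+y)] - word [v x] - word [v y] \<in> U"
  and S: "0 \<in> S" "!!x y. x \<in> S ==> y \<in> S ==> x+y \<in> S"
  and f: "!!i. i \<in> I ==> f i \<in> S" and I: "finite I"
 shows "word [v (SUM i:I. f i)] - (SUM i:I. word [v (f i)]) \<in> U & (SUM i:I. f i) \<in> S"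
 using I f
proof (induction I)
 case empty
 thus ?case using zero S(1) by simp
next
 case (insert i I)
 have IH: "word [v (SUM i:I. f i)] - (SUM i:I. word [v (f i)]) \<in> U" "(SUM i:I. f i) \<in> S" using insert by auto
 have fi: "f i \<in> S" using insert.prems by simp
 have "(word [v (f i+(SUM i:I. f i))] - word [v (f i)] - word [v (SUM i:I. f i)])
   +(word [v (SUM i:I. f i)] - (SUM i:I. word [v (f i)])) \<in> U"
  by (rule fv.subspace_add[OF assms(1) add[OF fi IH(2)] IH(1)])
 thus ?case using insert.hyps S(2)[OF fi IH(2)] by (simp add: algebra_simps)
qed

lemma swapsym_\<phi>A: assumes "g \<in> sym_gens ground dualM" shows "\<phi>A g \<in> Symf deg XA" "\<phi>A g \<in> homog deg (sdeg g)"
  "\<phi>A g \<in> wthom (%_. 1) (swt g)" (is ?P1)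
proof -
 have "\<phi>A g \<in> Symf deg XA & \<phi>A g \<in> homog deg (sdeg g) & \<phi>A g \<in> wthom (%_. 1) (swt g)"
  using assms
 proof (cases rule: sym_gens_cases)
  case (1 i a)
  have "\<phi>A g \<in> homog deg (sdeg g)"
   using 1 by (auto simp: homog_def shone_def split: if_splits)
  moreover have "\<phi>A g \<in> wthom (%_. 1) (swt g)" using 1 by (auto simp: wthom_def shone_def split: if_splits)
  ultimately show ?thesis using 1 by (simp add: Symf_scale[OF Symf_one])
 next
  case (2 i x)
  hence x: "x \<in> grade (dual V) (i - 1)" by simp
  have "lin (dfun x) \<in> Symf deg XA" by (rule Symf_lin) (use dfun_nonzero[OF x] in blast)
  moreover have "lin (dfun x) \<in> homog deg i" by (rule homog_lin) (use dfun_nonzero[OF x] in blast)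
  moreover have "lin (dfun x) \<in> wthom (%_. 1) 1" by (auto simp: wthom_def lin_nonzero)
  ultimately show ?thesis using 2 by simp
 qed
 thus "\<phi>A g \<in> Symf deg XA" "\<phi>A g \<in> homog deg (sdeg g)" ?P1 by blast+
qed

lemma lin_add: "lin (%x. f x+g x) w = lin f w+lin g w"
 and lin_scale: "lin (%x. c*f x) w = c*lin f w"
 by (simp_all add: lin_def split: list.split)

lemma dfun_add: "dfun (\<theta>+\<theta>') = (%x. dfun \<theta> x+dfun \<theta>' x)"
 and dfun_scale: "dfun (%j x. c*\<theta> j x) = (%x. c*dfun \<theta> x)"
 by (auto simp: fun_eq_iff split: sum.split)

lemma ground_act: "a \<in> grade ground i ==> act dualM i a x = (%j y. a*x j y)"
 by (auto simp: dual_simps dual_scl[unfolded dual_simps] split: if_splits)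

lemma FA_model: "sym_model ground dualM deg (%_. 1) XA genA \<phi>A"
proof
 show "finite XA" using finite_B by simp
 fix x assume "x \<in> XA"
 then obtain b where b: "x = Inr b" "b \<in> B" by auto
 show "genA x \<in> sym_gens ground dualM" "sdeg (genA x) = deg x" "swt (genA x) = 1"
  using b dualvec_grade[OF b(2)] by (simp_all add: genA_def)
 have "dfun (dualvec b) y = letter (Inr b) y" for y
  using b B_grade co_basis by (cases y) (auto simp: letter_def dualvec_def)
 hence "dfun (dualvec b) = letter (Inr b)" by blast
 thus "\<phi>A (genA x) = lin (letter x)" using b by (simp add: genA_def)
next
 fix g assume "g \<in> sym_gens ground dualM"
 thus "\<phi>A g \<in> Symf deg XA" "\<phi>A g \<in> homog deg (sdeg g)" "\<phi>A g \<in> wthom (%_. 1) (swt g)"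
  by (rule swapsym_\<phi>A)+
next
 fix r :: "('k, int => 'v => 'k) sgen list \<Rightarrow>\<^sub>0 'k"
 assume "r \<in> sym_rels ground dualM"
 thus "ev deg \<phi>A r = (%w. 0)"
 proof cases
  case (coef_add a i b)
  show ?thesis unfolding coef_add(1) by (simp add: fun_eq_iff algebra_simps)
 next
  case (coef_scl a i c)
  show ?thesis unfolding coef_scl(1) by (simp add: fun_eq_iff algebra_simps)
 next
  case (coef_mul a i b j)
  show ?thesis unfolding coef_mul(1) by (simp add: fun_eq_iff sh_scale_left algebra_simps)
 next
  case coef_one
  show ?thesis unfolding coef_one(1) by (simp add: fun_eq_iff)
 next
  case (vec_add x i y)
  show ?thesis unfolding vec_add(1) by (simp add: fun_eq_iff dfun_add lin_add)
 next
  case (vec_scl x i c)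
  show ?thesis unfolding vec_scl(1) by (simp add: fun_eq_iff dual_scl dfun_scale lin_scale)
 next
  case (commute u v)
  have "sh deg (\<phi>A u) (\<phi>A v) w = eps (sdeg u*sdeg v)*sh deg (\<phi>A v) (\<phi>A u) w" for w
   by (rule sh_comm) (use commute swapsym_\<phi>A in auto)
  thus ?thesis using commute by (simp add: fun_eq_iff sg_eps)
 next
  case (vec_act a i x j)
  show ?thesis unfolding vec_act(1) ground_act[OF vec_act(2)]
   by (simp add: fun_eq_iff dfun_scale lin_scale sh_scale_left)
 qed
next
 fix r :: "('k, int => 'v => 'k) sgen list \<Rightarrow>\<^sub>0 'k"
 assume "r \<in> sym_rels ground dualM"
 thus "keys r <= lists (sym_gens ground dualM)"
 proof (rule sym_rels_closed[rotated -1])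
  fix i j :: int and a :: 'k and x assume a: "a \<in> grade ground i" and x: "x \<in> grade dualM j"
  show "act dualM i a x \<in> grade dualM (i+j)"
  proof (cases "i = 0")
   case True
   thus ?thesis unfolding ground_act[OF a] using dual_closed(2)[of x "j - 1" a] x by (simp add: dual_scl)
  next
   case False
   hence "act dualM i a x = 0" using ground_act[OF a, of x] a by (simp add: fun_eq_iff)
   thus ?thesis using dual_closed(3) by simp
  qed
 qed (auto intro: dual_closed split: if_splits)
next
 let ?U = "rel_ideal (sym_gens ground dualM) (sym_rels ground dualM)"
 fix g assume "g \<in> sym_gens ground dualM"
 thus "EX q. keys q <= lists XA & word [g] - comb genA q \<in> ?U"
 proof (cases rule: sym_gens_cases)
  case (1 i a)
  show ?thesis
  proof (cases "i = 0")
   case True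
   have "(word [Coef 0 (scl ground a 1)] - fscl a (word [Coef 0 (1::'k)]))+fscl a (word [Coef 0 (aone ground)] - word []) \<in> ?U"
    by (intro rel_ideal_add rel_ideal_fscl rel_idealI sym_rels.coef_scl sym_rels.coef_one) simp
   hence "word [g] - comb genA (fscl a (word [])) \<in> ?U"
    using 1 True by (simp add: comb_def fv.scale_right_diff_distrib)
   thus ?thesis by (intro exI[of _ "fscl a (word [])"]) (simp add: subset_trans[OF keys_fscl_word])
  next
   case False
   have "word [Coef i (scl ground 0 (0::'k))] - fscl 0 (word [Coef i 0]) \<in> ?U"
    by (intro rel_idealI sym_rels.coef_scl) simp
   thus ?thesis using 1 False by (intro exI[of _ 0]) (simp add: comb_def)
  qed
 next
  case (2 i x)
  hence x: "x \<in> grade (dual V) (i - 1)" by simp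
  let ?f = "%b. scl (dual V) (x (fst b) (snd b)) (dualvec b)"
  have fb: "x (fst b) (snd b) = 0 \<or> i = 1 - fst b" if "b \<in> B" for b
   using dual_gradeD(1)[OF x B_grade[OF that]] by auto
  have S: "?f b \<in> grade (dual V) (i - 1)" if "b \<in> B" for b
   using fb[OF that] dual_closed(2)[OF dualvec_grade[OF that]] dual_closed(3)[of "i - 1"]
   by (auto simp: dual_scl zero_fun_def)
  have "word [Vec i 0] \<in> ?U"
   using rel_idealI[OF sym_rels.vec_scl[where A = ground and M = dualM and x = 0 and i = i and c = 0]] dual_closed(3)
   by (simp add: dual_scl zero_fun_def)
  have "word [Vec i (SUM b:B. ?f b)] - (SUM b:B. word [Vec i (?f b)]) \<in> ?U & (SUM b:B. ?f b) \<in> grade (dual V) (i - 1)"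
  proof (rule cl_word_sum[where v = "Vec i", OF subspace_rel_ideal \<open>word [Vec i 0] \<in> ?U\<close> _ dual_closed(3) dual_closed(1) S finite_B], goal_cases)
   case (1 y z)
   thus ?case
    by (intro rel_idealI sym_rels.vec_add) simp_all
  qed
  hence 1: "word [g] - (SUM b:B. word [Vec i (?f b)]) \<in> ?U" using dual_basis[OF x] 2 by simp
  have "(SUM b:B. word [Vec i (?f b)] - fscl (x (fst b) (snd b)) (word [genA (Inr b)])) \<in> ?U"
  proof (rule rel_ideal_sum, goal_cases)
   case (1 b)
   note b = 1(1)
   show ?case
   proof (cases "i = 1 - fst b")
    case True
    thus ?thesis using dualvec_grade[OF b] sym_rels.vec_scl[where A = ground and M = dualM and x = "dualvec b" and i = i and c = "x (fst b) (snd b)"]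
     by (intro rel_idealI) (simp add: genA_def)
   next
    case False
    hence "x (fst b) (snd b) = 0" using fb[OF b] by auto
    thus ?thesis using \<open>word [Vec i 0] \<in> ?U\<close> by (simp add: dual_scl zero_fun_def)
   qed
  qed
  with 1 have "(word [g] - (SUM b:B. word [Vec i (?f b)]))+(SUM b:B. word [Vec i (?f b)] - fscl (x (fst b) (snd b)) (word [genA (Inr b)])) \<in> ?U"
   by (rule rel_ideal_add)
  hence "word [g] - comb genA (SUM b:B. fscl (x (fst b) (snd b)) (word [Inr b])) \<in> ?U"
   by (simp add: comb_def flin_sum sum_subtractf)
  moreover have "keys (SUM b:B. fscl (x (fst b) (snd b)) (word [Inr b :: 'v lbl])) <= lists XA"
   by (intro keys_sum_subset subset_trans[OF keys_fscl_word]) auto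
  ultimately show ?thesis by blast
 qed
qed

sublocale FA: sym_model ground dualM deg "%_. 1" XA genA \<phi>A
 by (rule FA_model)

abbreviation FF :: "('k, ('v, 'k) free_el) dga" where "FF \<equiv> free_cdga V"

lemma FF_Sym: "FF = Sym ground dualM"
 by (simp add: free_cdga_def)

abbreviation \<alpha> :: "('v, 'k) free_el => 'v lbl list => 'k" where "\<alpha> \<equiv> FA.E"

lemma FF_simps [simp]: "scl FF = fscl"
 by (simp add: FF_Sym Sym_def)

lemmas FF_gradeE = FA.gradeE[folded FF_Sym]
 and FF_eqI = FA.grade_eqI[folded FF_Sym]
 and FF_mul = FA.E_mul[folded FF_Sym]
 and FF_one = FA.E_aone[folded FF_Sym]
 and FF_add = FA.grade_add[folded FF_Sym]
 and FF_fscl = FA.grade_fscl[folded FF_Sym]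
 and FF_0 = FA.grade_0[folded FF_Sym]
 and FF_sum = FA.grade_sum[folded FF_Sym]
 and FF_back = FA.inv_E[folded FF_Sym]
 and FF_induct = FA.grade_induct[folded FF_Sym]

definition eb :: "int \<times> 'v => ('v, 'k) free_el" where
 "eb b = FA.cl (word [genA (Inr b)])"

lemma eb: "b \<in> B ==> eb b \<in> grade FF (1 - fst b)" "b \<in> B ==> \<alpha> (eb b) = lin (letter (Inr b))"
 using FA.gen_class[of "genA (Inr b)"] FA.gen[of "Inr b"] unfolding eb_def FF_Sym by auto

lemma susp_grade: "\<theta> \<in> grade (dual V) j ==> susp V j \<theta> \<in> grade FF (j+1)"
 and \<alpha>_susp: "\<theta> \<in> grade (dual V) j ==> \<alpha> (susp V j \<theta>) = lin (dfun \<theta>)"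
 using FA.gen_class[of "Vec (j+1) \<theta>"] unfolding susp_def vec_in_def FF_Sym by auto

lemma eb_susp: "eb b = susp V (- fst b) (dualvec b)"
 by (simp add: eb_def susp_def vec_in_def genA_def)

end

section \<open>Derivations of the free algebra\<close>

lemma sh_assoc_fun: "sh deg (sh deg f g) h = sh deg f (sh deg g h)"
 by (rule ext) (rule sh_assoc)

lemma Symf_mono: "f \<in> Symf deg X ==> X <= Y ==> f \<in> Symf deg Y"
 unfolding Symf_def by blast

lemma sh_twist_homog:
 assumes "f \<in> homog deg j"
 shows "sh deg (%u. eps (c*wdeg deg u)*f u) g w = eps (c*j)*sh deg f g w"
 unfolding homog_twist[OF assms] sh_scale_left ..

context fin_cplx
begin

text \<open>
 The derivation SUM c_b d/d(\<open>Inr b\<close>): removing the first letter \<open>Inr b\<close> is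
 the partial derivative.
\<close>

definition vfield :: "(int \<times> 'v => 'v lbl list => 'k) => ('v lbl list => 'k) => 'v lbl list => 'k" where
 "vfield c f w = (SUM b:B. sh deg (c b) (%u. f (Inr b#u)) w)"

definition coefs :: "int => (int \<times> 'v => 'v lbl list => 'k) => bool" where
 "coefs i c \<longleftrightarrow> (ALL b:B. c b \<in> Symf deg XA & c b \<in> homog deg (i+1 - fst b))"

lemma coefsD: "coefs i c ==> b \<in> B ==> c b \<in> Symf deg XA" "coefs i c ==> b \<in> B ==> c b \<in> homog deg (i+1 - fst b)"
 by (auto simp: coefs_def)

lemma vfield_add: "vfield c (%w. f w+g w) w = vfield c f w+vfield c g w"
 by (simp add: vfield_def sh_add_right sum.distrib)

lemma vfield_scale: "vfield c (%w. a*f w) w = a*vfield c f w"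
 by (simp add: vfield_def sh_scale_right sum_distrib_left)

lemma vfield_sh:
 assumes c: "coefs i c" and f: "f \<in> homog deg j"
 shows "vfield c (sh deg f g) w = sh deg (vfield c f) g w+eps (i*j)*sh deg f (vfield c g) w"
proof -
 have "sh deg (c b) (%u. sh deg f g (Inr b#u)) w = sh deg (sh deg (c b) (%u. f (Inr b#u))) g w
   +eps (i*j)*sh deg f (sh deg (c b) (%u. g (Inr b#u))) w" if b: "b \<in> B" for b
 proof -
  let ?g = "%u. g (Inr b#u)"
  have "sh deg (c b) (%u. sh deg f g (Inr b#u)) w = sh deg (c b) (%u. sh deg (%u. f (Inr b#u)) g u
    +eps ((1 - fst b)*j)*sh deg f ?g u) w"
   by (simp add: sh_twist_homog[OF f])
  also have "... = sh deg (sh deg (c b) (%u. f (Inr b#u))) g w+eps ((1 - fst b)*j)*sh deg (sh deg (c b) f) ?g w"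
   by (simp add: sh_add_right sh_scale_right sh_assoc_fun)
  also have "sh deg (c b) f = (%w. eps ((i+1 - fst b)*j)*sh deg f (c b) w)"
   by (rule ext, rule sh_comm[OF coefsD(2)[OF c b] f])
  also have "eps ((1 - fst b)*j)*sh deg (%w. eps ((i+1 - fst b)*j)*sh deg f (c b) w) ?g w
    = eps ((1 - fst b)*j+(i+1 - fst b)*j)*sh deg (sh deg f (c b)) ?g w"
   by (simp add: sh_scale_left eps_add)
  also have "eps ((1 - fst b)*j+(i+1 - fst b)*j) = (eps (i*j) :: 'k)"
   by (rule eps_cong) auto
  finally show ?thesis by (simp add: sh_assoc_fun)
 qed
 moreover have "sh deg (vfield c f) g w = (SUM b:B. sh deg (sh deg (c b) (%u. f (Inr b#u))) g w)"
  unfolding vfield_def by (rule sh_sum_left)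
 moreover have "sh deg f (vfield c g) w = (SUM b:B. sh deg f (sh deg (c b) (%u. g (Inr b#u))) w)"
  unfolding vfield_def by (rule sh_sum_right)
 ultimately show ?thesis
  unfolding vfield_def by (simp add: sum.distrib sum_distrib_left)
qed

lemma vfield_Symf: "coefs i c ==> f \<in> Symf deg X ==> XA <= X ==> vfield c f \<in> Symf deg X"
 unfolding vfield_def by (intro Symf_sum Symf_sh Symf_left_shift) (auto dest: coefsD intro: Symf_mono)

lemma vfield_homog:
 assumes "coefs i c" "f \<in> homog deg j" shows "vfield c f \<in> homog deg (j+i)"
 unfolding vfield_def
proof (rule homog_sum, goal_cases)
 case (1 b)
 note b = 1(1)
 have "sh deg (c b) (%u. f (Inr b#u)) \<in> homog deg ((i+1 - fst b)+(j - deg (Inr b)))"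
  by (intro sh_homog homog_left_shift coefsD(2)[OF assms(1) b] assms(2))
 thus ?case by (simp add: algebra_simps)
qed

lemma vfield_letter: "b \<in> B ==> vfield c (lin (letter (Inr b))) = c b"
proof (rule ext)
 fix w assume b: "b \<in> B"
 have "vfield c (lin (letter (Inr b))) w = (SUM b':B. if b' = b then c b w else 0)"
  unfolding vfield_def by (intro sum.cong refl) (auto simp: lin_Cons letter_def sh_scale_right)
 thus "vfield c (lin (letter (Inr b))) w = c b w" using b finite_B by simp
qed

lemma vfield_one: "vfield c shone w = 0"
 by (simp add: vfield_def)

lemma vfield_cong: "(!!b. b \<in> B ==> c b = c' b) ==> vfield c f = vfield c' f"
 unfolding vfield_def by (intro ext sum.cong refl) simp

definition dcoef :: "(int => ('v, 'k) free_el => ('v, 'k) free_el) => int \<times> 'v => 'v lbl list => 'k" where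
 "dcoef D b = \<alpha> (D (1 - fst b) (eb b))"

lemma Der_simps: "scl (Der A) = scl (hom_cplx A A)" "dif (Der A) = dif (hom_cplx A A)"
 "act (Der A) i a D = (%k b. if b \<in> grade A k then mul A a (D k b) else 0)"
 by (simp_all add: Der_def)

lemma DerD:
 assumes "D \<in> grade (Der A) i"
 shows "D \<in> grade (hom_cplx A A) i"
  "a \<in> grade A j ==> b \<in> grade A k ==>
   D (j+k) (mul A a b) = mul A (D j a) b+scl A (sg (i*j)) (mul A a (D k b))"
 using assms by (auto simp: Der_def)

lemmas Der_hom = hom_gradeD[OF DerD(1)]

text \<open>
 A map that acts as a vector field is a derivation, since the first-letter shifts are derivations of
 the shuffle product.
\<close>

lemma derI:
 assumes c: "coefs i c"
  and g: "!!j a. a \<in> grade FF j ==> D j a \<in> grade FF (j+i)"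
  and v: "!!j a. a \<in> grade FF j ==> \<alpha> (D j a) = vfield c (\<alpha> a)"
  and z: "!!j a. a \<notin> grade FF j ==> D j a = 0"
 shows "D \<in> grade (Der FF) i" "b \<in> B ==> dcoef D b = c b"
proof -
 have h: "D \<in> grade (hom_cplx FF FF) i"
 proof (rule hom_gradeI[OF g _ _ z])
  fix j x y assume x: "x \<in> grade FF j" and y: "y \<in> grade FF j"
  show "D j (x+y) = D j x+D j y"
   by (rule FF_eqI[OF g[OF FF_add[OF x y]] FF_add[OF g[OF x] g[OF y]]])
     (simp add: v FF_add x y vfield_add fun_eq_iff)
 next
  fix j s x assume x: "x \<in> grade FF j"
  have "D j (fscl s x) = fscl s (D j x)"
   by (rule FF_eqI[OF g[OF FF_fscl[OF x]] FF_fscl[OF g[OF x]]])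
     (simp add: v FF_fscl x vfield_scale fun_eq_iff)
  thus "D j (scl FF s x) = scl FF s (D j x)" by simp
 qed
 have "D (j+k) (mul FF a b) = mul FF (D j a) b+scl FF (sg (i*j)) (mul FF a (D k b))"
  if a: "a \<in> grade FF j" and b: "b \<in> grade FF k" for j k a b
 proof -
  have g1: "mul FF (D j a) b \<in> grade FF (j+k+i)"
   using FF_mul(2)[OF g[OF a] b] by (simp add: algebra_simps)
  have g2: "mul FF a (D k b) \<in> grade FF (j+k+i)"
   using FF_mul(2)[OF a g[OF b]] by (simp add: algebra_simps)
  show ?thesis unfolding FF_simps
  proof (rule FF_eqI[OF g[OF FF_mul(2)[OF a b]] FF_add[OF g1 FF_fscl[OF g2]]])
   show "\<alpha> (D (j+k) (mul FF a b)) = \<alpha> (mul FF (D j a) b+fscl (sg (i*j)) (mul FF a (D k b)))"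
    unfolding v[OF FF_mul(2)[OF a b]] FF_mul(1)[OF a b]
    by (simp add: FF_mul(1)[OF g[OF a] b] FF_mul(1)[OF a g[OF b]] v a b fun_eq_iff
      vfield_sh[OF c FF_gradeE(4)[OF a]] sg_eps)
  qed
 qed
 with h show "D \<in> grade (Der FF) i" by (simp add: Der_def)
 show "dcoef D b = c b" if b: "b \<in> B"
  unfolding dcoef_def v[OF eb(1)[OF b]] eb(2)[OF b] by (rule vfield_letter[OF b])
qed

lemma dcoef_coefs: "D \<in> grade (Der FF) i ==> coefs i (dcoef D)"
proof -
 assume D: "D \<in> grade (Der FF) i"
 show ?thesis unfolding coefs_def dcoef_def
 proof (intro ballI conjI)
  fix b assume b: "b \<in> B"
  have "D (1 - fst b) (eb b) \<in> grade FF (1 - fst b+i)" by (rule Der_hom(1)[OF D eb(1)[OF b]])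
  from FF_gradeE(3,4)[OF this]
  show "\<alpha> (D (1 - fst b) (eb b)) \<in> Symf deg XA" "\<alpha> (D (1 - fst b) (eb b)) \<in> homog deg (i+1 - fst b)"
   by (simp_all add: algebra_simps)
 qed
qed

text \<open>
 Both sides vanish on 1 and satisfy the same Leibniz rule, and they agree on the coordinates; the
 claim follows by induction over products of coordinates.
\<close>

lemma der_formula:
 assumes D: "D \<in> grade (Der FF) i" and a: "a \<in> grade FF j"
 shows "\<alpha> (D j a) = vfield (dcoef D) (\<alpha> a)"
 using a
proof (induction rule: FF_induct[consumes 1, case_names one mult zero add])
 case one
 have "D (0+0) (mul FF (aone FF) (aone FF)) = mul FF (D 0 (aone FF)) (aone FF)
   +scl FF (sg (i*0)) (mul FF (aone FF) (D 0 (aone FF)))"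
  by (rule DerD(2)[OF D FF_one(2) FF_one(2)])
 moreover have "mul FF (aone FF) (aone FF) = aone FF"
  by (rule FF_eqI[OF FF_mul(2)[OF FF_one(2) FF_one(2)] FF_one(2)])
    (simp add: FF_mul(1)[OF FF_one(2) FF_one(2)] FF_one(1))
 ultimately have eq: "D 0 (aone FF) = mul FF (D 0 (aone FF)) (aone FF)+mul FF (aone FF) (D 0 (aone FF))"
  by simp
 have g: "D 0 (aone FF) \<in> grade FF i" using Der_hom(1)[OF D FF_one(2)] by simp
 have "\<alpha> (D 0 (aone FF)) w = \<alpha> (D 0 (aone FF)) w+\<alpha> (D 0 (aone FF)) w" for w
 proof -
  have "\<alpha> (D 0 (aone FF)) w = \<alpha> (mul FF (D 0 (aone FF)) (aone FF)+mul FF (aone FF) (D 0 (aone FF))) w"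
   by (rule arg_cong[OF eq])
  thus ?thesis by (simp only: ev_simps FF_mul(1)[OF g FF_one(2)] FF_mul(1)[OF FF_one(2) g] FF_one(1) sh_one_left sh_one_right)
 qed
 hence "\<alpha> (D 0 (aone FF)) w = 0" for w by (metis add_cancel_right_right)
 thus ?case by (simp add: FF_one(1) vfield_one fun_eq_iff)
next
 case (mult x j Q)
 then obtain b where b: "x = Inr b" "b \<in> B" by auto
 have e: "FA.cl (word [genA x]) = eb b" by (simp add: b eb_def)
 have dx: "deg x = 1 - fst b" using b by simp
 note eb1 = eb(1)[OF b(2)] and eb2 = eb(2)[OF b(2)]
 have D1: "D (1 - fst b) (eb b) \<in> grade FF (1 - fst b+i)" by (rule Der_hom(1)[OF D eb1])
 have D2: "D j Q \<in> grade FF (j+i)" by (rule Der_hom(1)[OF D mult(2)])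
 have "D (1 - fst b+j) (mul FF (eb b) Q) = mul FF (D (1 - fst b) (eb b)) Q
   +scl FF (sg (i*(1 - fst b))) (mul FF (eb b) (D j Q))"
  by (rule DerD(2)[OF D eb1 mult(2)])
 hence "\<alpha> (D (deg x+j) (mul FF (eb b) Q)) w = sh deg (dcoef D b) (\<alpha> Q) w
   +eps (i*(1 - fst b))*sh deg (lin (letter x)) (vfield (dcoef D) (\<alpha> Q)) w" for w
  unfolding dx by (simp add: FF_mul(1)[OF D1 mult(2)] FF_mul(1)[OF eb1 D2] mult(3) eb2 b(1) dcoef_def[of D b] sg_eps)
 moreover have "vfield (dcoef D) (\<alpha> (mul FF (eb b) Q)) w = sh deg (dcoef D b) (\<alpha> Q) w
   +eps (i*(1 - fst b))*sh deg (lin (letter x)) (vfield (dcoef D) (\<alpha> Q)) w" for w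
  unfolding FF_mul(1)[OF eb1 mult(2)]
  using vfield_sh[OF dcoef_coefs[OF D] FF_gradeE(4)[OF eb1], of "\<alpha> Q" w]
  by (simp add: eb2 b vfield_letter)
 ultimately show ?case unfolding e by (simp add: fun_eq_iff)
next
 case (zero j)
 have "D j (fscl 0 0) = fscl 0 (D j 0)" using Der_hom(5)[OF D FF_0, of j 0] by simp
 thus ?case by (simp add: fun_eq_iff vfield_def)
next
 case (add j s Q R)
 have "D j (fscl s Q+R) = fscl s (D j Q)+D j R"
  using Der_hom(4)[OF D FF_fscl[OF add(1)] add(2), of s] Der_hom(5)[OF D add(1), of s] by simp
 thus ?case by (simp add: add vfield_add vfield_scale fun_eq_iff)
qed

lemma der_eqI:
 assumes D: "D \<in> grade (Der FF) i" and D': "D' \<in> grade (Der FF) i"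
  and e: "!!b. b \<in> B ==> dcoef D b = dcoef D' b"
 shows "D = D'"
proof (intro ext)
 fix j a
 show "D j a = D' j a"
 proof (cases "a \<in> grade FF j")
  case True
  show ?thesis
   by (rule FF_eqI[OF Der_hom(1)[OF D True] Der_hom(1)[OF D' True]])
     (simp add: der_formula[OF D True] der_formula[OF D' True] vfield_cong[OF e])
 qed (simp add: Der_hom(3)[OF D] Der_hom(3)[OF D'])
qed

definition der_of :: "int => (int \<times> 'v => 'v lbl list => 'k) => int => ('v, 'k) free_el => ('v, 'k) free_el" where
 "der_of i c j a = (if a \<in> grade FF j then FA.inv_E (j+i) (vfield c (\<alpha> a)) else 0)"

lemma der_of:
 assumes c: "coefs i c"
 shows "der_of i c \<in> grade (Der FF) i" "b \<in> B ==> dcoef (der_of i c) b = c b"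
  "a \<in> grade FF j ==> \<alpha> (der_of i c j a) = vfield c (\<alpha> a)"
proof -
 have m: "der_of i c j a \<in> grade FF (j+i) & \<alpha> (der_of i c j a) = vfield c (\<alpha> a)"
  if a: "a \<in> grade FF j" for a j
  using FF_back[OF vfield_Symf[OF c FF_gradeE(3)[OF a] subset_refl] vfield_homog[OF c FF_gradeE(4)[OF a]]] a
  by (simp add: der_of_def)
 show "a \<in> grade FF j ==> \<alpha> (der_of i c j a) = vfield c (\<alpha> a)" using m by blast
 show "der_of i c \<in> grade (Der FF) i"
  by (rule derI(1)[OF c]) (use m in \<open>auto simp: der_of_def\<close>)
 show "b \<in> B ==> dcoef (der_of i c) b = c b"
  by (rule derI(2)[OF c]) (use m in \<open>auto simp: der_of_def\<close>)
qed

lemma coefs_add: "coefs i c ==> coefs i c' ==> coefs i (%b w. c b w+c' b w)"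
 by (auto simp: coefs_def intro: Symf_add homog_add)

lemma coefs_scale: "coefs i c ==> coefs i (%b w. s*c b w)"
 by (auto simp: coefs_def intro: Symf_scale homog_scale)

lemma coefs_mult:
 assumes "coefs i c" "f \<in> Symf deg XA" "f \<in> homog deg k" shows "coefs (k+i) (%b. sh deg f (c b))"
 unfolding coefs_def
proof (intro ballI conjI)
 fix b assume b: "b \<in> B"
 show "sh deg f (c b) \<in> Symf deg XA" by (intro Symf_sh assms coefsD[OF assms(1) b])
 have "sh deg f (c b) \<in> homog deg (k+(i+1 - fst b))" by (intro sh_homog assms coefsD[OF assms(1) b])
 thus "sh deg f (c b) \<in> homog deg (k+i+1 - fst b)" by (simp add: algebra_simps)
qed

lemma Der_add:
 assumes D: "D \<in> grade (Der FF) i" and D': "D' \<in> grade (Der FF) i"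
 shows "D+D' \<in> grade (Der FF) i" "b \<in> B ==> dcoef (D+D') b = (%w. dcoef D b w+dcoef D' b w)"
proof -
 have "vfield (dcoef D) f w+vfield (dcoef D') f w = vfield (%b w. dcoef D b w+dcoef D' b w) f w" for f w
  by (simp add: vfield_def sh_add_left sum.distrib)
 thus "D+D' \<in> grade (Der FF) i"
  by (intro derI(1)[OF coefs_add[OF dcoef_coefs[OF D] dcoef_coefs[OF D']]])
    (simp_all add: FF_add Der_hom[OF D] Der_hom[OF D'] der_formula[OF D] der_formula[OF D'])
 show "b \<in> B ==> dcoef (D+D') b = (%w. dcoef D b w+dcoef D' b w)"
  by (simp add: dcoef_def)
qed

lemma Der_scl:
 assumes D: "D \<in> grade (Der FF) i"
 shows "scl (Der FF) s D \<in> grade (Der FF) i" "dcoef (scl (Der FF) s D) b = (%w. s*dcoef D b w)" (is ?P1)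
proof -
 have "s*vfield (dcoef D) f w = vfield (%b w. s*dcoef D b w) f w" for f w
  by (simp add: vfield_def sh_scale_left sum_distrib_left)
 thus "scl (Der FF) s D \<in> grade (Der FF) i"
  by (intro derI(1)[OF coefs_scale[OF dcoef_coefs[OF D]]])
    (simp_all add: FF_fscl Der_hom[OF D] der_formula[OF D] Der_simps hom_scl)
 show ?P1
  by (simp add: dcoef_def Der_simps hom_scl)
qed

lemma Der_act:
 assumes D: "D \<in> grade (Der FF) i" and a: "a \<in> grade FF k"
 shows "act (Der FF) k a D \<in> grade (Der FF) (k+i)" (is ?P1)
  "b \<in> B ==> dcoef (act (Der FF) k a D) b = sh deg (\<alpha> a) (dcoef D b)"
proof -
 have v: "sh deg (\<alpha> a) (vfield (dcoef D) f) w = vfield (%b. sh deg (\<alpha> a) (dcoef D b)) f w" for f w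
  unfolding vfield_def sh_sum_right sh_assoc_fun ..
 note c = coefs_mult[OF dcoef_coefs[OF D] FF_gradeE(3,4)[OF a]]
 have 1: "act (Der FF) k a D j x \<in> grade FF (j+(k+i))" if x: "x \<in> grade FF j" for j x
  using FF_mul(2)[OF a Der_hom(1)[OF D x]] x by (simp add: Der_simps algebra_simps)
 have 2: "\<alpha> (act (Der FF) k a D j x) = vfield (%b. sh deg (\<alpha> a) (dcoef D b)) (\<alpha> x)"
  if x: "x \<in> grade FF j" for j x
  by (rule ext) (simp add: Der_simps x FF_mul(1)[OF a Der_hom(1)[OF D x]] der_formula[OF D x] v)
 have 3: "act (Der FF) k a D j x = 0" if "x \<notin> grade FF j" for j x using that by (simp add: Der_simps)
 show ?P1 by (rule derI(1)[OF c 1 2 3])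
 show "b \<in> B ==> dcoef (act (Der FF) k a D) b = sh deg (\<alpha> a) (dcoef D b)" by (rule derI(2)[OF c 1 2 3])
qed

lemma Der_0: "0 \<in> grade (Der FF) i" "dcoef 0 b = (%w. 0)"
proof -
 have "coefs i (%b w. 0)" by (auto simp: coefs_def Symf_zero homog_zero)
 thus "0 \<in> grade (Der FF) i"
  by (rule derI(1)) (simp_all add: FF_0 vfield_def fun_eq_iff)
 show "dcoef 0 b = (%w. 0)" by (simp add: dcoef_def fun_eq_iff)
qed

lemma Der_sum:
 assumes "!!s. s \<in> S ==> D s \<in> grade (Der FF) i"
 shows "sum D S \<in> grade (Der FF) i" "b \<in> B ==> dcoef (sum D S) b = (%w. SUM s:S. dcoef (D s) b w)"
proof -
 have "sum D S \<in> grade (Der FF) i & (ALL b:B. dcoef (sum D S) b = (%w. SUM s:S. dcoef (D s) b w))"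
  using assms
 proof (induction S rule: infinite_finite_induct)
  case (insert s S)
  hence IH: "sum D S \<in> grade (Der FF) i" "ALL b:B. dcoef (sum D S) b = (%w. SUM s:S. dcoef (D s) b w)" by blast+
  have s: "D s \<in> grade (Der FF) i" using insert.prems by blast
  show ?case unfolding sum.insert[OF insert.hyps]
  proof (intro conjI ballI)
   show "D s+sum D S \<in> grade (Der FF) i" by (rule Der_add(1)[OF s IH(1)])
   fix b assume b: "b \<in> B"
   show "dcoef (D s+sum D S) b = (%w. dcoef (D s) b w+(SUM s:S. dcoef (D s) b w))"
    unfolding Der_add(2)[OF s IH(1) b] using IH(2) b by simp
  qed
 qed (simp_all add: Der_0)
 thus "sum D S \<in> grade (Der FF) i" "b \<in> B ==> dcoef (sum D S) b = (%w. SUM s:S. dcoef (D s) b w)"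
  by blast+
qed

text \<open>The constant vector field of a homogeneous element of V.\<close>

definition dvx :: "int \<times> 'v => int => ('v, 'k) free_el => ('v, 'k) free_el" where
 "dvx g = der_of (fst g - 1) (%b w. co g b*shone w)"

lemma coefs_const: "coefs (fst g - 1) (%b w. co g b*shone w)"
 unfolding coefs_def
proof (intro ballI conjI)
 fix b
 show "(%w. co g b*shone w) \<in> Symf deg XA" by (intro Symf_scale Symf_one)
 show "(%w. co g b*shone w) \<in> homog deg (fst g - 1+1 - fst b)"
  using co_nonzero[of g b] by (auto simp: homog_def shone_def split: if_splits)
qed

lemma dvx: "dvx g \<in> grade (Der FF) (fst g - 1)" "b \<in> B ==> dcoef (dvx g) b = (%w. co g b*shone w)"
 using der_of[OF coefs_const] unfolding dvx_def by blast+

text \<open>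
 The derivation of x sends a generator s\<open>\<theta>\<close> to the scalar
 \<open>\<langle>\<theta>,x\<rangle>\<close>, so its coefficients are the coordinates of x.
\<close>

lemma desusp_dvx:
 assumes x: "x \<in> grade V i" shows "desusp_der V i x = dvx (i, x)"
 unfolding desusp_der_def
proof (rule the_equality)
 have D: "dvx (i, x) \<in> grade (Der FF) (i - 1)" using dvx(1)[of "(i, x)"] by simp
 have "dvx (i, x) (j+1) (susp V j \<theta>) = fscl (\<theta> i x) (aone FF)" if t: "\<theta> \<in> grade (dual V) j" for j \<theta>
 proof (cases "i+j = 0")
  case True
  have g: "dvx (i, x) (j+1) (susp V j \<theta>) \<in> grade FF 0"
   using Der_hom(1)[OF D susp_grade[OF t]] True by (simp add: algebra_simps)
  show ?thesis
  proof (rule FF_eqI[OF g FF_fscl[OF FF_one(2)]], rule ext, goal_cases)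
   case (1 w)
   have "\<alpha> (dvx (i, x) (j+1) (susp V j \<theta>)) w = vfield (%b w. co (i, x) b*shone w) (lin (dfun \<theta>)) w"
    using der_formula[OF D susp_grade[OF t]] vfield_cong[of "dcoef (dvx (i, x))"] dvx(2)
    by (simp add: \<alpha>_susp[OF t])
   also have "... = (SUM b:B. co (i, x) b*\<theta> (fst b) (snd b))*shone w"
    unfolding vfield_def sum_distrib_right
    by (intro sum.cong refl) (simp add: lin_Cons sh_scale_left sh_scale_right)
   finally show ?case
    by (simp add: dual_expand[OF t x, symmetric] FF_one(1))
  qed
 next
  case False
  have z: "\<theta> i x = 0" using dual_gradeD(1)[OF t x False] .
  have g: "dvx (i, x) (j+1) (susp V j \<theta>) \<in> grade FF (i+j)"
   using Der_hom(1)[OF D susp_grade[OF t]] by (simp add: algebra_simps)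
  show ?thesis unfolding z
  proof (rule FF_eqI[OF g FF_fscl[OF FF_one(2)]], rule ext, goal_cases)
   case (1 w)
   have "\<alpha> (dvx (i, x) (j+1) (susp V j \<theta>)) w = vfield (%b w. co (i, x) b*shone w) (lin (dfun \<theta>)) w"
    using der_formula[OF D susp_grade[OF t]] vfield_cong[of "dcoef (dvx (i, x))"] dvx(2)
    by (simp add: \<alpha>_susp[OF t])
   also have "... = (SUM b:B. co (i, x) b*\<theta> (fst b) (snd b))*shone w"
    unfolding vfield_def sum_distrib_right
    by (intro sum.cong refl) (simp add: lin_Cons sh_scale_left sh_scale_right)
   finally show ?case
    by (simp add: dual_expand[OF t x, symmetric] z)
  qed
 qed
 with D show "dvx (i, x) \<in> grade (Der FF) (i - 1) & (ALL j. ALL \<theta>:grade (dual V) j.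
   dvx (i, x) (j+1) (susp V j \<theta>) = scl FF (\<theta> i x) (aone FF))" by simp
next
 fix D assume D: "D \<in> grade (Der FF) (i - 1) & (ALL j. ALL \<theta>:grade (dual V) j.
   D (j+1) (susp V j \<theta>) = scl FF (\<theta> i x) (aone FF))"
 show "D = dvx (i, x)"
 proof (rule der_eqI[of _ "i - 1"])
  fix b assume b: "b \<in> B"
  have "D (- fst b+1) (susp V (- fst b) (dualvec b)) = scl FF (dualvec b i x) (aone FF)"
   using D dualvec_grade[OF b] by blast
  thus "dcoef D b = dcoef (dvx (i, x)) b"
   unfolding dvx(2)[OF b] by (simp add: dcoef_def eb_susp FF_one(1) dualvec_def x)
 qed (use D dvx(1)[of "(i, x)"] in simp_all)
qed

section \<open>The algebra of polyvectors\<close>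

abbreviation DM :: "('k, ('v, 'k) free_el, int => ('v, 'k) free_el => ('v, 'k) free_el) dgmod" where
 "DM \<equiv> shifted_Der FF n"

lemma DM_grade: "grade DM i = grade (Der FF) (i - n - 1)"
 by (simp add: algebra_simps)

abbreviation XP :: "'v lbl set" where "XP \<equiv> Inl ` B \<union> Inr ` B"

definition wtP :: "'v lbl => nat" where "wtP x = (case x of Inl b => 1 | Inr b => 0)"

lemma wtP_simps [simp]: "wtP (Inl b) = 1" "wtP (Inr b) = 0"
 by (simp_all add: wtP_def)

abbreviation dl :: "int \<times> 'v => 'v lbl list => 'k" where "dl b \<equiv> lin (letter (Inl b))"

text \<open>
 The vector s^{n+1}D as a function of all letters: the sum of its coefficients times the conjugate
 letters. The sign arises from moving s^{n+1} past the coefficient.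
\<close>

definition dvec :: "int => (int \<times> 'v => 'v lbl list => 'k) => 'v lbl list => 'k" where
 "dvec i c w = (SUM b:B. eps ((i - n - fst b)*(n+1))*sh deg (c b) (dl b) w)"

primrec \<phi>P :: "(('v, 'k) free_el, int => ('v, 'k) free_el => ('v, 'k) free_el) sgen => 'v lbl list => 'k" where
 "\<phi>P (Coef i a) = \<alpha> a"
| "\<phi>P (Vec i D) = dvec i (dcoef D)"

definition genP :: "'v lbl => (('v, 'k) free_el, int => ('v, 'k) free_el => ('v, 'k) free_el) sgen" where
 "genP x = (case x of Inl b => Vec (fst b+n) (dvx b) | Inr b => Coef (1 - fst b) (eb b))"

lemma genP_simps [simp]: "genP (Inl b) = Vec (fst b+n) (dvx b)" "genP (Inr b) = Coef (1 - fst b) (eb b)"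
 by (simp_all add: genP_def)

lemma wthom_A: "f \<in> Symf deg XA ==> f \<in> wthom wtP 0"
 unfolding wthom_def
proof safe
 fix w assume "f \<in> Symf deg XA" "f w ~= 0"
 hence "set w <= XA" by (rule Symf_supp)
 thus "(SUM x<-w. wtP x) = 0" by (induction w) auto
qed

lemma wthom_sum: "(!!s. s \<in> S ==> f s \<in> wthom wt m) ==> (%w. SUM s:S. c s*f s w) \<in> wthom wt m"
 unfolding wthom_def
proof safe
 fix w assume *: "!!s. s \<in> S ==> f s \<in> {f. ALL w. f w ~= 0 --> (SUM x<-w. wt x) = m}" "(SUM s:S. c s*f s w) ~= 0"
 then obtain s where "s \<in> S" "c s*f s w ~= 0" by (meson sum.neutral)
 thus "(SUM x<-w. wt x) = m" using *(1) by auto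
qed

lemma Symf_dl: "b \<in> B ==> dl b \<in> Symf deg XP" "dl b \<in> homog deg (fst b+n)" "dl b \<in> wthom wtP 1"
proof -
 show "b \<in> B ==> dl b \<in> Symf deg XP" by (rule Symf_lin) (auto simp: letter_def split: if_splits)
 show "dl b \<in> homog deg (fst b+n)" by (rule homog_lin) (auto simp: letter_def split: if_splits)
 show "dl b \<in> wthom wtP 1" by (auto simp: wthom_def lin_nonzero letter_def split: if_splits)
qed

lemma dvec_props:
 assumes "coefs (i - n - 1) c"
 shows "dvec i c \<in> Symf deg XP" "dvec i c \<in> homog deg i" "dvec i c \<in> wthom wtP 1"
proof -
 have A: "c b \<in> Symf deg XP" if "b \<in> B" for b using coefsD(1)[OF assms that] by (rule Symf_mono) auto
 show "dvec i c \<in> Symf deg XP"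
  unfolding dvec_def by (intro Symf_sum Symf_scale Symf_sh A Symf_dl)
 show "dvec i c \<in> homog deg i"
  unfolding dvec_def
 proof (intro homog_sum homog_scale)
  fix b assume b: "b \<in> B"
  have "sh deg (c b) (dl b) \<in> homog deg ((i - n - 1+1 - fst b)+(fst b+n))"
   by (intro sh_homog coefsD(2)[OF assms b] Symf_dl)
  thus "sh deg (c b) (dl b) \<in> homog deg i" by simp
 qed
 show "dvec i c \<in> wthom wtP 1"
  unfolding dvec_def
 proof (rule wthom_sum)
  fix b assume b: "b \<in> B"
  show "sh deg (c b) (dl b) \<in> wthom wtP 1"
   using wthom_sh[OF wthom_A[OF coefsD(1)[OF assms b]] Symf_dl(3)[of b]] by simp
 qed
qed

lemma \<phi>P_props:
 assumes "g \<in> sym_gens FF DM"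
 shows "\<phi>P g \<in> Symf deg XP" "\<phi>P g \<in> homog deg (sdeg g)" "\<phi>P g \<in> wthom wtP (swt g)"
proof -
 have "\<phi>P g \<in> Symf deg XP & \<phi>P g \<in> homog deg (sdeg g) & \<phi>P g \<in> wthom wtP (swt g)"
  using assms
 proof (cases rule: sym_gens_cases)
  case (1 i a)
  thus ?thesis using FF_gradeE(3,4)[OF 1(2)] wthom_A by (auto intro: Symf_mono)
 next
  case (2 i D)
  thus ?thesis using dvec_props[OF dcoef_coefs[OF 2(2)[unfolded DM_grade]]] by simp
 qed
 thus "\<phi>P g \<in> Symf deg XP" "\<phi>P g \<in> homog deg (sdeg g)" "\<phi>P g \<in> wthom wtP (swt g)" by blast+
qed

lemma dvec_cong: "(!!b. b \<in> B ==> c b = c' b) ==> dvec i c = dvec i c'"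
 unfolding dvec_def by (intro ext sum.cong refl) simp

lemma dvec_add: "dvec i (%b w. c b w+c' b w) w = dvec i c w+dvec i c' w"
 by (simp add: dvec_def sh_add_left distrib_left sum.distrib)

lemma dvec_scale: "dvec i (%b w. s*c b w) w = s*dvec i c w"
 by (simp add: dvec_def sh_scale_left sum_distrib_left ac_simps)

lemma dvec_mult: "sh deg f (dvec j c) w = eps (i*(n+1))*dvec (i+j) (%b. sh deg f (c b)) w"
proof -
 have "sh deg f (dvec j c) w = (SUM b:B. eps ((j - n - fst b)*(n+1))*sh deg f (sh deg (c b) (dl b)) w)"
  unfolding dvec_def by (simp add: sh_sum_right sh_scale_right)
 also have "... = eps (i*(n+1))*dvec (i+j) (%b. sh deg f (c b)) w"
  unfolding dvec_def sum_distrib_left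
 proof (intro sum.cong refl, goal_cases)
  case (1 b)
  have "(eps ((j - n - fst b)*(n+1)) :: 'k) = eps (i*(n+1)+(i+j - n - fst b)*(n+1))"
   by (rule eps_cong) auto
  thus ?case
   by (simp add: sh_assoc eps_add)
 qed
 finally show ?thesis .
qed

lemma dvec_dvx: "b \<in> B ==> dvec (fst b+n) (dcoef (dvx b)) = dl b"
proof (rule ext)
 fix w assume b: "b \<in> B"
 have "dvec (fst b+n) (dcoef (dvx b)) w = (SUM c:B. if c = b then dl b w else 0)"
  unfolding dvec_def
  by (intro sum.cong refl) (auto simp: dvx(2) co_basis[OF b] sh_scale_left)
 thus "dvec (fst b+n) (dcoef (dvx b)) w = dl b w" using b finite_B by simp
qed

text \<open>
 The relation that links both kinds of generators is A-linearity in D; it holds as the coefficients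
 of aD are a times those of D.
\<close>

lemma FP_rel: "r \<in> sym_rels FF DM ==> ev deg \<phi>P r = (%w. 0)"
proof (erule sym_rels.cases)
 fix a b i assume "r = word [Coef i (a+b)] - word [Coef i a] - word [Coef i b]"
 thus ?thesis by (simp add: fun_eq_iff)
next
 fix a i c assume "r = word [Coef i (scl FF c a)] - fscl c (word [Coef i a])"
 thus ?thesis by (simp add: fun_eq_iff)
next
 fix a i b j assume "r = word [Coef i a, Coef j b] - word [Coef (i+j) (mul FF a b)]"
  "a \<in> grade FF i" "b \<in> grade FF j"
 thus ?thesis by (simp add: fun_eq_iff FF_mul(1))
next
 assume "r = word [Coef 0 (aone FF)] - word []"
 thus ?thesis by (simp add: fun_eq_iff FF_one)
next
 fix x i y assume r: "r = word [Vec i (x+y)] - word [Vec i x] - word [Vec i y]"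
  "x \<in> grade DM i" "y \<in> grade DM i"
 have "dvec i (dcoef (x+y)) = dvec i (%b w. dcoef x b w+dcoef y b w)"
  by (rule dvec_cong) (rule Der_add(2)[OF r(2,3)[unfolded DM_grade]])
 thus ?thesis using r(1) by (simp add: fun_eq_iff dvec_add)
next
 fix x i c assume r: "r = word [Vec i (scl DM c x)] - fscl c (word [Vec i x])" "x \<in> grade DM i"
 have "dvec i (dcoef (scl DM c x)) = dvec i (%b w. c*dcoef x b w)"
  by (rule dvec_cong) (use Der_scl(2)[OF r(2)[unfolded DM_grade]] in simp)
 thus ?thesis using r(1) by (simp add: fun_eq_iff dvec_scale del: shift_mod_simps)
next
 fix a i x j assume r: "r = word [Coef i a, Vec j x] - word [Vec (i+j) (act DM i a x)]"
  "a \<in> grade FF i" "x \<in> grade DM j"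
 note x = r(3)[unfolded DM_grade]
 have "dvec (i+j) (dcoef (act DM i a x)) = dvec (i+j) (%b w. eps (i*(n+1))*sh deg (\<alpha> a) (dcoef x b) w)"
 proof (rule dvec_cong, goal_cases)
  case (1 b)
  note b = 1(1)
  have "sg (i*(- n - 1)) = (eps (i*(n+1)) :: 'k)" unfolding sg_eps by (rule eps_cong) auto
  thus ?case
   by (simp only: shift_mod_simps Der_scl(2)[OF Der_act(1)[OF x r(2)]] Der_act(2)[OF x r(2) b])
 qed
 thus ?thesis using r(1) dvec_mult[of "\<alpha> a" j "dcoef x" _ i]
  by (simp add: fun_eq_iff dvec_scale del: shift_mod_simps)
next
 fix u v assume r: "r = word [u, v] - fscl (sg (sdeg u*sdeg v)) (word [v, u])"
  "u \<in> sym_gens FF DM" "v \<in> sym_gens FF DM"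
 have "sh deg (\<phi>P u) (\<phi>P v) w = eps (sdeg u*sdeg v)*sh deg (\<phi>P v) (\<phi>P u) w" for w
  by (rule sh_comm) (use r \<phi>P_props in auto)
 thus ?thesis using r(1) by (simp add: fun_eq_iff sg_eps)
qed

abbreviation "GP \<equiv> sym_gens FF DM"
abbreviation "UP \<equiv> rel_ideal GP (sym_rels FF DM)"

lemma DM_closed:
 "x \<in> grade DM i ==> y \<in> grade DM i ==> x+y \<in> grade DM i"
 "x \<in> grade DM i ==> scl DM c x \<in> grade DM i"
 "0 \<in> grade DM i"
 "a \<in> grade FF i ==> x \<in> grade DM j ==> act DM i a x \<in> grade DM (i+j)"
proof -
 show "x \<in> grade DM i ==> y \<in> grade DM i ==> x+y \<in> grade DM i" unfolding DM_grade by (rule Der_add(1))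
 show "x \<in> grade DM i ==> scl DM c x \<in> grade DM i" unfolding DM_grade shift_mod_simps by (rule Der_scl(1))
 show "0 \<in> grade DM i" unfolding DM_grade by (rule Der_0)
 assume a: "a \<in> grade FF i" and x: "x \<in> grade DM j"
 have "act DM i a x \<in> grade (Der FF) (i+(j - n - 1))"
  unfolding shift_mod_simps(3) by (rule Der_scl(1)[OF Der_act(1)[OF x[unfolded DM_grade] a]])
 thus "act DM i a x \<in> grade DM (i+j)" unfolding DM_grade by (simp add: algebra_simps del: shift_mod_simps)
qed

lemma FP_closed: "r \<in> sym_rels FF DM ==> keys r <= lists GP"
 by (rule sym_rels_closed) (use DM_closed FF_add FF_fscl FF_mul FF_one in \<open>auto simp del: shift_mod_simps\<close>)


definition eqv :: "((('v, 'k) free_el, int => ('v, 'k) free_el => ('v, 'k) free_el) sgen list \<Rightarrow>\<^sub>0 'k)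
  => ((('v, 'k) free_el, int => ('v, 'k) free_el => ('v, 'k) free_el) sgen list \<Rightarrow>\<^sub>0 'k) => bool" where
 "eqv p q \<longleftrightarrow> p - q \<in> UP"

lemma eqv_quot: "eqv p q \<longleftrightarrow> quot UP p = quot UP q"
 unfolding eqv_def by (rule quot_eq_iff[OF subspace_rel_ideal, symmetric])

lemma eqv_refl: "eqv p p" and eqv_sym: "eqv p q ==> eqv q p" and eqv_trans [trans]: "eqv p q ==> eqv q r ==> eqv p r"
 by (simp_all add: eqv_quot)

lemma eqv_add: "eqv p q ==> eqv p' q' ==> eqv (p+p') (q+q')"
 and eqv_fscl: "eqv p q ==> eqv (fscl c p) (fscl c q)"
 by (simp_all add: eqv_quot quot_add[OF subspace_rel_ideal] quot_fscl[OF subspace_rel_ideal])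

lemma eqv_left: "eqv p q ==> u \<in> lists GP ==> eqv (fmul (word u) p) (fmul (word u) q)"
 unfolding eqv_def using rel_ideal_word_left[of "p - q" GP _ u] by simp

lemma eqv_right: "eqv p q ==> u \<in> lists GP ==> eqv (fmul p (word u)) (fmul q (word u))"
 unfolding eqv_def using rel_ideal_word_right[of "p - q" GP _ u] by simp

lemma eqv_rel: "p - q \<in> sym_rels FF DM ==> eqv p q"
 unfolding eqv_def by (rule rel_idealI)

text \<open>
 Modulo the relations the letters suffice. This property passes to sums and products, so it has to
 be proved for the generators only.
\<close>

definition generic :: "((('v, 'k) free_el, int => ('v, 'k) free_el => ('v, 'k) free_el) sgen list \<Rightarrow>\<^sub>0 'k) => bool" where
 "generic p \<longleftrightarrow> (EX q. keys q <= lists XP & eqv p (comb genP q))"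

lemma genericE: "generic p ==> EX q. keys q <= lists XP & eqv p (comb genP q)"
 by (simp add: generic_def)

lemma generic_eqv: "eqv p p' ==> generic p' ==> generic p"
 unfolding generic_def using eqv_trans by blast

lemma comb_add: "comb gen (p+q) = comb gen p+comb gen q"
 and comb_fscl: "comb gen (fscl c p) = fscl c (comb gen p)"
 by (simp_all add: comb_def)

lemma generic_add: "generic p ==> generic q ==> generic (p+q)"
proof -
 assume "generic p" "generic q"
 then obtain p' q' where "keys p' <= lists XP" "eqv p (comb genP p')" "keys q' <= lists XP" "eqv q (comb genP q')"
  unfolding generic_def by blast
 thus ?thesis unfolding generic_def
  by (intro exI[of _ "p'+q'"]) (simp add: comb_add eqv_add keys_add_subset)
qed

lemma generic_fscl: "generic p ==> generic (fscl c p)"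
proof -
 assume "generic p"
 then obtain p' where "keys p' <= lists XP" "eqv p (comb genP p')" unfolding generic_def by blast
 thus ?thesis unfolding generic_def
  by (intro exI[of _ "fscl c p'"]) (simp add: comb_fscl eqv_fscl subset_trans[OF keys_fscl])
qed

lemma generic_0: "generic 0"
 unfolding generic_def by (rule exI[of _ 0]) (simp add: comb_def eqv_refl)

lemma generic_sum: "(!!s. s \<in> S ==> generic (f s)) ==> generic (sum f S)"
 by (induction S rule: infinite_finite_induct) (auto intro: generic_0 generic_add)

lemma generic_one: "generic (word [])"
 unfolding generic_def by (rule exI[of _ "word []"]) (simp add: comb_def eqv_refl)

lemma genP_in: "x \<in> XP ==> genP x \<in> GP"
 using dvx(1) eb(1) by (auto simp: DM_grade simp del: shift_mod_simps(1))

lemma comb_left: "fmul (word [genP x]) (comb genP q) = comb genP (fmul (word [x]) q)"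
 by (induction q rule: pm_induct_all) (simp_all add: comb_def)

lemma comb_right: "fmul (comb genP q) (word [genP x]) = comb genP (fmul q (word [x]))"
 by (induction q rule: pm_induct_all) (simp_all add: comb_def)

lemma generic_left: "generic p ==> x \<in> XP ==> generic (fmul (word [genP x]) p)"
proof -
 assume x: "x \<in> XP" and "generic p"
 then obtain q where q: "keys q <= lists XP" "eqv p (comb genP q)" using genericE by blast
 have "eqv (fmul (word [genP x]) p) (comb genP (fmul (word [x]) q))"
  using eqv_left[OF q(2), of "[genP x]"] genP_in[OF x] by (simp only: comb_left) simp
 moreover have "keys (fmul (word [x]) q) <= lists XP"
  by (rule keys_fmul[where S = "{[x]}"]) (use q x in auto)
 ultimately show ?thesis unfolding generic_def by blast
qed

lemma generic_right: "generic p ==> x \<in> XP ==> generic (fmul p (word [genP x]))"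
proof -
 assume x: "x \<in> XP" and "generic p"
 then obtain q where q: "keys q <= lists XP" "eqv p (comb genP q)" using genericE by blast
 have "eqv (fmul p (word [genP x])) (comb genP (fmul q (word [x])))"
  using eqv_right[OF q(2), of "[genP x]"] genP_in[OF x] by (simp only: comb_right) simp
 moreover have "keys (fmul q (word [x])) <= lists XP"
  by (rule keys_fmul[where T = "{[x]}"]) (use q x in auto)
 ultimately show ?thesis unfolding generic_def by blast
qed

lemma generic_Coef: "a \<in> grade FF i ==> generic (word [Coef i a])"
proof (induction rule: FF_induct[consumes 1, case_names one mult zero add])
 case one
 have "eqv (word [Coef 0 (aone FF)]) (word [])" by (intro eqv_rel sym_rels.coef_one)
 thus ?case using generic_one generic_eqv by blast
next
 case (mult x j Q)
 then obtain b where b: "x = Inr b" "b \<in> B" by auto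
 have e: "FA.cl (word [genA x]) = eb b" by (simp add: b eb_def)
 have e1: "eqv (word [Coef (1 - fst b) (eb b), Coef j Q]) (word [Coef (1 - fst b+j) (mul FF (eb b) Q)])"
  by (intro eqv_rel sym_rels.coef_mul eb mult b)
 have "generic (fmul (word [genP (Inr b)]) (word [Coef j Q]))"
  by (rule generic_left[OF mult(3)]) (use b in auto)
 hence "generic (word [Coef (1 - fst b+j) (mul FF (eb b) Q)])"
  using generic_eqv[OF eqv_sym[OF e1]] by simp
 thus ?case unfolding e using b by simp
next
 case (zero j)
 have "eqv (word [Coef j (scl FF 0 0)]) (fscl 0 (word [Coef j 0]))"
  by (intro eqv_rel sym_rels.coef_scl FF_0)
 thus ?case using generic_eqv[OF _ generic_0] by simp
next
 case (add j c Q R)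
 have "eqv (word [Coef j (fscl c Q+R)]) (word [Coef j (fscl c Q)]+word [Coef j R])"
  by (rule eqv_rel) (use sym_rels.coef_add[OF FF_fscl[OF add(1)] add(2), where M = DM] in \<open>simp add: diff_diff_eq\<close>)
 moreover have "eqv (word [Coef j (fscl c Q)]) (fscl c (word [Coef j Q]))"
  by (rule eqv_rel) (use sym_rels.coef_scl[OF add(1), where c = c and M = DM] in simp)
 ultimately show ?case using generic_eqv[OF _ generic_add[OF generic_eqv[OF _ generic_fscl[OF add(3)]] add(4)]] by blast
qed

lemma der_expand:
 assumes D: "D \<in> grade (Der FF) i"
 shows "D = (SUM b:B. act (Der FF) (i+1 - fst b) (D (1 - fst b) (eb b)) (dvx b))"
proof -
 have g: "D (1 - fst b) (eb b) \<in> grade FF (i+1 - fst b)" if "b \<in> B" for b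
  using Der_hom(1)[OF D eb(1)[OF that]] by (simp add: algebra_simps)
 have m: "act (Der FF) (i+1 - fst b) (D (1 - fst b) (eb b)) (dvx b) \<in> grade (Der FF) i" if "b \<in> B" for b
  using Der_act(1)[OF dvx(1)[of b] g[OF that]] by simp
 show ?thesis
 proof (rule der_eqI[OF D Der_sum(1)[OF m]])
  fix c assume c: "c \<in> B"
  have "(SUM b:B. dcoef (act (Der FF) (i+1 - fst b) (D (1 - fst b) (eb b)) (dvx b)) c w)
    = (SUM b:B. if b = c then dcoef D c w else 0)" for w
  proof (intro sum.cong refl, goal_cases)
   case (1 b)
   note b = 1(1)
   have "dcoef (act (Der FF) (i+1 - fst b) (D (1 - fst b) (eb b)) (dvx b)) c w = co b c*dcoef D b w"
    unfolding Der_act(2)[OF dvx(1)[of b] g[OF b] c] dvx(2)[OF c] dcoef_def[of D b] by (simp add: sh_scale_right)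
   thus ?case
    by (simp add: co_basis[OF b])
  qed
  hence "(SUM b:B. dcoef (act (Der FF) (i+1 - fst b) (D (1 - fst b) (eb b)) (dvx b)) c w) = dcoef D c w" for w
   using c finite_B by simp
  thus "dcoef D c = dcoef (SUM b:B. act (Der FF) (i+1 - fst b) (D (1 - fst b) (eb b)) (dvx b)) c"
   using Der_sum(2)[of B "%b. act (Der FF) (i+1 - fst b) (D (1 - fst b) (eb b)) (dvx b)" i c, OF m c] by (simp only:)
 qed
qed

text \<open>
 Every derivation is a combination of the constant vector fields of the basis, with coefficients its
 values on the coordinates.
\<close>

lemma generic_Vec:
 assumes "D \<in> grade DM i" shows "generic (word [Vec i D])"
proof -
 note D = assms[unfolded DM_grade]
 let ?a = "%b. D (1 - fst b) (eb b)"
 let ?f = "%b. act (Der FF) (i - n - 1+1 - fst b) (?a b) (dvx b)"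
 have g: "?a b \<in> grade FF (i - n - fst b)" if "b \<in> B" for b
  using Der_hom(1)[OF D eb(1)[OF that]] by (simp add: algebra_simps)
 have d: "dvx b \<in> grade DM (fst b+n)" for b using dvx(1)[of b] unfolding DM_grade by simp
 have m: "?f b \<in> grade DM i" if "b \<in> B" for b
  using Der_act(1)[OF dvx(1)[of b] g[OF that]] unfolding DM_grade by (simp add: algebra_simps)
 have z: "word [Vec i 0] \<in> UP"
  using rel_idealI[OF sym_rels.vec_scl[OF DM_closed(3)[of i], where c = 0 and A = FF], where G = GP]
  by (simp add: Der_simps hom_scl zero_fun_def)
 have "word [Vec i (SUM b:B. ?f b)] - (SUM b:B. word [Vec i (?f b)]) \<in> UP & (SUM b:B. ?f b) \<in> grade DM i"
 proof (rule cl_word_sum[where v = "Vec i", OF subspace_rel_ideal z _ DM_closed(3) DM_closed(1) m finite_B], goal_cases)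
  case (1 y z)
  thus ?case
   by (intro rel_idealI sym_rels.vec_add)
 qed
 hence 1: "eqv (word [Vec i D]) (SUM b:B. word [Vec i (?f b)])"
  using der_expand[OF D] by (simp add: eqv_def)
 have "generic (word [Vec i (?f b)])" if b: "b \<in> B" for b
 proof -
  (* The sign of the coefficient passing the shift in the action on the shifted module. *)
  let ?s = "sg ((i - n - fst b)*(- n - 1)) :: 'k"
  have s: "?s*?s = 1" unfolding sg_eps by simp
  have "eqv (word [Coef (i - n - fst b) (?a b), Vec (fst b+n) (dvx b)])
    (word [Vec (i - n - fst b+(fst b+n)) (act DM (i - n - fst b) (?a b) (dvx b))])"
   by (intro eqv_rel sym_rels.vec_act g b d)
  hence 2: "eqv (word [Coef (i - n - fst b) (?a b), Vec (fst b+n) (dvx b)])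
    (word [Vec i (scl DM ?s (?f b))])" by simp
  have "eqv (word [Vec i (scl DM ?s (?f b))]) (fscl ?s (word [Vec i (?f b)]))"
   by (intro eqv_rel sym_rels.vec_scl m b)
  hence "eqv (fscl ?s (word [Coef (i - n - fst b) (?a b), Vec (fst b+n) (dvx b)])) (fscl ?s (fscl ?s (word [Vec i (?f b)])))"
   using 2 by (intro eqv_fscl) (rule eqv_trans)
  hence "eqv (word [Vec i (?f b)]) (fscl ?s (word [Coef (i - n - fst b) (?a b), Vec (fst b+n) (dvx b)]))"
   using s by (simp add: eqv_sym)
  have "generic (fmul (word [Coef (i - n - fst b) (?a b)]) (word [genP (Inl b)]))"
   by (rule generic_right[OF generic_Coef[OF g[OF b]]]) (use b in auto)
  hence "generic (fscl ?s (word [Coef (i - n - fst b) (?a b), Vec (fst b+n) (dvx b)]))"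
   by (intro generic_fscl) simp
  thus ?thesis using \<open>eqv (word [Vec i (?f b)]) _\<close> by (rule generic_eqv[rotated])
 qed
 thus ?thesis by (rule generic_eqv[OF 1 generic_sum])
qed

lemma FP_model: "sym_model FF DM deg wtP XP genP \<phi>P"
proof
 show "finite XP" using finite_B by simp
 fix x assume x: "x \<in> XP"
 show "genP x \<in> GP" by (rule genP_in[OF x])
 show "sdeg (genP x) = deg x" "swt (genP x) = wtP x" using x by auto
 show "\<phi>P (genP x) = lin (letter x)" using x eb(2) dvec_dvx by auto
next
 fix g assume g: "g \<in> GP"
 show "\<phi>P g \<in> Symf deg XP" "\<phi>P g \<in> homog deg (sdeg g)" "\<phi>P g \<in> wthom wtP (swt g)"
  by (rule \<phi>P_props[OF g])+
 from g have "generic (word [g])"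
  by (cases rule: sym_gens_cases) (use generic_Coef generic_Vec in auto)
 thus "EX q. keys q <= lists XP & word [g] - comb genP q \<in> UP" by (simp add: generic_def eqv_def)
next
 fix r assume "r \<in> sym_rels FF DM"
 thus "ev deg \<phi>P r = (%w. 0)" "keys r <= lists GP" by (rule FP_rel, rule FP_closed)
qed

sublocale FP: sym_model FF DM deg wtP XP genP \<phi>P
 by (rule FP_model)

abbreviation PP :: "('k, (('v, 'k) free_el, 'k) pol) dga" where "PP \<equiv> Pol FF n"
abbreviation \<beta> :: "(('v, 'k) free_el, 'k) pol => 'v lbl list => 'k" where "\<beta> \<equiv> FP.E"

lemma PP_Sym: "PP = Sym FF DM"
 by (simp add: Pol_def)

lemma PP_simps [simp]: "scl PP = fscl"
 by (simp add: PP_Sym Sym_def)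

lemmas PP_gradeE = FP.gradeE[folded PP_Sym]
 and PP_gradeI = FP.gradeI[folded PP_Sym]
 and PP_eqI = FP.grade_eqI[folded PP_Sym]
 and PP_mul = FP.E_mul[folded PP_Sym]
 and PP_one = FP.E_aone[folded PP_Sym]
 and PP_add = FP.grade_add[folded PP_Sym]
 and PP_fscl = FP.grade_fscl[folded PP_Sym]
 and PP_0 = FP.grade_0[folded PP_Sym]
 and PP_sum = FP.grade_sum[folded PP_Sym]
 and PP_back = FP.inv_E[folded PP_Sym]
 and PP_induct = FP.grade_induct[folded PP_Sym]
 and Pol_wt_eq = FP.Sym_wt_eq[folded PP_Sym Pol_wt_def]

lemma pol_fun: "a \<in> grade FF i ==> pol_fun FF n i a \<in> grade PP i" "a \<in> grade FF i ==> \<beta> (pol_fun FF n i a) = \<alpha> a"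
 using FP.gen_class[of "Coef i a"] by (auto simp: pol_fun_def coef_in_def PP_Sym)

lemma pol_der: "D \<in> grade (Der FF) i ==> pol_der FF n i D \<in> grade PP (i+n+1)"
 "D \<in> grade (Der FF) i ==> \<beta> (pol_der FF n i D) = dvec (i+n+1) (dcoef D)"
 using FP.gen_class[of "Vec (i+n+1) D"]
 by (auto simp: pol_der_def vec_in_def PP_Sym DM_grade simp del: shift_mod_simps(1))

end

section \<open>The Schouten bracket\<close>

context fin_cplx
begin

text \<open>The Poisson bracket of the conjugate coordinates \<open>Inl b\<close> and \<open>Inr b\<close>.\<close>

definition pb :: "('v lbl list => 'k) => ('v lbl list => 'k) => 'v lbl list => 'k" where
 "pb f g w = (SUM b:B. eps ((fst b - 1)*(n+1))*sh deg (%u. f (u@[Inl b])) (%u. g (Inr b#u)) w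
  +eps (fst b)*sh deg (%u. f (u@[Inr b])) (%u. g (Inl b#u)) w)"

lemma pb_add_left: "pb (%w. f w+f' w) g w = pb f g w+pb f' g w"
 unfolding pb_def sum.distrib[symmetric]
 by (intro sum.cong refl) (simp add: sh_add_left algebra_simps)

lemma pb_add_right: "pb f (%w. g w+g' w) w = pb f g w+pb f g' w"
 unfolding pb_def sum.distrib[symmetric]
 by (intro sum.cong refl) (simp add: sh_add_right algebra_simps)

lemma pb_scale_left: "pb (%w. c*f w) g w = c*pb f g w"
 unfolding pb_def sum_distrib_left
 by (intro sum.cong refl) (simp add: sh_scale_left algebra_simps)

lemma pb_scale_right: "pb f (%w. c*g w) w = c*pb f g w"
 unfolding pb_def sum_distrib_left
 by (intro sum.cong refl) (simp add: sh_scale_right algebra_simps)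

lemma pb_zero: "pb (%w. 0) g w = 0" "pb f (%w. 0) w = 0"
 by (simp_all add: pb_def)

lemma pb_one: "pb f shone w = 0"
 by (simp add: pb_def)

lemma pb_Symf: "f \<in> Symf deg X ==> g \<in> Symf deg X ==> pb f g \<in> Symf deg X"
 unfolding pb_def by (intro Symf_sum Symf_add Symf_scale Symf_sh Symf_left_shift Symf_right_shift)

lemma pb_homog:
 assumes "f \<in> homog deg i" "g \<in> homog deg j" shows "pb f g \<in> homog deg (i+j - n - 1)"
 unfolding pb_def
proof (intro homog_sum homog_add homog_scale)
 fix b
 have "sh deg (%u. f (u@[Inl b])) (%u. g (Inr b#u)) \<in> homog deg ((i - deg (Inl b))+(j - deg (Inr b)))"
  by (intro sh_homog homog_left_shift homog_right_shift assms)
 thus "sh deg (%u. f (u@[Inl b])) (%u. g (Inr b#u)) \<in> homog deg (i+j - n - 1)" by (simp add: algebra_simps)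
 have "sh deg (%u. f (u@[Inr b])) (%u. g (Inl b#u)) \<in> homog deg ((i - deg (Inr b))+(j - deg (Inl b)))"
  by (intro sh_homog homog_left_shift homog_right_shift assms)
 thus "sh deg (%u. f (u@[Inr b])) (%u. g (Inl b#u)) \<in> homog deg (i+j - n - 1)" by (simp add: algebra_simps)
qed

lemma right_shift_left:
 assumes "f \<in> swapsym deg" "f \<in> homog deg i"
 shows "f (u@[x]) = eps (deg x*(i - deg x))*f (x#u)"
proof -
 have "f (u@[x]) = eps (deg x*wdeg deg u)*f (x#u)"
  using swapsym_to_front[OF assms(1), of u x "[]"] by simp
 also have "... = eps (deg x*(i - deg x))*f (x#u)"
  using homogD[OF assms(2), of "x#u"] by (cases "wdeg deg u = i - deg x") auto
 finally show ?thesis .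
qed

text \<open>
 For symmetric functions removing the last letter is, up to sign, removing the first one, and the
 shuffle product is graded commutative.
\<close>

lemma sh_swap_ends:
 assumes f: "f \<in> swapsym deg" "f \<in> homog deg i" and g: "g \<in> swapsym deg" "g \<in> homog deg j"
 shows "sh deg (%u. g (u@[y])) (%u. f (x#u)) w
   = eps (deg y*(j - deg y)+deg x*(i - deg x)+(i - deg x)*(j - deg y))*sh deg (%u. f (u@[x])) (%u. g (y#u)) w"
proof -
 have "(%u. f (x#u)) = (%u. eps (deg x*(i - deg x))*f (u@[x]))"
  by (simp add: right_shift_left[OF f])
 moreover have "(%u. g (u@[y])) = (%u. eps (deg y*(j - deg y))*g (y#u))"
  by (simp add: right_shift_left[OF g])
 ultimately have "sh deg (%u. g (u@[y])) (%u. f (x#u)) w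
   = eps (deg y*(j - deg y))*(eps (deg x*(i - deg x))*sh deg (%u. g (y#u)) (%u. f (u@[x])) w)"
  by (simp only: sh_scale_left sh_scale_right)
 also have "sh deg (%u. g (y#u)) (%u. f (u@[x])) w
   = eps ((j - deg y)*(i - deg x))*sh deg (%u. f (u@[x])) (%u. g (y#u)) w"
  by (intro sh_comm homog_left_shift homog_right_shift f g)
 finally show ?thesis by (simp add: eps_add mult.commute)
qed

text \<open>Exchanging f and g exchanges the two halves of \<open>pb\<close>.\<close>

lemma pb_antisym:
 assumes f: "f \<in> swapsym deg" "f \<in> homog deg i" and g: "g \<in> swapsym deg" "g \<in> homog deg j"
 shows "pb f g w = - eps ((i - n - 1)*(j - n - 1))*pb g f w"
proof -
 note sw = sh_swap_ends[OF f g]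
 have 1: "eps (fst b)*sh deg (%u. g (u@[Inr b])) (%u. f (Inl b#u)) w
   = - eps ((i - n - 1)*(j - n - 1))*(eps ((fst b - 1)*(n+1))*sh deg (%u. f (u@[Inl b])) (%u. g (Inr b#u)) w)" for b
 proof -
  have "(eps (fst b+(deg (Inr b)*(j - deg (Inr b))+deg (Inl b)*(i - deg (Inl b))+(i - deg (Inl b))*(j - deg (Inr b)))) :: 'k)
    = eps (1+(i - n - 1)*(j - n - 1)+(fst b - 1)*(n+1))"
   by (rule eps_cong) (auto simp: algebra_simps)
  thus ?thesis unfolding sw by (simp add: eps_mult_left minus_mult_left minus_eps) (simp add: add_ac)
 qed
 have 2: "eps ((fst b - 1)*(n+1))*sh deg (%u. g (u@[Inl b])) (%u. f (Inr b#u)) w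
   = - eps ((i - n - 1)*(j - n - 1))*(eps (fst b)*sh deg (%u. f (u@[Inr b])) (%u. g (Inl b#u)) w)" for b
 proof -
  have "(eps ((fst b - 1)*(n+1)+(deg (Inl b)*(j - deg (Inl b))+deg (Inr b)*(i - deg (Inr b))+(i - deg (Inr b))*(j - deg (Inl b)))) :: 'k)
    = eps (1+(i - n - 1)*(j - n - 1)+fst b)"
   by (rule eps_cong) (auto simp: algebra_simps)
  thus ?thesis unfolding sw by (simp add: eps_mult_left minus_mult_left minus_eps) (simp add: add_ac)
 qed
 have "pb g f w = - eps ((i - n - 1)*(j - n - 1))*pb f g w"
  unfolding pb_def 1 2 sum_distrib_left by (intro sum.cong refl) (simp add: algebra_simps)
 thus ?thesis by simp
qed

text \<open>
 Removing the first letter is a derivation, and g is moved to the left of the other factor by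
 commutativity.
\<close>

lemma pb_leibniz:
 assumes f: "f \<in> homog deg i" and g: "g \<in> homog deg j"
 shows "pb f (sh deg g h) w = sh deg (pb f g) h w+eps (i*j)*eps (j*(n+1))*sh deg g (pb f h) w"
proof -
 have s: "sh deg (%u. f (u@[x])) (%u. sh deg g h (y#u)) w
   = sh deg (sh deg (%u. f (u@[x])) (%u. g (y#u))) h w
    +eps (i*j)*eps (j*(n+1))*sh deg g (sh deg (%u. f (u@[x])) (%u. h (y#u))) w"
  if xy: "deg x+deg y = n+1" for x y
 proof -
  let ?f = "%u. f (u@[x])" and ?h = "%u. h (y#u)"
  have hf: "?f \<in> homog deg (i - deg x)" by (rule homog_right_shift[OF f])
  have "sh deg ?f (%u. sh deg g h (y#u)) w = sh deg ?f (%u. sh deg (%u. g (y#u)) h u+eps (deg y*j)*sh deg g ?h u) w"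
   by (simp add: sh_twist_homog[OF g])
  also have "... = sh deg (sh deg ?f (%u. g (y#u))) h w+eps (deg y*j)*sh deg (sh deg ?f g) ?h w"
   by (simp add: sh_add_right sh_scale_right sh_assoc_fun)
  also have "sh deg ?f g = (%w. eps ((i - deg x)*j)*sh deg g ?f w)"
   by (rule ext, rule sh_comm[OF hf g])
  also have "eps (deg y*j)*sh deg (%w. eps ((i - deg x)*j)*sh deg g ?f w) ?h w
    = eps (deg y*j+(i - deg x)*j)*sh deg g (sh deg ?f ?h) w"
   by (simp add: sh_scale_left eps_add sh_assoc)
  also have "(eps (deg y*j+(i - deg x)*j) :: 'k) = eps (i*j+j*(n+1))"
   unfolding xy[symmetric] by (rule eps_cong) auto
  finally show ?thesis by (simp add: eps_add)
 qed
 have 1: "sh deg (pb f g) h w = (SUM b:B. eps ((fst b - 1)*(n+1))*sh deg (sh deg (%u. f (u@[Inl b])) (%u. g (Inr b#u))) h w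
  +eps (fst b)*sh deg (sh deg (%u. f (u@[Inr b])) (%u. g (Inl b#u))) h w)"
  unfolding pb_def by (simp only: sh_sum_left sh_add_left sh_scale_left)
 have 2: "sh deg g (pb f h) w = (SUM b:B. eps ((fst b - 1)*(n+1))*sh deg g (sh deg (%u. f (u@[Inl b])) (%u. h (Inr b#u))) w
  +eps (fst b)*sh deg g (sh deg (%u. f (u@[Inr b])) (%u. h (Inl b#u))) w)"
  unfolding pb_def by (simp only: sh_sum_right sh_add_right sh_scale_right)
 show ?thesis
  unfolding 1 2 unfolding pb_def sum_distrib_left sum.distrib[symmetric]
  by (intro sum.cong refl) (simp only: s deg_simps, simp add: s algebra_simps)
qed

lemma A_no_Inl: "f \<in> Symf deg XA ==> Inl b \<in> set w ==> f w = 0"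
 using Symf_supp[of f deg XA w] by auto

lemma A_left_shift: "f \<in> Symf deg XA ==> (%u. f (Inl b#u)) = (%u. 0)"
 and A_right_shift: "f \<in> Symf deg XA ==> (%u. f (u@[Inl b])) = (%u. 0)"
 by (rule ext, rule A_no_Inl[of _ b], simp_all)+

lemma pb_A_A: "f \<in> Symf deg XA ==> g \<in> Symf deg XA ==> pb f g w = 0"
 by (simp add: pb_def A_left_shift A_right_shift)

lemma lin_snoc: "lin h (w@[x]) = h x*shone w"
 by (cases w) (auto simp: lin_def split: list.split)

lemma dvec_right_Inl:
 assumes c: "coefs i c" and b: "b \<in> B"
 shows "dvec (i+n+1) c (u@[Inl b]) = eps ((i+1 - fst b)*(n+1))*c b u"
proof -
 have "dvec (i+n+1) c (u@[Inl b]) = (SUM e:B. if e = b then eps ((i+1 - fst b)*(n+1))*c b u else 0)"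
  unfolding dvec_def
  by (intro sum.cong refl)
    (auto simp: sh_snoc A_right_shift[OF coefsD(1)[OF c]] lin_snoc letter_def algebra_simps)
 thus ?thesis using b finite_B by simp
qed

lemma dvec_left_Inl:
 assumes c: "coefs i c" and b: "b \<in> B"
 shows "dvec (i+n+1) c (Inl b#u) = eps ((i+1 - fst b)*(fst b+1))*c b u"
proof -
 have "dvec (i+n+1) c (Inl b#u) = (SUM e:B. if e = b then eps ((i+1 - fst b)*(n+1)+(fst b+n)*(i+1 - fst b))*c b u else 0)"
  unfolding dvec_def
 proof (intro sum.cong refl, goal_cases)
  case (1 e)
  note e = 1(1)
  have "sh deg (c e) (dl e) (Inl b#u) = eps ((fst b+n)*(i+1 - fst e))*(letter (Inl e :: 'v lbl) (Inl b)*c e u)"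
  proof -
   have "sh deg (c e) (dl e) (Inl b#u) = sh deg (%u. eps (deg (Inl b)*wdeg deg u)*c e u) (%u. letter (Inl e :: 'v lbl) (Inl b)*shone u) u"
    by (simp only: sh.simps A_left_shift[OF coefsD(1)[OF c e]] sh_zero lin_Cons add_0)
   also have "... = eps (deg (Inl b)*(i+1 - fst e))*sh deg (c e) (%u. letter (Inl e :: 'v lbl) (Inl b)*shone u) u"
    by (rule sh_twist_homog[OF coefsD(2)[OF c e]])
   finally show ?thesis by (simp only: sh_scale_right sh_one_right deg_simps)
  qed
  thus ?case
   by (auto simp: letter_def eps_add)
 qed
 moreover have "(eps ((i+1 - fst b)*(n+1)+(fst b+n)*(i+1 - fst b)) :: 'k) = eps ((i+1 - fst b)*(fst b+1))"
  by (rule eps_cong) auto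
 ultimately show ?thesis using b finite_B by simp
qed

lemma dvec_left_Inr:
 assumes c: "coefs i c"
 shows "dvec (i+n+1) c (Inr b#u) = dvec (i+n+1) (%e u. c e (Inr b#u)) u"
 unfolding dvec_def by (intro sum.cong refl) (simp add: lin_Cons letter_def)

lemma dvec_right_Inr:
 assumes c: "coefs i c"
 shows "dvec (i+n+1) c (u@[Inr b]) = (SUM e:B. eps ((i+1 - fst e)*(n+1)+(1 - fst b)*(fst e+n)+(1 - fst b)*(i - fst e+fst b))
   *sh deg (%u. c e (Inr b#u)) (dl e) u)"
 unfolding dvec_def
proof (intro sum.cong refl, goal_cases)
 case (1 e)
 note e = 1(1)
 have 1: "(%u. c e (u@[Inr b])) = (%u. eps ((1 - fst b)*(i - fst e+fst b))*c e (Inr b#u))"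
  using right_shift_left[OF Symf_swapsym[OF coefsD(1)[OF c e]] coefsD(2)[OF c e], of _ "Inr b"]
  by (simp add: algebra_simps)
 have 2: "(%u. eps (deg (Inr b)*wdeg deg u)*dl e u) = (%u. eps ((1 - fst b)*(fst e+n))*dl e u)"
  unfolding deg_simps by (rule ext, rule homog_twist[OF Symf_dl(2)])
 have 3: "(%u. dl e (u@[Inr b])) = (%u. 0)" by (simp add: lin_snoc letter_def)
 have "sh deg (c e) (dl e) (u@[Inr b]) = eps ((1 - fst b)*(i - fst e+fst b))*(eps ((1 - fst b)*(fst e+n))*sh deg (%u. c e (Inr b#u)) (dl e) u)"
  unfolding sh_snoc 1 2 3 by (simp only: sh_scale_left sh_scale_right sh_zero) simp
 thus ?case
  by (simp add: eps_add mult.assoc mult.left_commute)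
qed

lemma pb_dvec_A:
 assumes c: "coefs i c" and f: "f \<in> Symf deg XA"
 shows "pb (dvec (i+n+1) c) f w = eps (i*(n+1))*vfield c f w"
 unfolding pb_def vfield_def sum_distrib_left
proof (intro sum.cong refl, goal_cases)
 case (1 b)
 note b = 1(1)
 have "(eps ((fst b - 1)*(n+1))*eps ((i+1 - fst b)*(n+1)) :: 'k) = eps (i*(n+1))"
  unfolding eps_mult by (rule eps_cong) auto
 thus ?case
  by (simp add: dvec_right_Inl[OF c b] A_left_shift[OF f] sh_scale_left flip: mult.assoc)
qed

text \<open>
 Vector fields are linear in the letters \<open>Inl\<close>, so one half of \<open>pb\<close>
 differentiates the coefficients of the second along the first, and the other half conversely.
\<close>

lemma pb_dvec_dvec:
 assumes c: "coefs i c" and c': "coefs j c'"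
 shows "pb (dvec (i+n+1) c) (dvec (j+n+1) c') w
  = dvec (i+j+n+1) (%e w. vfield c (c' e) w - eps (i*j)*vfield c' (c e) w) w"
proof -
 let ?S = "%b e. sh deg (sh deg (c b) (%u. c' e (Inr b#u))) (dl e) w"
 let ?T = "%b e. sh deg (sh deg (c' b) (%u. c e (Inr b#u))) (dl e) w"
 let ?s = "%e. eps ((i+j+1 - fst e)*(n+1)) :: 'k"
 have 1: "eps ((fst b - 1)*(n+1))*sh deg (%u. dvec (i+n+1) c (u@[Inl b])) (%u. dvec (j+n+1) c' (Inr b#u)) w
   = (SUM e:B. ?s e*?S b e)" if b: "b \<in> B" for b
 proof -
  have "eps ((fst b - 1)*(n+1))*sh deg (%u. dvec (i+n+1) c (u@[Inl b])) (%u. dvec (j+n+1) c' (Inr b#u)) w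
    = (SUM e:B. (eps ((fst b - 1)*(n+1))*eps ((i+1 - fst b)*(n+1))*eps ((j+n+1 - n - fst e)*(n+1)))*?S b e)"
   unfolding dvec_right_Inl[OF c b] dvec_left_Inr[OF c'] unfolding dvec_def[of "j+n+1"]
   by (simp del: sh.simps add: sh_scale_left sh_sum_right sh_scale_right sum_distrib_left sh_assoc mult.assoc)
  also have "... = (SUM e:B. ?s e*?S b e)"
  proof (intro sum.cong refl arg_cong2[where f = "(*)"])
   fix e show "(eps ((fst b - 1)*(n+1))*eps ((i+1 - fst b)*(n+1))*eps ((j+n+1 - n - fst e)*(n+1)) :: 'k) = ?s e"
    unfolding eps_mult by (rule eps_cong) auto
  qed
  finally show ?thesis .
 qed
 have 2: "eps (fst b)*sh deg (%u. dvec (i+n+1) c (u@[Inr b])) (%u. dvec (j+n+1) c' (Inl b#u)) w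
   = - (SUM e:B. ?s e*(eps (i*j)*?T b e))" if b: "b \<in> B" for b
 proof -
  let ?A = "%e u. c e (Inr b#u)"
  have cm: "sh deg (sh deg (?A e) (dl e)) (c' b) w = eps ((i+fst b+n)*(j+1 - fst b))*?T b e" if e: "e \<in> B" for e
  proof -
   have "?A e \<in> homog deg (i+1 - fst e - deg (Inr b))" by (rule homog_left_shift[OF coefsD(2)[OF c e]])
   hence "sh deg (?A e) (dl e) \<in> homog deg (i+1 - fst e - deg (Inr b)+(fst e+n))" by (rule sh_homog[OF _ Symf_dl(2)])
   hence "sh deg (?A e) (dl e) \<in> homog deg (i+fst b+n)" by (simp add: algebra_simps)
   from sh_comm[OF this coefsD(2)[OF c' b]] show ?thesis by (simp add: sh_assoc)
  qed
  have "eps (fst b)*sh deg (%u. dvec (i+n+1) c (u@[Inr b])) (%u. dvec (j+n+1) c' (Inl b#u)) w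
    = (SUM e:B. eps (fst b)*(eps ((j+1 - fst b)*(fst b+1))
     *(eps ((i+1 - fst e)*(n+1)+(1 - fst b)*(fst e+n)+(1 - fst b)*(i - fst e+fst b))
      *sh deg (sh deg (?A e) (dl e)) (c' b) w)))"
   unfolding dvec_left_Inl[OF c' b] dvec_right_Inr[OF c]
   by (simp add: sh_scale_right sh_sum_left sh_scale_left sum_distrib_left)
  also have "... = (SUM e:B. - (?s e*(eps (i*j)*?T b e)))"
  proof (intro sum.cong refl, goal_cases)
   case (1 e)
   note e = 1(1)
   have "(eps (fst b+(j+1 - fst b)*(fst b+1)+((i+1 - fst e)*(n+1)+(1 - fst b)*(fst e+n)+(1 - fst b)*(i - fst e+fst b))
     +(i+fst b+n)*(j+1 - fst b)) :: 'k) = eps (1+(i+j+1 - fst e)*(n+1)+i*j)"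
    by (rule eps_cong) auto
   thus ?case
    unfolding cm[OF e] eps_mult_left minus_mult_left minus_eps by (simp add: add_ac)
  qed
  finally show ?thesis by (simp add: sum_negf)
 qed
 have "pb (dvec (i+n+1) c) (dvec (j+n+1) c') w
   = (SUM b:B. (SUM e:B. ?s e*?S b e) - (SUM e:B. ?s e*(eps (i*j)*?T b e)))"
  unfolding pb_def by (intro sum.cong refl) (simp add: 1 2)
 also have "... = (SUM e:B. ?s e*((SUM b:B. ?S b e) - eps (i*j)*(SUM b:B. ?T b e)))"
 proof -
  have "(SUM b:B. SUM e:B. ?s e*?S b e) = (SUM e:B. ?s e*(SUM b:B. ?S b e))"
   unfolding sum_distrib_left by (rule sum.swap)
  moreover have "(SUM b:B. SUM e:B. ?s e*(eps (i*j)*?T b e)) = (SUM e:B. ?s e*(eps (i*j)*(SUM b:B. ?T b e)))"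
   unfolding sum_distrib_left by (rule sum.swap)
  ultimately show ?thesis by (simp add: sum_subtractf right_diff_distrib)
 qed
 also have "... = dvec (i+j+n+1) (%e w. vfield c (c' e) w - eps (i*j)*vfield c' (c e) w) w"
  unfolding dvec_def
 proof (intro sum.cong refl, goal_cases)
  case (1 e)
  have "(%w. vfield c (c' e) w - eps (i*j)*vfield c' (c e) w) = (%w. vfield c (c' e) w+(- eps (i*j))*vfield c' (c e) w)"
   by simp
  hence "sh deg (%w. vfield c (c' e) w - eps (i*j)*vfield c' (c e) w) (dl e) w
    = sh deg (vfield c (c' e)) (dl e) w+(- eps (i*j))*sh deg (vfield c' (c e)) (dl e) w"
   by (simp only: sh_add_left sh_scale_left)
  moreover have "sh deg (vfield c (c' e)) (dl e) w = (SUM b:B. ?S b e)" "sh deg (vfield c' (c e)) (dl e) w = (SUM b:B. ?T b e)"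
   unfolding vfield_def by (rule sh_sum_left)+
  ultimately have "sh deg (%w. vfield c (c' e) w - eps (i*j)*vfield c' (c e) w) (dl e) w
    = (SUM b:B. ?S b e) - eps (i*j)*(SUM b:B. ?T b e)" by simp
  thus ?case
   by (simp add: add.assoc)
 qed
 finally show ?thesis .
qed

text \<open>A commutator of vector fields is a vector field: its second-order terms cancel.\<close>

lemma der_bracket:
 assumes D: "D \<in> grade (Der FF) i" and D': "D' \<in> grade (Der FF) j"
 shows "der_bracket FF i j D D' \<in> grade (Der FF) (i+j)" (is ?P1)
  "b \<in> B ==> dcoef (der_bracket FF i j D D') b
   = (%w. vfield (dcoef D) (dcoef D' b) w - eps (i*j)*vfield (dcoef D') (dcoef D b) w)"
proof -
 note c = dcoef_coefs[OF D] and c' = dcoef_coefs[OF D']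
 have g1: "D (k+j) (D' k a) \<in> grade FF (k+(i+j))" "D' (k+i) (D k a) \<in> grade FF (k+(i+j))"
  if a: "a \<in> grade FF k" for k a
  using Der_hom(1)[OF D Der_hom(1)[OF D' a]] Der_hom(1)[OF D' Der_hom(1)[OF D a]] by (simp_all add: algebra_simps)
 have h: "der_bracket FF i j D D' \<in> grade (hom_cplx FF FF) (i+j)"
 proof (rule hom_gradeI)
  fix k a assume a: "a \<in> grade FF k"
  show "der_bracket FF i j D D' k a \<in> grade FF (k+(i+j))"
  proof -
   have "D (k+j) (D' k a)+fscl (- 1) (fscl (sg (i*j)) (D' (k+i) (D k a))) \<in> grade FF (k+(i+j))"
    by (intro FF_add FF_fscl g1 a)
   thus ?thesis by (simp add: der_bracket_def a)
  qed
 next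
  fix k x y assume "x \<in> grade FF k" "y \<in> grade FF k"
  thus "der_bracket FF i j D D' k (x+y) = der_bracket FF i j D D' k x+der_bracket FF i j D D' k y"
   by (simp add: der_bracket_def FF_add Der_hom[OF D] Der_hom[OF D'] fv.scale_right_distrib)
 next
  fix k s x assume x: "x \<in> grade FF k"
  have e: "D k (fscl s x) = fscl s (D k x)" "D' k (fscl s x) = fscl s (D' k x)"
   "D (k+j) (fscl s (D' k x)) = fscl s (D (k+j) (D' k x))"
   "D' (k+i) (fscl s (D k x)) = fscl s (D' (k+i) (D k x))"
   using Der_hom(5)[OF D x, of s] Der_hom(5)[OF D' x, of s] Der_hom(5)[OF D Der_hom(1)[OF D' x], of s]
    Der_hom(5)[OF D' Der_hom(1)[OF D x], of s] by simp_all
  show "der_bracket FF i j D D' k (scl FF s x) = scl FF s (der_bracket FF i j D D' k x)"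
   by (simp add: der_bracket_def x FF_fscl e fv.scale_right_diff_distrib mult.commute)
 qed (simp add: der_bracket_def)
 have v: "\<alpha> (der_bracket FF i j D D' k a) w = vfield (dcoef D) (vfield (dcoef D') (\<alpha> a)) w
   - eps (i*j)*vfield (dcoef D') (vfield (dcoef D) (\<alpha> a)) w" if a: "a \<in> grade FF k" for k a w
  by (simp add: der_bracket_def a der_formula[OF D Der_hom(1)[OF D' a]] der_formula[OF D' Der_hom(1)[OF D a]]
    der_formula[OF D a] der_formula[OF D' a] sg_eps)
 have dc: "dcoef (der_bracket FF i j D D') b
   = (%w. vfield (dcoef D) (dcoef D' b) w - eps (i*j)*vfield (dcoef D') (dcoef D b) w)" if b: "b \<in> B" for b
  using v[OF eb(1)[OF b]] by (simp add: fun_eq_iff eb(2)[OF b] vfield_letter[OF b] dcoef_def[of "der_bracket FF i j D D'"])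
 show "b \<in> B ==> dcoef (der_bracket FF i j D D') b
   = (%w. vfield (dcoef D) (dcoef D' b) w - eps (i*j)*vfield (dcoef D') (dcoef D b) w)" by (rule dc)
 have "der_bracket FF i j D D' (k+l) (mul FF a b) = mul FF (der_bracket FF i j D D' k a) b
   +scl FF (sg ((i+j)*k)) (mul FF a (der_bracket FF i j D D' l b))"
  if a: "a \<in> grade FF k" and b: "b \<in> grade FF l" for k l a b
 proof -
  let ?Q = "der_bracket FF i j D D'"
  have ga: "?Q k a \<in> grade FF (k+(i+j))" "?Q l b \<in> grade FF (l+(i+j))"
   "?Q (k+l) (mul FF a b) \<in> grade FF (k+l+(i+j))"
   using hom_gradeD(1)[OF h] a b FF_mul(2)[OF a b] by blast+
  have g2: "mul FF (?Q k a) b \<in> grade FF (k+l+(i+j))" "mul FF a (?Q l b) \<in> grade FF (k+l+(i+j))"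
   using FF_mul(2)[OF ga(1) b] FF_mul(2)[OF a ga(2)] by (simp_all add: algebra_simps)
  let ?f = "\<alpha> a" and ?g = "\<alpha> b" and ?v = "vfield (dcoef D)" and ?v' = "vfield (dcoef D')"
  have hf: "?f \<in> homog deg k" by (rule FF_gradeE(4)[OF a])
  have e1: "?v' (sh deg ?f ?g) = (%w. sh deg (?v' ?f) ?g w+eps (j*k)*sh deg ?f (?v' ?g) w)"
   by (rule ext, rule vfield_sh[OF c' hf])
  have e2: "?v (sh deg ?f ?g) = (%w. sh deg (?v ?f) ?g w+eps (i*k)*sh deg ?f (?v ?g) w)"
   by (rule ext, rule vfield_sh[OF c hf])
  have lhs: "\<alpha> (?Q (k+l) (mul FF a b)) w = sh deg (?v (?v' ?f)) ?g w+eps (i*(k+j))*sh deg (?v' ?f) (?v ?g) w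
   +eps (j*k)*(sh deg (?v ?f) (?v' ?g) w+eps (i*k)*sh deg ?f (?v (?v' ?g)) w)
    - eps (i*j)*(sh deg (?v' (?v ?f)) ?g w+eps (j*(k+i))*sh deg (?v ?f) (?v' ?g) w
    +eps (i*k)*(sh deg (?v' ?f) (?v ?g) w+eps (j*k)*sh deg ?f (?v' (?v ?g)) w))" for w
   unfolding v[OF FF_mul(2)[OF a b]] FF_mul(1)[OF a b] e1 e2 vfield_add vfield_scale
    vfield_sh[OF c hf] vfield_sh[OF c' hf] vfield_sh[OF c vfield_homog[OF c' hf]] vfield_sh[OF c' vfield_homog[OF c hf]] by simp
  have d: "sh deg (%w. p w - r*q w) h w = sh deg p h w - r*sh deg q h w"
   "sh deg h (%w. p w - r*q w) w = sh deg h p w - r*sh deg h q w" for p q h :: "'v lbl list => 'k" and r w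
  proof -
   have "(%w. p w - r*q w) = (%w. p w+(- r)*q w)" by simp
   thus "sh deg (%w. p w - r*q w) h w = sh deg p h w - r*sh deg q h w"
    "sh deg h (%w. p w - r*q w) w = sh deg h p w - r*sh deg h q w"
    by (simp_all only: sh_add_left sh_scale_left sh_add_right sh_scale_right) simp_all
  qed
  have va: "\<alpha> (?Q k a) = (%w. ?v (?v' ?f) w - eps (i*j)*?v' (?v ?f) w)"
   and vb: "\<alpha> (?Q l b) = (%w. ?v (?v' ?g) w - eps (i*j)*?v' (?v ?g) w)"
   by (rule ext, rule v, fact)+
  have rhs: "\<alpha> (mul FF (?Q k a) b+fscl (sg ((i+j)*k)) (mul FF a (?Q l b))) w
    = sh deg (?v (?v' ?f)) ?g w - eps (i*j)*sh deg (?v' (?v ?f)) ?g w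
    +eps ((i+j)*k)*(sh deg ?f (?v (?v' ?g)) w - eps (i*j)*sh deg ?f (?v' (?v ?g)) w)" for w
   by (simp add: FF_mul(1)[OF ga(1) b] FF_mul(1)[OF a ga(2)] va vb d sg_eps)
  have "\<alpha> (?Q (k+l) (mul FF a b)) = \<alpha> (mul FF (?Q k a) b+fscl (sg ((i+j)*k)) (mul FF a (?Q l b)))"
   by (rule ext, unfold lhs rhs) (simp add: eps_add algebra_simps)
  thus ?thesis unfolding FF_simps by (rule FF_eqI[OF ga(3) FF_add[OF g2(1) FF_fscl[OF g2(2)]]])
 qed
 with h show ?P1 by (simp add: Der_def)
qed

text \<open>The Schouten bracket exists: it is the Poisson bracket of symmetric functions.\<close>

definition sbr :: "(('v, 'k) free_el, 'k) pol => (('v, 'k) free_el, 'k) pol => (('v, 'k) free_el, 'k) pol" where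
 "sbr P Q = (THE R. (EX i. R \<in> grade PP i) & \<beta> R = pb (\<beta> P) (\<beta> Q))"

lemma sbr:
 assumes "P \<in> grade PP i" "Q \<in> grade PP j"
 shows "sbr P Q \<in> grade PP (i+j - n - 1)" "\<beta> (sbr P Q) = pb (\<beta> P) (\<beta> Q)" (is ?P1)
proof -
 obtain R where R: "R \<in> grade PP (i+j - n - 1)" "\<beta> R = pb (\<beta> P) (\<beta> Q)"
  using PP_back[OF pb_Symf[OF PP_gradeE(3)[OF assms(1)] PP_gradeE(3)[OF assms(2)]]
    pb_homog[OF PP_gradeE(4)[OF assms(1)] PP_gradeE(4)[OF assms(2)]]] by blast
 have "sbr P Q = R" unfolding sbr_def
 proof (rule the_equality)
  fix R' assume R': "(EX i. R' \<in> grade PP i) & \<beta> R' = pb (\<beta> P) (\<beta> Q)"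
  then obtain k where "R' \<in> grade PP k" by blast
  thus "R' = R" by (rule PP_eqI[OF _ R(1)]) (use R' R(2) in simp)
 qed (use R in blast)
 with R show "sbr P Q \<in> grade PP (i+j - n - 1)" ?P1 by simp_all
qed

lemma sbr_schouten: "is_schouten FF n sbr"
 unfolding is_schouten_def PP_simps
proof (intro conjI allI ballI)
 fix i j P Q assume P: "P \<in> grade PP i" and Q: "Q \<in> grade PP j"
 show "sbr P Q \<in> grade PP (i+j - n - 1)" by (rule sbr(1)[OF P Q])
 have "fscl (- sg ((i - n - 1)*(j - n - 1))) (sbr Q P) \<in> grade PP (i+j - n - 1)"
  by (rule PP_fscl) (use sbr(1)[OF Q P] in \<open>simp add: algebra_simps\<close>)
 hence "sbr P Q = fscl (- sg ((i - n - 1)*(j - n - 1))) (sbr Q P)"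
  by (rule PP_eqI[OF sbr(1)[OF P Q]])
    (simp add: sbr(2)[OF P Q] sbr(2)[OF Q P] fun_eq_iff sg_eps
     pb_antisym[OF Symf_swapsym[OF PP_gradeE(3)[OF P]] PP_gradeE(4)[OF P] Symf_swapsym[OF PP_gradeE(3)[OF Q]] PP_gradeE(4)[OF Q]])
 thus "sbr P Q = - fscl (sg ((i - n - 1)*(j - n - 1))) (sbr Q P)" by simp
next
 fix i j P assume P: "P \<in> grade PP i"
 show "linear_on PP (grade PP j) PP (sbr P)" unfolding linear_on_def PP_simps
 proof (intro conjI ballI allI)
  fix x y assume x: "x \<in> grade PP j" and y: "y \<in> grade PP j"
  show "sbr P (x+y) = sbr P x+sbr P y"
   by (rule PP_eqI[OF sbr(1)[OF P PP_add[OF x y]] PP_add[OF sbr(1)[OF P x] sbr(1)[OF P y]]])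
     (simp add: sbr(2)[OF P PP_add[OF x y]] sbr(2)[OF P x] sbr(2)[OF P y] pb_add_right fun_eq_iff)
 next
  fix c x assume x: "x \<in> grade PP j"
  show "sbr P (fscl c x) = fscl c (sbr P x)"
   by (rule PP_eqI[OF sbr(1)[OF P PP_fscl[OF x]] PP_fscl[OF sbr(1)[OF P x]]])
     (simp add: sbr(2)[OF P PP_fscl[OF x]] sbr(2)[OF P x] pb_scale_right fun_eq_iff)
 qed
next
 fix i j Q assume Q: "Q \<in> grade PP j"
 show "linear_on PP (grade PP i) PP (%P. sbr P Q)" unfolding linear_on_def PP_simps
 proof (intro conjI ballI allI)
  fix x y assume x: "x \<in> grade PP i" and y: "y \<in> grade PP i"
  show "sbr (x+y) Q = sbr x Q+sbr y Q"
   by (rule PP_eqI[OF sbr(1)[OF PP_add[OF x y] Q] PP_add[OF sbr(1)[OF x Q] sbr(1)[OF y Q]]])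
     (simp add: sbr(2)[OF PP_add[OF x y] Q] sbr(2)[OF x Q] sbr(2)[OF y Q] pb_add_left fun_eq_iff)
 next
  fix c x assume x: "x \<in> grade PP i"
  show "sbr (fscl c x) Q = fscl c (sbr x Q)"
   by (rule PP_eqI[OF sbr(1)[OF PP_fscl[OF x] Q] PP_fscl[OF sbr(1)[OF x Q]]])
     (simp add: sbr(2)[OF PP_fscl[OF x] Q] sbr(2)[OF x Q] pb_scale_left fun_eq_iff)
 qed
next
 fix i j k P Q R assume P: "P \<in> grade PP i" and Q: "Q \<in> grade PP j" and R: "R \<in> grade PP k"
 have g1: "mul PP (sbr P Q) R \<in> grade PP (i+(j+k) - n - 1)"
  using PP_mul(2)[OF sbr(1)[OF P Q] R] by (simp add: algebra_simps)
 have g2: "mul PP Q (sbr P R) \<in> grade PP (i+(j+k) - n - 1)"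
  using PP_mul(2)[OF Q sbr(1)[OF P R]] by (simp add: algebra_simps)
 show "sbr P (mul PP Q R) = mul PP (sbr P Q) R+fscl (sg (i*j)*sg (j*(n+1))) (mul PP Q (sbr P R))"
  by (rule PP_eqI[OF sbr(1)[OF P PP_mul(2)[OF Q R]] PP_add[OF g1 PP_fscl[OF g2]]])
    (simp add: sbr(2)[OF P PP_mul(2)[OF Q R]] PP_mul(1)[OF Q R] PP_mul(1)[OF sbr(1)[OF P Q] R] PP_mul(1)[OF Q sbr(1)[OF P R]]
     sbr(2)[OF P Q] sbr(2)[OF P R] pb_leibniz[OF PP_gradeE(4)[OF P] PP_gradeE(4)[OF Q]] sg_eps fun_eq_iff)
next
 fix i j a a' assume a: "a \<in> grade FF i" and a': "a' \<in> grade FF j"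
 show "sbr (pol_fun FF n i a) (pol_fun FF n j a') = 0"
  by (rule PP_eqI[OF sbr(1)[OF pol_fun(1)[OF a] pol_fun(1)[OF a']] PP_0])
    (simp add: sbr(2)[OF pol_fun(1)[OF a] pol_fun(1)[OF a']] pol_fun(2)[OF a] pol_fun(2)[OF a'] fun_eq_iff
     pb_A_A FF_gradeE(3)[OF a] FF_gradeE(3)[OF a'])
next
 fix i j D a assume D: "D \<in> grade (Der FF) i" and a: "a \<in> grade FF j"
 have "D j a \<in> grade FF (i+j)" using Der_hom(1)[OF D a] by (simp add: add.commute)
 note Da = this
 show "sbr (pol_der FF n i D) (pol_fun FF n j a) = fscl (sg (i*(n+1))) (pol_fun FF n (i+j) (D j a))"
  by (rule PP_eqI[OF sbr(1)[OF pol_der(1)[OF D] pol_fun(1)[OF a]] PP_fscl[OF pol_fun(1)[OF Da]]])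
    (simp add: sbr(2)[OF pol_der(1)[OF D] pol_fun(1)[OF a]] pol_der(2)[OF D] pol_fun(2)[OF a] pol_fun(2)[OF Da] fun_eq_iff
     pb_dvec_A[OF dcoef_coefs[OF D] FF_gradeE(3)[OF a]] der_formula[OF D a] sg_eps)
next
 fix i j D D' assume D: "D \<in> grade (Der FF) i" and D': "D' \<in> grade (Der FF) j"
 note b = der_bracket[OF D D']
 have "dvec (i+j+n+1) (dcoef (der_bracket FF i j D D')) = dvec (i+j+n+1)
   (%e w. vfield (dcoef D) (dcoef D' e) w - eps (i*j)*vfield (dcoef D') (dcoef D e) w)"
  by (rule dvec_cong) (rule b(2))
 thus "sbr (pol_der FF n i D) (pol_der FF n j D') = pol_der FF n (i+j) (der_bracket FF i j D D')"
  by (intro PP_eqI[OF sbr(1)[OF pol_der(1)[OF D] pol_der(1)[OF D']] pol_der(1)[OF b(1)]])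
    (simp add: sbr(2)[OF pol_der(1)[OF D] pol_der(1)[OF D']] pol_der(2)[OF D] pol_der(2)[OF D'] pol_der(2)[OF b(1)]
     fun_eq_iff pb_dvec_dvec[OF dcoef_coefs[OF D] dcoef_coefs[OF D']])
qed

text \<open>Conversely, the defining properties determine the bracket: by the Leibniz rule and antisymmetry it
 is known once it is known on pairs of generators. On 1 it vanishes because 1 = 1 1.\<close>

lemma schouten_unique:
 assumes s: "is_schouten FF n br" and P: "P \<in> grade PP i" and Q: "Q \<in> grade PP j"
 shows "br P Q = sbr P Q"
proof -
 note t = sbr_schouten
 note s' = s[unfolded is_schouten_def PP_simps]
 note t' = t[unfolded is_schouten_def PP_simps]
 note r1 = conjunct2[OF s'] note r2 = conjunct2[OF r1] note r3 = conjunct2[OF r2]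
 note r4 = conjunct2[OF r3] note r5 = conjunct2[OF r4] note r6 = conjunct2[OF r5] note r7 = conjunct2[OF r6]
 note q1 = conjunct2[OF t'] note q2 = conjunct2[OF q1] note q3 = conjunct2[OF q2]
 note q4 = conjunct2[OF q3] note q5 = conjunct2[OF q4] note q6 = conjunct2[OF q5] note q7 = conjunct2[OF q6]
 note gr = conjunct1[OF s', rule_format]
 note lin = conjunct1[OF r1, rule_format] conjunct1[OF q1, rule_format]
 note anti = conjunct1[OF r3, rule_format] conjunct1[OF q3, rule_format]
 note leib = conjunct1[OF r4, rule_format] conjunct1[OF q4, rule_format]
 note funs = conjunct1[OF r5, rule_format] conjunct1[OF q5, rule_format]
 note derf = conjunct1[OF r6, rule_format] conjunct1[OF q6, rule_format]
 note ders = r7[rule_format] q7[rule_format]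
 (* Known values may be exchanged, so that the Leibniz rule serves for both arguments. *)
 have flip: "br P Q = sbr P Q" if "P \<in> grade PP i" "Q \<in> grade PP j" "br Q P = sbr Q P" for i j P Q
  unfolding anti[OF that(1,2)] that(3) ..
 have one': "br P (aone PP) = sbr P (aone PP)" if P: "P \<in> grade PP i" for i P
 proof -
  have m: "mul PP (aone PP) (aone PP) = aone PP"
   by (rule PP_eqI[OF PP_mul(2)[OF PP_one(2) PP_one(2)] PP_one(2)])
     (simp add: PP_mul(1)[OF PP_one(2) PP_one(2)] PP_one(1))
  have g: "br P (aone PP) \<in> grade PP (i - n - 1)" using gr[OF P PP_one(2)] by simp
  have eq: "br P (aone PP) = mul PP (br P (aone PP)) (aone PP)+mul PP (aone PP) (br P (aone PP))"
   using leib(1)[OF P PP_one(2) PP_one(2)] unfolding m by simp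
  have "\<beta> (br P (aone PP)) w = \<beta> (br P (aone PP)) w+\<beta> (br P (aone PP)) w" for w
  proof -
   have "\<beta> (br P (aone PP)) w = \<beta> (mul PP (br P (aone PP)) (aone PP)+mul PP (aone PP) (br P (aone PP))) w"
    by (rule arg_cong[OF eq])
   thus ?thesis by (simp only: ev_simps PP_mul(1)[OF g PP_one(2)] PP_mul(1)[OF PP_one(2) g] PP_one(1) sh_one_left sh_one_right)
  qed
  hence "\<beta> (br P (aone PP)) w = 0" for w by (metis add_cancel_right_right)
  moreover have "\<beta> (sbr P (aone PP)) w = 0" for w unfolding sbr(2)[OF P PP_one(2)] PP_one(1) by (rule pb_one)
  ultimately have "\<beta> (br P (aone PP)) = \<beta> (sbr P (aone PP))" by (intro ext) simp
  thus ?thesis by (rule PP_eqI[OF g sbr(1)[OF P PP_one(2)]])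
 qed
 let ?g = "%x. FP.cl (word [genP x])"
 have gx: "?g x \<in> grade PP (deg x)" if "x \<in> XP" for x
  using FP.gen_class(1)[OF genP_in[OF that]] FP.gen(2)[OF that] by (simp add: PP_Sym)
 have ind: "br P Q = sbr P Q" if P: "P \<in> grade PP i" and Q: "Q \<in> grade PP j"
  and b: "!!x. x \<in> XP ==> br P (?g x) = sbr P (?g x)" for i j P Q
  using Q
 proof (induction rule: PP_induct[consumes 1, case_names one mult zero add])
  case one show ?case by (rule one'[OF P])
 next
  case (mult x j Q)
  show ?case unfolding leib(1)[OF P gx[OF mult(1)] mult(2)] leib(2)[OF P gx[OF mult(1)] mult(2)]
   using b[OF mult(1)] mult(3) by simp
 next
  case (zero j)
  have "br P (fscl 0 0) = fscl 0 (br P 0)" "sbr P (fscl 0 0) = fscl 0 (sbr P 0)"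
   using lin[OF P, of j] PP_0[of j] unfolding linear_on_def PP_simps by blast+
  thus ?case by simp
 next
  case (add j c Q R)
  have "br P (fscl c Q+R) = fscl c (br P Q)+br P R" "sbr P (fscl c Q+R) = fscl c (sbr P Q)+sbr P R"
   using lin[OF P, of j] add(1,2) PP_fscl[OF add(1), of c] unfolding linear_on_def PP_simps by simp_all
  thus ?case using add by simp
 qed
 have gf: "?g (Inr b) = pol_fun FF n (1 - fst b) (eb b)" for b
  by (simp add: pol_fun_def coef_in_def)
 have gd: "?g (Inl b) = pol_der FF n (fst b - 1) (dvx b)" for b
  by (simp add: pol_der_def vec_in_def)
 have base: "br (?g x) (?g y) = sbr (?g x) (?g y)" if x: "x \<in> XP" and y: "y \<in> XP" for x y
 proof -
  have fd: "br (?g (Inl b)) (?g (Inr c)) = sbr (?g (Inl b)) (?g (Inr c))" if "b \<in> B" "c \<in> B" for b c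
   unfolding gf gd derf[OF dvx(1) eb(1)[OF that(2)]] ..
  have dd: "br (?g (Inl b)) (?g (Inl c)) = sbr (?g (Inl b)) (?g (Inl c))" for b c
   unfolding gd ders[OF dvx(1) dvx(1)] ..
  have ff: "br (?g (Inr b)) (?g (Inr c)) = sbr (?g (Inr b)) (?g (Inr c))" if "b \<in> B" "c \<in> B" for b c
   unfolding gf funs[OF eb(1)[OF that(1)] eb(1)[OF that(2)]] ..
  show ?thesis
  proof (cases x; cases y)
   fix b c assume "x = Inr b" "y = Inl c"
   thus ?thesis using flip[OF gx[OF x] gx[OF y]] fd[of c b] x y by auto
  qed (use x y fd dd ff in auto)
 qed
 have "br (?g x) Q = sbr (?g x) Q" if "x \<in> XP" "Q \<in> grade PP j" for x Q j
  by (rule ind[OF gx[OF that(1)] that(2)]) (rule base[OF that(1)])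
 hence "br P (?g x) = sbr P (?g x)" if "x \<in> XP" for x
  by (intro flip[OF P gx[OF that]]) (use that P in blast)
 thus ?thesis by (rule ind[OF P Q])
qed

lemma schouten:
 assumes "P \<in> grade PP i" "Q \<in> grade PP j"
 shows "schouten FF n P Q \<in> grade PP (i+j - n - 1)" (is ?P1) "\<beta> (schouten FF n P Q) = pb (\<beta> P) (\<beta> Q)" (is ?P2)
proof -
 have "is_schouten FF n (schouten FF n)"
  unfolding schouten_def by (rule someI[of "is_schouten FF n", OF sbr_schouten])
 from schouten_unique[OF this assms] sbr[OF assms]
 show ?P1 ?P2 by simp_all
qed

end

section \<open>The differentials of derivations and polyvectors\<close>

text \<open>The derivation of the shuffle algebra with \<open>d x' = SUM x. D x' x * x\<close> on letters.\<close>

fun dC :: "('x => int) => 'x set => ('x => 'x => 'k::field) => ('x list => 'k) => 'x list => 'k" where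
 "dC deg X D f [] = 0"
| "dC deg X D f (x#w) = (SUM x':X. D x' x*f (x'#w))+eps (deg x)*dC deg X D (%u. f (x#u)) w"

lemma dC_add: "dC deg X D (%w. f w+g w) w = dC deg X D f w+dC deg X D g w"
 by (induction w arbitrary: f g) (simp_all add: distrib_left sum.distrib)

lemma dC_scale: "dC deg X D (%w. c*f w) w = c*dC deg X D f w"
proof (induction w arbitrary: f)
 case (Cons x w)
 have "(SUM x':X. D x' x*(c*f (x'#w))) = c*(SUM x':X. D x' x*f (x'#w))"
  unfolding sum_distrib_left by (intro sum.cong refl) (rule mult.left_commute)
 thus ?case by (simp add: Cons distrib_left mult.left_commute)
qed simp

lemma dC_zero: "dC deg X D (%w. 0) w = 0"
 by (induction w) simp_all

lemma dC_sum: "dC deg X D (%w. SUM i:I. f i w) w = (SUM i:I. dC deg X D (f i) w)"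
 by (induction I rule: infinite_finite_induct) (simp_all add: dC_zero dC_add)

lemma dC_one: "dC deg X D shone w = 0"
 by (cases w) (simp_all add: dC_zero)

lemma dC_lin: "dC deg X D (lin h) w = lin (%x. SUM x':X. D x' x*h x') w"
proof (cases w)
 case (Cons x v)
 have "(%u. lin h (x#u)) = (%u. h x*shone u)" by (simp add: lin_Cons)
 thus ?thesis using Cons by (cases v) (simp_all add: dC_scale dC_one dC_zero)
qed simp

lemma dC_twist:
 assumes D: "!!x' x. D x' x ~= 0 ==> deg x = deg x'+1"
 shows "dC deg X D (%u. eps (c*wdeg deg u)*f u) w = eps (c*(wdeg deg w - 1))*dC deg X D f w"
proof (induction w arbitrary: f)
 case (Cons x w)
 have 1: "(SUM x':X. D x' x*(eps (c*wdeg deg (x'#w))*f (x'#w)))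
   = eps (c*(wdeg deg (x#w) - 1))*(SUM x':X. D x' x*f (x'#w))"
  unfolding sum_distrib_left
 proof (intro sum.cong refl)
  fix x' show "D x' x*(eps (c*wdeg deg (x'#w))*f (x'#w)) = eps (c*(wdeg deg (x#w) - 1))*(D x' x*f (x'#w))"
   using D[of x' x] by (cases "D x' x = 0") (simp_all add: algebra_simps)
 qed
 have 2: "(%u. eps (c*wdeg deg (x#u))*f (x#u)) = (%u. eps (c*deg x)*(eps (c*wdeg deg u)*f (x#u)))"
  by (simp add: eps_add distrib_left mult.assoc)
 show ?case unfolding dC.simps 1 2 dC_scale Cons
  by (simp add: eps_add eps_diff algebra_simps)
qed simp

lemma dC_sh_twist:
 assumes D: "!!x' x. D x' x ~= 0 ==> deg x = deg x'+1"
 shows "dC deg X D (sh deg f g) w = sh deg (dC deg X D f) g w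
  +sh deg (%u. eps (1*wdeg deg u)*f u) (dC deg X D g) w"
proof (induction w arbitrary: f g)
 case (Cons x w)
 let ?d = "dC deg X D" and ?fx = "%u. f (x#u)" and ?gx = "%u. g (x#u)"
 let ?t = "%c f u. eps (c*wdeg deg u)*f u"
 have L1: "(%u. sh deg f g (x#u)) = (%u. sh deg ?fx g u+sh deg (?t (deg x) f) ?gx u)" by simp
 have lhs: "?d (sh deg f g) (x#w) = (SUM x':X. D x' x*(sh deg (%u. f (x'#u)) g w+sh deg (?t (deg x') f) (%u. g (x'#u)) w))
  +eps (deg x)*((sh deg (?d ?fx) g w+sh deg (?t 1 ?fx) (?d g) w)
   +(sh deg (?d (?t (deg x) f)) ?gx w+sh deg (?t 1 (?t (deg x) f)) (?d ?gx) w))"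
  unfolding dC.simps L1 dC_add Cons by simp
 have tw: "?d (?t (deg x) f) = (%w. eps (deg x)*?t (deg x) (?d f) w)"
  by (rule ext, subst dC_twist[OF D]) (simp_all add: eps_diff algebra_simps right_diff_distrib)
 have tt: "?t 1 (?t (deg x) f) = ?t (deg x) (?t 1 f)" by (simp add: ac_simps)
 have dtt: "D x' x*sh deg (?t (deg x') f) h w = D x' x*sh deg (?t (deg x) (?t 1 f)) h w" for x' h
 proof (cases "D x' x = 0")
  case False
  have "?t (deg x) (?t 1 f) = ?t (deg x') f"
   unfolding D[OF False] by (simp add: eps_add distrib_right mult.assoc)
  thus ?thesis by simp
 qed simp
 have r1: "(%u. ?d f (x#u)) = (%u. (SUM x':X. D x' x*f (x'#u))+eps (deg x)*?d ?fx u)" by simp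
 have r2: "(%u. ?d g (x#u)) = (%u. (SUM x':X. D x' x*g (x'#u))+eps (deg x)*?d ?gx u)" by simp
 have r3: "(%u. ?t 1 f (x#u)) = (%u. eps (deg x)*?t 1 ?fx u)" by (simp add: eps_add mult.assoc)
 have "sh deg (?d f) g (x#w)+sh deg (?t 1 f) (?d g) (x#w)
   = ((SUM x':X. D x' x*sh deg (%u. f (x'#u)) g w)+eps (deg x)*sh deg (?d ?fx) g w
    +sh deg (?t (deg x) (?d f)) ?gx w)
   +(eps (deg x)*sh deg (?t 1 ?fx) (?d g) w
    +((SUM x':X. D x' x*sh deg (?t (deg x) (?t 1 f)) (%u. g (x'#u)) w)
     +eps (deg x)*sh deg (?t (deg x) (?t 1 f)) (?d ?gx) w))"
  unfolding sh.simps(2) r1 r2 r3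
  by (simp only: sh_add_left sh_add_right sh_scale_left sh_scale_right sh_sum_left sh_sum_right)
 also have "... = ?d (sh deg f g) (x#w)"
  unfolding lhs tt tw
  by (simp only: distrib_left sum.distrib dtt sh_scale_left) (simp add: algebra_simps)
 finally show ?case by simp
qed simp

text \<open>
 The differential replaces one letter at a time, and this letter belongs to exactly one of the two
 subwords.
\<close>

lemma dC_sh:
 assumes D: "!!x' x. D x' x ~= 0 ==> deg x = deg x'+1" and f: "f \<in> homog deg i"
 shows "dC deg X D (sh deg f g) w = sh deg (dC deg X D f) g w+eps i*sh deg f (dC deg X D g) w"
 using dC_sh_twist[where D = D and X = X and f = f and g = g and w = w and deg = deg] D sh_twist_homog[OF f, of 1] by simp

lemma dC_homog:
 assumes D: "!!x' x. D x' x ~= 0 ==> deg x = deg x'+1" and f: "f \<in> homog deg i"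
 shows "dC deg X D f \<in> homog deg (i+1)"
proof -
 have "dC deg X D f w = 0" if "wdeg deg w ~= i+1" for w
  using f that
 proof (induction w arbitrary: f i)
  case (Cons x w)
  have "(SUM x':X. D x' x*f (x'#w)) = 0"
  proof (rule sum.neutral, rule ballI)
   fix x' show "D x' x*f (x'#w) = 0"
    using D[of x' x] homogD[OF Cons.prems(1), of "x'#w"] Cons.prems(2) by (cases "D x' x = 0") auto
  qed
  moreover have "dC deg X D (%u. f (x#u)) w = 0"
   by (rule Cons.IH[OF homog_left_shift[OF Cons.prems(1)]]) (use Cons.prems(2) in auto)
  ultimately show ?case by simp
 qed simp
 thus ?thesis unfolding homog_def by blast
qed

lemma dC_explicit:
 "dC deg X D f w = (SUM k<length w. eps (wdeg deg (take k w))*(SUM x':X. D x' (w ! k)*f (w[k := x'])))"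
proof (induction w arbitrary: f)
 case (Cons x w)
 show ?case
  by (simp add: Cons sum.lessThan_Suc_shift sum_distrib_left eps_add mult.assoc del: sum.lessThan_Suc)
qed simp

context sym_model
begin

lemma sdeg_sdif: "sdeg (sdif A M g) = sdeg g+1"
 by (cases g) simp_all

lemma dword_Cons: "dword d s (g#w) = word (s g#w)+fscl (eps (d g)) (fmul (word [g]) (dword d s w))"
 unfolding dword_def
 by (simp add: sum.lessThan_Suc_shift fmul_sum_right fv.scale_sum_right sg_eps eps_add del: sum.lessThan_Suc)

text \<open>
 The differentials of the algebra and of the model are derivations, so agreement on the generators
 suffices.
\<close>

lemma E_dif:
 assumes D: "!!x' x. D x' x ~= 0 ==> deg x = deg x'+1"
  and g: "!!g. g \<in> G ==> sdif A M g \<in> G"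
  and dg: "!!g. g \<in> G ==> \<phi> (sdif A M g) = dC deg Y D (\<phi> g)"
  and P: "P \<in> grade (Sym A M) i"
 shows "dif (Sym A M) i P \<in> grade (Sym A M) (i+1)" (is ?P1) "E (dif (Sym A M) i P) = dC deg Y D (E P)" (is ?P2)
proof -
 let ?dw = "dword sdeg (sdif A M)"
 have w: "E (?dw w) = dC deg Y D (evw deg \<phi> w)" and k: "keys (?dw w :: _ \<Rightarrow>\<^sub>0 'k) <= lists G" if "w \<in> lists G" for w
 proof -
  show "E (?dw w) = dC deg Y D (evw deg \<phi> w)"
   using that
  proof (induction w)
   case Nil
   show ?case by (simp add: dword_def fun_eq_iff dC_one)
  next
   case (Cons h w)
   hence h: "h \<in> G" and IH: "E (?dw w) = dC deg Y D (evw deg \<phi> w)" by auto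
   have "E (?dw (h#w)) u = dC deg Y D (evw deg \<phi> (h#w)) u" for u
    using dC_sh[where D = D and X = Y and g = "evw deg \<phi> w" and w = u, OF D \<phi>_homog[OF h]]
    by (simp add: dword_Cons ev_fmul IH dg[OF h])
   thus ?case by (rule ext)
  qed
  show "keys (?dw w :: _ \<Rightarrow>\<^sub>0 'k) <= lists G"
   using that
  proof (induction w)
   case (Cons h w)
   hence h: "h \<in> G" and wl: "w \<in> lists G" and IH: "keys (?dw w :: _ \<Rightarrow>\<^sub>0 'k) <= lists G" by auto
   have "keys (fmul (word [h]) (?dw w :: _ \<Rightarrow>\<^sub>0 'k)) <= lists G"
    by (rule keys_fmul[where S = "lists G" and T = "lists G"]) (use h IH in simp_all)
   thus ?case unfolding dword_Cons using g[OF h] wl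
    by (intro keys_add_subset subset_trans[OF keys_fscl]) simp_all
  qed (simp add: dword_def)
 qed
 have kP: "keys P <= lists G" by (rule gradeE(2)[OF P])
 have E: "E (flin ?dw P) = dC deg Y D (E P)"
  using kP
 proof (induction rule: pm_induct)
  case zero show ?case by (simp add: fun_eq_iff dC_zero)
 next
  case (add c v q)
  thus ?case by (simp add: w dC_add dC_scale fun_eq_iff)
 qed
 have kd: "keys (flin ?dw P) <= lists G" by (rule keys_flin_subset) (use kP k in blast)
 have e: "dif (Sym A M) i P = cl (flin ?dw P)" by (simp add: Sym_def)
 show ?P2 unfolding e by (simp add: E)
 show ?P1 unfolding e
  by (rule gradeI[OF kd]) (unfold E, rule dC_homog[OF D gradeE(4)[OF P]])
qed

end

context fin_cplx
begin

definition dm :: "int \<times> 'v => int \<times> 'v => 'k" where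
 "dm b b' = (if b \<in> B then co (fst b+1, dif V (fst b) (snd b)) b' else 0)"

lemma dm_nonzero: "dm b b' ~= 0 ==> fst b' = fst b+1 & b' \<in> B"
 unfolding dm_def using co_nonzero[of "(fst b+1, dif V (fst b) (snd b))" b'] by (auto split: if_splits)

lemma dif_V:
 assumes "x \<in> grade V i"
 shows "dif V i x \<in> grade V (i+1)" "y \<in> grade V i ==> dif V i (x+y) = dif V i x+dif V i y"
  "dif V i (scl V c x) = scl V c (dif V i x)"
 using cc assms by (auto simp: cochain_complex_def linear_on_def)

lemma co_dif: "x \<in> grade V i ==> co (i+1, dif V i x) b' = (SUM b:B. co (i, x) b*dm b b')"
proof -
 assume x: "x \<in> grade V i"
 have "co (i+1, dif V i x) b' = (SUM b:B. co (i, x) b*co (i+1, dif V i (snd b)) b')"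
  by (rule linear_expand[OF x]) (simp_all add: dif_V co_add co_scl)
 also have "... = (SUM b:B. co (i, x) b*dm b b')"
 proof (intro sum.cong refl)
  fix b show "co (i, x) b*co (i+1, dif V i (snd b)) b' = co (i, x) b*dm b b'"
   using co_nonzero[of "(i, x)" b] by (cases "co (i, x) b = 0") (auto simp: dm_def)
 qed
 finally show ?thesis .
qed

text \<open>
 On \<open>Inl\<close> the differential of the shift of V, which has the sign (-1)^n; on
 \<open>Inr\<close> the differential of the dual, which is the transpose of d up to sign.
\<close>

definition Dm :: "'v lbl => 'v lbl => 'k" where
 "Dm x y = (case (x, y) of (Inl b, Inl b') => eps n*dm b b' | (Inr b, Inr b') => eps (fst b)*dm b' b | _ => 0)"

lemma Dm_simps [simp]: "Dm (Inl b) (Inl b') = eps n*dm b b'" "Dm (Inr b) (Inr b') = eps (fst b)*dm b' b"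
 "Dm (Inl b) (Inr b') = 0" "Dm (Inr b) (Inl b') = 0"
 by (simp_all add: Dm_def)

lemma Dm_deg: "Dm x y ~= 0 ==> deg y = deg x+1"
 by (cases x; cases y) (auto dest: dm_nonzero)

abbreviation dP :: "('v lbl list => 'k) => 'v lbl list => 'k" where "dP \<equiv> dC deg XP Dm"

lemma sum_XP: "(SUM x:XP. f x) = (SUM b:B. f (Inl b))+(SUM b:B. f (Inr b))"
proof -
 have "(SUM x:XP. f x) = sum f (Inl ` B)+sum f (Inr ` B)"
  by (rule sum.union_disjoint) (use finite_B in auto)
 thus ?thesis by (simp add: sum.reindex)
qed

lemma FA_sdif:
 assumes "g \<in> sym_gens ground dualM"
 shows "sdif ground dualM g \<in> sym_gens ground dualM" (is ?P1) "\<phi>A (sdif ground dualM g) = dP (\<phi>A g)" (is ?P2)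
proof -
 have "sdif ground dualM g \<in> sym_gens ground dualM & \<phi>A (sdif ground dualM g) = dP (\<phi>A g)"
  using assms
 proof (cases rule: sym_gens_cases)
  case (1 i a)
  thus ?thesis by (auto simp: fun_eq_iff dC_scale dC_one)
 next
  case (2 i \<theta>)
  hence t: "\<theta> \<in> grade (dual V) (i - 1)" by simp
  have d: "dif dualM i \<theta> = (%j x. if x \<in> grade V j then eps (i - 1)*\<theta> (j+1) (dif V j x) else 0)"
   unfolding shift_mod_simps dual_scl
   by (auto simp: dual_simps hom_cplx_def sg_eps fun_eq_iff eps_if)
  have g: "dif dualM i \<theta> \<in> grade (dual V) i"
   unfolding d dual_simps
  proof (rule hom_gradeI)
   fix j x assume x: "x \<in> grade V j"
   show "(if x \<in> grade V j then eps (i - 1)*\<theta> (j+1) (dif V j x) else 0) \<in> grade ground (j+i)"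
    using dual_gradeD(1)[OF t dif_V(1)[OF x]] by auto
  next
   fix j x y assume "x \<in> grade V j" "y \<in> grade V j"
   thus "(if x+y \<in> grade V j then eps (i - 1)*\<theta> (j+1) (dif V j (x+y)) else 0)
    = (if x \<in> grade V j then eps (i - 1)*\<theta> (j+1) (dif V j x) else 0)
     +(if y \<in> grade V j then eps (i - 1)*\<theta> (j+1) (dif V j y) else 0)"
    using gspace_add[OF gspace_V] dif_V by (simp add: dual_gradeD(2)[OF t] distrib_left)
  next
   fix j c x assume "x \<in> grade V j"
   thus "(if scl V c x \<in> grade V j then eps (i - 1)*\<theta> (j+1) (dif V j (scl V c x)) else 0)
    = scl ground c (if x \<in> grade V j then eps (i - 1)*\<theta> (j+1) (dif V j x) else 0)"
    using gspace_scl[OF gspace_V] dif_V by (simp add: dual_gradeD(3)[OF t])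
  qed simp
  have "dfun (dif dualM i \<theta>) x = (SUM x':XP. Dm x' x*dfun \<theta> x')" for x
  proof (cases x)
   case (Inl b)
   thus ?thesis by (simp add: sum_XP)
  next
   case (Inr b)
   show ?thesis
   proof (cases "b \<in> B")
    case True
    have db: "dif V (fst b) (snd b) \<in> grade V (fst b+1)" by (rule dif_V(1)[OF B_grade[OF True]])
    have "dfun (dif dualM i \<theta>) x = eps (i - 1)*(SUM b':B. dm b b'*\<theta> (fst b') (snd b'))"
     unfolding d using Inr True B_grade[OF True] dual_expand[OF t db] by (simp add: dm_def)
    also have "... = (SUM b':B. eps (fst b')*dm b b'*\<theta> (fst b') (snd b'))"
     unfolding sum_distrib_left
    proof (intro sum.cong refl, goal_cases)
     case (1 b')
     note b' = 1(1)
     show ?case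
     proof (cases "fst b'+(i - 1) = 0")
      case True
      hence "(eps (i - 1) :: 'k) = eps (fst b')" by (intro eps_cong) presburger
      thus ?thesis by simp
     next
      case False
      thus ?thesis using dual_gradeD(1)[OF t B_grade[OF b']] by simp
     qed
    qed
    finally show ?thesis using Inr by (simp add: sum_XP)
   next
    case False
    thus ?thesis using Inr by (simp add: sum_XP dm_def)
   qed
  qed
  hence "dfun (dif dualM i \<theta>) = (%x. SUM x':XP. Dm x' x*dfun \<theta> x')" by (rule ext)
  moreover have "dP (lin (dfun \<theta>)) = lin (%x. SUM x':XP. Dm x' x*dfun \<theta> x')" by (rule ext, rule dC_lin)
  ultimately have "\<phi>A (sdif ground dualM g) = dP (\<phi>A g)"
   by (simp only: 2(1) sdif.simps \<phi>A.simps)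
  moreover have "sdif ground dualM g \<in> sym_gens ground dualM"
   unfolding 2(1) sdif.simps sym_gensI shift_mod_simps(1) using g by simp
  ultimately show ?thesis by blast
 qed
 thus ?P1 ?P2 by blast+
qed

lemma FF_dif:
 assumes "a \<in> grade FF i"
 shows "dif FF i a \<in> grade FF (i+1)" "\<alpha> (dif FF i a) = dP (\<alpha> a)"
 using FA.E_dif[where D = Dm and Y = XP, OF Dm_deg FA_sdif assms[unfolded FF_Sym]] unfolding FF_Sym by blast+

lemma dP_sh: "f \<in> homog deg i ==> dP (sh deg f g) w = sh deg (dP f) g w+eps i*sh deg f (dP g) w"
 by (rule dC_sh[OF Dm_deg])


definition dcoefs :: "int => (int \<times> 'v => 'v lbl list => 'k) => int \<times> 'v => 'v lbl list => 'k" where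
 "dcoefs k c b w = dP (c b) w - eps k*(SUM b':B. Dm (Inr b) (Inr b')*c b' w)"

text \<open>
 The graded commutator of dP and a vector field is the vector field with coefficients
 \<open>dcoefs\<close>: the two second-order terms cancel because dP commutes with removing a letter
 up to the matrix \<open>Dm\<close>.
\<close>

lemma dP_vfield:
 assumes c: "coefs k c"
 shows "dP (vfield c f) w = eps k*vfield c (dP f) w+vfield (dcoefs k c) f w"
proof -
 let ?L = "%b u. f (Inr b#u)"
 have L: "(%u. dP f (Inr b#u)) = (%u. (SUM b':B. Dm (Inr b') (Inr b)*f (Inr b'#u))+eps (1 - fst b)*dP (?L b) u)" for b
  by (simp add: sum_XP)
 have t: "dP (sh deg (c b) (?L b)) w = sh deg (dP (c b)) (?L b) w+eps k*sh deg (c b) (%u. dP f (Inr b#u)) w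
   - eps k*(SUM b':B. Dm (Inr b') (Inr b)*sh deg (c b) (?L b') w)" if b: "b \<in> B" for b
 proof -
  have e: "eps k*eps (1 - fst b) = (eps (k+1 - fst b) :: 'k)" by (simp add: eps_mult add_diff_eq)
  have "sh deg (c b) (%u. dP f (Inr b#u)) w = (SUM b':B. Dm (Inr b') (Inr b)*sh deg (c b) (?L b') w)
    +eps (1 - fst b)*sh deg (c b) (dP (?L b)) w"
   unfolding L by (simp only: sh_add_right sh_sum_right sh_scale_right)
  hence "eps k*sh deg (c b) (%u. dP f (Inr b#u)) w = eps k*(SUM b':B. Dm (Inr b') (Inr b)*sh deg (c b) (?L b') w)
    +eps (k+1 - fst b)*sh deg (c b) (dP (?L b)) w"
   by (simp only: distrib_left e[symmetric] mult.assoc)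
  thus ?thesis using dP_sh[OF coefsD(2)[OF c b], of "?L b" w] by simp
 qed
 have v: "sh deg (dcoefs k c b) (?L b) w = sh deg (dP (c b)) (?L b) w - eps k*(SUM b':B. Dm (Inr b) (Inr b')*sh deg (c b') (?L b) w)" for b
 proof -
  have "dcoefs k c b = (%w. dP (c b) w+(- eps k)*(SUM b':B. Dm (Inr b) (Inr b')*c b' w))"
   by (simp add: dcoefs_def fun_eq_iff)
  hence "sh deg (dcoefs k c b) (?L b) w = sh deg (dP (c b)) (?L b) w+(- eps k)*(SUM b':B. Dm (Inr b) (Inr b')*sh deg (c b') (?L b) w)"
   by (simp only: sh_add_left sh_scale_left sh_sum_left)
  thus ?thesis by simp
 qed
 have sw: "(SUM b:B. SUM b':B. Dm (Inr b') (Inr b)*sh deg (c b) (?L b') w) = (SUM b:B. SUM b':B. Dm (Inr b) (Inr b')*sh deg (c b') (?L b) w)"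
  by (rule sum.swap)
 have "dP (vfield c f) w = (SUM b:B. dP (sh deg (c b) (?L b)) w)"
  unfolding vfield_def by (rule dC_sum)
 also have "... = (SUM b:B. sh deg (dP (c b)) (?L b) w)+eps k*vfield c (dP f) w
   - eps k*(SUM b:B. SUM b':B. Dm (Inr b') (Inr b)*sh deg (c b) (?L b') w)"
  by (simp add: t sum.distrib sum_subtractf vfield_def[of c "dP f"] sum_distrib_left del: dC.simps Dm_simps)
 also have "... = eps k*vfield c (dP f) w+vfield (dcoefs k c) f w"
  unfolding sw vfield_def[of "dcoefs k c"] v by (simp add: sum_subtractf sum_distrib_left del: Dm_simps)
 finally show ?thesis .
qed

lemma Der_dif:
 assumes D: "D \<in> grade (Der FF) k"
 shows "dif (Der FF) k D \<in> grade (Der FF) (k+1)" "b \<in> B ==> dcoef (dif (Der FF) k D) b = dcoefs k (dcoef D) b"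
proof -
 let ?Q = "dif (Der FF) k D"
 note c = dcoef_coefs[OF D]
 have Q: "?Q j a = dif FF (j+k) (D j a) - fscl (eps k) (D (j+1) (dif FF j a))" if "a \<in> grade FF j" for j a
  using that by (simp add: Der_simps hom_cplx_def sg_eps)
 have g: "?Q j a \<in> grade FF (j+(k+1))" if a: "a \<in> grade FF j" for j a
 proof -
  have "dif FF (j+k) (D j a) \<in> grade FF (j+k+1)" by (rule FF_dif(1)[OF Der_hom(1)[OF D a]])
  moreover have "D (j+1) (dif FF j a) \<in> grade FF (j+1+k)" by (rule Der_hom(1)[OF D FF_dif(1)[OF a]])
  ultimately have "dif FF (j+k) (D j a)+fscl (- eps k) (D (j+1) (dif FF j a)) \<in> grade FF (j+(k+1))"
   by (intro FF_add FF_fscl) (simp_all add: algebra_simps)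
  thus ?thesis unfolding Q[OF a] by simp
 qed
 have v: "\<alpha> (?Q j a) w = dP (vfield (dcoef D) (\<alpha> a)) w - eps k*vfield (dcoef D) (dP (\<alpha> a)) w" if a: "a \<in> grade FF j" for j a w
  unfolding Q[OF a] by (simp add: FF_dif(2)[OF Der_hom(1)[OF D a]] der_formula[OF D a] der_formula[OF D FF_dif(1)[OF a]] FF_dif(2)[OF a])
 have v': "\<alpha> (?Q j a) = vfield (dcoefs k (dcoef D)) (\<alpha> a)" if a: "a \<in> grade FF j" for j a
  by (rule ext) (simp add: v[OF a] dP_vfield[OF c])
 have dc: "dcoef ?Q b = dcoefs k (dcoef D) b" if b: "b \<in> B" for b
  unfolding dcoef_def[of ?Q] v'[OF eb(1)[OF b]] eb(2)[OF b] by (rule vfield_letter[OF b])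
 have cc: "coefs (k+1) (dcoefs k (dcoef D))"
  unfolding coefs_def
 proof
  fix b assume b: "b \<in> B"
  have "?Q (1 - fst b) (eb b) \<in> grade FF (k+1+1 - fst b)"
   using g[OF eb(1)[OF b]] by (simp add: algebra_simps)
  from FF_gradeE(3,4)[OF this]
  show "dcoefs k (dcoef D) b \<in> Symf deg XA & dcoefs k (dcoef D) b \<in> homog deg (k+1+1 - fst b)"
   unfolding dc[OF b, symmetric] dcoef_def by blast
 qed
 show "b \<in> B ==> dcoef ?Q b = dcoefs k (dcoef D) b" by (rule dc)
 show "?Q \<in> grade (Der FF) (k+1)"
  by (rule derI(1)[OF cc g v']) (simp_all add: Der_simps hom_cplx_def)
qed

lemma dP_dl: "dP (dl b) w = (SUM b':B. eps n*dm b b'*dl b' w)" if b: "b \<in> B"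
proof -
 have "(SUM x':XP. Dm x' x*letter (Inl b) x') = (SUM b':B. eps n*dm b b'*letter (Inl b') x)" for x
 proof (cases x)
  case (Inl b')
  have "(SUM x':XP. Dm x' x*letter (Inl b) x') = eps n*dm b b'"
   unfolding sum_XP Inl using b finite_B
   by (simp add: letter_def if_distrib[of "%a. _*a"] cong: if_cong)
  also have "... = (SUM b'':B. eps n*dm b b''*letter (Inl b'') x)"
   using dm_nonzero[of b b'] finite_B unfolding Inl
   by (cases "b' \<in> B") (auto simp: letter_def if_distrib[of "%a. _*a"] cong: if_cong)
  finally show ?thesis .
 next
  case (Inr b')
  thus ?thesis by (simp add: sum_XP letter_def)
 qed
 hence "dP (dl b) w = lin (%x. SUM b':B. eps n*dm b b'*letter (Inl b') x) w"
  unfolding dC_lin by simp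
 also have "... = (SUM b':B. eps n*dm b b'*dl b' w)"
  by (simp add: lin_def split: list.split)
 finally show ?thesis .
qed

lemma dP_dvec:
 assumes c: "coefs (i - n - 1) c"
 shows "dvec (i+1) (%b w. eps (n+1)*dcoefs (i - n - 1) c b w) w = dP (dvec i c) w"
proof -
 let ?e = "%b. eps ((i - n - fst b)*(n+1)) :: 'k"
 let ?T = "%b' b. sh deg (c b') (dl b) w"
 have 1: "eps ((i+1 - n - fst b)*(n+1))*sh deg (%w. eps (n+1)*dcoefs (i - n - 1) c b w) (dl b) w
   = ?e b*sh deg (dP (c b)) (dl b) w - (SUM b':B. ?e b*eps (i - n - 1)*(eps (fst b)*dm b' b)*?T b' b)" for b
 proof -
  have d: "(%w. eps (n+1)*dcoefs (i - n - 1) c b w)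
    = (%w. eps (n+1)*dP (c b) w+(- eps (n+1)*eps (i - n - 1))*(SUM b':B. Dm (Inr b) (Inr b')*c b' w))"
   by (simp add: dcoefs_def right_diff_distrib mult.assoc del: Dm_simps)
  have s: "(eps ((i+1 - n - fst b)*(n+1))*eps (n+1) :: 'k) = ?e b"
   unfolding eps_mult by (rule eps_cong) auto
  have "eps ((i+1 - n - fst b)*(n+1))*sh deg (%w. eps (n+1)*dcoefs (i - n - 1) c b w) (dl b) w
    = (eps ((i+1 - n - fst b)*(n+1))*eps (n+1))*sh deg (dP (c b)) (dl b) w
     - (eps ((i+1 - n - fst b)*(n+1))*eps (n+1))*eps (i - n - 1)*(SUM b':B. Dm (Inr b) (Inr b')*?T b' b)"
   unfolding d by (simp only: sh_add_left sh_scale_left sh_sum_left) (simp add: algebra_simps del: Dm_simps)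
  thus ?thesis unfolding s by (simp add: sum_distrib_left mult.assoc)
 qed
 have 2: "dP (%w. eps ((i - n - fst b)*(n+1))*sh deg (c b) (dl b) w) w
   = ?e b*sh deg (dP (c b)) (dl b) w+(SUM b':B. ?e b*eps (i - n - fst b)*(eps n*dm b b')*?T b b')" if b: "b \<in> B" for b
 proof -
  have h: "c b \<in> homog deg (i - n - fst b)" using coefsD(2)[OF c b] by simp
  have "dP (dl b) = (%w. SUM b':B. eps n*dm b b'*dl b' w)" by (rule ext, rule dP_dl[OF b])
  thus ?thesis unfolding dC_scale dP_sh[OF h]
   by (simp add: sh_sum_right sh_scale_right sum_distrib_left distrib_left mult.assoc del: sh.simps)
 qed
 have 3: "?e b*eps (i - n - 1)*(eps (fst b)*dm b' b) = - (?e b'*eps (i - n - fst b')*(eps n*dm b' b))" for b b'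
 proof (cases "dm b' b = 0")
  case False
  hence fb: "fst b = fst b'+1" using dm_nonzero by blast
  have "(eps ((i - n - fst b)*(n+1)+(i - n - 1)+fst b) :: 'k) = eps (1+((i - n - fst b')*(n+1)+(i - n - fst b')+n))"
   unfolding fb by (rule eps_cong) auto
  hence "(?e b*eps (i - n - 1)*eps (fst b) :: 'k) = - (?e b'*eps (i - n - fst b')*eps n)"
   unfolding eps_mult minus_eps by (simp only: add_ac)
  hence "(?e b*eps (i - n - 1)*eps (fst b))*dm b' b = - (?e b'*eps (i - n - fst b')*eps n)*dm b' b" by simp
  thus ?thesis by (simp only: mult.assoc minus_mult_left)
 qed simp
 have "dP (dvec i c) w = (SUM b:B. dP (%w. eps ((i - n - fst b)*(n+1))*sh deg (c b) (dl b) w) w)"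
  unfolding dvec_def by (rule dC_sum)
 also have "... = (SUM b:B. ?e b*sh deg (dP (c b)) (dl b) w)+(SUM b':B. SUM b:B. ?e b'*eps (i - n - fst b')*(eps n*dm b' b)*?T b' b)"
  by (simp add: 2 sum.distrib del: dC.simps)
 also have "(SUM b':B. SUM b:B. ?e b'*eps (i - n - fst b')*(eps n*dm b' b)*?T b' b)
   = (SUM b:B. SUM b':B. ?e b'*eps (i - n - fst b')*(eps n*dm b' b)*?T b' b)" by (rule sum.swap)
 also have "(SUM b:B. ?e b*sh deg (dP (c b)) (dl b) w)+... = dvec (i+1) (%b w. eps (n+1)*dcoefs (i - n - 1) c b w) w"
  unfolding dvec_def 1 3 by (simp add: sum_negf sum.distrib)
 finally show ?thesis by simp
qed

lemma FP_sdif: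
 assumes "g \<in> GP"
 shows "sdif FF DM g \<in> GP" "\<phi>P (sdif FF DM g) = dP (\<phi>P g)"
proof -
 have "sdif FF DM g \<in> GP & \<phi>P (sdif FF DM g) = dP (\<phi>P g)"
  using assms
 proof (cases rule: sym_gens_cases)
  case (1 i a)
  thus ?thesis using FF_dif by simp
 next
  case (2 i D)
  note D = 2(2)[unfolded DM_grade]
  let ?Q = "dif (Der FF) (i - n - 1) D"
  have s: "sg (- n - 1) = (eps (n+1) :: 'k)" unfolding sg_eps by (rule eps_cong) auto
  have d: "dif DM i D = scl (Der FF) (eps (n+1)) ?Q"
   using s by (simp add: algebra_simps)
  have m: "dif DM i D \<in> grade (Der FF) (i - n)"
   unfolding d using Der_scl(1)[OF Der_dif(1)[OF D]] by simp
  have "dvec (i+1) (dcoef (dif DM i D)) = dvec (i+1) (%b w. eps (n+1)*dcoefs (i - n - 1) (dcoef D) b w)"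
   by (rule dvec_cong) (simp only: d Der_scl(2)[OF Der_dif(1)[OF D]] Der_dif(2)[OF D])
  also have "... = dP (dvec i (dcoef D))" by (rule ext, rule dP_dvec[OF dcoef_coefs[OF D]])
  finally have "\<phi>P (sdif FF DM g) = dP (\<phi>P g)" by (simp only: 2(1) sdif.simps \<phi>P.simps)
  moreover have "sdif FF DM g \<in> GP" unfolding 2(1) sdif.simps sym_gensI DM_grade using m by simp
  ultimately show ?thesis by blast
 qed
 thus "sdif FF DM g \<in> GP" "\<phi>P (sdif FF DM g) = dP (\<phi>P g)" by blast+
qed

lemma PP_dif:
 assumes "P \<in> grade PP i"
 shows "dif PP i P \<in> grade PP (i+1)" "\<beta> (dif PP i P) = dP (\<beta> P)"
 using FP.E_dif[where D = Dm and Y = XP, OF Dm_deg FP_sdif assms[unfolded PP_Sym]] unfolding PP_Sym by blast+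

end

section \<open>Tensor powers in coordinates\<close>

context fin_cplx
begin

abbreviation "kf z \<equiv> koszul (map fst z)"
abbreviation "TG \<equiv> tens_gens V"
abbreviation "TU \<equiv> rel_ideal TG (tens_rels V)"
abbreviation "tcl \<equiv> tens_class V"
abbreviation "pt \<equiv> pure_tens V"

lemma TG_iff [simp]: "(i, x) \<in> TG \<longleftrightarrow> x \<in> grade V i"
 by (simp add: tens_gens_def)

lemma B_TG: "b \<in> B ==> b \<in> TG"
 using B_grade by (cases b) (auto simp: tens_gens_def)

lemma lists_B_TG: "set w <= B ==> w \<in> lists TG"
 by (induction w) (auto simp: B_TG)

lemma tcl_eq_iff: "tcl p = tcl q \<longleftrightarrow> p - q \<in> TU"
 unfolding tens_class_def by (rule quot_eq_iff[OF subspace_rel_ideal])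

lemma tcl_add [simp]: "tcl (p+q) = tcl p+tcl q"
 unfolding tens_class_def by (rule quot_add[OF subspace_rel_ideal])

lemma tcl_fscl [simp]: "tcl (fscl c p) = fscl c (tcl p)"
 unfolding tens_class_def by (rule quot_fscl[OF subspace_rel_ideal])

lemma tcl_0 [simp]: "tcl 0 = 0"
 unfolding tens_class_def by (rule quot_zero[OF subspace_rel_ideal])

lemma tcl_sum: "tcl (sum g S) = (SUM s:S. tcl (g s))"
 unfolding tens_class_def by (rule quot_sum[OF subspace_rel_ideal])

lemma tcl_tcl [simp]: "tcl (tcl p) = tcl p"
 unfolding tens_class_def by (rule quot_quot[OF subspace_rel_ideal])

text \<open>The coordinate of a pure tensor at a word of basis elements.\<close>

fun tcw :: "(int \<times> 'v) list => (int \<times> 'v) list => 'k" where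
 "tcw [] [] = 1"
| "tcw (g#w) (b#ob) = co g b*tcw w ob"
| "tcw _ _ = 0"

lemma tcw_nonzero: "tcw w ob ~= 0 ==> set ob <= B & length ob = length w & map fst ob = map fst w"
 by (induction w ob rule: tcw.induct) (auto dest: co_nonzero)

lemma tcw_append: "tcw (u@v) ob = tcw u (take (length u) ob)*tcw v (drop (length u) ob)"
proof (induction u arbitrary: ob)
 case (Cons g u)
 thus ?case by (cases ob) simp_all
qed simp

lemma tcw_basis: "set w <= B ==> tcw w ob = (if ob = w then 1 else 0)"
proof (induction w arbitrary: ob)
 case Nil
 thus ?case by (cases ob) simp_all
next
 case (Cons g w)
 thus ?case by (cases ob) (auto simp: co_basis)
qed

lemma tcw_prod: "length w = length ob ==> tcw w ob = (PROD k<length w. co (w ! k) (ob ! k))"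
proof (induction w ob rule: tcw.induct)
 case (2 g w b ob)
 thus ?case by (simp add: prod.lessThan_Suc_shift del: prod.lessThan_Suc)
qed simp_all

lemma tcw_add: "x \<in> grade V i ==> y \<in> grade V i ==>
  tcw (u@(i, x+y)#v) ob = tcw (u@(i, x)#v) ob+tcw (u@(i, y)#v) ob"
 unfolding tcw_append by (cases "drop (length u) ob") (simp_all add: co_add algebra_simps)

lemma tcw_scl: "x \<in> grade V i ==> tcw (u@(i, scl V c x)#v) ob = c*tcw (u@(i, x)#v) ob"
 unfolding tcw_append by (cases "drop (length u) ob") (simp_all add: co_scl)

definition tco :: "((int \<times> 'v) list \<Rightarrow>\<^sub>0 'k) => (int \<times> 'v) list => 'k" where
 "tco p = fext tcw p"

lemma tco_simps [simp]:
 "tco (p+q) ob = tco p ob+tco q ob" "tco (p - q) ob = tco p ob - tco q ob"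
 "tco (fscl c p) ob = c*tco p ob" "tco 0 ob = 0" "tco (word w) ob = tcw w ob"
 by (simp_all add: tco_def)

lemma tco_sum: "tco (sum g S) ob = (SUM s:S. tco (g s) ob)"
 by (simp add: tco_def fext_sum)

lemma tco_TU: "p \<in> TU ==> tco p ob = 0"
proof (induction rule: rel_ideal_induct)
 case (add c u r v q)
 from add(2) have "tco (fmul (word u) (fmul r (word v))) ob = 0"
  by cases (simp_all add: tcw_add tcw_scl)
 thus ?case using add by simp
qed simp

lemma tco_tcl [simp]: "tco (tcl p) ob = tco p ob"
proof -
 have "tcl p - p \<in> TU" using tcl_eq_iff[of "tcl p" p] by simp
 from tco_TU[OF this] show ?thesis by simp
qed

lemma tco_pt [simp]: "tco (pt w) = tcw w"
 by (simp add: pure_tens_def fun_eq_iff)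

lemma tens_rels_closed: "r \<in> tens_rels V ==> keys r <= lists TG"
proof (erule tens_rels.cases)
 fix x i y assume r: "r = word [(i, x+y)] - word [(i, x)] - word [(i, y)]" "x \<in> grade V i" "y \<in> grade V i"
 show "keys r <= lists TG" unfolding r(1)
  by (intro keys_diff_subset) (simp_all add: r gspace_add[OF gspace_V])
next
 fix x i c assume r: "r = word [(i, scl V c x)] - fscl c (word [(i, x)])" "x \<in> grade V i"
 show "keys r <= lists TG" unfolding r(1)
  by (intro keys_diff_subset subset_trans[OF keys_fscl_word]) (simp_all add: r gspace_scl[OF gspace_V])
qed

lemma keys_tcl: "keys p <= lists TG ==> keys (tcl p) <= lists TG"
proof -
 assume p: "keys p <= lists TG"
 have "tcl p - p \<in> TU" using tcl_eq_iff[of "tcl p" p] by simp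
 hence "keys (tcl p - p) <= lists TG" by (rule keys_rel_ideal) (rule tens_rels_closed)
 from keys_add_subset[OF this p] show ?thesis by simp
qed

lemma letter_expand:
 assumes x: "x \<in> grade V i"
 shows "word [(i, x)] - (SUM b:B. fscl (co (i, x) b) (word [b])) \<in> TU"
proof -
 let ?f = "%b. scl V (co (i, x) b) (snd b)"
 have z: "word [(i, 0)] \<in> TU"
  using rel_idealI[OF tens_rels.intros(2)[OF gspace_0[OF gspace_V, of i], of 0], of TG]
  by (simp add: gspace_scl_0[OF gspace_V])
 have m: "?f b \<in> grade V i" if "b \<in> B" for b
  using co_nonzero[of "(i, x)" b] B_grade[OF that] gspace_scl[OF gspace_V] gspace_0[OF gspace_V]
  by (cases "co (i, x) b = 0") auto
 have 1: "word [(i, SUM b:B. ?f b)] - (SUM b:B. word [(i, ?f b)]) \<in> TU & (SUM b:B. ?f b) \<in> grade V i"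
 proof (rule cl_word_sum[where v = "Pair i", OF subspace_rel_ideal z _ gspace_0[OF gspace_V] gspace_add[OF gspace_V] m finite_B], goal_cases)
  case (1 y z)
  thus ?case
   by (intro rel_idealI tens_rels.intros)
 qed
 have 2: "(SUM b:B. word [(i, ?f b)] - fscl (co (i, x) b) (word [b])) \<in> TU"
 proof (rule rel_ideal_sum)
  fix b assume b: "b \<in> B"
  show "word [(i, ?f b)] - fscl (co (i, x) b) (word [b]) \<in> TU"
  proof (cases "co (i, x) b = 0")
   case True
   thus ?thesis using z by simp
  next
   case False
   hence "b = (i, snd b)" using co_nonzero[of "(i, x)" b] by (cases b) simp
   moreover have "word [(i, scl V (co (i, x) b) (snd b))] - fscl (co (i, x) b) (word [(i, snd b)]) \<in> TU"
    by (intro rel_idealI tens_rels.intros) (use B_grade[OF b] \<open>b = (i, snd b)\<close> in \<open>metis fst_conv\<close>)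
   ultimately show ?thesis by metis
  qed
 qed
 from rel_ideal_add[OF conjunct1[OF 1] 2] show ?thesis
  using co_expand[OF x] by (simp add: sum_subtractf)
qed

text \<open>
 A product of vectors is expanded in the basis one slot at a time; each step is one of the linearity
 relations.
\<close>

lemma word_expand:
 "w \<in> lists TG ==> word w - (SUM ob:words B (length w). fscl (tcw w ob) (word ob)) \<in> TU"
proof (induction w)
 case Nil
 show ?case by (simp add: rel_ideal_0)
next
 case (Cons g w)
 obtain i x where g: "g = (i, x)" "x \<in> grade V i" using Cons.prems by (cases g) auto
 have w: "w \<in> lists TG" using Cons.prems by simp
 let ?S = "SUM ob:words B (length w). fscl (tcw w ob) (word ob)"
 have 1: "fmul (word [g] - (SUM b:B. fscl (co g b) (word [b]))) (word w) \<in> TU"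
  unfolding g(1) by (rule rel_ideal_word_right[OF letter_expand[OF g(2)] w])
 have 2: "(SUM b:B. fscl (co g b) (fmul (word [b]) (word w - ?S))) \<in> TU"
  by (intro rel_ideal_sum rel_ideal_fscl rel_ideal_word_left Cons.IH w) (simp add: B_TG)
 have "word (g#w) - (SUM ob:words B (length (g#w)). fscl (tcw (g#w) ob) (word ob))
   = fmul (word [g] - (SUM b:B. fscl (co g b) (word [b]))) (word w)
    +(SUM b:B. fscl (co g b) (fmul (word [b]) (word w - ?S)))"
  by (simp add: sum_words_Suc[OF finite_B] fmul_sum_left fmul_sum_right fv.scale_right_diff_distrib
    sum_subtractf fv.scale_sum_right)
 with rel_ideal_add[OF 1 2] show ?case by (simp only:)
qed

lemma tens_expand:
 assumes "keys p <= lists TG"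
 shows "EX S. finite S & S <= {ob. set ob <= B} & tcl p = (SUM ob:S. fscl (tco p ob) (pt ob))"
proof -
 let ?S = "\<Union>w\<in>keys p. words B (length w)"
 have fin: "finite ?S" using finite_words[OF finite_B] by simp
 have "tcl p = (SUM w:keys p. fscl (lookup p w) (tcl (word w)))"
  using arg_cong[OF pm_expand[of p], of tcl] by (simp add: tcl_sum)
 also have "... = (SUM w:keys p. fscl (lookup p w) (SUM ob:?S. fscl (tcw w ob) (pt ob)))"
 proof (intro sum.cong refl arg_cong[of _ _ "fscl _"])
  fix w assume w: "w \<in> keys p"
  have "tcl (word w) = tcl (SUM ob:words B (length w). fscl (tcw w ob) (word ob))"
   unfolding tcl_eq_iff by (rule word_expand) (use w assms in blast)
  also have "... = (SUM ob:words B (length w). fscl (tcw w ob) (pt ob))"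
   by (simp add: tcl_sum pure_tens_def)
  also have "... = (SUM ob:?S. fscl (tcw w ob) (pt ob))"
  proof (rule sum.mono_neutral_left[OF fin])
   show "words B (length w) <= ?S" using w by blast
   show "ALL ob:?S - words B (length w). fscl (tcw w ob) (pt ob) = 0"
    using tcw_nonzero by (auto simp: words_def)
  qed
  finally show "tcl (word w) = (SUM ob:?S. fscl (tcw w ob) (pt ob))" .
 qed
 also have "... = (SUM w:keys p. SUM ob:?S. fscl (lookup p w*tcw w ob) (pt ob))"
  by (simp add: fv.scale_sum_right)
 also have "... = (SUM ob:?S. SUM w:keys p. fscl (lookup p w*tcw w ob) (pt ob))" by (rule sum.swap)
 also have "... = (SUM ob:?S. fscl (tco p ob) (pt ob))"
  by (simp add: tco_def fext_def fv.scale_sum_left)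
 finally show ?thesis using fin by (intro exI[of _ ?S]) (auto simp: words_def)
qed

lemma tcl_eqI:
 assumes "keys p <= lists TG" "keys q <= lists TG" "!!ob. tco p ob = tco q ob" shows "tcl p = tcl q"
proof -
 have k: "keys (p - q) <= lists TG" by (rule keys_diff_subset[OF assms(1,2)])
 have "tcl (p - q) = 0" using tens_expand[OF k] assms(3) by auto
 hence "p - q - 0 \<in> TU" unfolding tcl_eq_iff[symmetric] by simp
 thus ?thesis by (simp add: tcl_eq_iff)
qed

abbreviation "gT k \<equiv> grade (Tens V k)"
abbreviation "gH m l \<equiv> grade (homl V m l)"

lemma TensE:
 assumes "t \<in> gT k j"
 shows "t = tcl t" "keys t <= lists TG" "tco t ob ~= 0 ==> ob \<in> words B k & tdeg ob = j"
proof -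
 from assms obtain p where p: "t = tcl p" "ALL w:keys p. w \<in> lists TG & tdeg w = j & length w = k"
  by (auto simp: Tens_def)
 have k: "keys p <= lists TG" using p(2) by blast
 show "t = tcl t" "keys t <= lists TG" using p(1) keys_tcl[OF k] by simp_all
 assume nz: "tco t ob ~= 0"
 moreover have "tco t ob = tco p ob" using p(1) by (simp only: tco_tcl)
 ultimately have "(SUM w:keys p. lookup p w*tcw w ob) ~= 0" by (simp add: tco_def fext_def)
 then obtain w where w: "w \<in> keys p" "lookup p w*tcw w ob ~= 0" by (meson sum.neutral)
 hence "tcw w ob ~= 0" by simp
 from tcw_nonzero[OF this] show "ob \<in> words B k & tdeg ob = j"
  using p(2) w(1) by (auto simp: words_def wdeg_def)
qed

lemma TensI:
 assumes k: "keys p <= lists TG" and nz: "!!ob. tco p ob ~= 0 ==> length ob = k & tdeg ob = j"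
 shows "tcl p \<in> gT k j"
proof -
 obtain S where S: "finite S" "S <= {ob. set ob <= B}" "tcl p = (SUM ob:S. fscl (tco p ob) (pt ob))"
  using tens_expand[OF k] by blast
 let ?q = "SUM ob:S. fscl (tco p ob) (word ob)"
 have "tcl p = tcl ?q" unfolding S(3) by (simp add: tcl_sum pure_tens_def)
 moreover have "keys ?q <= {w. w \<in> lists TG & tdeg w = j & length w = k}"
 proof (rule keys_sum_subset, goal_cases)
  case (1 ob)
  note ob = 1(1)
  show ?case
  proof (cases "tco p ob = 0")
   case False
   thus ?thesis using nz[OF False] lists_B_TG[of ob] S(2) ob
    by (intro subset_trans[OF keys_fscl_word]) auto
  qed simp
 qed
 ultimately show ?thesis unfolding Tens_def by (auto simp del: in_listsI intro!: image_eqI[where x = ?q])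
qed

lemma Tens_eqI:
 assumes "t \<in> gT k j" "t' \<in> gT k' j'" "!!ob. tco t ob = tco t' ob" shows "t = t'"
 using tcl_eqI[OF TensE(2)[OF assms(1)] TensE(2)[OF assms(2)] assms(3)] TensE(1)[OF assms(1)] TensE(1)[OF assms(2)]
 by simp

lemma Tens_basis:
 assumes t: "t \<in> gT k j"
 shows "t = (SUM ob:words B k. fscl (tco t ob) (pt ob))"
proof -
 let ?q = "SUM ob:words B k. fscl (tco t ob) (word ob)"
 have kq: "keys ?q <= lists TG"
  by (intro keys_sum_subset subset_trans[OF keys_fscl_word]) (auto simp: words_def lists_B_TG)
 have "tco ?q ob = tco t ob" for ob
 proof -
  have "tco ?q ob = (SUM ob':words B k. if ob' = ob then tco t ob else 0)"
   unfolding tco_sum by (intro sum.cong refl) (auto simp: tcw_basis words_def)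
  also have "... = tco t ob" using TensE(3)[OF t, of ob] finite_words[OF finite_B] by auto
  finally show ?thesis .
 qed
 hence "tcl t = tcl ?q" by (intro tcl_eqI TensE(2)[OF t] kq) simp
 thus ?thesis using TensE(1)[OF t] by (simp add: tcl_sum pure_tens_def)
qed

lemma pt_Tens: "w \<in> lists TG ==> pt w \<in> gT (length w) (tdeg w)"
 unfolding pure_tens_def Tens_def by auto

lemma scl_Tens [simp]: "scl (Tens V k) = fscl"
 by (simp add: Tens_def)

lemma gspace_Tens: "gspace (Tens V k)"
proof -
 have vs: "vector_space (fscl :: 'k => ((int \<times> 'v) list \<Rightarrow>\<^sub>0 'k) => _)" by (rule fv.vector_space_axioms)
 have "fv.subspace (gT k j)" for j
 proof (rule fv.subspaceI)
  show "0 \<in> gT k j" using TensI[of 0 k j] by simp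
  fix x y assume x: "x \<in> gT k j" and y: "y \<in> gT k j"
  have "tcl (x+y) \<in> gT k j"
  proof (rule TensI)
   show "keys (x+y) <= lists TG" by (intro keys_add_subset TensE(2)[OF x] TensE(2)[OF y])
   fix ob assume "tco (x+y) ob ~= 0"
   hence "tco x ob ~= 0 \<or> tco y ob ~= 0" by auto
   thus "length ob = k & tdeg ob = j" using TensE(3)[OF x] TensE(3)[OF y] by (auto simp: words_def)
  qed
  thus "x+y \<in> gT k j" using TensE(1)[OF x] TensE(1)[OF y] by simp
 next
  fix c x assume x: "x \<in> gT k j"
  have "tcl (fscl c x) \<in> gT k j"
   by (rule TensI) (use TensE[OF x] in \<open>auto simp: words_def intro!: subset_trans[OF keys_fscl]\<close>)
  thus "fscl c x \<in> gT k j" using TensE(1)[OF x] by simp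
 qed
 with vs show ?thesis by (simp add: gspace_def)
qed

lemmas Tens_add = gspace_add[OF gspace_Tens]
 and Tens_scl = gspace_scl[OF gspace_Tens, unfolded scl_Tens]
 and Tens_0 = gspace_0[OF gspace_Tens]

lemma Tens_sum: "(!!s. s \<in> S ==> f s \<in> gT k j) ==> sum f S \<in> gT k j"
 by (induction S rule: infinite_finite_induct) (auto intro: Tens_0 Tens_add)

section \<open>Multilinear maps on tensor powers\<close>

definition mlin :: "nat => ((int \<times> 'v) list => ('u \<Rightarrow>\<^sub>0 'k)) => bool" where
 "mlin k F \<longleftrightarrow> (ALL u v i x y c. u \<in> lists TG --> v \<in> lists TG --> length u+length v+1 = k -->
   x \<in> grade V i --> y \<in> grade V i -->
   F (u@(i, x+y)#v) = F (u@(i, x)#v)+F (u@(i, y)#v) &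
   F (u@(i, scl V c x)#v) = fscl c (F (u@(i, x)#v)))"

lemma mlinI:
 assumes "!!u v i x y. u \<in> lists TG ==> v \<in> lists TG ==> length u+length v+1 = k ==>
   x \<in> grade V i ==> y \<in> grade V i ==> F (u@(i, x+y)#v) = F (u@(i, x)#v)+F (u@(i, y)#v)"
  and "!!u v i x c. u \<in> lists TG ==> v \<in> lists TG ==> length u+length v+1 = k ==>
   x \<in> grade V i ==> F (u@(i, scl V c x)#v) = fscl c (F (u@(i, x)#v))"
 shows "mlin k F"
 unfolding mlin_def using assms by blast

lemma mlinD:
 assumes "mlin k F" "u \<in> lists TG" "v \<in> lists TG" "length u+length v+1 = k" "x \<in> grade V i"
 shows "y \<in> grade V i ==> F (u@(i, x+y)#v) = F (u@(i, x)#v)+F (u@(i, y)#v)"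
  "F (u@(i, scl V c x)#v) = fscl c (F (u@(i, x)#v))"
 using assms unfolding mlin_def by blast+

lemma tlin_simps [simp]:
 "tlin k F (p+q) = tlin k F p+tlin k F q" "tlin k F (p - q) = tlin k F p - tlin k F q"
 "tlin k F (fscl c p) = fscl c (tlin k F p)" "tlin k F 0 = 0"
 "tlin k F (word w) = (if length w = k then F w else 0)"
 by (simp_all add: tlin_def)

lemma tlin_sum: "tlin k F (sum g S) = (SUM s:S. tlin k F (g s))"
 by (simp add: tlin_def flin_sum)

lemma tlin_TU:
 assumes F: "mlin k F" and p: "p \<in> TU" shows "tlin k F p = 0"
 using p
proof (induction rule: rel_ideal_induct)
 case (add c u r v q)
 from add(2) have "tlin k F (fmul (word u) (fmul r (word v))) = 0"
 proof cases
  case (1 x i y)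
  show ?thesis unfolding 1(1)
   using mlinD(1)[OF F add(1,3) _ 1(2,3)] by simp
 next
  case (2 x i a)
  show ?thesis unfolding 2(1)
   using mlinD(2)[OF F add(1,3) _ 2(2), of a] by simp
 qed
 thus ?case using add by simp
qed simp

text \<open>
 A multilinear function of the slots is determined by its values on words of basis elements.
\<close>

lemma tlin_expand:
 assumes F: "mlin k F" and p: "keys p <= lists TG"
 shows "tlin k F p = (SUM ob:words B k. fscl (tco p ob) (F ob))"
 using p
proof (induction rule: pm_induct)
 case zero show ?case by simp
next
 case (add c w q)
 have "tlin k F (word w) = tlin k F (SUM ob:words B (length w). fscl (tcw w ob) (word ob))"
  using tlin_TU[OF F word_expand[OF add(1)]] by simp
 also have "... = (SUM ob:words B (length w). if length w = k then fscl (tcw w ob) (F ob) else 0)"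
  by (auto simp: tlin_sum words_def intro!: sum.cong)
 also have "... = (SUM ob:words B k. fscl (tcw w ob) (F ob))"
 proof (cases "length w = k")
  case False
  hence "tcw w ob = 0" if "ob \<in> words B k" for ob using that tcw_nonzero[of w ob] by (auto simp: words_def)
  thus ?thesis using False by simp
 qed simp
 finally show ?case using add by (simp add: fv.scale_left_distrib sum.distrib fv.scale_sum_right)
qed

lemma tlin_pt: "mlin k F ==> w \<in> words B k ==> tlin k F (pt w) = F w"
proof -
 assume F: "mlin k F" and w: "w \<in> words B k"
 have k: "keys (pt w) <= lists TG"
  unfolding pure_tens_def by (rule keys_tcl) (use w lists_B_TG in \<open>simp add: words_def\<close>)
 have "tlin k F (pt w) = (SUM ob:words B k. if ob = w then F w else 0)"
  unfolding tlin_expand[OF F k] by (intro sum.cong refl) (use w in \<open>auto simp: tcw_basis words_def\<close>)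
 thus ?thesis using w finite_words[OF finite_B] by simp
qed

lemma tlin_Tens:
 assumes F: "mlin k F" and t: "t \<in> gT k j"
  and g: "!!w. w \<in> words B k ==> tdeg w = j ==> F w \<in> gT k' j'"
 shows "tlin k F t \<in> gT k' j'"
 unfolding tlin_expand[OF F TensE(2)[OF t]]
proof (rule Tens_sum)
 fix ob assume ob: "ob \<in> words B k"
 show "fscl (tco t ob) (F ob) \<in> gT k' j'"
  using g[OF ob] TensE(3)[OF t, of ob] by (cases "tco t ob = 0") (auto intro: Tens_scl Tens_0)
qed

lemma Tens_eqI_word:
 assumes "w \<in> lists TG" "w' \<in> lists TG" "w'' \<in> lists TG"
  and "!!ob. tcw w ob = c*tcw w' ob+d*tcw w'' ob"
 shows "pt w = fscl c (pt w')+fscl d (pt w'')"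
proof -
 have "tcl (word w) = tcl (fscl c (word w')+fscl d (word w''))"
 proof (rule tcl_eqI)
  show "keys (fscl c (word w')+fscl d (word w'')) <= lists TG"
   by (intro keys_add_subset subset_trans[OF keys_fscl_word]) (simp_all add: assms)
 qed (simp_all add: assms)
 thus ?thesis by (simp add: pure_tens_def)
qed

lemma tcw_permute:
 assumes "si permutes {..<length w}"
 shows "tcw (perm si w) ob = (if length ob = length w then tcw w (perm (inv si) ob) else 0)"
proof (cases "length ob = length w")
 case True
 let ?n = "length w"
 have i: "inv si permutes {..<?n}" by (rule permutes_inv[OF assms])
 have "tcw (perm si w) ob = (PROD k<?n. co (w ! si k) (ob ! k))"
  using True by (subst tcw_prod) (auto simp: permute_list_def)
 also have "... = (PROD k<?n. co (w ! k) (ob ! inv si k))"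
 proof (rule prod.reindex_bij_betw[where h = "inv si", symmetric, THEN trans])
  show "bij_betw (inv si) {..<?n} {..<?n}" by (rule permutes_imp_bij[OF i])
  show "(PROD k<?n. co (w ! si (inv si k)) (ob ! inv si k)) = (PROD k<?n. co (w ! k) (ob ! inv si k))"
   using permutes_inverses(1)[OF assms] by simp
 qed
 also have "... = tcw w (perm (inv si) ob)"
  using True by (subst tcw_prod) (auto simp: permute_list_def)
 finally show ?thesis using True by simp
next
 case False
 thus ?thesis using tcw_nonzero[of "perm si w" ob] by auto
qed

lemma mlin_braid:
 assumes "si permutes {..<k}"
 shows "mlin k (%w. fscl (kf w si) (pt (perm si w)))"
proof (rule mlinI, goal_cases)
 case a: (1 u v i x y)
 have s: "si permutes {..<length (u@(i, z)#v)}" for z using assms a(3) by (simp add: add.commute)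
 have l: "u@(i, z)#v \<in> lists TG" if "z \<in> grade V i" for z using a that by simp
 have xy: "x+y \<in> grade V i" by (rule gspace_add[OF gspace_V a(4,5)])
 have "pt (perm si (u@(i, x+y)#v)) = fscl 1 (pt (perm si (u@(i, x)#v)))+fscl 1 (pt (perm si (u@(i, y)#v)))"
  by (rule Tens_eqI_word[OF permute_lists[OF l[OF xy] s] permute_lists[OF l[OF a(4)] s] permute_lists[OF l[OF a(5)] s]])
   (simp add: tcw_permute[OF s] tcw_add a)
 thus ?case
  by (simp add: fv.scale_right_distrib)
next
 case a: (2 u v i x c)
 have s: "si permutes {..<length (u@(i, z)#v)}" for z using assms a(3) by (simp add: add.commute)
 have l: "u@(i, z)#v \<in> lists TG" if "z \<in> grade V i" for z using a that by simp
 have xy: "scl V c x \<in> grade V i" by (rule gspace_scl[OF gspace_V a(4)])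
 have "pt (perm si (u@(i, scl V c x)#v)) = fscl c (pt (perm si (u@(i, x)#v)))+fscl 0 (pt (perm si (u@(i, x)#v)))"
  by (rule Tens_eqI_word[OF permute_lists[OF l[OF xy] s] permute_lists[OF l[OF a(4)] s] permute_lists[OF l[OF a(4)] s]])
   (simp add: tcw_permute[OF s] tcw_scl a)
 thus ?case
  by (simp add: mult.commute)
qed

lemma braid_Tens:
 assumes s: "si permutes {..<k}" and t: "t \<in> gT k j"
 shows "braid V k si t \<in> gT k j"
 unfolding braid_def
proof (rule tlin_Tens[OF mlin_braid[OF s] t], goal_cases)
 case (1 w)
 note w = 1(1-2)
 have s': "si permutes {..<length w}" using s w by (simp add: words_def)
 have "perm si w \<in> lists TG" using lists_B_TG permute_words[OF w(1) s] by (simp add: words_def)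
 from pt_Tens[OF this] have "pt (perm si w) \<in> gT k j"
  using w wdeg_permute[OF s', of fst] by (simp add: words_def)
 thus ?case by (rule Tens_scl)
qed

lemma braid_pt: "si permutes {..<k} ==> w \<in> words B k ==>
  braid V k si (pt w) = fscl (kf w si) (pt (perm si w))"
 unfolding braid_def by (rule tlin_pt[OF mlin_braid])

text \<open>
 By linearity it suffices to take t a pure tensor of basis elements, which the braiding permutes
 with the Koszul sign.
\<close>

lemma tco_braid:
 assumes s: "si permutes {..<k}" and t: "t \<in> gT k j" and ob: "ob \<in> words B k"
 shows "tco (braid V k si t) (perm si ob) = kf ob si*tco t ob"
proof -
 have lo: "length ob = k" using ob by (simp add: words_def)
 have so: "si permutes {..<length ob}" using s lo by simp
 have "tco (braid V k si t) (perm si ob)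
   = (SUM ob':words B k. tco t ob'*(kf ob' si*tcw (perm si ob') (perm si ob)))"
  unfolding braid_def tlin_expand[OF mlin_braid[OF s] TensE(2)[OF t]] by (simp add: tco_sum mult.assoc)
 also have "... = (SUM ob':words B k. if ob' = ob then kf ob si*tco t ob else 0)"
 proof (intro sum.cong refl, goal_cases)
  case (1 ob')
  note o' = 1(1)
  have s': "si permutes {..<length ob'}" using s o' by (simp add: words_def)
  have "tcw (perm si ob') (perm si ob) = (if ob = ob' then 1 else 0)"
   unfolding tcw_permute[OF s'] permute_inv(2)[OF so] using o' lo by (auto simp: words_def tcw_basis)
  thus ?case by simp
 qed
 also have "... = kf ob si*tco t ob" using ob finite_words[OF finite_B] by simp
 finally show ?thesis .
qed

section \<open>Matrices of maps between tensor powers\<close>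

definition mat :: "(int => ((int \<times> 'v) list \<Rightarrow>\<^sub>0 'k) => ((int \<times> 'v) list \<Rightarrow>\<^sub>0 'k)) => (int \<times> 'v) list => (int \<times> 'v) list => 'k" where
 "mat L ob y = tco (L (tdeg y) (pt y)) ob"

lemma pt_words: "y \<in> words B l ==> pt y \<in> gT l (tdeg y)"
 using pt_Tens[of y] lists_B_TG by (auto simp: words_def)

lemma hom_sum:
 assumes L: "L \<in> gH m l e" and f: "!!s. s \<in> S ==> f s \<in> gT l j" and "finite S"
 shows "L j (sum f S) = (SUM s:S. L j (f s))"
 using assms(3,2)
proof (induction S)
 case empty
 show ?case using hom_gradeD(5)[OF L Tens_0, of j 0] by simp
next
 case (insert s S)
 have "L j (f s+sum f S) = L j (f s)+L j (sum f S)"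
  by (rule hom_gradeD(4)[OF L]) (use insert in \<open>auto intro: Tens_sum\<close>)
 thus ?case using insert by simp
qed

lemma hom_expand:
 assumes L: "L \<in> gH m l e" and t: "t \<in> gT l j"
 shows "L j t = (SUM y:words B l. fscl (tco t y) (L (tdeg y) (pt y)))"
proof -
 have m: "fscl (tco t y) (pt y) \<in> gT l j" if "y \<in> words B l" for y
  using TensE(3)[OF t, of y] pt_words[OF that] by (cases "tco t y = 0") (auto intro: Tens_scl Tens_0)
 have "L j t = L j (SUM y:words B l. fscl (tco t y) (pt y))" using Tens_basis[OF t] by simp
 also have "... = (SUM y:words B l. L j (fscl (tco t y) (pt y)))"
  by (rule hom_sum[OF L m finite_words[OF finite_B]])
 also have "... = (SUM y:words B l. fscl (tco t y) (L (tdeg y) (pt y)))"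
 proof (intro sum.cong refl, goal_cases)
  case (1 y)
  note y = 1(1)
  show ?case
  proof (cases "tco t y = 0")
   case True
   thus ?thesis using hom_gradeD(5)[OF L Tens_0, of j 0] by simp
  next
   case False
   hence j: "j = tdeg y" using TensE(3)[OF t] by blast
   show ?thesis unfolding j using hom_gradeD(5)[OF L pt_words[OF y], of "tco t y"] by simp
  qed
 qed
 finally show ?thesis .
qed

lemma tco_hom:
 assumes L: "L \<in> gH m l e" and t: "t \<in> gT l j"
 shows "tco (L j t) ob = (SUM y:words B l. tco t y*mat L ob y)"
 unfolding hom_expand[OF L t] by (simp add: tco_sum mat_def)

lemma mat_nonzero:
 assumes L: "L \<in> gH m l e" and y: "y \<in> words B l" and nz: "mat L ob y ~= 0"
 shows "ob \<in> words B m" "tdeg ob = tdeg y+e"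
 using TensE(3)[OF hom_gradeD(1)[OF L pt_words[OF y]]] nz unfolding mat_def by blast+

text \<open>
 The tensor words in the basis span the tensor power, and the coordinates separate its elements.
\<close>

lemma hom_eqI:
 assumes L: "L \<in> gH m l e" and L': "L' \<in> gH m l e'"
  and eq: "!!ob y. ob \<in> words B m ==> y \<in> words B l ==> mat L ob y = mat L' ob y"
 shows "L = L'"
proof (intro ext)
 fix j t
 show "L j t = L' j t"
 proof (cases "t \<in> gT l j")
  case True
  show ?thesis
  proof (rule Tens_eqI[OF hom_gradeD(1)[OF L True] hom_gradeD(1)[OF L' True]])
   fix ob
   show "tco (L j t) ob = tco (L' j t) ob"
    unfolding tco_hom[OF L True] tco_hom[OF L' True]
   proof (intro sum.cong refl)
    fix y assume y: "y \<in> words B l"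
    show "tco t y*mat L ob y = tco t y*mat L' ob y"
     using eq[OF _ y] mat_nonzero(1)[OF L y] mat_nonzero(1)[OF L' y] by metis
   qed
  qed
 next
  case False
  thus ?thesis using hom_gradeD(3)[OF L] hom_gradeD(3)[OF L'] by simp
 qed
qed

text \<open>
 The map with a given matrix; inputs outside of the degree in question go to 0, as for all graded
 maps.
\<close>

definition homm :: "nat => nat => ((int \<times> 'v) list => (int \<times> 'v) list => 'k)
  => int => ((int \<times> 'v) list \<Rightarrow>\<^sub>0 'k) => ((int \<times> 'v) list \<Rightarrow>\<^sub>0 'k)" where
 "homm m l c j t = (if t \<in> gT l j
   then SUM y:words B l. fscl (tco t y) (SUM ob:words B m. fscl (c ob y) (pt ob)) else 0)"

lemma homm:
 assumes c: "!!ob y. ob \<in> words B m ==> y \<in> words B l ==> c ob y ~= 0 ==> tdeg ob = tdeg y+e"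
 shows "homm m l c \<in> gH m l e"
  "ob \<in> words B m ==> y \<in> words B l ==> mat (homm m l c) ob y = c ob y"
proof -
 have d: "(SUM ob:words B m. fscl (c ob y) (pt ob)) \<in> gT m (tdeg y+e)" if y: "y \<in> words B l" for y
 proof (rule Tens_sum)
  fix ob assume ob: "ob \<in> words B m"
  show "fscl (c ob y) (pt ob) \<in> gT m (tdeg y+e)"
   using c[OF ob y] pt_words[OF ob] by (cases "c ob y = 0") (auto intro: Tens_scl Tens_0)
 qed
 show "homm m l c \<in> gH m l e"
 proof (rule hom_gradeI)
  fix j t assume t: "t \<in> gT l j"
  show "homm m l c j t \<in> gT m (j+e)"
  proof -
   have "fscl (tco t y) (SUM ob:words B m. fscl (c ob y) (pt ob)) \<in> gT m (j+e)" if y: "y \<in> words B l" for y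
    using d[OF y] TensE(3)[OF t, of y] by (cases "tco t y = 0") (auto intro: Tens_scl Tens_0)
   thus ?thesis using t by (auto simp: homm_def intro: Tens_sum)
  qed
 next
  fix j x y assume x: "x \<in> gT l j" and y: "y \<in> gT l j"
  thus "homm m l c j (x+y) = homm m l c j x+homm m l c j y"
   using Tens_add[OF x y] by (simp only: homm_def if_True tco_simps fv.scale_left_distrib sum.distrib)
 next
  fix j x a assume x: "x \<in> gT l j"
  thus "homm m l c j (scl (Tens V l) a x) = scl (Tens V m) a (homm m l c j x)"
   using Tens_scl[OF x, of a]
   by (simp only: homm_def if_True scl_Tens tco_simps fv.scale_sum_right[of a] fv.scale_scale[symmetric])
 qed (simp add: homm_def)
 assume ob: "ob \<in> words B m" and y: "y \<in> words B l"
 have "mat (homm m l c) ob y = (SUM y':words B l. tcw y y'*(SUM ob':words B m. c ob' y'*tcw ob' ob))"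
  unfolding mat_def homm_def using pt_words[OF y] by (simp add: tco_sum)
 also have "... = (SUM y':words B l. if y' = y then c ob y else 0)"
 proof (intro sum.cong refl, goal_cases)
  case (1 y')
  note y' = 1(1)
  have "(SUM ob':words B m. c ob' y'*tcw ob' ob) = (SUM ob':words B m. if ob' = ob then c ob y' else 0)"
   by (intro sum.cong refl) (auto simp: words_def tcw_basis)
  also have "... = c ob y'" using ob finite_words[OF finite_B] by simp
  finally show ?case
   using y by (auto simp: words_def tcw_basis)
 qed
 also have "... = c ob y" using y finite_words[OF finite_B] by simp
 finally show "mat (homm m l c) ob y = c ob y" .
qed

text \<open>The symmetry conditions in terms of matrices.\<close>

lemma hom_symD:
 assumes L: "L \<in> hom_sym V n m l e" and ob: "ob \<in> words B m" and y: "y \<in> words B l"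
 shows "si permutes {..<l} ==> mat L ob (perm si y) = kf y si*perm_sgn si*mat L ob y"
  "ro permutes {..<m} ==> mat L (perm ro ob) y = kf ob ro*perm_sgn ro powi n*mat L ob y"
proof -
 have g: "L \<in> gH m l e" using L by (simp add: hom_sym_def)
 note p = pt_words[OF y]
 {
  assume s: "si permutes {..<l}"
  have s': "si permutes {..<length y}" using s y by (simp add: words_def)
  have py: "perm si y \<in> words B l" by (rule permute_words[OF y s])
  have td: "tdeg (perm si y) = tdeg y" by (rule wdeg_permute[OF s'])
  have "L (tdeg y) (braid V l si (pt y)) = fscl (perm_sgn si) (L (tdeg y) (pt y))"
   using L s p by (simp add: hom_sym_def)
  moreover have "L (tdeg y) (braid V l si (pt y)) = fscl (kf y si) (L (tdeg y) (pt (perm si y)))"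
   unfolding braid_pt[OF s y] using hom_gradeD(5)[OF g pt_words[OF py], of "kf y si"] td by simp
  ultimately have "tco (fscl (kf y si) (L (tdeg y) (pt (perm si y)))) ob
    = tco (fscl (perm_sgn si) (L (tdeg y) (pt y))) ob" by simp
  hence "kf y si*mat L ob (perm si y) = perm_sgn si*mat L ob y"
   by (simp add: mat_def td)
  thus "mat L ob (perm si y) = kf y si*perm_sgn si*mat L ob y"
   by (metis koszul_self(2) mult.assoc)
 }
 {
  assume r: "ro permutes {..<m}"
  have "braid V m ro (L (tdeg y) (pt y)) = fscl (perm_sgn ro powi n) (L (tdeg y) (pt y))"
   using L r p by (simp add: hom_sym_def)
  hence "tco (braid V m ro (L (tdeg y) (pt y))) (perm ro ob) = perm_sgn ro powi n*mat L (perm ro ob) y"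
   by (simp add: mat_def)
  hence e: "kf ob ro*mat L ob y = perm_sgn ro powi n*mat L (perm ro ob) y"
   unfolding tco_braid[OF r hom_gradeD(1)[OF g p] ob] mat_def by simp
  have "(perm_sgn ro powi n :: 'k)*perm_sgn ro powi n = 1"
   using perm_sgn_cases[of ro, where ?'k = 'k] by (auto simp: power_int_minus_left)
  thus "mat L (perm ro ob) y = kf ob ro*perm_sgn ro powi n*mat L ob y"
   using e by (metis (no_types, lifting) mult.assoc mult.commute mult_1)
 }
qed

lemma hom_symI:
 assumes L: "L \<in> gH m l e"
  and s: "!!si ob y. si permutes {..<l} ==> ob \<in> words B m ==> y \<in> words B l ==>
   mat L ob (perm si y) = kf y si*perm_sgn si*mat L ob y"
  and r: "!!ro ob y. ro permutes {..<m} ==> ob \<in> words B m ==> y \<in> words B l ==>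
   mat L (perm ro ob) y = kf ob ro*perm_sgn ro powi n*mat L ob y"
 shows "L \<in> hom_sym V n m l e"
 unfolding hom_sym_def
proof (intro CollectI conjI allI impI ballI L)
 fix si j t assume si: "si permutes {..<l}" and t: "t \<in> gT l j"
 have bt: "braid V l si t \<in> gT l j" by (rule braid_Tens[OF si t])
 show "L j (braid V l si t) = fscl (perm_sgn si) (L j t)"
 proof (rule Tens_eqI[OF hom_gradeD(1)[OF L bt] Tens_scl[OF hom_gradeD(1)[OF L t]]], goal_cases)
  case (1 ob)
  have bij: "bij_betw (perm si) (words B l) (words B l)"
  proof (rule bij_betw_byWitness[where f' = "perm (inv si)"])
   show "perm si ` words B l <= words B l" "perm (inv si) ` words B l <= words B l"
    using permute_words si permutes_inv[OF si] by blast+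
  qed (use si permute_inv in \<open>auto simp: words_def\<close>)
  have "tco (L j (braid V l si t)) ob = (SUM y:words B l. tco (braid V l si t) (perm si y)*mat L ob (perm si y))"
   unfolding tco_hom[OF L bt] by (rule sum.reindex_bij_betw[OF bij, symmetric])
  also have "... = (SUM y:words B l. perm_sgn si*(tco t y*mat L ob y))"
  proof (intro sum.cong refl)
   fix y assume y: "y \<in> words B l"
   have py: "perm si y \<in> words B l" by (rule permute_words[OF y si])
   have "mat L ob (perm si y) = kf y si*perm_sgn si*mat L ob y"
    using s[OF si _ y] mat_nonzero(1)[OF L y] mat_nonzero(1)[OF L py] by (metis mult_zero_right)
   thus "tco (braid V l si t) (perm si y)*mat L ob (perm si y) = perm_sgn si*(tco t y*mat L ob y)"
    unfolding tco_braid[OF si t y] by (simp add: mult.assoc mult.left_commute)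
  qed
  also have "... = tco (fscl (perm_sgn si) (L j t)) ob"
   by (simp add: tco_hom[OF L t] sum_distrib_left)
  finally show ?case .
 qed
next
 fix ro j t assume ro: "ro permutes {..<m}" and t: "t \<in> gT l j"
 have Lt: "L j t \<in> gT m (j+e)" by (rule hom_gradeD(1)[OF L t])
 show "braid V m ro (L j t) = fscl (perm_sgn ro powi n) (L j t)"
 proof (rule Tens_eqI[OF braid_Tens[OF ro Lt] Tens_scl[OF Lt]], goal_cases)
  case (1 ob)
  show ?case
  proof (cases "ob \<in> words B m")
   case True
   define o' where "o' = perm (inv ro) ob"
   have o': "o' \<in> words B m" unfolding o'_def by (rule permute_words[OF True permutes_inv[OF ro]])
   have ob: "ob = perm ro o'" unfolding o'_def
    using permute_inv(1)[of ro ob] ro True by (simp add: words_def)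
   have "tco (L j t) ob = kf o' ro*perm_sgn ro powi n*tco (L j t) o'"
    unfolding tco_hom[OF L t] ob sum_distrib_left
    by (intro sum.cong refl) (simp add: r[OF ro o'] mult.left_commute)
   moreover have "(perm_sgn ro powi n :: 'k)*perm_sgn ro powi n = 1"
    using perm_sgn_cases[of ro, where ?'k = 'k] by (auto simp: power_int_minus_left)
   moreover have "tco (braid V m ro (L j t)) ob = kf o' ro*tco (L j t) o'"
    unfolding ob by (rule tco_braid[OF ro Lt o'])
   ultimately show ?thesis
    by (simp add: mult.assoc mult.left_commute)
  next
   case False
   hence "tco (braid V m ro (L j t)) ob = 0" "tco (L j t) ob = 0"
    using TensE(3)[OF braid_Tens[OF ro Lt], of ob] TensE(3)[OF Lt, of ob] by blast+
   thus ?thesis by simp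
  qed
 qed
qed


section \<open>Differentials on tensor powers and on maps between them\<close>

abbreviation dV :: "(int \<times> 'v) list => ((int \<times> 'v) list \<Rightarrow>\<^sub>0 'k)" where
 "dV \<equiv> dword fst (%(i, x). (i+1, dif V i x))"

lemma tco_fmul_letter: "tco (fmul (word [g]) p) ob = (case ob of [] => 0 | b#ob' => co g b*tco p ob')"
proof (induction p rule: pm_induct_all)
 case (add c v q)
 thus ?case by (cases ob) (simp_all add: algebra_simps)
qed (simp split: list.split)

lemma dV_Cons: "dV ((i, x)#w) = word ((i+1, dif V i x)#w)+fscl (eps i) (fmul (word [(i, x)]) (dV w))"
 unfolding dword_def
 by (simp add: sum.lessThan_Suc_shift fmul_sum_right fv.scale_sum_right sg_eps eps_add del: sum.lessThan_Suc)

lemma keys_dV: "w \<in> lists TG ==> keys (dV w) <= lists TG"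
proof (induction w)
 case (Cons g w)
 obtain i x where g: "g = (i, x)" "x \<in> grade V i" using Cons.prems by (cases g) auto
 have IH: "keys (dV w) <= lists TG" and wl: "w \<in> lists TG" using Cons by simp_all
 have "keys (fmul (word [(i, x)]) (dV w)) <= lists TG"
  by (rule keys_fmul[where S = "lists TG" and T = "lists TG"]) (use g IH in simp_all)
 thus ?case unfolding g dV_Cons
  by (intro keys_add_subset subset_trans[OF keys_fscl]) (simp_all add: dif_V(1)[OF g(2)] wl)
qed (simp add: dword_def)

lemma tco_dV: "w \<in> lists TG ==> tco (dV w) ob = dC fst B dm (tcw w) ob"
proof (induction w arbitrary: ob)
 case Nil
 have "tcw [] u = shone u" for u :: "(int \<times> 'v) list" by (cases u) (simp_all add: shone_def)
 hence "tcw [] = shone" by (rule ext)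
 thus ?case by (simp add: dword_def dC_one)
next
 case (Cons g w)
 obtain i x where g: "g = (i, x)" "x \<in> grade V i" using Cons.prems by (cases g) auto
 have wl: "w \<in> lists TG" using Cons.prems by simp
 show ?case
 proof (cases ob)
  case Nil
  thus ?thesis unfolding g dV_Cons by (simp add: tco_fmul_letter)
 next
  case (Cons b o')
  have "dC fst B dm (tcw (g#w)) ob = (SUM b':B. co g b'*dm b' b)*tcw w o'+eps (fst b)*(co g b*dC fst B dm (tcw w) o')"
   unfolding Cons by (simp add: dC_scale sum_distrib_right mult.left_commute mult.assoc)
  moreover have "eps (fst b)*co g b = eps i*co g b"
   using co_nonzero[of g b] g by (cases "co g b = 0") auto
  ultimately show ?thesis unfolding g dV_Cons Cons
   by (simp add: tco_fmul_letter co_dif[OF g(2)] Cons.IH[OF wl] g(1) mult.assoc[symmetric])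
 qed
qed

lemma dC_nonzero:
 assumes "dC deg' X D f w ~= 0" and D: "!!x' x. D x' x ~= 0 ==> h x = h x'+(c :: int)"
 shows "EX w'. f w' ~= 0 & length w' = length w & wdeg h w = wdeg h w'+c"
 using assms(1)
proof (induction w arbitrary: f)
 case (Cons x w)
 have "\<not> ((SUM x':X. D x' x*f (x'#w)) = 0 & dC deg' X D (%u. f (x#u)) w = 0)"
 proof
  assume a: "(SUM x':X. D x' x*f (x'#w)) = 0 & dC deg' X D (%u. f (x#u)) w = 0"
  show False using Cons.prems unfolding dC.simps conjunct1[OF a] conjunct2[OF a] by simp
 qed
 then consider "(SUM x':X. D x' x*f (x'#w)) ~= 0" | "dC deg' X D (%u. f (x#u)) w ~= 0" by blast
 thus ?case
 proof cases
  case 1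
  then obtain x' where "D x' x*f (x'#w) ~= 0" by (meson sum.neutral)
  thus ?thesis using D[of x' x] by (intro exI[of _ "x'#w"]) auto
 next
  case 2
  from Cons.IH[OF this] obtain w' where "f (x#w') ~= 0" "length w' = length w" "wdeg h w = wdeg h w'+c" by blast
  thus ?thesis by (intro exI[of _ "x#w'"]) auto
 qed
qed simp

lemma dif_Tens:
 assumes t: "t \<in> gT k j"
 shows "dif (Tens V k) j t \<in> gT k (j+1)" (is ?P1) "tco (dif (Tens V k) j t) ob = dC fst B dm (tco t) ob" (is ?P2)
proof -
 have kt: "keys t <= lists TG" by (rule TensE(2)[OF t])
 have e: "dif (Tens V k) j t = tcl (flin dV t)" by (simp add: Tens_def)
 have c: "tco (flin dV t) ob = dC fst B dm (tco t) ob" for ob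
  using kt
 proof (induction rule: pm_induct)
  case zero
  show ?case by (simp add: dC_zero)
 next
  case (add c v q)
  have "tco (fscl c (word v)+q) = (%u. c*tcw v u+tco q u)" by (rule ext) simp
  thus ?case using add by (simp add: tco_dV dC_add dC_scale)
 qed
 show ?P2 unfolding e by (simp add: c)
 show ?P1 unfolding e
 proof (rule TensI)
  show "keys (flin dV t) <= lists TG" by (rule keys_flin_subset) (use kt keys_dV in blast)
  fix ob assume "tco (flin dV t) ob ~= 0"
  hence "dC fst B dm (tco t) ob ~= 0" unfolding c .
  from dC_nonzero[OF this, of fst 1] obtain w' where "tco t w' ~= 0" "length w' = length ob" "tdeg ob = tdeg w'+1"
   by (auto dest: dm_nonzero)
  thus "length ob = k & tdeg ob = j+1" using TensE(3)[OF t, of w'] by (auto simp: words_def)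
 qed
qed

lemma dif_Tens_lin:
 "dif (Tens V k) j (x+y) = dif (Tens V k) j x+dif (Tens V k) j y" "dif (Tens V k) j (fscl c x) = fscl c (dif (Tens V k) j x)"
 by (simp_all add: Tens_def)

text \<open>Precomposition with the differential transposes it.\<close>

lemma dC_transpose:
 "y \<in> words B l ==> (SUM w:words B l. dC fst B dm (tcw y) w*f w) = dC fst B (%b b'. dm b' b) f y"
proof (induction l arbitrary: y f)
 case 0
 thus ?case by (simp add: words_0 words_def)
next
 case (Suc l)
 then obtain x z where y: "y = x#z" "x \<in> B" "z \<in> words B l" by (cases y) (auto simp: words_def)
 have tz: "tcw z w = (if w = z then 1 else 0)" for w using y(3) by (simp add: words_def tcw_basis)
 have cx: "co x b = (if b = x then 1 else 0)" for b by (cases "b \<in> B") (use co_basis[OF y(2)] in auto)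
 have fw: "finite (words B l)" by (rule finite_words[OF finite_B])
 have "(SUM w:words B (Suc l). dC fst B dm (tcw y) w*f w)
   = (SUM b:B. SUM w:words B l. (SUM b':B. dm b' b*(co x b'*tcw z w))*f (b#w)
    +eps (fst b)*(co x b*dC fst B dm (tcw z) w)*f (b#w))"
  unfolding sum_words_Suc[OF finite_B] y(1) by (simp add: dC_scale distrib_right)
 also have "... = (SUM b:B. dm x b*f (b#z))+(SUM b:B. if b = x then eps (fst x)*(SUM w:words B l. dC fst B dm (tcw z) w*f (x#w)) else 0)"
  unfolding sum.distrib
 proof (intro arg_cong2[of _ _ _ _ "(+)"] sum.cong refl)
  fix b
  have i: "(SUM b':B. dm b' b*(co x b'*tcw z w))*f (b#w) = (if w = z then dm x b*f (b#z) else 0)" for w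
  proof -
   have "(SUM b':B. dm b' b*(co x b'*tcw z w)) = (SUM b':B. if b' = x then (if w = z then dm x b else 0) else 0)"
    by (intro sum.cong refl) (auto simp: cx tz)
   also have "... = (if w = z then dm x b else 0)" using y(2) finite_B by simp
   finally show ?thesis by simp
  qed
  show "(SUM w:words B l. (SUM b':B. dm b' b*(co x b'*tcw z w))*f (b#w)) = dm x b*f (b#z)"
   unfolding i using y(3) fw by simp
  show "(SUM w:words B l. eps (fst b)*(co x b*dC fst B dm (tcw z) w)*f (b#w))
    = (if b = x then eps (fst x)*(SUM w:words B l. dC fst B dm (tcw z) w*f (x#w)) else 0)"
   by (simp add: cx sum_distrib_left mult.assoc)
 qed
 also have "... = dC fst B (%b b'. dm b' b) f y"
  unfolding Suc.IH[OF y(3)] using y finite_B by (simp add: y(1))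
 finally show ?case .
qed

text \<open>
 The differential on tensor words is a signed sum over the slots, which is the derivation
 \<open>dC\<close> of the matrix in its outputs; on the inputs it appears transposed.
\<close>

lemma dif_hom:
 assumes L: "L \<in> gH m l e"
 shows "dif (homl V m l) e L \<in> gH m l (e+1)" (is ?P1)
  and "y \<in> words B l ==> mat (dif (homl V m l) e L) ob y
   = dC fst B dm (%ob. mat L ob y) ob - eps e*dC fst B (%b b'. dm b' b) (mat L ob) y"
proof -
 have ev: "dif (homl V m l) e L j t = dif (Tens V m) (j+e) (L j t) - fscl (eps e) (L (j+1) (dif (Tens V l) j t))"
  if "t \<in> gT l j" for j t
  using that by (simp add: hom_cplx_def sg_eps)
 show ?P1
 proof (rule hom_gradeI)
  fix j t assume t: "t \<in> gT l j"
  have "dif (Tens V m) (j+e) (L j t)+fscl (-1) (fscl (eps e) (L (j+1) (dif (Tens V l) j t))) \<in> gT m (j+(e+1))"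
   using dif_Tens(1)[OF hom_gradeD(1)[OF L t]] hom_gradeD(1)[OF L dif_Tens(1)[OF t]]
   by (intro Tens_add Tens_scl) (simp_all add: add_ac)
  thus "dif (homl V m l) e L j t \<in> gT m (j+(e+1))" unfolding ev[OF t]
   by (simp del: fv.scale_scale)
 next
  fix j x y assume x: "x \<in> gT l j" and y: "y \<in> gT l j"
  show "dif (homl V m l) e L j (x+y) = dif (homl V m l) e L j x+dif (homl V m l) e L j y"
   unfolding ev[OF x] ev[OF y] ev[OF Tens_add[OF x y]] hom_gradeD(4)[OF L x y] dif_Tens_lin
    hom_gradeD(4)[OF L dif_Tens(1)[OF x] dif_Tens(1)[OF y]]
   by (simp add: fv.scale_right_distrib)
 next
  fix j c x assume x: "x \<in> gT l j"
  show "dif (homl V m l) e L j (scl (Tens V l) c x) = scl (Tens V m) c (dif (homl V m l) e L j x)"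
   using hom_gradeD(5)[OF L x, of c] hom_gradeD(5)[OF L dif_Tens(1)[OF x], of c]
   by (simp add: ev[OF x] ev[OF Tens_scl[OF x]] dif_Tens_lin fv.scale_right_diff_distrib mult.commute)
 qed (simp add: hom_cplx_def)
 assume y: "y \<in> words B l"
 note p = pt_words[OF y]
 have "tco (L (tdeg y+1) (dif (Tens V l) (tdeg y) (pt y))) ob = dC fst B (%b b'. dm b' b) (mat L ob) y"
  unfolding tco_hom[OF L dif_Tens(1)[OF p]] dC_transpose[OF y, symmetric] dif_Tens(2)[OF p] by simp
 moreover have "(%ob. mat L ob y) = tco (L (tdeg y) (pt y))" by (simp add: mat_def)
 ultimately show "mat (dif (homl V m l) e L) ob y
   = dC fst B dm (%ob. mat L ob y) ob - eps e*dC fst B (%b b'. dm b' b) (mat L ob) y"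
  unfolding mat_def[of "dif (homl V m l) e L"] ev[OF p] tco_simps dif_Tens(2)[OF hom_gradeD(1)[OF L p]] by simp
qed

section \<open>The operation star in matrix form\<close>

lemma tco_fmul: "tco (fmul a b) ob = (SUM s<=length ob. tco a (take s ob)*tco b (drop s ob))"
proof (induction a rule: pm_induct_all)
 case (add c u q)
 have "tco (fmul (word u) b) ob = (SUM s<=length ob. tcw u (take s ob)*tco b (drop s ob))"
 proof (induction b rule: pm_induct_all)
  case (add d v r)
  have "(SUM s<=length ob. tcw u (take s ob)*tcw v (drop s ob))
    = (SUM s<=length ob. if s = length u then tcw u (take s ob)*tcw v (drop s ob) else 0)"
   using tcw_nonzero[of u] by (intro sum.cong refl) force
  also have "... = tcw (u@v) ob"
   unfolding tcw_append using tcw_nonzero[of u ob] by (cases "length u <= length ob") force+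
  finally show ?case using add
   by (simp add: distrib_left sum.distrib mult.left_commute[of _ d] sum_distrib_left[symmetric])
 qed simp
 thus ?case using add by (simp add: distrib_right sum.distrib sum_distrib_left mult.assoc)
qed simp

lemma fmul_Tens:
 assumes a: "a \<in> gT p i" and b: "b \<in> gT q j"
 shows "tcl (fmul a b) \<in> gT (p+q) (i+j)" (is ?P1)
  "tco (fmul a b) ob = tco a (take p ob)*tco b (drop p ob)"
  "keys (fmul a b) <= lists TG"
proof -
 show e: "tco (fmul a b) ob = tco a (take p ob)*tco b (drop p ob)" for ob
 proof -
  have "tco (fmul a b) ob = (SUM s<=length ob. if s = p then tco a (take p ob)*tco b (drop p ob) else 0)"
   unfolding tco_fmul using TensE(3)[OF a] by (intro sum.cong refl) (force simp: words_def)
  thus ?thesis using TensE(3)[OF a, of "take p ob"] by (auto simp: words_def min_def split: if_splits)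
 qed
 show k: "keys (fmul a b) <= lists TG"
  by (rule keys_fmul[OF TensE(2)[OF a] TensE(2)[OF b]]) simp
 show ?P1
 proof (rule TensI[OF k])
  fix ob assume "tco (fmul a b) ob ~= 0"
  hence "take p ob \<in> words B p & tdeg (take p ob) = i" "drop p ob \<in> words B q & tdeg (drop p ob) = j"
   unfolding e using TensE(3)[OF a] TensE(3)[OF b] by auto
  moreover have "tdeg ob = tdeg (take p ob)+tdeg (drop p ob)"
   by (metis append_take_drop_id wdeg_simps(3))
  ultimately show "length ob = p+q & tdeg ob = i+j" by (auto simp: words_def min_def split: if_splits)
 qed
qed

lemma take_lists: "w \<in> lists A ==> take k w \<in> lists A"
 and drop_lists: "w \<in> lists A ==> drop k w \<in> lists A"
 by (auto dest: in_set_takeD in_set_dropD)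

text \<open>Each tensor slot is linear, also when it lies in one of the two blocks of a tensor product of maps.\<close>

lemma pt_slot:
 assumes "u \<in> lists TG" "v \<in> lists TG" "x \<in> grade V i"
 shows "y \<in> grade V i ==> pt (u@(i, x+y)#v) = pt (u@(i, x)#v)+pt (u@(i, y)#v)"
  "pt (u@(i, scl V c x)#v) = fscl c (pt (u@(i, x)#v))"
 using Tens_eqI_word[of "u@(i, x+y)#v" "u@(i, x)#v" "u@(i, y)#v" 1 1]
  Tens_eqI_word[of "u@(i, scl V c x)#v" "u@(i, x)#v" "u@(i, x)#v" c 0]
 by (simp_all add: assms gspace_add[OF gspace_V] gspace_scl[OF gspace_V] tcw_add tcw_scl)

lemma hom_slot:
 assumes L: "L \<in> gH m k e" and a: "u \<in> lists TG" "v \<in> lists TG" "x \<in> grade V i" "length u+length v+1 = k"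
 shows "y \<in> grade V i ==> L (tdeg u+(i+tdeg v)) (pt (u@(i, x+y)#v))
   = L (tdeg u+(i+tdeg v)) (pt (u@(i, x)#v))+L (tdeg u+(i+tdeg v)) (pt (u@(i, y)#v))"
  "L (tdeg u+(i+tdeg v)) (pt (u@(i, scl V c x)#v)) = fscl c (L (tdeg u+(i+tdeg v)) (pt (u@(i, x)#v)))" (is ?P1)
proof -
 have p: "pt (u@(i, z)#v) \<in> gT k (tdeg u+(i+tdeg v))" if "z \<in> grade V i" for z
  using pt_Tens[of "u@(i, z)#v"] a that by simp
 show "y \<in> grade V i ==> L (tdeg u+(i+tdeg v)) (pt (u@(i, x+y)#v))
   = L (tdeg u+(i+tdeg v)) (pt (u@(i, x)#v))+L (tdeg u+(i+tdeg v)) (pt (u@(i, y)#v))"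
  unfolding pt_slot(1)[OF a(1,2,3)] by (rule hom_gradeD(4)[OF L p[OF a(3)] p])
 show ?P1
  unfolding pt_slot(2)[OF a(1,2,3)] using hom_gradeD(5)[OF L p[OF a(3)], of c] by simp
qed

lemma mlin_tens_map:
 assumes L: "L \<in> gH p' p d" and L': "L' \<in> gH q' q e"
 shows "mlin (p+q) (%w. fscl (eps (e*tdeg (take p w)))
    (tcl (fmul (L (tdeg (take p w)) (pt (take p w))) (L' (tdeg (drop p w)) (pt (drop p w))))))"
proof -
 have split: "(length u < p & take p (u@g#v) = u@g#take (p - length u - 1) v
    & drop p (u@g#v) = drop (p - length u - 1) v & length u+length (take (p - length u - 1) v)+1 = p)
  \<or> (p <= length u & take p (u@g#v) = take p u & drop p (u@g#v) = drop p u@g#v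
    & length (drop p u)+length v+1 = q)"
  if "length u+length v+1 = p+q" for u v and g :: "int \<times> 'v"
 proof (cases "length u < p")
  case True
  then obtain r where r: "p - length u = Suc r" by (metis Suc_diff_Suc)
  thus ?thesis using that True by auto
 qed (use that in auto)
 show ?thesis
 proof (rule mlinI, goal_cases)
  case a: (1 u v i x y)
  note S = split[OF a(3), of "(i, x+y)"] split[OF a(3), of "(i, x)"] split[OF a(3), of "(i, y)"]
  show ?case
  proof (cases "length u < p")
   case True
   have t: "take (p - length u - 1) v \<in> lists TG" using a(2) by (rule take_lists)
   show ?thesis using S True hom_slot(1)[OF L a(1) t a(4) _ a(5)]
    by (simp add: fv.scale_right_distrib)
  next
   case False
   have t: "drop p u \<in> lists TG" using a(1) by (rule drop_lists)
   show ?thesis using S False hom_slot(1)[OF L' t a(2) a(4) _ a(5)]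
    by (simp add: fv.scale_right_distrib)
  qed
 next
  case a: (2 u v i x c)
  note S = split[OF a(3), of "(i, scl V c x)"] split[OF a(3), of "(i, x)"]
  show ?case
  proof (cases "length u < p")
   case True
   have t: "take (p - length u - 1) v \<in> lists TG" using a(2) by (rule take_lists)
   show ?thesis using S True hom_slot(2)[OF L a(1) t a(4), of c]
    by (simp add: mult.commute)
  next
   case False
   have t: "drop p u \<in> lists TG" using a(1) by (rule drop_lists)
   show ?thesis using S False hom_slot(2)[OF L' t a(2) a(4), of c]
    by (simp add: mult.commute)
  qed
 qed
qed

lemma tens_map:
 assumes L: "L \<in> gH p' p d" and L': "L' \<in> gH q' q e" and t: "t \<in> gT (p+q) j"
 shows "tens_map V p q L e L' t \<in> gT (p'+q') (j+d+e)" (is ?P1)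
  "tco (tens_map V p q L e L' t) ob = (SUM w:words B (p+q). tco t w *
    (eps (e*tdeg (take p w))*(mat L (take p' ob) (take p w)*mat L' (drop p' ob) (drop p w))))" (is ?P2)
proof -
 note M = mlin_tens_map[OF L L']
 have td: "take p w \<in> words B p" "drop p w \<in> words B q" "tdeg w = tdeg (take p w)+tdeg (drop p w)"
  if "w \<in> words B (p+q)" for w
  using that set_take_subset[of p w] set_drop_subset[of p w]
  by (auto simp: words_def min_def) (metis append_take_drop_id wdeg_simps(3))
 note F = fmul_Tens[OF hom_gradeD(1)[OF L pt_words[OF td(1)]] hom_gradeD(1)[OF L' pt_words[OF td(2)]]]
 show ?P1
  unfolding tens_map_def sg_eps
 proof (rule tlin_Tens[OF M t], goal_cases)
  case (1 w)
  note w = 1(1-2)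
  have j: "j+d+e = tdeg (take p w)+d+(tdeg (drop p w)+e)" using td(3)[OF w(1)] w(2) by simp
  show ?case
   unfolding j by (rule Tens_scl[OF F(1)[OF w(1) w(1)]])
 qed
 show ?P2
  unfolding tens_map_def sg_eps tlin_expand[OF M TensE(2)[OF t]] tco_sum
  by (intro sum.cong refl) (simp add: F(2) mat_def)
qed

definition tid :: "nat => int => ((int \<times> 'v) list \<Rightarrow>\<^sub>0 'k) => ((int \<times> 'v) list \<Rightarrow>\<^sub>0 'k)" where
 "tid k j t = (if t \<in> gT k j then t else 0)"

lemma tid: "tid k \<in> gH k k 0" "y \<in> words B k ==> mat (tid k) ob y = (if ob = y then 1 else 0)"
proof -
 show "tid k \<in> gH k k 0"
  by (rule hom_gradeI) (simp_all add: tid_def Tens_add Tens_scl)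
 show "y \<in> words B k ==> mat (tid k) ob y = (if ob = y then 1 else 0)"
  using pt_words[of y k] by (simp add: mat_def tid_def words_def tcw_basis)
qed

lemma tens_map_tid:
 assumes t: "t \<in> gT (p+q) j"
 shows "tens_map V p q L e (%_ t. t) t = tens_map V p q L e (tid q) t" (is ?P1)
  "tens_map V p q (%_ t. t) e L t = tens_map V p q (tid p) e L t" (is ?P2)
proof -
 have "pt (take p w) \<in> gT p (tdeg (take p w))" "pt (drop p w) \<in> gT q (tdeg (drop p w))"
  if "w \<in> keys t" "length w = p+q" for w
  using pt_Tens[OF take_lists, of w p] pt_Tens[OF drop_lists, of w p] TensE(2)[OF t] that by auto
 thus ?P1
  ?P2
  unfolding tens_map_def tlin_def by (auto intro!: flin_cong simp: tid_def)
qed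

lemma sum_words_append:
 "(SUM w:words B (p+q). F w) = (SUM u:words B p. SUM v:words B q. F (u@v))"
 by (induction p arbitrary: F) (simp_all add: words_0 sum_words_Suc[OF finite_B])

abbreviation "sterm F G e m q si ro z y \<equiv> kf y si*kf z ro*eps (e*tdeg (take q (perm si y))) *
  (SUM b:B. F (take m (perm ro z)) (take q (perm si y)@[b])*G (b#drop m (perm ro z)) (drop q (perm si y)))"

text \<open>
 The composite is evaluated on a tensor word of the basis from the right. The sum over b is over the
 basis vector that goes from the first output of L' into the last input of L.
\<close>

lemma star_term:
 assumes L: "L \<in> gH m l d" and L': "L' \<in> gH m' l' e" and l: "l > 0" "m' > 0"
  and s: "si permutes {..<l+l' - 1}" and r: "ro permutes {..<m+m' - 1}"
 defines "T \<equiv> %t. braid V (m+m' - 1) (inv ro) (tens_map V l (m' - 1) L 0 (%_ t. t)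
   (tens_map V (l - 1) l' (%_ t. t) e L' (braid V (l+l' - 1) si t)))"
 shows "t \<in> gT (l+l' - 1) j ==> T t \<in> gT (m+m' - 1) (j+(d+e))"
  "ob \<in> words B (m+m' - 1) ==> y \<in> words B (l+l' - 1) ==> tco (T (pt y)) ob =
   sterm (mat L) (mat L') e m (l - 1) si ro ob y"
proof -
 have n1: "l+l' - 1 = l - 1+l'" "m+m' - 1 = m+(m' - 1)" "l - 1+m' = l+(m' - 1)" using l by simp_all
 have ri: "inv ro permutes {..<m+m' - 1}" by (rule permutes_inv[OF r])
 define T1 where "T1 t = tens_map V (l - 1) l' (tid (l - 1)) e L' t" for t
 define T2 where "T2 t = tens_map V l (m' - 1) L 0 (tid (m' - 1)) t" for t
 have T1: "T1 t \<in> gT (l+(m' - 1)) (j+e)" if "t \<in> gT (l+l' - 1) j" for t j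
  using tens_map(1)[OF tid(1) L', of t "l - 1" j] that unfolding n1 T1_def by simp
 have T2: "T2 t \<in> gT (m+m' - 1) (j+d)" if "t \<in> gT (l+(m' - 1)) j" for t j
  using tens_map(1)[OF L tid(1) that] unfolding n1 T2_def by simp
 have T: "T t = braid V (m+m' - 1) (inv ro) (T2 (T1 (braid V (l+l' - 1) si t)))"
  if t: "t \<in> gT (l+l' - 1) j" for t j
 proof -
  have b: "braid V (l+l' - 1) si t \<in> gT (l - 1+l') j" using braid_Tens[OF s t] n1 by simp
  show ?thesis unfolding T_def T1_def[symmetric] tens_map_tid(2)[OF b]
   unfolding T2_def using tens_map_tid(1)[OF T1[OF braid_Tens[OF s t]]] by simp
 qed
 show "t \<in> gT (l+l' - 1) j ==> T t \<in> gT (m+m' - 1) (j+(d+e))"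
  using braid_Tens[OF ri T2[OF T1[OF braid_Tens[OF s]]], of t j] T[of t j] by (simp only: add_ac)
 assume ob: "ob \<in> words B (m+m' - 1)" and y: "y \<in> words B (l+l' - 1)"
 define y' where "y' = perm si y"
 define o' where "o' = perm ro ob"
 have y': "y' \<in> words B (l+l' - 1)" unfolding y'_def by (rule permute_words[OF y s])
 have o': "o' \<in> words B (m+m' - 1)" unfolding o'_def by (rule permute_words[OF ob r])
 have ro: "ro permutes {..<length ob}" using r ob by (simp add: words_def)
 have oo: "ob = perm (inv ro) o'" unfolding o'_def using permute_inv(2)[OF ro] by simp
 have ko: "kf o' (inv ro) = kf ob ro"
  unfolding o'_def using koszul_inv[of ro "map fst ob"] ro by (simp add: permute_list_map)
 define a where "a = take (l - 1) y'"
 define z where "z = drop (l - 1) y'"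
 have ly: "length y' = l - 1+l'" using y' n1 by (simp add: words_def)
 have a: "a \<in> words B (l - 1)" and z: "z \<in> words B l'"
  using y' ly set_take_subset[of "l - 1" y'] set_drop_subset[of "l - 1" y'] unfolding a_def z_def by (auto simp: words_def)
 have c: "drop m o' \<in> words B (m' - 1)"
  using o' n1 set_drop_subset[of m o'] by (auto simp: words_def)
 have p1: "tco (T1 (pt y')) w = eps (e*tdeg a)*((if take (l - 1) w = a then 1 else 0)*mat L' (drop (l - 1) w) z)" for w
 proof -
  have py: "pt y' \<in> gT (l - 1+l') (tdeg y')" using pt_words[OF y'] n1 by simp
  have "tco (T1 (pt y')) w = (SUM x:words B (l - 1+l'). if x = y' then eps (e*tdeg a)*((if take (l - 1) w = a then 1 else 0)*mat L' (drop (l - 1) w) z) else 0)"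
   unfolding T1_def tens_map(2)[OF tid(1) L' py]
   by (intro sum.cong refl) (use y' tid(2)[OF a] in \<open>auto simp: words_def tcw_basis a_def z_def\<close>)
  thus ?thesis using y' n1 finite_words[OF finite_B] by simp
 qed
 have p2: "tco (T2 t) o' = (SUM u:words B (l - 1). SUM b:B. tco t (u@b#drop m o')*mat L (take m o') (u@[b]))"
  if t: "t \<in> gT (l+(m' - 1)) j" for t j
 proof -
  have e1: "l+(m' - 1) = (l - 1)+Suc (m' - 1)" using l by simp
  have "tco (T2 t) o' = (SUM u:words B (l - 1). SUM b:B. SUM v:words B (m' - 1). tco t (u@b#v) *
    (mat L (take m o') (take l (u@b#v))*mat (tid (m' - 1)) (drop m o') (drop l (u@b#v))))"
   unfolding T2_def tens_map(2)[OF L tid(1) t] unfolding e1 sum_words_append sum_words_Suc[OF finite_B] by simp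
  also have "... = (SUM u:words B (l - 1). SUM b:B. SUM v:words B (m' - 1). if v = drop m o' then tco t (u@b#drop m o')*mat L (take m o') (u@[b]) else 0)"
  proof (intro sum.cong refl)
   fix u b v assume u: "u \<in> words B (l - 1)" and v: "v \<in> words B (m' - 1)"
   have "take l (u@b#v) = u@[b]" "drop l (u@b#v) = v" using u l by (cases l; simp add: words_def)+
   moreover have "mat (tid (m' - 1)) (drop m o') v = (if v = drop m o' then 1 else 0)" using tid(2)[OF v, of "drop m o'"] by auto
   ultimately show "tco t (u@b#v)*(mat L (take m o') (take l (u@b#v))*mat (tid (m' - 1)) (drop m o') (drop l (u@b#v)))
     = (if v = drop m o' then tco t (u@b#drop m o')*mat L (take m o') (u@[b]) else 0)"
    by (cases "v = drop m o'") (simp_all only: if_True if_False simp_thms mult_1_right mult_zero_right)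
  qed
  finally show ?thesis using c finite_words[OF finite_B] by simp
 qed
 have "tco (T (pt y)) ob = kf ob ro*tco (T2 (T1 (braid V (l+l' - 1) si (pt y)))) o'"
  unfolding T[OF pt_words[OF y]]
  using tco_braid[OF ri T2[OF T1[OF braid_Tens[OF s pt_words[OF y]]]] o'] unfolding oo[symmetric] ko .
 also have "T1 (braid V (l+l' - 1) si (pt y)) = fscl (kf y si) (T1 (pt y'))"
  unfolding braid_pt[OF s y] y'_def T1_def tens_map_def by simp
 also have "T2 (fscl (kf y si) (T1 (pt y'))) = fscl (kf y si) (T2 (T1 (pt y')))"
  unfolding T2_def tens_map_def by simp
 also have "tco (fscl (kf y si) (T2 (T1 (pt y')))) o' = kf y si *
   (SUM u:words B (l - 1). if u = a then eps (e*tdeg a)*(SUM b:B. mat L (take m o') (a@[b])*mat L' (b#drop m o') z) else 0)"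
  unfolding tco_simps p2[OF T1[OF pt_words[OF y']]] p1
  by (intro arg_cong2[of _ _ _ _ "(*)"] refl sum.cong) (auto simp: words_def sum_distrib_left mult_ac)
 also have "... = kf y si*(eps (e*tdeg a)*(SUM b:B. mat L (take m o') (a@[b])*mat L' (b#drop m o') z))"
  using a finite_words[OF finite_B] by simp
 finally show "tco (T (pt y)) ob =
   sterm (mat L) (mat L') e m (l - 1) si ro ob y"
  unfolding a_def z_def o'_def y'_def by (simp add: mult_ac)
qed

lemma star:
 assumes L: "L \<in> gH m l d" and L': "L' \<in> gH m' l' e" and l: "l > 0" "m' > 0"
 shows "star V n m l m' l' e L L' \<in> gH (m+m' - 1) (l+l' - 1) (d+e)" (is ?P1)
  "ob \<in> words B (m+m' - 1) ==> y \<in> words B (l+l' - 1) ==> mat (star V n m l m' l' e L L') ob y =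
   (SUM si:shuffles (l - 1) l'. SUM ro:shuffles m (m' - 1). perm_sgn si*perm_sgn ro powi n *
   sterm (mat L) (mat L') e m (l - 1) si ro ob y)"
proof -
 have n1: "l - 1+l' = l+l' - 1" "m+(m' - 1) = m+m' - 1" using l by simp_all
 have s: "si permutes {..<l+l' - 1}" if "si \<in> shuffles (l - 1) l'" for si using shufflesD(1)[OF that] n1 by simp
 have r: "ro permutes {..<m+m' - 1}" if "ro \<in> shuffles m (m' - 1)" for ro using shufflesD(1)[OF that] n1 by simp
 define T where "T = (%si ro t. braid V (m+m' - 1) (inv ro) (tens_map V l (m' - 1) L 0 (%_ t. t)
   (tens_map V (l - 1) l' (%_ t. t) e L' (braid V (l+l' - 1) si t))))"
 have st: "star V n m l m' l' e L L' = (%j t. if t \<in> gT (l+l' - 1) j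
   then SUM si:shuffles (l - 1) l'. SUM ro:shuffles m (m' - 1). fscl (perm_sgn si*perm_sgn ro powi n) (T si ro t) else 0)"
  unfolding star_def T_def using l by (simp only: neq0_conv[symmetric] simp_thms if_False)
 have Tl: "T si ro (x+y) = T si ro x+T si ro y" "T si ro (fscl c x) = fscl c (T si ro x)" for si ro x y c
  by (simp_all add: T_def braid_def tens_map_def)
 show ?P1
 proof (rule hom_gradeI)
  fix j x assume x: "x \<in> gT (l+l' - 1) j"
  have "(SUM si:shuffles (l - 1) l'. SUM ro:shuffles m (m' - 1). fscl (perm_sgn si*perm_sgn ro powi n) (T si ro x))
    \<in> gT (m+m' - 1) (j+(d+e))"
   unfolding T_def by (intro Tens_sum Tens_scl star_term(1)[OF L L' l s r x])
  thus "star V n m l m' l' e L L' j x \<in> gT (m+m' - 1) (j+(d+e))" using x by (simp add: st)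
 next
  fix j x y assume x: "x \<in> gT (l+l' - 1) j" and y: "y \<in> gT (l+l' - 1) j"
  show "star V n m l m' l' e L L' j (x+y) = star V n m l m' l' e L L' j x+star V n m l m' l' e L L' j y"
   using x y Tens_add[OF x y] by (simp add: st Tl fv.scale_right_distrib sum.distrib)
 next
  fix j c x assume x: "x \<in> gT (l+l' - 1) j"
  show "star V n m l m' l' e L L' j (scl (Tens V (l+l' - 1)) c x) = scl (Tens V (m+m' - 1)) c (star V n m l m' l' e L L' j x)"
   using x Tens_scl[OF x] by (simp add: st Tl fv.scale_sum_right mult_ac)
 qed (simp add: st)
 assume ob: "ob \<in> words B (m+m' - 1)" and y: "y \<in> words B (l+l' - 1)"
 have "mat (star V n m l m' l' e L L') ob y
   = (SUM si:shuffles (l - 1) l'. SUM ro:shuffles m (m' - 1). perm_sgn si*perm_sgn ro powi n*tco (T si ro (pt y)) ob)"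
  unfolding mat_def st using pt_words[OF y] by (simp add: tco_sum)
 also have "... = (SUM si:shuffles (l - 1) l'. SUM ro:shuffles m (m' - 1). perm_sgn si*perm_sgn ro powi n *
   sterm (mat L) (mat L') e m (l - 1) si ro ob y)"
  unfolding T_def by (intro sum.cong refl arg_cong2[of _ _ _ _ "(*)"]) (rule star_term(2)[OF L L' l s r ob y])
 finally show "mat (star V n m l m' l' e L L') ob y = ..." .
qed

end

section \<open>Symmetric functions on sorted words\<close>

lemma sh_split_right:
 fixes F G :: "('a+'b) list => 'k::field"
 assumes "!!u. F u ~= 0 ==> set u <= range Inl"
 shows "sh deg F G (map Inr y) = F []*G (map Inr y)"
 using assms
proof (induction y arbitrary: F G)
 case (Cons b y)
 have 0: "(%u. F (Inr b#u)) = (%u. 0)" using Cons.prems by fastforce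
 have "sh deg (%u. eps (deg (Inr b)*wdeg deg u)*F u) (%u. G (Inr b#u)) (map Inr y)
   = eps (deg (Inr b)*wdeg deg [])*F []*G (Inr b#map Inr y)"
  by (rule Cons.IH) (use Cons.prems in simp)
 thus ?case by (simp add: 0)
qed simp

text \<open>
 The supports leave only one way to split the sorted word, and it needs no rearrangement.
\<close>

lemma sh_split:
 fixes F G :: "('a+'b) list => 'k::field"
 assumes "!!u. F u ~= 0 ==> set u <= range Inl" "!!u. G u ~= 0 ==> set u <= range Inr"
 shows "sh deg F G (map Inl z@map Inr y) = F (map Inl z)*G (map Inr y)"
 using assms(1)
proof (induction z arbitrary: F)
 case Nil
 show ?case using sh_split_right[OF Nil] by simp
next
 case (Cons b z)
 have 0: "(%u. G (Inl b#u)) = (%u. 0)" using assms(2) by fastforce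
 have "sh deg (%u. F (Inl b#u)) G (map Inl z@map Inr y) = F (Inl b#map Inl z)*G (map Inr y)"
  by (rule Cons.IH) (use Cons.prems[of "Inl b#_"] in auto)
 thus ?case by (simp add: 0)
qed

lemma linprod_append: "linprod deg (hs@hs') w = sh deg (linprod deg hs) (linprod deg hs') w"
proof (induction hs arbitrary: w)
 case (Cons a hs)
 have e: "linprod deg (hs@hs') = sh deg (linprod deg hs) (linprod deg hs')" by (rule ext) (rule Cons.IH)
 show ?case by (cases a) (simp add: e sh_assoc)
qed simp

lemma linprod_supp: "linprod deg hs u ~= 0 ==> ALL (i, h):set hs. ALL x. h x ~= 0 --> x \<in> S ==> set u <= S"
proof (induction hs arbitrary: u)
 case Nil
 thus ?case by (simp add: shone_def split: if_splits)
next
 case (Cons a hs)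
 obtain i h where a: "a = (i, h)" by (cases a)
 from Cons.prems(1) obtain p q where pq: "lin h p ~= 0" "linprod deg hs q ~= 0" "mset u = mset p+mset q"
  unfolding a linprod_simps using sh_nonzero by blast
 have "set q <= S" by (rule Cons.IH[OF pq(2)]) (use Cons.prems(2) in simp)
 moreover have "set p <= S" using pq(1) Cons.prems(2) by (auto simp: a lin_nonzero)
 moreover have "set u = set p \<union> set q" using pq(3) by (metis set_mset_mset set_mset_union)
 ultimately show ?case by simp
qed

lemma linprod_sorted:
 assumes "ALL (i, h):set hs. ALL x. h x ~= 0 --> x \<in> range Inl" "ALL (i, h):set hs'. ALL x. h x ~= 0 --> x \<in> range Inr"
 shows "linprod deg (hs@hs') (map Inl z@map Inr y) = linprod deg hs (map Inl z)*linprod deg hs' (map Inr y)"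
 unfolding linprod_append
 by (rule sh_split) (use linprod_supp assms in blast)+

lemma monomial_homog: "monomial deg u \<in> homog deg (wdeg deg u)"
proof (induction u)
 case (Cons x u)
 have "lin (letter x) \<in> homog deg (deg x)" by (rule homog_lin) (auto simp: letter_def split: if_splits)
 thus ?case using sh_homog Cons by simp
qed (simp add: homog_one)

lemma monomial_wthom: "monomial deg u \<in> wthom wt (SUM x<-u. wt x)"
proof (induction u)
 case (Cons x u)
 have "lin (letter x) \<in> wthom wt (wt x)" by (auto simp: wthom_def lin_nonzero letter_def split: if_splits)
 thus ?case using wthom_sh Cons by simp
qed (auto simp: wthom_def shone_def split: if_splits)

text \<open>Every word can be sorted by permutations, which change the value by a sign only.\<close>

lemma sorted_zero:
 assumes "f \<in> swapsym deg" "set w <= Inl ` X \<union> Inr ` X"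
  "!!z y. set z <= X ==> set y <= X ==> f (map Inl z@map Inr y) = 0"
 shows "f w = 0"
 using assms
proof (induction w arbitrary: f)
 case Nil
 show ?case using Nil(3)[of "[]" "[]"] by simp
next
 case (Cons x w)
 have s: "(%u. f (x#u)) \<in> swapsym deg" by (rule swapsym_left_shift[OF Cons.prems(1)])
 have w: "set w <= Inl ` X \<union> Inr ` X" using Cons.prems(2) by simp
 show ?case
 proof (rule Cons.IH[OF s w])
  fix z y assume zy: "set z <= X" "set y <= X"
  show "f (x#map Inl z@map Inr y) = 0"
  proof (cases x)
   case (Inl b)
   hence "set (b#z) <= X" using Cons.prems(2) zy by auto
   from Cons.prems(3)[OF this zy(2)] show ?thesis by (simp add: Inl)
  next
   case (Inr b)
   hence "set (b#y) <= X" using Cons.prems(2) zy by auto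
   from Cons.prems(3)[OF zy(1) this] have "f (map Inl z@x#map Inr y) = 0" by (simp add: Inr)
   thus ?thesis unfolding swapsym_to_front[OF Cons.prems(1)] by simp
  qed
 qed
qed

context fin_cplx
begin

abbreviation "kI z \<equiv> koszul (map (%b. deg (Inl b)) z)"
abbreviation "kJ y \<equiv> koszul (map (%b. deg (Inr b)) y)"
abbreviation sw :: "(int \<times> 'v) list => (int \<times> 'v) list => 'v lbl list" where
 "sw z y \<equiv> map Inl z@map Inr y"

lemma sorted_eqI:
 assumes "f \<in> Symf deg XP" "g \<in> Symf deg XP" and e: "!!z y. set z <= B ==> set y <= B ==> f (sw z y) = g (sw z y)"
 shows "f = g"
proof
 fix w
 have s: "(%w. f w+(- 1)*g w) \<in> Symf deg XP" by (intro Symf_add Symf_scale assms)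
 show "f w = g w"
 proof (cases "set w <= XP")
  case True
  have "f w+(- 1)*g w = 0" by (rule sorted_zero[OF Symf_swapsym[OF s] True]) (simp only: e mult_minus1 add.right_inverse)
  thus ?thesis by simp
 next
  case False
  have "f w = 0" "g w = 0" using False Symf_supp[OF assms(1), of w] Symf_supp[OF assms(2), of w] by blast+
  thus ?thesis by simp
 qed
qed

lemma wt_sw: "(SUM x<-sw z y. wtP x) = length z"
 by (simp add: comp_def sum_list_triv)

lemma wdeg_sw: "wdeg deg (sw z y) = tdeg z+int (length z)*n+int (length y) - tdeg y"
proof -
 have "wdeg deg (map Inl z) = tdeg z+int (length z)*n" by (induction z) (simp_all add: algebra_simps)
 moreover have "wdeg deg (map Inr y) = int (length y) - tdeg y" by (induction y) simp_all
 ultimately show ?thesis by simp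
qed

lemma swapsym_sw_permute:
 assumes f: "f \<in> swapsym deg"
 shows "ro permutes {..<length z} ==> f (sw (perm ro z) y) = kI z ro*f (sw z y)"
  "si permutes {..<length y} ==> f (sw z (perm si y)) = kJ y si*f (sw z y)"
proof -
 have 1: "(%u. f (u@map Inr y)) \<in> swapsym deg"
 proof (rule swapsymI, goal_cases)
  case (1 u x x' v)
  show ?case
   using swapsymD[OF f, of u x x' "v@map Inr y"] by (simp only: append_assoc append_Cons)
 qed
 have 2: "(%u. f (map Inl z@u)) \<in> swapsym deg"
 proof (rule swapsymI, goal_cases)
  case (1 u x x' v)
  show ?case
   using swapsymD[OF f, of "map Inl z@u" x x' v] by (simp only: append_assoc)
 qed
 show "ro permutes {..<length z} ==> f (sw (perm ro z) y) = kI z ro*f (sw z y)"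
  using swapsym_permute[OF 1, of ro "map Inl z"] by (simp add: permute_list_map comp_def)
 show "si permutes {..<length y} ==> f (sw z (perm si y)) = kJ y si*f (sw z y)"
  using swapsym_permute[OF 2, of si "map Inr y"] by (simp add: permute_list_map comp_def)
qed

text \<open>
 The symmetrization of the values C at sorted words. Each summand occurs for all orders of u and of
 v, hence the two factorials.
\<close>

definition asm :: "nat => nat => ((int \<times> 'v) list => (int \<times> 'v) list => 'k) => 'v lbl list => 'k" where
 "asm m K C w = (SUM l<=K. SUM u:words B m. SUM v:words B l. C u v / (fact m*fact l)*monomial deg (sw u v) w)"

lemma asm_Symf: "asm m K C \<in> Symf deg XP"
 unfolding asm_def by (intro Symf_sum Symf_scale Symf_monomial) (auto simp: words_def)

lemma asm_homog:
 assumes "!!u v. u \<in> words B m ==> set v <= B ==> C u v ~= 0 ==> wdeg deg (sw u v) = i"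
 shows "asm m K C \<in> homog deg i"
 unfolding asm_def
proof (intro homog_sum)
 fix l u v assume uv: "u \<in> words B m" "v \<in> words B l"
 show "(%w. C u v / (fact m*fact l)*monomial deg (sw u v) w) \<in> homog deg i"
 proof (cases "C u v = 0")
  case False
  have "wdeg deg (sw u v) = i" using assms[of u v] uv False by (simp add: words_def)
  thus ?thesis using homog_scale[OF monomial_homog[of deg "sw u v"]] by metis
 qed (simp add: homog_zero)
qed

lemma asm_wthom: "asm m K C \<in> wthom wtP m"
proof -
 have "asm m K C w = 0" if "(SUM x<-w. wtP x) ~= m" for w
  unfolding asm_def
 proof (intro sum.neutral ballI, goal_cases)
  case (1 l u v)
  hence "monomial deg (sw u v) w = (0 :: 'k)"
   using that monomial_wthom[of deg "sw u v" wtP] unfolding wt_sw by (auto simp only: wthom_def words_def)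
  thus ?case by simp
 qed
 thus ?thesis by (auto simp only: wthom_def)
qed

lemma monomial_sorted: "monomial deg (sw u v) (sw z y) = monomial deg (map Inl u) (map Inl z)*(monomial deg (map Inr v) (map Inr y) :: 'k)"
 unfolding monomial_def map_append by (rule linprod_sorted) (auto simp: letter_def split: if_splits)

lemma monomial_length: "monomial deg u w ~= (0 :: 'k) ==> length w = length u"
 unfolding monomial_def using linprod_length[of deg "map (%x. (deg x, letter x :: _ => 'k)) u" w]
 by (auto simp: lhomog_def letter_def split: if_splits)

lemma asm_sorted:
 assumes z: "z \<in> words B m" and y: "y \<in> words B l" and l: "l <= K"
  and C1: "!!ro v. ro permutes {..<m} ==> v \<in> words B l ==> C (perm ro z) v = kI z ro*C z v"
  and C2: "!!si. si permutes {..<l} ==> C z (perm si y) = kJ y si*C z y"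
 shows "asm m K C (sw z y) = C z y"
proof -
 let ?M = "%v. monomial deg (map Inr v) (map Inr y) :: 'k"
 have "asm m K C (sw z y) = (SUM l'<=K. if l' = l then (SUM u:words B m. SUM v:words B l.
   C u v*monomial deg (map Inl u) (map Inl z)*?M v / (fact m*fact l)) else 0)"
  unfolding asm_def monomial_sorted
 proof (intro sum.cong refl, goal_cases)
  case (1 l')
  have M: "?M v = 0" if "v \<in> words B l'" "l' ~= l" for v
   using monomial_length[of "map Inr v" "map Inr y"] that y by (cases "?M v = 0") (auto simp: words_def)
  show ?case
  proof (cases "l' = l")
   case True
   thus ?thesis by (simp add: mult.assoc)
  next
   case False
   thus ?thesis by (simp add: M)
  qed
 qed
 also have "... = (SUM u:words B m. SUM v:words B l. C u v*monomial deg (map Inl u) (map Inl z)*?M v / (fact m*fact l))"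
  using l by simp
 also have "... = (SUM v:words B l. (SUM u:words B m. C u v*monomial deg (map Inl u) (map Inl z))*?M v / (fact m*fact l))"
  by (subst sum.swap) (simp add: sum_distrib_right sum_divide_distrib)
 also have "... = (SUM v:words B l. C z v*?M v) / fact l"
  unfolding sum_divide_distrib
 proof (intro sum.cong refl, goal_cases)
  case (1 v)
  note v = 1(1)
  have "(SUM u:words B m. C u v*monomial deg (map Inl u) (map Inl z)) = fact m*C z v"
   by (rule monomial_sum[OF _ finite_B z]) (simp_all add: C1[OF _ v])
  thus ?case
   by (simp add: field_simps)
 qed
 also have "(SUM v:words B l. C z v*?M v) = fact l*C z y"
  by (rule monomial_sum[OF _ finite_B y]) (simp_all add: C2)
 finally show ?thesis by simp
qed

lemma Symf_asm:
 assumes f: "f \<in> Symf deg XP" and m: "f \<in> wthom wtP m" and K: "!!w. f w ~= 0 ==> length w <= K"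
 shows "f = asm m K (%u v. f (sw u v))"
proof (rule sorted_eqI[OF f asm_Symf])
 fix z y assume zy: "set z <= B" "set y <= B"
 let ?A = "asm m K (%u v. f (sw u v))"
 show "f (sw z y) = ?A (sw z y)"
 proof (cases "length z = m & length y <= K")
  case True
  have "?A (sw z y) = f (sw z y)"
   by (rule asm_sorted[where l = "length y"])
     (use zy True swapsym_sw_permute[OF Symf_swapsym[OF f]] in \<open>auto simp: words_def\<close>)
  thus ?thesis by simp
 next
  case False
  have "f (sw z y) = 0"
  proof (rule ccontr)
   assume nz: "f (sw z y) ~= 0"
   have "length z = m" using m nz wt_sw[of z y] unfolding wthom_def by force
   thus False using False K[OF nz] by simp
  qed
  moreover have "?A (sw z y) = 0"
  proof (cases "length z = m")
   case True
   hence l: "length y > K" using False by simp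
   show ?thesis unfolding asm_def monomial_sorted
   proof (intro sum.neutral ballI, goal_cases)
    case (1 l u v)
    hence "monomial deg (map Inr v) (map Inr y) = (0 :: 'k)"
     using monomial_length[of "map Inr v" "map Inr y"] l
     by (cases "monomial deg (map Inr v) (map Inr y) = (0 :: 'k)") (auto simp: words_def)
    thus ?case by simp
   qed
  next
   case False
   thus ?thesis using asm_wthom[of m K "%u v. f (sw u v)"] wt_sw[of z y] by (force simp: wthom_def)
  qed
  ultimately show ?thesis by simp
 qed
qed

section \<open>The polyvector monomials\<close>

definition xh :: "int \<times> 'v => int \<times> ('v lbl => 'k)" where
 "xh g = (fst g+n, case_sum (co g) (%_. 0))"

definition th :: "int \<times> (int => 'v => 'k) => int \<times> ('v lbl => 'k)" where
 "th t = (fst t+1, dfun (snd t))"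

abbreviation "DG \<equiv> {(j, \<theta>). \<theta> \<in> grade (dual V) j}"

lemma fst_xh [simp]: "fst (xh g) = fst g+n" and fst_th [simp]: "fst (th t) = fst t+1"
 by (simp_all add: xh_def th_def)

lemma th_eq: "t = (j, \<theta>) ==> th t = (j+1, dfun \<theta>)"
 unfolding th_def by (simp only: fst_conv snd_conv)

lemma xh_eq: "xh (i, x) = (i+n, case_sum (co (i, x)) (%_. 0))"
 by (simp add: xh_def)

lemma pol_monomial:
 assumes "set xs <= TG" "set ts <= DG"
 shows "pol_monomial V n xs ts \<in> grade PP (wdeg fst (map xh xs@map th ts))" (is ?P1)
  "\<beta> (pol_monomial V n xs ts) = linprod deg (map xh xs@map th ts)" (is ?P2)
proof -
 have 0: "pol_monomial V n [] ts \<in> grade PP (wdeg fst (map th ts)) & \<beta> (pol_monomial V n [] ts) = linprod deg (map th ts)"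
  using assms(2)
 proof (induction ts)
  case Nil
  show ?case using PP_one by (simp add: pol_monomial_def)
 next
  case (Cons t ts)
  obtain j \<theta> where t: "t = (j, \<theta>)" "\<theta> \<in> grade (dual V) j" using Cons.prems by (cases t) auto
  have e: "pol_monomial V n [] (t#ts) = mul PP (pol_fun FF n (j+1) (susp V j \<theta>)) (pol_monomial V n [] ts)"
   by (simp add: pol_monomial_def t)
  have g: "pol_fun FF n (j+1) (susp V j \<theta>) \<in> grade PP (j+1)" "\<beta> (pol_fun FF n (j+1) (susp V j \<theta>)) = lin (dfun \<theta>)"
   using pol_fun[OF susp_grade[OF t(2)]] \<alpha>_susp[OF t(2)] by simp_all
  have IH: "pol_monomial V n [] ts \<in> grade PP (wdeg fst (map th ts))" "\<beta> (pol_monomial V n [] ts) = linprod deg (map th ts)"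
   using Cons by simp_all
  show ?case unfolding e using PP_mul[OF g(1) IH(1)] unfolding t(1) list.map th_eq[OF refl] by (simp add: g(2) IH(2))
 qed
 have "pol_monomial V n xs ts \<in> grade PP (wdeg fst (map xh xs@map th ts))
   & \<beta> (pol_monomial V n xs ts) = linprod deg (map xh xs@map th ts)"
  using assms(1)
 proof (induction xs)
  case Nil
  show ?case using 0 by simp
 next
  case (Cons g xs)
  obtain i x where x: "g = (i, x)" "x \<in> grade V i" using Cons.prems by (cases g) auto
  have D: "dvx (i, x) \<in> grade (Der FF) (i - 1)" using dvx(1)[of "(i, x)"] by simp
  have e: "pol_monomial V n (g#xs) ts = mul PP (pol_der FF n (i - 1) (dvx (i, x))) (pol_monomial V n xs ts)"
   by (simp add: pol_monomial_def x(1) desusp_dvx[OF x(2)])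
  have "dvec (i - 1+n+1) (dcoef (dvx (i, x))) w = lin (case_sum (co g) (%_. 0)) w" for w
  proof -
   have "dvec (i - 1+n+1) (dcoef (dvx (i, x))) w = (SUM b:B. co g b*dl b w)"
    unfolding dvec_def
   proof (intro sum.cong refl, goal_cases)
    case (1 b)
    note b = 1(1)
    have "sh deg (%w. co (i, x) b*shone w) (dl b) w = co (i, x) b*dl b w" by (simp only: sh_scale_left sh_one_left)
    thus ?case
     using co_nonzero[of "(i, x)" b] by (cases "co (i, x) b = 0") (simp_all add: dvx(2)[OF b] x(1))
   qed
   also have "... = lin (%z :: 'v lbl. SUM b:B. co g b*letter (Inl b) z) w"
    by (simp add: lin_def sum.neutral split: list.split)
   also have "(%z :: 'v lbl. SUM b:B. co g b*letter (Inl b) z) = case_sum (co g) (%_. 0)"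
   proof (rule ext, rename_tac z, case_tac z, goal_cases)
    case (1 z c)
    note z = 1(1)
    have "(SUM b:B. co g b*letter (Inl b) z) = (SUM b:B. if b = c then co g c else 0)"
     by (intro sum.cong refl) (simp add: letter_def z)
    thus ?case
     using finite_B co_nonzero[of g c] by (auto simp: z)
   qed (simp add: letter_def)
   finally show ?thesis .
  qed
  hence g: "pol_der FF n (i - 1) (dvx (i, x)) \<in> grade PP (i+n)" "\<beta> (pol_der FF n (i - 1) (dvx (i, x))) = lin (case_sum (co g) (%_. 0))"
   using pol_der[OF D] by (simp_all add: fun_eq_iff)
  have IH: "pol_monomial V n xs ts \<in> grade PP (wdeg fst (map xh xs@map th ts))"
   "\<beta> (pol_monomial V n xs ts) = linprod deg (map xh xs@map th ts)" using Cons by simp_all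
  show ?case unfolding e using PP_mul[OF g(1) IH(1)] unfolding x(1) list.map xh_eq by (simp add: g(2) IH(2) x(1) add.assoc)
 qed
 thus ?P1
  ?P2 by simp_all
qed

abbreviation dg :: "int \<times> 'v => int \<times> (int => 'v => 'k)" where
 "dg b \<equiv> (- fst b, dualvec b)"

lemma pol_monomial_basis:
 assumes u: "u \<in> words B m" and v: "v \<in> words B l"
 shows "pol_monomial V n u (map dg v) \<in> grade PP (wdeg deg (sw u v))" (is ?P1) "\<beta> (pol_monomial V n u (map dg v)) = monomial deg (sw u v)" (is ?P2)
  "set u <= TG" "set (map dg v) <= DG"
proof -
 show u': "set u <= TG" using u B_TG by (auto simp: words_def)
 show v': "set (map dg v) <= DG" using v dualvec_grade by (auto simp: words_def)
 have 1: "xh b = (deg (Inl b), letter (Inl b))" if "b \<in> B" for b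
  using that co_basis[OF that] by (auto simp: xh_def letter_def fun_eq_iff split: sum.split)
 have 2: "th (dg b) = (deg (Inr b), letter (Inr b))" if b: "b \<in> B" for b
 proof -
  have "dualvec b (fst c) (snd c) = (if c = b then 1 else 0)" if "c \<in> B" for c
   using B_grade[OF that] co_basis[OF that] by (auto simp: dualvec_def)
  hence "dfun (dualvec b) = letter (Inr b)" using b by (auto simp: letter_def fun_eq_iff split: sum.split)
  thus ?thesis by (simp only: th_eq[OF refl] deg_simps) simp
 qed
 have e: "map xh u@map th (map dg v) = map (%x. (deg x, letter x)) (sw u v)"
  using u v 1 2 by (auto simp: words_def)
 have d: "wdeg fst (map xh u@map th (map dg v)) = wdeg deg (sw u v)"
  unfolding e by (simp only: wdeg_map fst_conv)
 show ?P1 ?P2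
  using pol_monomial[OF u' v'] unfolding d unfolding e monomial_def by simp_all
qed

lemma scl_PP [simp]: "scl PP = fscl"
 by (simp add: PP_Sym Sym_def)

text \<open>The preimage in the algebra of the expansion \<open>Symf_asm\<close>.\<close>

lemma Pol_expand:
 assumes P: "P \<in> Pol_wt FF n m i"
 obtains K where "P = (SUM l<=K. SUM u:words B m. SUM v:words B l.
   fscl (\<beta> P (sw u v) / (fact m*fact l)) (pol_monomial V n u (map dg v)))"
  "!!u v l. u \<in> words B m ==> v \<in> words B l ==> \<beta> P (sw u v) ~= 0 ==> pol_monomial V n u (map dg v) \<in> Pol_wt FF n m i"
proof -
 have g: "P \<in> grade PP i" and w: "\<beta> P \<in> wthom wtP m" using P by (simp_all add: Pol_wt_eq)
 obtain K where K: "!!w. \<beta> P w ~= 0 ==> length w <= K" using Symf_bound[OF PP_gradeE(3)[OF g]] by blast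
 have t: "pol_monomial V n u (map dg v) \<in> Pol_wt FF n m i" if "u \<in> words B m" "v \<in> words B l" "\<beta> P (sw u v) ~= 0" for u v l
 proof -
  have "wdeg deg (sw u v) = i" using PP_gradeE(4)[OF g] that(3) by (auto simp: homog_def)
  moreover have "monomial deg (sw u v) \<in> wthom wtP m"
   using monomial_wthom[of deg "sw u v" wtP] that(1) unfolding wt_sw by (simp add: words_def)
  ultimately show ?thesis using pol_monomial_basis[OF that(1,2)] by (simp add: Pol_wt_eq)
 qed
 let ?Q = "SUM l<=K. SUM u:words B m. SUM v:words B l. fscl (\<beta> P (sw u v) / (fact m*fact l)) (pol_monomial V n u (map dg v))"
 have "?Q \<in> grade PP i"
 proof (intro PP_sum)
  fix l u v assume uv: "u \<in> words B m" "v \<in> words B l"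
  show "fscl (\<beta> P (sw u v) / (fact m*fact l)) (pol_monomial V n u (map dg v)) \<in> grade PP i"
   using t[OF uv] by (cases "\<beta> P (sw u v) = 0") (simp_all add: PP_0 PP_fscl Pol_wt_eq)
 qed
 moreover have "\<beta> P = \<beta> ?Q"
 proof -
  have "\<beta> P = asm m K (%u v. \<beta> P (sw u v))" by (rule Symf_asm[OF PP_gradeE(3)[OF g] w K])
  also have "... = \<beta> ?Q"
   by (rule ext) (auto simp: asm_def ev_sum pol_monomial_basis(2) intro!: sum.cong)
  finally show ?thesis .
 qed
 ultimately have "P = ?Q" by (rule PP_eqI[OF g])
 thus ?thesis using that t by blast
qed

end

section \<open>The signs of the isomorphism\<close>

primrec revs :: "int list => 'k::field" where
 "revs [] = 1"
| "revs (d#ds) = eps (d*sum_list ds)*revs ds"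

lemma revs_append: "revs (u@v) = eps (sum_list u*sum_list v)*revs u*revs v"
 by (induction u) (simp_all add: eps_add algebra_simps)

lemma revs_self: "revs ds*revs ds = 1"
 by (induction ds) (simp_all add: algebra_simps)

lemma koszul_zero: "koszul (map (%_. 0) w) si = (1 :: 'k::field)" if "si permutes {..<length w}"
proof -
 have "si i < length w" if "i < length w" for i
  using permutes_in_image[OF \<open>si permutes {..<length w}\<close>, of i] that by simp
 thus ?thesis unfolding koszul_eps by (intro prod.neutral) auto
qed

lemma revs_permute: "si permutes {..<length ds} ==> revs (perm si ds) = (revs ds :: 'k::field)"
proof -
 have "(revs :: int list => 'k) \<in> swapsym (%_. 0)"
  by (rule swapsymI) (simp add: revs_append eps_add algebra_simps)
 thus "si permutes {..<length ds} ==> revs (perm si ds) = (revs ds :: 'k)"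
  using swapsym_permute[of "revs :: int list => 'k" "%_. 0" si ds] koszul_zero[of si ds, where ?'k = 'k] by simp
qed

lemma koszul_cong: "(!!i. i < length ds ==> si i = ta i) ==> koszul ds si = koszul ds ta"
 unfolding koszul_eps by (rule prod.cong) auto

lemma koszul_rev: "koszul ds (%i. length ds - 1 - i) = (revs ds :: 'k::field)"
proof (induction ds rule: rev_induct)
 case (snoc d ds)
 let ?k = "length ds"
 define ta where "ta = (%i. if i < ?k then ?k - 1 - i else i)"
 have t: "ta permutes {..<?k}"
  by (rule permutes_injI) (auto simp: ta_def inj_on_def)
 have "koszul (ds@[d]) (%i. length (ds@[d]) - 1 - i) = (koszul (ds@[d]) (cons_perm ?k ta) :: 'k)"
 proof (rule koszul_cong)
  fix i assume "i < length (ds@[d])"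
  thus "length (ds@[d]) - 1 - i = cons_perm ?k ta i" by (cases i) (auto simp: ta_def)
 qed
 also have "... = eps (d*sum_list ds)*koszul ds ta"
  using koszul_cons_perm[of "ds@[d]" ?k ?k ta] t by (simp add: nth_append)
 also have "koszul ds ta = (koszul ds (%i. ?k - 1 - i) :: 'k)" by (rule koszul_cong) (simp add: ta_def)
 finally show ?case using snoc by (simp add: revs_append mult.commute)
qed simp

lemma koszul_neg: "si permutes {..<length ds} ==> koszul (map uminus ds) si = (koszul ds si :: 'k::field)"
proof -
 assume s: "si permutes {..<length ds}"
 have "si i < length ds" if "i < length ds" for i using permutes_in_image[OF s, of i] that by simp
 thus ?thesis unfolding koszul_eps by (intro prod.cong) auto
qed

context fin_cplx
begin

text \<open>
 The sign of \<open>\<Phi>\<close> on the basis: the shifts s^n pass the x's among themselves, then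
 all of these are passed by s^l, and the shifts of the dual vectors pass one another. The last
 factor is the sign of the reversal in the definition of L_B.
\<close>

definition sgnf :: "(int \<times> 'v) list => (int \<times> 'v) list => 'k" where
 "sgnf z y = pre_sign n (map fst z)*eps (int (length y)*tdeg z)*pre_sign 1 (map (%b. - fst b) y)*revs (map fst y)"

lemma sgnf_self [simp]: "sgnf z y*sgnf z y = 1"
proof -
 have "sgnf z y*sgnf z y = (pre_sign n (map fst z)*pre_sign n (map fst z))*(eps (int (length y)*tdeg z)*eps (int (length y)*tdeg z))
  *(pre_sign 1 (map (%b. - fst b) y)*pre_sign 1 (map (%b. - fst b) y))*(revs (map fst y)*revs (map fst y))"
  unfolding sgnf_def by (simp only: mult_ac)
 thus ?thesis by (simp only: pre_sign_self eps_self revs_self mult_1)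
qed

lemma sgnf_self_left [simp]: "sgnf z y*(sgnf z y*x) = x"
 by (metis sgnf_self mult.assoc mult_1)

text \<open>
 This is where the symmetry of polyvectors turns into the one of \<open>hom_sym\<close>: the shift
 by n contributes the n-th power of the signature on outputs, and the shift by 1 the signature on
 inputs.
\<close>

lemma sgnf_permute:
 shows "ro permutes {..<length z} ==> sgnf (perm ro z) y*kI z ro
   = kf z ro*perm_sgn ro powi n*sgnf z y"
  "si permutes {..<length y} ==> sgnf z (perm si y)*kJ y si
   = kf y si*perm_sgn si*sgnf z y"
proof -
 assume r: "ro permutes {..<length z}"
 have 1: "kI z ro = (kf z ro*perm_sgn ro powi n*pre_sign n (map fst z)
   *pre_sign n (map fst (perm ro z)) :: 'k)"
  using koszul_shift[of ro "map fst z" n, where ?'k = 'k] r by (simp add: comp_def permute_list_map)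
 show "sgnf (perm ro z) y*kI z ro
   = kf z ro*perm_sgn ro powi n*sgnf z y"
  unfolding sgnf_def 1 wdeg_permute[OF r] by (simp add: mult_ac)
next
 assume s: "si permutes {..<length y}"
 have e: "map (%b. deg (Inr b)) y = map (%d. d+1) (map uminus (map fst y))" by simp
 have 1: "kJ y si = (kf y si*perm_sgn si*pre_sign 1 (map (%b. - fst b) y)
   *pre_sign 1 (map (%b. - fst b) (perm si y)) :: 'k)"
  unfolding e using koszul_shift[of si "map uminus (map fst y)" 1, where ?'k = 'k] koszul_neg[of si "map fst y", where ?'k = 'k] s
  by (simp add: comp_def permute_list_map)
 have 2: "revs (map fst (perm si y)) = (revs (map fst y) :: 'k)"
  using revs_permute[of si "map fst y", where ?'k = 'k] s by (simp add: permute_list_map)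
 show "sgnf z (perm si y)*kJ y si = kf y si*perm_sgn si*sgnf z y"
  unfolding sgnf_def 1 2 by (simp add: mult_ac)
qed

section \<open>The isomorphism\<close>

definition cmat :: "('v lbl list => 'k) => (int \<times> 'v) list => (int \<times> 'v) list => 'k" where
 "cmat f z y = sgnf z y*f (sw z y)"

definition Phimap :: "nat => nat => (('v, 'k) free_el, 'k) pol => int
  => ((int \<times> 'v) list \<Rightarrow>\<^sub>0 'k) => ((int \<times> 'v) list \<Rightarrow>\<^sub>0 'k)" where
 "Phimap m l P = homm m l (cmat (\<beta> P))"

lemma Phimap_lin:
 "Phimap m l (P+Q) = Phimap m l P+Phimap m l Q" (is ?P1) "Phimap m l (fscl c P) = (%j t. fscl c (Phimap m l P j t))" (is ?P2)
proof -
 show ?P1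
  by (intro ext) (simp add: Phimap_def homm_def cmat_def distrib_left fv.scale_left_distrib fv.scale_right_distrib sum.distrib)
 show ?P2
  by (intro ext) (simp add: Phimap_def homm_def cmat_def fv.scale_sum_right mult.left_commute mult.commute)
qed

text \<open>The value of a product of linear functions is a sum over permutations; its Koszul signs are for the
 shifted degrees, and \<open>pre_sign\<close> turns them into those of unshifted degrees times the signature.\<close>

lemma lin_x:
 assumes z: "length z = length xs"
 shows "pre_sign n (map fst z)*eps (L*tdeg z)*linprod deg (map xh xs) (map Inl z)
  = eps (SUM k<length xs. fst (xs ! k)*(int (length xs - (k+1))*n+L))
   *(SUM ro | ro permutes {..<length xs}. kf xs ro*(if even n then 1 else perm_sgn ro)*tcw (perm ro xs) z)"
proof -
 let ?ds = "map fst xs"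
 have l: "lhomog deg (map xh xs)"
  unfolding lhomog_def
 proof (safe)
  fix i h x assume "(i, h) \<in> set (map xh xs)" "h x ~= 0"
  then obtain g where "g \<in> set xs" "i = fst g+n" "h = case_sum (co g) (%_. 0)" by (auto simp: xh_def)
  thus "deg x = i" using \<open>h x ~= 0\<close> by (cases x) (auto dest: co_nonzero)
 qed
 have s: "pre_sign n ?ds*eps (L*tdeg xs) = (eps (SUM k<length xs. fst (xs ! k)*(int (length xs - (k+1))*n+L)) :: 'k)"
 proof -
  have "tdeg xs = (SUM k<length xs. fst (xs ! k))" by (simp add: wdeg_def sum_list_sum_nth lessThan_atLeast0)
  thus ?thesis unfolding pre_sign_explicit eps_mult
   by (intro arg_cong[of _ _ eps]) (simp add: sum_distrib_left sum.distrib distrib_left mult.commute)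
 qed
 have "linprod deg (map xh xs) (map Inl z) = (SUM ro | ro permutes {..<length (map xh xs)}.
   koszul (map fst (map xh xs)) ro*(PROD k<length (map xh xs). snd (map xh xs ! ro k) (map Inl z ! k)))"
  by (rule linprod_permutes[OF l]) (simp add: z)
 also have "... = (SUM ro | ro permutes {..<length xs}. koszul (map (%d. d+n) ?ds) ro*tcw (perm ro xs) z)"
  unfolding length_map
 proof (intro sum.cong arg_cong2[of _ _ _ _ "(*)"] refl)
  fix ro assume "ro \<in> {ro. ro permutes {..<length xs}}"
  hence r: "ro permutes {..<length xs}" by simp
  have i: "ro k < length xs" if "k < length xs" for k using permutes_in_image[OF r, of k] that by simp
  show "koszul (map fst (map xh xs)) ro = (koszul (map (%d. d+n) ?ds) ro :: 'k)" by (simp add: comp_def)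
  show "(PROD k<length xs. snd (map xh xs ! ro k) (map Inl z ! k)) = tcw (perm ro xs) z"
   using z by (subst tcw_prod) (auto simp: i xh_def permute_list_nth[OF r] intro!: prod.cong)
 qed
 finally have P: "linprod deg (map xh xs) (map Inl z)
  = (SUM ro | ro permutes {..<length xs}. koszul (map (%d. d+n) ?ds) ro*tcw (perm ro xs) z)" .
 show ?thesis
  unfolding P sum_distrib_left
 proof (intro sum.cong refl, goal_cases)
  case (1 ro)
  hence r: "ro permutes {..<length xs}" by simp
  show ?case
  proof (cases "tcw (perm ro xs) z = 0")
   case False
   from tcw_nonzero[OF this] have f: "map fst z = perm ro ?ds" using r by (simp add: permute_list_map)
   have "map fst z = map fst (perm ro xs)" using f r by (simp add: permute_list_map)
   hence d: "tdeg z = tdeg xs" using wdeg_permute[OF r, of fst] by (simp add: wdeg_def)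
   have p: "perm_sgn ro powi n = (if even n then 1 else perm_sgn ro :: 'k)"
    using perm_sgn_cases[of ro, where ?'k = 'k] by (auto simp: power_int_minus_left)
   have "koszul (map (%d. d+n) ?ds) ro = (koszul ?ds ro*perm_sgn ro powi n*pre_sign n ?ds*pre_sign n (map fst z) :: 'k)"
    unfolding f by (rule koszul_shift) (use r in simp)
   thus ?thesis unfolding d s[symmetric] p by (simp add: mult_ac)
  qed simp
 qed
qed

lemma lhomog_th: assumes ts: "set ts <= DG" shows "lhomog deg (map th ts)"
 unfolding lhomog_def
proof safe
 fix i h x assume "(i, h) \<in> set (map th ts)" "h x ~= 0"
 then obtain t where t: "t \<in> set ts" "i = fst t+1" "h = dfun (snd t)" by (auto simp: th_def)
 have "snd t \<in> grade (dual V) (i - 1)" using ts t(1,2) by auto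
 from dfun_nonzero[OF this, of x] show "deg x = i" using \<open>h x ~= 0\<close> t(3) by simp
qed

lemma lin_y:
 assumes y: "y \<in> words B (length ts)" and ts: "set ts <= DG"
 shows "pre_sign 1 (map (%b. - fst b) y)*linprod deg (map th ts) (map Inr y)
  = eps (SUM j<length ts. fst (ts ! j)*int (length ts - (j+1)))
   *(SUM si | si permutes {..<length ts}. kf ts si*perm_sgn si
     *(PROD k<length ts. snd (ts ! si k) (fst (y ! k)) (snd (y ! k))))"
proof -
 let ?ds = "map fst ts"
 have ly: "length y = length ts" and yB: "!!k. k < length ts ==> y ! k \<in> B" using y by (auto simp: words_def)
 have tG: "snd (ts ! k) \<in> grade (dual V) (fst (ts ! k))" if "k < length ts" for k
  using subsetD[OF ts nth_mem[OF that]] by auto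
 note l = lhomog_th[OF ts]
 have "linprod deg (map th ts) (map Inr y) = (SUM si | si permutes {..<length (map th ts)}.
   koszul (map fst (map th ts)) si*(PROD k<length (map th ts). snd (map th ts ! si k) (map Inr y ! k)))"
  by (rule linprod_permutes[OF l]) (simp add: ly)
 also have "... = (SUM si | si permutes {..<length ts}.
   koszul (map (%d. d+1) ?ds) si*(PROD k<length ts. snd (ts ! si k) (fst (y ! k)) (snd (y ! k))))"
  unfolding length_map
 proof (intro sum.cong arg_cong2[of _ _ _ _ "(*)"] refl)
  fix si assume "si \<in> {ro. ro permutes {..<length ts}}"
  hence r: "si permutes {..<length ts}" by simp
  have i: "si k < length ts" if "k < length ts" for k using permutes_in_image[OF r, of k] that by simp
  show "koszul (map fst (map th ts)) si = (koszul (map (%d. d+1) ?ds) si :: 'k)" by (simp add: comp_def)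
  show "(PROD k<length ts. snd (map th ts ! si k) (map Inr y ! k)) = (PROD k<length ts. snd (ts ! si k) (fst (y ! k)) (snd (y ! k)))"
   by (intro prod.cong refl) (auto simp: i th_def ly yB)
 qed
 finally have P: "linprod deg (map th ts) (map Inr y) = (SUM si | si permutes {..<length ts}.
   koszul (map (%d. d+1) ?ds) si*(PROD k<length ts. snd (ts ! si k) (fst (y ! k)) (snd (y ! k))))" .
 show ?thesis
  unfolding P sum_distrib_left
 proof (intro sum.cong refl, goal_cases)
  case (1 si)
  hence r: "si permutes {..<length ts}" by simp
  have i: "si k < length ts" if "k < length ts" for k using permutes_in_image[OF r, of k] that by simp
  let ?P = "PROD k<length ts. snd (ts ! si k) (fst (y ! k)) (snd (y ! k))"
  show ?case
  proof (cases "?P = 0")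
   case False
   have "- fst (y ! k) = fst (ts ! si k)" if k: "k < length ts" for k
   proof -
    have "snd (ts ! si k) (fst (y ! k)) (snd (y ! k)) ~= 0" using False k by (meson finite_lessThan lessThan_iff prod_zero)
    thus ?thesis using dual_gradeD(1)[OF tG[OF i[OF k]] B_grade[OF yB[OF k]]] by force
   qed
   hence f: "map (%b. - fst b) y = perm si ?ds"
    using r by (intro nth_equalityI) (simp_all add: ly permute_list_nth i)
   have "koszul (map (%d. d+1) ?ds) si = (koszul ?ds si*perm_sgn si powi 1*pre_sign 1 ?ds*pre_sign 1 (map (%b. - fst b) y) :: 'k)"
    unfolding f by (rule koszul_shift) (use r in simp)
   moreover have "pre_sign 1 ?ds = (eps (SUM j<length ts. fst (ts ! j)*int (length ts - (j+1))) :: 'k)"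
    unfolding pre_sign_explicit by (intro arg_cong[of _ _ eps]) simp
   ultimately show ?thesis by (simp add: mult_ac)
  qed simp
 qed
qed

lemma mlin_L_B:
 fixes c :: "(nat => nat) => (nat => nat) => int list => 'k"
 assumes ts: "set ts <= DG"
 shows "mlin (length ts) (%ys. SUM si | si permutes {..<length ts}. SUM ro | ro permutes {..<length xs}.
     fscl (c si ro (map fst ys)*(PROD k<length ts. snd (ts ! si k) (fst (ys ! k)) (snd (ys ! k))))
      (pt (perm ro xs)))"
proof -
 have P: "(PROD k<length ts. snd (ts ! si k) (fst ((u@(i, x)#v) ! k)) (snd ((u@(i, x)#v) ! k)))
   = snd (ts ! si (length u)) i x*(PROD k:{..<length ts} - {length u}. snd (ts ! si k) (fst ((u@(i, 0)#v) ! k)) (snd ((u@(i, 0)#v) ! k)))"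
  if "length u+length v+1 = length ts" for u v i x si
 proof -
  have "length u \<in> {..<length ts}" using that by simp
  show ?thesis unfolding prod.remove[OF finite_lessThan \<open>length u \<in> {..<length ts}\<close>]
   by (intro arg_cong2[of _ _ _ _ "(*)"] prod.cong refl) (auto simp: nth_append nth_Cons')
 qed
 have th: "snd (ts ! si (length u)) \<in> grade (dual V) (fst (ts ! si (length u)))"
  if "length u+length v+1 = length ts" "si permutes {..<length ts}" for u v :: "(int \<times> 'v) list" and si
 proof -
  have "si (length u) < length ts" using permutes_in_image[OF that(2), of "length u"] that(1) by simp
  from subsetD[OF ts nth_mem[OF this]] show ?thesis by auto
 qed
 show ?thesis
 proof (rule mlinI, goal_cases)
  case (1 u v i x y)
  note a = 1(3-5)
  show ?case
   unfolding P[OF a(1)] sum.distrib[symmetric]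
  proof (intro sum.cong refl, goal_cases)
   case (1 si ro)
   hence s: "si permutes {..<length ts}" by simp
   show ?case
    unfolding dual_gradeD(2)[OF th[OF a(1) s] a(2,3)] distrib_right distrib_left fv.scale_left_distrib by simp
  qed
 next
  case (2 u v i r x)
  note a = 2(3,4)
  show ?case
   unfolding P[OF a(1)] fv.scale_sum_right
  proof (intro sum.cong refl, goal_cases)
   case (1 si ro)
   hence s: "si permutes {..<length ts}" by simp
   show ?case
    unfolding dual_gradeD(3)[OF th[OF a(1) s] a(2)] by (simp add: mult_ac)
  qed
 qed
qed

text \<open>
 The formula that defines \<open>\<Phi>\<close>. The value of a monomial at a sorted word splits
 into the sums over \<rho> and \<sigma> of L_B, by \<open>sh_split\<close> and \<open>lin_x\<close>,
 \<open>lin_y\<close>.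
\<close>

lemma Phimap_monomial:
 assumes xs: "set xs <= TG" and ts: "set ts <= DG"
 shows "Phimap (length xs) l (pol_monomial V n xs ts) =
     (if l = length ts
      then scl (homl V (length xs) l)
       (sg (SUM k<length xs. fst (xs ! k)*(int (length xs - (k+1))*n+int l))
       *sg (SUM j<l. fst (ts ! j)*int (l - (j+1))))
       (L_B V n xs ts)
      else 0)"
proof -
 let ?m = "length xs"
 let ?c = "cmat (\<beta> (pol_monomial V n xs ts))"
 have c: "?c z y = sgnf z y*(linprod deg (map xh xs) (map Inl z)*linprod deg (map th ts) (map Inr y))" for z y
  unfolding cmat_def pol_monomial(2)[OF xs ts]
  by (subst linprod_sorted) (auto simp: xh_def th_def split: sum.splits)
 note lt = lhomog_th[OF ts]
 show ?thesis
 proof (cases "l = length ts")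
  case False
  have "?c z y = 0" if "y \<in> words B l" for z y
   using linprod_length[of deg "map th ts" "map Inr y", OF _ lt] that False unfolding c
   by (cases "linprod deg (map th ts) (map Inr y) = 0") (auto simp: words_def)
  hence "homm ?m l ?c j t = 0" for j t by (simp add: homm_def)
  thus ?thesis using False by (simp add: Phimap_def fun_eq_iff)
 next
  case True
  let ?s1 = "SUM k<?m. fst (xs ! k)*(int (?m - (k+1))*n+int l)"
  let ?s2 = "SUM j<l. fst (ts ! j)*int (l - (j+1))"
  let ?cc = "%si ro ds. (kf xs ro*(if even n then 1 else perm_sgn ro))
       *(kf ts si*perm_sgn si)
       *koszul ds (%i. length ts - 1 - i) :: 'k"
  let ?P = "%si ys. PROD k<length ts. snd (ts ! si k) (fst (ys ! k)) (snd (ys ! k))"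
  let ?G = "%ys. SUM si | si permutes {..<length ts}. SUM ro | ro permutes {..<?m}. fscl (?cc si ro (map fst ys)*?P si ys) (pt (perm ro xs))"
  have M: "mlin (length ts) ?G" by (rule mlin_L_B[OF ts])
  have xl: "xs \<in> lists TG" using xs by auto
  have G: "fscl (eps ?s1*eps ?s2) (?G y) = (SUM z:words B ?m. fscl (?c z y) (pt z))" if y: "y \<in> words B l" for y
  proof -
   have r: "kf y (%i. length ts - 1 - i) = (revs (map fst y) :: 'k)"
    using koszul_rev[of "map fst y", where ?'k = 'k] y True by (simp add: words_def)
   have p: "pt (perm ro xs) = (SUM z:words B ?m. fscl (tcw (perm ro xs) z) (pt z))" if "ro permutes {..<?m}" for ro
    using Tens_basis[OF pt_Tens[OF permute_lists[OF xl that]]] by simp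
   have "fscl (eps ?s1*eps ?s2) (?G y) = (SUM si | si permutes {..<length ts}. SUM ro | ro permutes {..<?m}. SUM z:words B ?m.
     fscl (eps ?s1*eps ?s2*(?cc si ro (map fst y)*?P si y)*tcw (perm ro xs) z) (pt z))"
    unfolding fv.scale_sum_right
   proof (intro sum.cong refl, goal_cases)
    case (1 si ro)
    hence r: "ro permutes {..<?m}" by simp
    show ?case
     unfolding p[OF r] fv.scale_sum_right fv.scale_scale by (simp only: mult.assoc)
   qed
   also have "... = (SUM z:words B ?m. SUM si | si permutes {..<length ts}. SUM ro | ro permutes {..<?m}.
     fscl (eps ?s1*eps ?s2*(?cc si ro (map fst y)*?P si y)*tcw (perm ro xs) z) (pt z))"
    unfolding sum.swap[of _ "words B ?m"] ..
   also have "... = (SUM z:words B ?m. fscl (?c z y) (pt z))"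
   proof (intro sum.cong refl, goal_cases)
    case (1 z)
    note z = 1(1)
    have lz: "length z = ?m" and ly: "length y = l" using z y by (simp_all add: words_def)
    let ?X = "%ro. kf xs ro*(if even n then 1 else perm_sgn ro)*tcw (perm ro xs) z"
    let ?Y = "%si. kf ts si*perm_sgn si*?P si y"
    have "?c z y = (pre_sign n (map fst z)*eps (int l*tdeg z)*linprod deg (map xh xs) (map Inl z))
      *(pre_sign 1 (map (%b. - fst b) y)*linprod deg (map th ts) (map Inr y))*revs (map fst y)"
     unfolding c sgnf_def ly by (simp only: mult_ac)
    also have "... = (eps ?s1*(SUM ro | ro permutes {..<?m}. ?X ro))*(eps ?s2*(SUM si | si permutes {..<length ts}. ?Y si))*revs (map fst y)"
     unfolding lin_x[OF lz] using lin_y[OF y[unfolded True] ts] True by simp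
    also have "... = eps ?s1*eps ?s2*revs (map fst y)*((SUM si | si permutes {..<length ts}. ?Y si)*(SUM ro | ro permutes {..<?m}. ?X ro))"
     by (simp only: mult_ac)
    also have "... = (SUM si | si permutes {..<length ts}. SUM ro | ro permutes {..<?m}. eps ?s1*eps ?s2*revs (map fst y)*(?Y si*?X ro))"
     unfolding sum_product unfolding sum_distrib_left ..
    also have "... = (SUM si | si permutes {..<length ts}. SUM ro | ro permutes {..<?m}.
      eps ?s1*eps ?s2*(?cc si ro (map fst y)*?P si y)*tcw (perm ro xs) z)"
     unfolding r by (intro sum.cong refl) (simp only: mult_ac)
    finally show ?case
     by (simp only: fv.scale_sum_left)
   qed
   finally show ?thesis .
  qed
  have "homm ?m l ?c j t = fscl (eps ?s1*eps ?s2) (L_B V n xs ts j t)" for j t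
  proof (cases "t \<in> gT l j")
   case t: True
   have "L_B V n xs ts j t = tlin (length ts) ?G t" using t True by (simp only: L_B_def if_True)
   also have "... = (SUM y:words B (length ts). fscl (tco t y) (?G y))" by (rule tlin_expand[OF M TensE(2)[OF t]])
   finally have "fscl (eps ?s1*eps ?s2) (L_B V n xs ts j t) = (SUM y:words B l. fscl (tco t y) (fscl (eps ?s1*eps ?s2) (?G y)))"
    unfolding True by (simp only: fv.scale_sum_right fv.scale_scale mult_ac)
   also have "... = homm ?m l ?c j t" using t by (simp only: homm_def if_True) (intro sum.cong refl, simp only: G)
   finally show ?thesis by simp
  next
   case False
   thus ?thesis using True by (simp add: homm_def L_B_def)
  qed
  thus ?thesis using True by (simp add: Phimap_def hom_scl sg_eps fun_eq_iff)
 qed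
qed

lemma is_Phi_Phimap: "is_Phi V n Phimap"
 unfolding is_Phi_def
 by (intro conjI allI impI Phimap_monomial) (simp_all add: linear_on_def Phimap_lin hom_scl)

text \<open>
 The polyvector monomials of basis elements span each weight, so a linear map with the prescribed
 values on monomials is unique.
\<close>

lemma is_Phi_unique:
 assumes Q: "is_Phi V n Q" and P: "P \<in> Pol_wt FF n m i"
 shows "Q m l P = Phimap m l P"
proof -
 have lin: "F (x+y) = F x+F y" "F (fscl c x) = (%j t. fscl c (F x j t))"
  if "F = Q m l \<or> F = Phimap m l" "x \<in> Pol_wt FF n m i" "y \<in> Pol_wt FF n m i" for F x y c
  using Q is_Phi_Phimap that unfolding is_Phi_def linear_on_def hom_scl scl_PP scl_Tens by blast+
 have Z: "0 \<in> Pol_wt FF n m i" by (simp add: Pol_wt_eq PP_0 wthom_def)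
 have F0: "F 0 = 0" if "F = Q m l \<or> F = Phimap m l" for F using lin(1)[OF that Z Z] by simp
 have W: "x+y \<in> Pol_wt FF n m i" if "x \<in> Pol_wt FF n m i" "y \<in> Pol_wt FF n m i" for x y
  using that by (auto simp: Pol_wt_eq PP_add wthom_def) (metis add_0)
 have Wc: "fscl c x \<in> Pol_wt FF n m i" if "x \<in> Pol_wt FF n m i" for x c
  using that by (auto simp: Pol_wt_eq PP_fscl wthom_def)
 have S: "sum h I \<in> Pol_wt FF n m i & Q m l (sum h I) = Phimap m l (sum h I)"
  if "!!x. x \<in> I ==> h x \<in> Pol_wt FF n m i & Q m l (h x) = Phimap m l (h x)" for h and I :: "'z set"
  using that
 proof (induction I rule: infinite_finite_induct)
  case (insert x I)
  have a: "h x \<in> Pol_wt FF n m i" "sum h I \<in> Pol_wt FF n m i" "Q m l (h x) = Phimap m l (h x)"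
   "Q m l (sum h I) = Phimap m l (sum h I)" using insert by auto
  show ?case using insert(1,2) W[OF a(1,2)] lin(1)[OF disjI1[OF refl] a(1,2)] lin(1)[OF disjI2[OF refl] a(1,2)] a by simp
 qed (simp_all add: Z F0)
 obtain K where K: "P = (SUM l<=K. SUM u:words B m. SUM v:words B l.
   fscl (\<beta> P (sw u v) / (fact m*fact l)) (pol_monomial V n u (map dg v)))"
  "!!u v l. u \<in> words B m ==> v \<in> words B l ==> \<beta> P (sw u v) ~= 0 ==> pol_monomial V n u (map dg v) \<in> Pol_wt FF n m i"
  using Pol_expand[OF P] by blast
 let ?S = "SUM l<=K. SUM u:words B m. SUM v:words B l. fscl (\<beta> P (sw u v) / (fact m*fact l)) (pol_monomial V n u (map dg v))"
 have "?S \<in> Pol_wt FF n m i & Q m l ?S = Phimap m l ?S"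
 proof (intro S)
  fix l' u v assume uv: "u \<in> words B m" "v \<in> words B l'"
  show "fscl (\<beta> P (sw u v) / (fact m*fact l')) (pol_monomial V n u (map dg v)) \<in> Pol_wt FF n m i &
   Q m l (fscl (\<beta> P (sw u v) / (fact m*fact l')) (pol_monomial V n u (map dg v)))
   = Phimap m l (fscl (\<beta> P (sw u v) / (fact m*fact l')) (pol_monomial V n u (map dg v)))"
  proof (cases "\<beta> P (sw u v) = 0")
   case True
   thus ?thesis using F0 Z by simp
  next
   case False
   note t = K(2)[OF uv False]
   have lu: "length u = m" using uv by (simp add: words_def)
   have "Q (length u) l (pol_monomial V n u (map dg v)) = Phimap (length u) l (pol_monomial V n u (map dg v))"
    using Q is_Phi_Phimap pol_monomial_basis(3,4)[OF uv] unfolding is_Phi_def by (metis (no_types, lifting))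
   thus ?thesis using Wc[OF t] lin(2)[OF disjI1[OF refl] t t] lin(2)[OF disjI2[OF refl] t t] lu by simp
  qed
 qed
 thus ?thesis unfolding K(1)[symmetric] by simp
qed

lemma Phi_Phimap: "P \<in> Pol_wt FF n m i ==> Phi V n m l P = Phimap m l P"
 by (rule is_Phi_unique[OF someI[of "is_Phi V n", OF is_Phi_Phimap, folded Phi_def]])

end

lemma dC_append: "dC deg X D f (u@v) = dC deg X D (%u. f (u@v)) u+eps (wdeg deg u)*dC deg X D (%v. f (u@v)) v"
 by (induction u arbitrary: f) (simp_all add: eps_add algebra_simps)

lemma sum_pairs: "(SUM (a, b):{(a, b). a+b = (N :: nat)}. F a b) = (SUM a<=N. F a (N - a))"
proof -
 have "{(a, b). a+b = N} = (%a. (a, N - a)) ` {..N}" by force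
 thus ?thesis by (simp add: sum.reindex inj_on_def)
qed

lemma finite_pairs: "finite {(a, b). a+b = (N :: nat)}"
 by (rule finite_subset[of _ "{..N} \<times> {..N}"]) auto

context fin_cplx
begin

section \<open>The image of the isomorphism\<close>

lemma mat_lin: "mat (L+L') z y = mat L z y+mat L' z y" "mat (scl (homl V m l) c L) z y = c*mat L z y"
 "mat 0 z y = 0" "mat (sum g S) z y = (SUM s:S. mat (g s) z y)"
 by (simp_all add: mat_def hom_scl sum_fun_apply2 tco_sum)

lemma mat_Phimap:
 assumes P: "P \<in> Pol_wt FF n m i"
 shows "Phimap m l P \<in> gH m l (i - int m*n - int l)" (is ?P1)
  "z \<in> words B m ==> y \<in> words B l ==> mat (Phimap m l P) z y = cmat (\<beta> P) z y"
proof -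
 have "tdeg z = tdeg y+(i - int m*n - int l)" if "z \<in> words B m" "y \<in> words B l" "cmat (\<beta> P) z y ~= 0" for z y
 proof -
  have "\<beta> P (sw z y) ~= 0" using that(3) by (auto simp: cmat_def)
  hence "wdeg deg (sw z y) = i" using PP_gradeE(4)[of P i] P by (auto simp: Pol_wt_eq homog_def)
  thus ?thesis using that(1,2) by (simp only: wdeg_sw) (simp add: words_def)
 qed
 note h = homm[of m l "cmat (\<beta> P)", OF this]
 show ?P1 unfolding Phimap_def by (rule h(1))
 show "z \<in> words B m ==> y \<in> words B l ==> mat (Phimap m l P) z y = cmat (\<beta> P) z y"
  unfolding Phimap_def by (rule h(2))
qed

lemma Phimap_hom_sym:
 assumes P: "P \<in> Pol_wt FF n m i"
 shows "Phimap m l P \<in> hom_sym V n m l (i - int m*n - int l)"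
proof (rule hom_symI[OF mat_Phimap(1)[OF P]])
 have f: "\<beta> P \<in> swapsym deg" using Symf_swapsym[OF PP_gradeE(3)[of P i]] P by (simp add: Pol_wt_eq)
 {
  fix si z y assume a: "si permutes {..<l}" "z \<in> words B m" "y \<in> words B l"
  have s: "si permutes {..<length y}" using a by (simp add: words_def)
  show "mat (Phimap m l P) z (perm si y) = kf y si*perm_sgn si*mat (Phimap m l P) z y"
   unfolding mat_Phimap(2)[OF P a(2,3)] mat_Phimap(2)[OF P a(2) permute_words[OF a(3,1)]] cmat_def swapsym_sw_permute(2)[OF f s]
   by (simp only: mult.assoc[symmetric] sgnf_permute(2)[OF s])
 }
 {
  fix si z y assume a: "si permutes {..<m}" "z \<in> words B m" "y \<in> words B l"
  have s: "si permutes {..<length z}" using a by (simp add: words_def)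
  show "mat (Phimap m l P) (perm si z) y = kf z si*perm_sgn si powi n*mat (Phimap m l P) z y"
   unfolding mat_Phimap(2)[OF P a(2,3)] mat_Phimap(2)[OF P permute_words[OF a(2,1)] a(3)] cmat_def swapsym_sw_permute(1)[OF f s]
   by (simp only: mult.assoc[symmetric] sgnf_permute(1)[OF s])
 }
qed

lemma Pol_sorted_zero: "P \<in> Pol_wt FF n m i ==> length z ~= m ==> \<beta> P (sw z y) = 0"
 using wt_sw[of z y] unfolding Pol_wt_eq wthom_def by force

lemma Phimap_finite:
 assumes P: "P \<in> Pol_wt FF n m i" shows "finite {l. Phimap m l P ~= 0}"
proof -
 obtain K where K: "!!w. \<beta> P w ~= 0 ==> length w <= K" using Symf_bound[OF PP_gradeE(3)[of P i]] P by (auto simp: Pol_wt_eq)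
 have "Phimap m l P = 0" if "l > K" for l
 proof -
  have "\<beta> P (sw z y) = 0" if "y \<in> words B l" for z y
   using K[of "sw z y"] that \<open>l > K\<close> by (force simp: words_def)
  thus ?thesis by (simp add: Phimap_def homm_def cmat_def fun_eq_iff)
 qed
 hence "{l. Phimap m l P ~= 0} <= {..K}" by (auto simp: not_le[symmetric])
 thus ?thesis by (rule finite_subset) simp
qed

text \<open>
 The matrices are the values at sorted words, up to sign, and these determine a symmetric function.
\<close>

lemma Phimap_inj:
 assumes P: "P \<in> Pol_wt FF n m i" and Q: "Q \<in> Pol_wt FF n m i" and e: "!!l. Phimap m l P = Phimap m l Q"
 shows "P = Q"
proof (rule PP_eqI)
 show g: "P \<in> grade PP i" "Q \<in> grade PP i" using P Q by (simp_all add: Pol_wt_eq)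
 show "\<beta> P = \<beta> Q"
 proof (rule sorted_eqI[OF PP_gradeE(3)[OF g(1)] PP_gradeE(3)[OF g(2)]])
  fix z y assume zy: "set z <= B" "set y <= B"
  show "\<beta> P (sw z y) = \<beta> Q (sw z y)"
  proof (cases "length z = m")
   case True
   hence w: "z \<in> words B m" "y \<in> words B (length y)" using zy by (simp_all add: words_def)
   have "cmat (\<beta> P) z y = cmat (\<beta> Q) z y"
    using mat_Phimap(2)[OF P w] mat_Phimap(2)[OF Q w] e by simp
   thus ?thesis unfolding cmat_def by (metis sgnf_self_left)
  qed (simp add: Pol_sorted_zero[OF P] Pol_sorted_zero[OF Q])
 qed
qed

text \<open>
 The preimage is the symmetrization of the matrices divided by \<open>sgnf\<close>; it is a bounded
 function as only finitely many maps are nonzero.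
\<close>

lemma Phimap_surj:
 assumes h: "!!l. h l \<in> hom_sym V n m l (i - int m*n - int l)" and fin: "finite {l. h l ~= 0}"
 shows "EX P:Pol_wt FF n m i. ALL l. Phimap m l P = h l"
proof -
 obtain K where K: "!!l. h l ~= 0 ==> l <= K" using finite_nat_set_iff_bounded_le[THEN iffD1, OF fin] by auto
 have g: "h l \<in> gH m l (i - int m*n - int l)" for l using h[of l] by (simp add: hom_sym_def)
 (* sgnf is its own inverse. *)
 define C where "C u v = sgnf u v*mat (h (length v)) u v" for u v
 let ?f = "asm m K C"
 have fh: "?f \<in> homog deg i"
 proof (rule asm_homog)
  fix u v assume uv: "u \<in> words B m" "set v <= B" "C u v ~= 0"
  have v: "v \<in> words B (length v)" using uv(2) by (simp add: words_def)
  have "mat (h (length v)) u v ~= 0" using uv(3) by (auto simp: C_def)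
  from mat_nonzero(2)[OF g v this] show "wdeg deg (sw u v) = i"
   using uv(1) by (simp only: wdeg_sw) (simp add: words_def)
 qed
 obtain P where P: "P \<in> grade PP i" "\<beta> P = ?f" using PP_back[OF asm_Symf fh] by blast
 have Pw: "P \<in> Pol_wt FF n m i" using P by (simp add: Pol_wt_eq asm_wthom)
 have "Phimap m l P = h l" for l
 proof (rule hom_eqI[OF mat_Phimap(1)[OF Pw] g])
  fix z y assume z: "z \<in> words B m" and y: "y \<in> words B l"
  have lz: "length z = m" and ly: "length y = l" using z y by (simp_all add: words_def)
  have "?f (sw z y) = C z y"
  proof (cases "l <= K")
   case True
   show ?thesis
   proof (rule asm_sorted[OF z y True])
    fix ro v assume r: "ro permutes {..<m}" and v: "v \<in> words B l"
    have r': "ro permutes {..<length z}" using r lz by simp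
    have lv: "length v = l" using v by (simp add: words_def)
    have "C (perm ro z) v = sgnf (perm ro z) v*(kf z ro*perm_sgn ro powi n)*mat (h l) z v"
     unfolding C_def lv hom_symD(2)[OF h z v r] by (simp only: mult.assoc)
    also have "kf z ro*perm_sgn ro powi n = sgnf (perm ro z) v*kI z ro*sgnf z v"
     unfolding sgnf_permute(1)[OF r'] by (simp only: mult.assoc sgnf_self mult_1_right)
    finally show "C (perm ro z) v = kI z ro*C z v"
     unfolding C_def lv by (simp add: mult.assoc)
   next
    fix si assume s: "si permutes {..<l}"
    have s': "si permutes {..<length y}" using s ly by simp
    have "C z (perm si y) = sgnf z (perm si y)*(kf y si*perm_sgn si)*mat (h l) z y"
     unfolding C_def length_permute_list ly hom_symD(1)[OF h z y s] by (simp only: mult.assoc)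
    also have "kf y si*perm_sgn si = sgnf z (perm si y)*kJ y si*sgnf z y"
     unfolding sgnf_permute(2)[OF s'] by (simp only: mult.assoc sgnf_self mult_1_right)
    finally show "C z (perm si y) = kJ y si*C z y"
     unfolding C_def ly by (simp add: mult.assoc)
   qed
  next
   case False
   have "?f (sw z y) = 0"
    unfolding asm_def monomial_sorted
   proof (intro sum.neutral ballI, goal_cases)
    case (1 l' u v)
    hence "monomial deg (map Inr v) (map Inr y) = (0 :: 'k)"
     using monomial_length[of "map Inr v" "map Inr y"] False ly
     by (cases "monomial deg (map Inr v) (map Inr y) = (0 :: 'k)") (auto simp: words_def)
    thus ?case by simp
   qed
   moreover have "h l = 0" using K[of l] False by blast
   ultimately show ?thesis by (simp add: C_def ly mat_lin)
  qed
  thus "mat (Phimap m l P) z y = mat (h l) z y"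
   unfolding mat_Phimap(2)[OF Pw z y] cmat_def P(2) by (simp add: C_def ly)
 qed
 thus ?thesis using Pw by blast
qed

section \<open>The differential on sorted words\<close>

lemma ps_app: "pre_sign n (map fst (z@z')) = eps (n*tdeg z*int (length z'))*pre_sign n (map fst z)*pre_sign n (map fst (z' :: (int \<times> 'v) list))"
 by (simp add: pre_sign_append wdeg_def)

lemma p1_app: "pre_sign 1 (map (%b. - fst b) (y@y')) = eps (tdeg y*int (length y'))*pre_sign 1 (map (%b. - fst b) y)*pre_sign 1 (map (%b. - fst b) (y' :: (int \<times> 'v) list))"
proof -
 have "sum_list (map (%b. - fst b) y) = - tdeg y" by (induction y) simp_all
 thus ?thesis by (simp add: pre_sign_append)
qed

lemma revs_app: "revs (map fst (y@y')) = eps (tdeg y*tdeg y')*revs (map fst y)*revs (map fst (y' :: (int \<times> 'v) list))"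
 by (simp add: revs_append wdeg_def)

lemma sgnf_update:
 assumes "fst c = fst b+1"
 shows "sgnf (u@c#v) y = eps (n*int (length v)+int (length y))*sgnf (u@b#v) y" (is ?P1)
  "sgnf z (u@b#v) = eps (int (length v)+tdeg u+tdeg v)*sgnf z (u@c#v)" (is ?P2)
proof -
 have 1: "pre_sign n (map fst (g#v)) = eps (n*fst g*int (length v))*pre_sign n (map fst v)" for g :: "int \<times> 'v" by simp
 have 2: "pre_sign 1 (map (%b. - fst b) (g#v)) = eps (fst g*int (length v))*pre_sign 1 (map (%b. - fst b) v)" for g :: "int \<times> 'v" by simp
 have 3: "revs (map fst (g#v)) = eps (fst g*tdeg v)*revs (map fst v)" for g :: "int \<times> 'v" by (simp add: wdeg_def)
 show ?P1
  unfolding sgnf_def ps_app 1 by (simp add: assms eps_add algebra_simps)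
 show ?P2
  unfolding sgnf_def p1_app 2 revs_app 3 by (simp add: assms eps_add algebra_simps)
qed

lemma dP_Inl: "dP f (map Inl z) = (SUM k<length z. eps (tdeg (take k z)+int k*n)*(SUM b:B. eps n*dm b (z ! k)*f (map Inl (take k z@b#drop (Suc k) z))))"
 unfolding dC_explicit sum_XP length_map
proof (intro sum.cong refl, goal_cases)
 case (1 k)
 hence k: "k < length z" by simp
 have "wdeg deg (take k (map Inl z)) = tdeg (take k z)+int k*n"
  using wdeg_sw[of "take k z" "[]"] k by (simp add: take_map)
 moreover have "(map Inl z)[k := Inl b] = (map Inl (take k z@b#drop (Suc k) z) :: 'v lbl list)" for b
  using k by (simp only: map_update[symmetric] upd_conv_take_nth_drop)
 ultimately show ?case
  using k by simp
qed

lemma dP_Inr: "dP f (map Inr y) = (SUM k<length y. eps (int k+tdeg (take k y))*(SUM b:B. eps (fst b)*dm (y ! k) b*f (map Inr (take k y@b#drop (Suc k) y))))"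
 unfolding dC_explicit sum_XP length_map
proof (intro sum.cong refl, goal_cases)
 case (1 k)
 hence k: "k < length y" by simp
 have "wdeg deg (take k (map Inr y)) = int k - tdeg (take k y)"
  using wdeg_sw[of "[]" "take k y"] k by (simp add: take_map)
 hence "eps (wdeg deg (take k (map Inr y))) = (eps (int k+tdeg (take k y)) :: 'k)" by (simp only: eps_add eps_diff)
 moreover have "(map Inr y)[k := Inr b] = (map Inr (take k y@b#drop (Suc k) y) :: 'v lbl list)" for b
  using k by (simp only: map_update[symmetric] upd_conv_take_nth_drop)
 ultimately show ?case
  using k by simp
qed

abbreviation "PW m \<equiv> Pol_wt FF n m (n+2)"
abbreviation "ed m l \<equiv> (1 - int m)*n+2 - int l"

text \<open>
 On both sides the differential acts on one letter at a time. The overall sign is that of the shift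
 by mn + l; the signs in \<open>Dm\<close> compensate for the change of \<open>sgnf\<close> when the
 degree of a letter changes by 1.
\<close>

lemma mat_dif:
 assumes P: "P \<in> PW m" and z: "z \<in> words B m" and y: "y \<in> words B l"
 defines "e \<equiv> (1 - int m)*n+2 - int l"
 shows "sgnf z y*dP (\<beta> P) (sw z y) = eps (int m*n+int l)*mat (dif (homl V m l) e (Phimap m l P)) z y"
proof -
 let ?f = "\<beta> P" and ?L = "Phimap m l P"
 have e: "e = n+2 - int m*n - int l" by (simp add: e_def algebra_simps)
 note L = mat_Phimap(1)[OF P, of l, folded e]
 have lz: "length z = m" and ly: "length y = l" using z y by (simp_all add: words_def)
 have zw: "take k z@b#drop (Suc k) z \<in> words B m" if "b \<in> B" "k < m" for k b
  using that z set_take_subset[of k z] set_drop_subset[of "Suc k" z] by (auto simp: words_def)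
 have yw: "take k y@b#drop (Suc k) y \<in> words B l" if "b \<in> B" "k < l" for k b
  using that y set_take_subset[of k y] set_drop_subset[of "Suc k" y] by (auto simp: words_def)
 have c: "?f (sw z y) = sgnf z y*mat ?L z y" if "z \<in> words B m" "y \<in> words B l" for z y
  unfolding mat_Phimap(2)[OF P that] cmat_def by simp
 have 1: "sgnf z y*dP (%u. ?f (u@map Inr y)) (map Inl z)
   = eps (int m*n+int l)*dC fst B dm (%z. mat ?L z y) z"
  unfolding dP_Inl unfolding dC_explicit sum_distrib_left lz
 proof (intro sum.cong refl, goal_cases)
  case (1 k b)
  note b = 1(2)
  from 1 have k: "k < m" by simp
  let ?u = "take k z" and ?v = "drop (Suc k) z"
  show ?case
  proof (cases "dm b (z ! k) = 0")
   case False
   hence fb: "fst (z ! k) = fst b+1" using dm_nonzero by blast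
   have zk: "z = ?u@z ! k#?v" using k lz by (simp add: id_take_nth_drop)
   have "int (length ?v) = int m - 1 - int k" using k lz by simp
   hence s: "sgnf z y = eps (n*(int m - 1 - int k)+int l)*sgnf (?u@b#?v) y"
    using sgnf_update(1)[OF fb, of ?u ?v y] zk ly by simp
   have "eps (n*(int m - 1 - int k)+int l+(tdeg ?u+int k*n)+n) = (eps (int m*n+int l+tdeg ?u) :: 'k)"
    by (rule eps_cong) auto
   hence ee: "eps (n*(int m - 1 - int k)+int l)*eps (tdeg ?u+int k*n)*eps n = (eps (int m*n+int l)*eps (tdeg ?u) :: 'k)"
    by (simp only: eps_mult add.assoc)
   have up: "z[k := b] = ?u@b#?v" using k lz by (simp only: upd_conv_take_nth_drop)
   have "sgnf z y*(eps (tdeg ?u+int k*n)*(eps n*dm b (z ! k)*?f (map Inl (?u@b#?v)@map Inr y)))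
     = (eps (n*(int m - 1 - int k)+int l)*eps (tdeg ?u+int k*n)*eps n)*(dm b (z ! k)*(sgnf (?u@b#?v) y*(sgnf (?u@b#?v) y*mat ?L (?u@b#?v) y)))"
    unfolding c[OF zw[OF b k] y] unfolding s by (simp only: mult_ac)
   thus ?thesis unfolding ee up sgnf_self_left by (simp only: mult_ac)
  qed simp
 qed
 have 2: "sgnf z y*(eps (tdeg z+int m*n)*dP (%v. ?f (map Inl z@v)) (map Inr y))
   = eps (int m*n+int l)*(- eps e*dC fst B (%b b'. dm b' b) (mat ?L z) y)"
  unfolding dP_Inr unfolding dC_explicit sum_distrib_left ly
 proof (intro sum.cong refl, goal_cases)
  case (1 k b)
  note b = 1(2)
  from 1 have k: "k < l" by simp
  let ?u = "take k y" and ?v = "drop (Suc k) y"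
  show ?case
  proof (cases "dm (y ! k) b = 0 \<or> mat ?L z (?u@b#?v) = 0")
   case False
   hence fb: "fst b = fst (y ! k)+1" and nz: "mat ?L z (?u@b#?v) ~= 0" using dm_nonzero by blast+
   have yk: "y = ?u@y ! k#?v" using k ly by (simp add: id_take_nth_drop)
   have "int (length ?v) = int l - 1 - int k" using k ly by simp
   hence s: "sgnf z y = eps (int l - 1 - int k+tdeg ?u+tdeg ?v)*sgnf z (?u@b#?v)"
    using sgnf_update(2)[OF fb, of z ?u ?v] yk by simp
   have d: "tdeg z = tdeg ?u+fst b+tdeg ?v+e" using mat_nonzero(2)[OF L yw[OF b k] nz] by simp
   have "eps (int l - 1 - int k+tdeg ?u+tdeg ?v+(tdeg z+int m*n)+(int k+tdeg ?u)+fst b)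
     = (eps (int m*n+int l+(e+1)+tdeg ?u) :: 'k)"
    unfolding d by (rule eps_cong) auto
   hence ee: "eps (int l - 1 - int k+tdeg ?u+tdeg ?v)*eps (tdeg z+int m*n)*eps (int k+tdeg ?u)*eps (fst b)
     = (eps (int m*n+int l)*(- eps e)*eps (tdeg ?u) :: 'k)"
    by (simp only: eps_mult minus_eps add.assoc)
   have up: "y[k := b] = ?u@b#?v" using k ly by (simp only: upd_conv_take_nth_drop)
   have "sgnf z y*(eps (tdeg z+int m*n)*(eps (int k+tdeg ?u)*(eps (fst b)*dm (y ! k) b*?f (map Inl z@map Inr (?u@b#?v)))))
     = (eps (int l - 1 - int k+tdeg ?u+tdeg ?v)*eps (tdeg z+int m*n)*eps (int k+tdeg ?u)*eps (fst b))
      *(dm (y ! k) b*(sgnf z (?u@b#?v)*(sgnf z (?u@b#?v)*mat ?L z (?u@b#?v))))"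
    unfolding c[OF z yw[OF b k]] unfolding s by (simp only: mult_ac)
   thus ?thesis unfolding ee up sgnf_self_left by (simp only: mult_ac)
  next
   case True
   have up: "y[k := b] = ?u@b#?v" using k ly by (simp only: upd_conv_take_nth_drop)
   show ?thesis using True unfolding c[OF z yw[OF b k]] up by auto
  qed
 qed
 have w: "wdeg deg (map Inl z) = tdeg z+int m*n" using wdeg_sw[of z "[]"] lz by simp
 show ?thesis unfolding dC_append w distrib_left 1 2 dif_hom(2)[OF L y] by (simp add: algebra_simps)
qed


section \<open>The bracket on sorted words\<close>

text \<open>
 The part of \<open>pb\<close> in which an input letter of f is contracted with an output letter of
 g.
\<close>

definition half :: "('v lbl list => 'k) => ('v lbl list => 'k) => 'v lbl list => 'k" where
 "half f g w = (SUM b:B. eps (fst b)*sh deg (%u. f (u@[Inr b])) (%u. g (Inl b#u)) w)"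

text \<open>
 By antisymmetry the other part of \<open>pb\<close> is the first one for g and f. In degree n + 2
 the shifted degree is 1, so the sign is +.
\<close>

lemma pb_half:
 assumes f: "f \<in> swapsym deg" "f \<in> homog deg (n+2)" and g: "g \<in> swapsym deg" "g \<in> homog deg (n+2)"
 shows "pb f g w = half f g w+half g f w"
proof -
 have "eps ((fst b - 1)*(n+1))*sh deg (%u. f (u@[Inl b])) (%u. g (Inr b#u)) w
   = eps (fst b)*sh deg (%u. g (u@[Inr b])) (%u. f (Inl b#u)) w" for b
 proof -
  have "eps ((fst b - 1)*(n+1)+(deg (Inl b)*(n+2 - deg (Inl b))+deg (Inr b)*(n+2 - deg (Inr b))
    +(n+2 - deg (Inr b))*(n+2 - deg (Inl b)))) = (eps (fst b) :: 'k)"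
   by (rule eps_cong) auto
  thus ?thesis unfolding sh_swap_ends[OF g f] eps_mult_left by simp
 qed
 thus ?thesis by (simp add: pb_def half_def sum.distrib)
qed

lemma half_zero: "half (%w. 0) g w = 0" "half f (%w. 0) w = 0"
 by (simp_all add: half_def)

lemma half_wthom:
 assumes f: "f \<in> wthom wtP m1" and g: "g \<in> wthom wtP (Suc k)"
 shows "half f g \<in> wthom wtP (m1+k)"
proof -
 have F: "(%u. f (u@[Inr b])) \<in> wthom wtP m1" and G: "(%u. g (Inl b#u)) \<in> wthom wtP k" for b
  using f g by (fastforce simp: wthom_def)+
 have "half f g w = 0" if "(SUM x<-w. wtP x) ~= m1+k" for w
 proof -
  have "sh deg (%u. f (u@[Inr b])) (%u. g (Inl b#u)) \<in> wthom wtP (m1+k)" for b by (rule wthom_sh[OF F G])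
  hence "sh deg (%u. f (u@[Inr b])) (%u. g (Inl b#u)) w = 0" for b using that unfolding wthom_def by blast
  thus ?thesis by (simp add: half_def)
 qed
 thus ?thesis unfolding wthom_def by blast
qed

text \<open>The exponents of the two signs in \<open>sgnf_star\<close>, as polynomials in the degrees and lengths.\<close>

lemma star_parity:
 fixes N m1 m2 q l a b r :: int
 shows "even (N*(N+2 - m1*N - (q+1)+a+b)*(m2 - 1)+(q+l)*(N+2 - m1*N - (q+1)+a+b+r)
   +a*l+a*(b+r+m2*N+l - N - 2)+b+(r+(m2 - 1)*N)*(q - a))
  = even (((1 - m1)*N+2 - (q+1))*((m2 - 1)*N+l - 1)+N*(m2 - 1)*(q+1 - 1)
   +((1 - m2)*N+2 - l)*a
   +(q+1)*(N+2 - m1*N - (q+1)+a+b)+a*1+a*b+N*b*(m2 - 1)+l*(b+r))"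
 by (cases "even N"; cases "even m1"; cases "even m2"; cases "even q"; cases "even l"; cases "even a"; cases "even b"; cases "even r";
   simp only: even_add even_mult_iff even_diff even_numeral odd_one simp_thms)

text \<open>
 The assumptions on the degrees state that both maps have total degree n + 2; they eliminate the
 degrees of z1 and y2, after which the comparison of signs is a parity check.
\<close>

lemma sgnf_star:
 assumes l: "int (length z2) = int m2 - 1"
  and d1: "tdeg z1 = n+2 - int m1*n - (int (length y1)+1)+tdeg y1+fst b"
  and d2: "tdeg y2 = fst b+tdeg z2+int m2*n+int (length y2) - n - 2"
 shows "sgnf (z1@z2) (y1@y2)*(eps (fst b)*eps (wdeg deg (map Inl z2)*wdeg deg (map Inr y1)))
  = eps ((ed m1 (length y1+1))*((int m2 - 1)*n+int (length y2) - 1)+n*(int m2 - 1)*(int (length y1+1) - 1))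
   *(eps ((ed m2 (length y2))*tdeg y1)*(sgnf z1 (y1@[b])*sgnf (b#z2) y2))"
proof -
 let ?q = "int (length y1)" and ?l = "int (length y2)"
 define C where "C = pre_sign n (map fst z1)*pre_sign n (map fst z2)*pre_sign 1 (map (%b. - fst b) y1)
  *pre_sign 1 (map (%b. - fst b) y2)*revs (map fst y1)*(revs (map fst y2) :: 'k)"
 have w: "wdeg deg (map Inl z2) = tdeg z2+(int m2 - 1)*n" "wdeg deg (map Inr y1) = ?q - tdeg y1"
  using wdeg_sw[of z2 "[]"] wdeg_sw[of "[]" y1] l by simp_all
 have t: "tdeg (z1@z2) = tdeg z1+tdeg z2" "tdeg (b#z2) = fst b+tdeg z2" by simp_all
 have c: "pre_sign n (map fst (b#z2)) = (eps (n*fst b*(int m2 - 1))*pre_sign n (map fst z2) :: 'k)"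
  "pre_sign 1 (map (%b. - fst b) [b]) = (1 :: 'k)" "revs (map fst [b]) = (1 :: 'k)" "tdeg [b] = fst b" "int (length [b]) = 1"
  using l by simp_all
 have L: "sgnf (z1@z2) (y1@y2) = eps (n*tdeg z1*(int m2 - 1))*eps ((?q+?l)*(tdeg z1+tdeg z2))
   *eps (tdeg y1*?l)*eps (tdeg y1*tdeg y2)*C"
  unfolding sgnf_def ps_app p1_app revs_app t l length_append of_nat_add C_def by (simp only: mult_ac)
 have R: "sgnf z1 (y1@[b])*sgnf (b#z2) y2 = eps ((?q+1)*tdeg z1)*eps (tdeg y1*1)*eps (tdeg y1*fst b)
   *eps (n*fst b*(int m2 - 1))*eps (?l*(fst b+tdeg z2))*C"
  unfolding sgnf_def p1_app revs_app t c length_append of_nat_add C_def by (simp only: mult_ac mult_1_right mult_1)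
 have "eps (n*tdeg z1*(int m2 - 1)+(?q+?l)*(tdeg z1+tdeg z2)+tdeg y1*?l+tdeg y1*tdeg y2
   +fst b+(tdeg z2+(int m2 - 1)*n)*(?q - tdeg y1))
  = (eps ((ed m1 (length y1+1))*((int m2 - 1)*n+?l - 1)+n*(int m2 - 1)*(int (length y1+1) - 1)
   +((1 - int m2)*n+2 - ?l)*tdeg y1
   +(?q+1)*tdeg z1+tdeg y1*1+tdeg y1*fst b+n*fst b*(int m2 - 1)+?l*(fst b+tdeg z2)) :: 'k)"
  unfolding d1 d2 of_nat_add of_nat_1 by (rule eps_cong) (rule star_parity)
 hence e: "eps (n*tdeg z1*(int m2 - 1))*eps ((?q+?l)*(tdeg z1+tdeg z2))*eps (tdeg y1*?l)*eps (tdeg y1*tdeg y2)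
   *eps (fst b)*eps ((tdeg z2+(int m2 - 1)*n)*(?q - tdeg y1))
  = eps ((ed m1 (length y1+1))*((int m2 - 1)*n+?l - 1)+n*(int m2 - 1)*(int (length y1+1) - 1))
   *eps (((1 - int m2)*n+2 - ?l)*tdeg y1)
   *eps ((?q+1)*tdeg z1)*eps (tdeg y1*1)*eps (tdeg y1*fst b)*eps (n*fst b*(int m2 - 1))*(eps (?l*(fst b+tdeg z2)) :: 'k)"
  by (simp only: eps_mult)
 show ?thesis unfolding L R w using arg_cong[OF e, of "%x. x*C"] by (simp only: mult_ac)
qed

text \<open>
 The product at a sorted word distributes first the letters \<open>Inl\<close>, then the letters
 \<open>Inr\<close>. As f has weight m1, exactly m1 of the former go to f, while any number q of the
 latter may do so.
\<close>

lemma half_sorted: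
 assumes f: "f \<in> wthom wtP m1" and z: "length z = m1+k"
 shows "half f g (sw z y) = (SUM b:B. SUM ro:shuffles m1 k. SUM q<=length y. SUM si:shuffles q (length y - q).
   eps (fst b)*(kI z ro*(kJ y si *
    (eps (wdeg deg (map Inl (drop m1 (perm ro z)))*wdeg deg (map Inr (take q (perm si y))))
    *f (sw (take m1 (perm ro z)) (take q (perm si y)@[b]))
    *g (sw (b#drop m1 (perm ro z)) (drop q (perm si y)))))))"
 unfolding half_def
proof (intro sum.cong refl, goal_cases)
 case (1 b)
 define F where "F = (%u. f (u@[Inr b]))"
 define G where "G = (%u. g (Inl b#u))"
 have pl: "perm ro (map Inl z) = map Inl (perm ro z)" if "ro permutes {..<length z}" for ro
  using permute_list_map[OF that] .
 have 1: "sh deg F G (sw z y) = (SUM ro:shuffles m1 k. kI z ro *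
   sh deg (%v. eps (wdeg deg (map Inl (drop m1 (perm ro z)))*wdeg deg v)*F (map Inl (take m1 (perm ro z))@v))
    (%v. G (map Inl (drop m1 (perm ro z))@v)) (map Inr y))" (is "_ = sum ?S _")
 proof -
  have "sh deg F G (sw z y) = (SUM p<=length z. if p = m1 then sum ?S (shuffles m1 k) else 0)"
   unfolding sh_shuffles length_map
  proof (intro sum.cong refl, goal_cases)
   case (1 p)
   hence p: "p <= length z" by simp
   have r: "ro permutes {..<length z}" if "ro \<in> shuffles p (length z - p)" for ro using shufflesD(1)[OF that] p by simp
   show ?case
   proof (cases "p = m1")
    case True
    hence k: "length z - p = k" using z by simp
    show ?thesis using True r unfolding k
     by (auto simp: pl comp_def take_map drop_map intro!: sum.cong)
   next
    case False
    have "sh deg (%v. eps (wdeg deg (drop p (perm ro (map Inl z)))*wdeg deg v)*F (take p (perm ro (map Inl z))@v))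
     (%v. G (drop p (perm ro (map Inl z))@v)) (map Inr y) = 0" (is "?s = 0") if "ro \<in> shuffles p (length z - p)" for ro
    proof (rule ccontr)
     assume "?s ~= 0"
     from sh_nonzero[OF this] obtain u v where uv: "F (take p (perm ro (map Inl z))@u) ~= 0" "mset (map Inr y) = mset u+mset v" by auto
     have "set (map Inr y) = set u \<union> set v" using uv(2) by (metis set_mset_mset set_mset_union)
     hence "set u <= range Inr" by auto
     hence "(SUM x<-u. wtP x) = 0" by (induction u) auto
     moreover have "(SUM x<-take p (perm ro (map Inl z)). wtP x) = p"
      unfolding pl[OF r[OF that]] take_map using p wt_sw[of "take p (perm ro z)" "[]"] by (simp add: min_def)
     ultimately have "(SUM x<-(take p (perm ro (map Inl z))@u)@[Inr b]. wtP x) = p" by simp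
     moreover have "(SUM x<-(take p (perm ro (map Inl z))@u)@[Inr b]. wtP x) = m1"
      using f uv(1) unfolding F_def wthom_def by blast
     ultimately show False using False by simp
    qed
    thus ?thesis using False by simp
   qed
  qed
  thus ?thesis using z by simp
 qed
 have 2: "sh deg F' G' (map Inr y) = (SUM q<=length y. SUM si:shuffles q (length y - q). kJ y si *
    (F' (map Inr (take q (perm si y)))*G' (map Inr (drop q (perm si y)))))" (is "_ = ?R") for F' G' :: "'v lbl list => 'k"
 proof -
  have "sh deg F' G' (map Inr y) = sh deg F' G' (map Inr y@[])" by simp
  also have "... = ?R"
   unfolding sh_shuffles length_map
  proof (intro sum.cong refl, goal_cases)
   case (1 q si)
   hence "si permutes {..<length y}" using shufflesD(1)[of si q "length y - q"] by simp
   hence "perm si (map Inr y) = (map Inr (perm si y) :: 'v lbl list)" by (rule permute_list_map)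
   thus ?case
    by (simp add: take_map drop_map comp_def)
  qed
  finally show ?thesis .
 qed
 show ?case
  using 1 unfolding 2 unfolding F_def G_def sum_distrib_left by (simp only: map_append append_assoc list.map append_Cons sum_distrib_left)
qed

lemma sign_transport:
 fixes s :: 'k
 assumes "s1*kz = A*p*s" "s2*ky = C*d*s1" and sq: "kz*kz = 1" "ky*ky = 1" "A*A = 1" "p*p = 1" "C*C = 1" "d*d = 1"
 shows "s*(kz*ky) = A*p*(C*d)*s2"
proof -
 have "A*p*(s1*kz) = (A*A)*(p*p)*s" unfolding assms(1) by (simp only: mult_ac)
 hence 1: "s = A*p*(s1*kz)" by (simp add: sq)
 have "C*d*(s2*ky) = (C*C)*(d*d)*s1" unfolding assms(2) by (simp only: mult_ac)
 hence 2: "s1 = C*d*(s2*ky)" by (simp add: sq)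
 have "s*(kz*ky) = A*p*(C*d)*s2*(kz*kz)*(ky*ky)" unfolding 1 2 by (simp only: mult_ac)
 thus ?thesis by (simp add: sq)
qed

text \<open>
 The summands correspond one by one: the shuffles of \<open>Inl\<close> letters to those of the
 outputs, the shuffles of \<open>Inr\<close> letters to those of the inputs, and b to the contracted
 vector.
\<close>

lemma half_star:
 assumes P: "P \<in> PW m1" and Q: "Q \<in> PW m2" and m: "m2 > 0" "m1+m2 = m+1"
  and z: "z \<in> words B m" and y: "y \<in> words B l"
 shows "sgnf z y*half (\<beta> P) (\<beta> Q) (sw z y) = (SUM q<=l.
   eps ((ed m1 (q+1))*((int m2 - 1)*n+int (l - q) - 1)+n*(int m2 - 1)*(int (q+1) - 1))
   *mat (star V n m1 (q+1) m2 (l - q) (ed m2 (l - q)) (Phimap m1 (q+1) P) (Phimap m2 (l - q) Q)) z y)"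
proof -
 obtain k where k: "m2 = Suc k" using m(1) by (cases m2) auto
 have lz: "length z = m1+k" and ly: "length y = l" using z y m k by (simp_all add: words_def)
 let ?S = "%q. star V n m1 (q+1) m2 (l - q) (ed m2 (l - q)) (Phimap m1 (q+1) P) (Phimap m2 (l - q) Q)"
 let ?f = "\<beta> P" and ?g = "\<beta> Q"
 let ?kz = "%ro. kI z ro :: 'k" and ?ky = "%si. kJ y si :: 'k"
 let ?z1 = "%ro. take m1 (perm ro z)" and ?z2 = "%ro. drop m1 (perm ro z)"
 let ?y1 = "%q si. take q (perm si y)" and ?y2 = "%q si. drop q (perm si y)"
 let ?SG = "%q. eps ((ed m1 (q+1))*((int m2 - 1)*n+int (l - q) - 1)+n*(int m2 - 1)*(int (q+1) - 1)) :: 'k"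
 let ?T = "%q si ro b. ?SG q*(perm_sgn si*perm_sgn ro powi n*(kf y si*kf z ro *
    eps ((ed m2 (l - q))*tdeg (?y1 q si)) *
    (cmat ?f (?z1 ro) (?y1 q si@[b])*cmat ?g (b#?z2 ro) (?y2 q si))))"
 have "sgnf z y*half ?f ?g (sw z y) = (SUM b:B. SUM ro:shuffles m1 k. SUM q<=l. SUM si:shuffles q (l - q). ?T q si ro b)"
  unfolding half_sorted[OF _ lz, of ?f ?g y, OF P[unfolded Pol_wt_eq, simplified, THEN conjunct2]] sum_distrib_left ly
 proof (intro sum.cong refl, goal_cases)
  case (1 b ro q si)
  note b = 1(1) and r = 1(2) and q = 1(3) and s = 1(4)
  have r': "ro permutes {..<length z}" using shufflesD(1)[OF r] lz by simp
  have s': "si permutes {..<length y}" using shufflesD(1)[OF s] ly q by simp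
  let ?W = "eps (fst b)*eps (wdeg deg (map Inl (?z2 ro))*wdeg deg (map Inr (?y1 q si)))" and ?FG = "?f (sw (?z1 ro) (?y1 q si@[b]))*?g (sw (b#?z2 ro) (?y2 q si))"
  have l1: "length (?z1 ro) = m1" "length (?z2 ro) = k" "length (?y1 q si) = q" "length (?y2 q si) = l - q"
   using lz ly q by simp_all
  have K: "sgnf z y*(?kz ro*?ky si) = kf z ro*perm_sgn ro powi n*(kf y si*perm_sgn si)
    *sgnf (perm ro z) (perm si y)"
  proof -
   have "(perm_sgn ro powi n :: 'k)*perm_sgn ro powi n = 1" "(perm_sgn si :: 'k)*perm_sgn si = 1"
    using perm_sgn_cases[of ro, where ?'k = 'k] perm_sgn_cases[of si, where ?'k = 'k]
    by (auto simp: power_int_minus_left)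
   from sign_transport[OF sgnf_permute(1)[OF r', of y] sgnf_permute(2)[OF s', of "perm ro z"] koszul_self(1) koszul_self(1)
     koszul_self(1) this(1) koszul_self(1) this(2)]
   show ?thesis .
  qed
  show ?case
  proof (cases "?f (sw (?z1 ro) (?y1 q si@[b])) = 0 \<or> ?g (sw (b#?z2 ro) (?y2 q si)) = 0")
   case False
   hence "wdeg deg (sw (?z1 ro) (?y1 q si@[b])) = n+2" "wdeg deg (sw (b#?z2 ro) (?y2 q si)) = n+2"
    using PP_gradeE(4)[of P "n+2"] PP_gradeE(4)[of Q "n+2"] P Q unfolding Pol_wt_eq homog_def by blast+
   hence d: "tdeg (?z1 ro) = n+2 - int m1*n - (int (length (?y1 q si))+1)+tdeg (?y1 q si)+fst b"
    "tdeg (?y2 q si) = fst b+tdeg (?z2 ro)+int m2*n+int (length (?y2 q si)) - n - 2"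
    unfolding wdeg_sw using l1 k by (simp_all add: algebra_simps)
   have S: "sgnf (perm ro z) (perm si y)*?W
    = ?SG q*(eps ((ed m2 (l - q))*tdeg (?y1 q si))*(sgnf (?z1 ro) (?y1 q si@[b])*sgnf (b#?z2 ro) (?y2 q si)))"
    using sgnf_star[OF _ d] unfolding l1 append_take_drop_id by (simp add: k)
   have "sgnf z y*(eps (fst b)*(?kz ro*(?ky si*(eps (wdeg deg (map Inl (?z2 ro))*wdeg deg (map Inr (?y1 q si)))
    *?f (sw (?z1 ro) (?y1 q si@[b]))*?g (sw (b#?z2 ro) (?y2 q si))))))
    = (sgnf z y*(?kz ro*?ky si))*?W
    *?FG" by (simp only: mult_ac)
   also have "... = kf z ro*perm_sgn ro powi n*(kf y si*perm_sgn si)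
    *(sgnf (perm ro z) (perm si y)*?W)
    *?FG" unfolding K by (simp only: mult_ac)
   also have "... = ?T q si ro b" unfolding S cmat_def by (simp only: mult_ac)
   finally show ?thesis .
  qed (auto simp: cmat_def)
 qed
 also have "... = (SUM q<=l. SUM si:shuffles q (l - q). SUM ro:shuffles m1 k. SUM b:B. ?T q si ro b)"
 proof -
  have "(SUM b:B. SUM ro:shuffles m1 k. SUM q<=l. SUM si:shuffles q (l - q). ?T q si ro b)
    = (SUM q<=l. SUM b:B. SUM ro:shuffles m1 k. SUM si:shuffles q (l - q). ?T q si ro b)"
   unfolding sum.swap[of _ "{..l}"] ..
  also have "... = (SUM q<=l. SUM si:shuffles q (l - q). SUM ro:shuffles m1 k. SUM b:B. ?T q si ro b)"
  proof (intro sum.cong refl, goal_cases)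
   case (1 q)
   have "(SUM b:B. SUM ro:shuffles m1 k. SUM si:shuffles q (l - q). ?T q si ro b)
     = (SUM ro:shuffles m1 k. SUM b:B. SUM si:shuffles q (l - q). ?T q si ro b)" by (rule sum.swap)
   also have "... = (SUM ro:shuffles m1 k. SUM si:shuffles q (l - q). SUM b:B. ?T q si ro b)"
    by (intro sum.cong refl) (rule sum.swap)
   also have "... = (SUM si:shuffles q (l - q). SUM ro:shuffles m1 k. SUM b:B. ?T q si ro b)" by (rule sum.swap)
   finally show ?case .
  qed
  finally show ?thesis .
 qed
 also have "... = (SUM q<=l. ?SG q*mat (?S q) z y)"
 proof (intro sum.cong refl, goal_cases)
  case (1 q)
  hence q: "q <= l" by simp
  have e2: "n+2 - int m2*n - int (l - q) = ed m2 (l - q)" by (simp add: algebra_simps)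
  note L1 = mat_Phimap(1)[OF P, of "q+1"] and L2 = mat_Phimap(1)[OF Q, of "l - q", unfolded e2]
  have w: "z \<in> words B (m1+m2 - 1)" "y \<in> words B (q+1+(l - q) - 1)" using z y m q by simp_all
  have M: "mat (?S q) z y
   = (SUM si:shuffles q (l - q). SUM ro:shuffles m1 k. perm_sgn si*perm_sgn ro powi n *
    sterm (mat (Phimap m1 (q+1) P)) (mat (Phimap m2 (l - q) Q)) (ed m2 (l - q)) m1 q si ro z y)"
   using star(2)[OF L1 L2 _ m(1) w] by (simp add: k)
  show ?case
   unfolding M sum_distrib_left
  proof (intro sum.cong refl, goal_cases)
   case (1 si ro b)
   note s = 1(1) and r = 1(2) and b = 1(3)
   have pz: "perm ro z \<in> words B (m1+k)" using shufflesD(1)[OF r] w(1) k by (intro permute_words) simp_all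
   have py: "perm si y \<in> words B l" using shufflesD(1)[OF s] y q by (intro permute_words) simp_all
   have ws: "?z1 ro \<in> words B m1" "b#?z2 ro \<in> words B m2" "?y1 q si@[b] \<in> words B (q+1)" "?y2 q si \<in> words B (l - q)"
    using pz py b q k by (auto simp: words_def dest: in_set_takeD in_set_dropD)
   show ?case
    unfolding mat_Phimap(2)[OF P ws(1,3)] mat_Phimap(2)[OF Q ws(2,4)] ..
  qed
 qed
 finally show ?thesis .
qed


section \<open>The Maurer-Cartan equation\<close>

abbreviation "pairs m \<equiv> {(m1, m2). m1+m2 = m+(1 :: nat)}"
abbreviation "pairs2 m \<equiv> {(m1, m2). 2 <= m1 & 2 <= m2 & m1+m2 = m+(1 :: nat)}"

text \<open>
 The component of weight m of the Maurer-Cartan equation; the bracket lowers the total weight by 1.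
\<close>

definition mc :: "(nat => (('v, 'k) free_el, 'k) pol) => nat => (('v, 'k) free_el, 'k) pol" where
 "mc \<pi> m = dif (shift (n+1) PP) 1 (\<pi> m)
  +scl PP (1 / 2) (SUM (m1, m2):pairs m. schouten FF n (\<pi> m1) (\<pi> m2))"

definition fam :: "(nat => nat => int => ((int \<times> 'v) list \<Rightarrow>\<^sub>0 'k) => ((int \<times> 'v) list \<Rightarrow>\<^sub>0 'k))
  => nat => nat => int => ((int \<times> 'v) list \<Rightarrow>\<^sub>0 'k) => ((int \<times> 'v) list \<Rightarrow>\<^sub>0 'k)" where
 "fam \<psi> m l = scl (homl V m l) (sg ((int m - 1)*n+int l - 1))
       (dif (homl V m l) (ed m l) (\<psi> m l))
      +(SUM (m1, m2):pairs2 m. SUM (l1, l2):pairs l.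
         scl (homl V m l)
          (sg ((ed m1 l1)*((int m2 - 1)*n+int l2 - 1))
          *sg (n*(int m2 - 1)*(int l1 - 1)))
          (star V n m1 l1 m2 l2 (ed m2 l2) (\<psi> m1 l1) (\<psi> m2 l2)))"

lemma mc_wt:
 assumes \<pi>: "!!m. \<pi> m \<in> PW m" and 0: "ALL m<2. \<pi> m = 0"
 shows "mc \<pi> m \<in> grade PP (n+3)"
  "\<beta> (mc \<pi> m) w = eps (n+1)*dP (\<beta> (\<pi> m)) w+(SUM (m1, m2):pairs2 m. half (\<beta> (\<pi> m1)) (\<beta> (\<pi> m2)) w)"
proof -
 have g: "\<pi> m \<in> grade PP (n+2)" for m using \<pi>[of m] by (simp add: Pol_wt_eq)
 have d: "dif (shift (n+1) PP) 1 (\<pi> m) = fscl (eps (n+1)) (dif PP (n+2) (\<pi> m))"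
 proof -
  have i: "1+(n+1) = n+2" by simp
  show ?thesis unfolding shift_def by (simp only: cplx.simps i sg_eps scl_PP)
 qed
 note D = PP_dif[OF g[of m]]
 have D1: "dif PP (n+2) (\<pi> m) \<in> grade PP (n+3)" using D(1) by (simp add: add.assoc)
 have S: "schouten FF n (\<pi> m1) (\<pi> m2) \<in> grade PP (n+3)" "\<beta> (schouten FF n (\<pi> m1) (\<pi> m2)) = pb (\<beta> (\<pi> m1)) (\<beta> (\<pi> m2))" for m1 m2
  using schouten[OF g[of m1] g[of m2]] by (simp_all add: algebra_simps)
 show "mc \<pi> m \<in> grade PP (n+3)" unfolding mc_def d scl_PP
  by (intro PP_add PP_fscl PP_sum D1) (auto intro: S)
 let ?f = "%m. \<beta> (\<pi> m)"
 have sw: "?f m \<in> swapsym deg" "?f m \<in> homog deg (n+2)" for m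
  using PP_gradeE(3,4)[OF g[of m]] Symf_swapsym by auto
 have z: "?f m = (%w. 0)" if "m < 2" for m using 0 that by (simp add: fun_eq_iff)
 have "(SUM (m1, m2):pairs m. pb (?f m1) (?f m2) w) = (SUM (m1, m2):pairs m. half (?f m1) (?f m2) w)+(SUM (m1, m2):pairs m. half (?f m2) (?f m1) w)"
  by (simp add: pb_half[OF sw sw] case_prod_unfold sum.distrib)
 (* The index set is symmetric, so both halves give the same sum and 1/2 cancels. *)
 also have "(SUM (m1, m2):pairs m. half (?f m2) (?f m1) w) = (SUM (m1, m2):pairs m. half (?f m1) (?f m2) w)"
  by (rule sum.reindex_bij_witness[of _ prod.swap prod.swap]) auto
 also have "(SUM (m1, m2):pairs m. half (?f m1) (?f m2) w) = (SUM (m1, m2):pairs2 m. half (?f m1) (?f m2) w)"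
 proof (rule sum.mono_neutral_right[OF finite_pairs])
  show "ALL p:pairs m - pairs2 m. (case p of (m1, m2) => half (?f m1) (?f m2) w) = 0"
  proof
   fix p assume "p \<in> pairs m - pairs2 m"
   then obtain m1 m2 where p: "p = (m1, m2)" "m1 < 2 \<or> m2 < 2" by (cases p) auto
   show "(case p of (m1, m2) => half (?f m1) (?f m2) w) = 0"
    using p(2) by (elim disjE) (simp_all add: p(1) z half_zero)
  qed
 qed auto
 finally have "(SUM (m1, m2):pairs m. pb (?f m1) (?f m2) w) = 2*(SUM (m1, m2):pairs2 m. half (?f m1) (?f m2) w)" by simp
 moreover have "\<beta> (mc \<pi> m) w = eps (n+1)*dP (?f m) w+1 / 2*(SUM (m1, m2):pairs m. pb (?f m1) (?f m2) w)"
  by (simp add: mc_def d D(2) ev_sum case_prod_unfold S(2))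
 ultimately show "\<beta> (mc \<pi> m) w = eps (n+1)*dP (?f m) w+(SUM (m1, m2):pairs2 m. half (?f m1) (?f m2) w)" by simp
qed

lemma dP_wthom: assumes f: "f \<in> wthom wtP m" shows "dP f \<in> wthom wtP m"
proof -
 have i: "wdeg (%x. int (wtP x)) w = int (SUM x<-w. wtP x)" for w by (induction w) simp_all
 have "(SUM x<-w. wtP x) = m" if "dP f w ~= 0" for w
 proof -
  have "int (wtP x) = int (wtP x')+0" if "Dm x' x ~= 0" for x x' using that by (cases x; cases x') auto
  from dC_nonzero[OF \<open>dP f w ~= 0\<close>, of "%x. int (wtP x)" 0, OF this] obtain w' where "f w' ~= 0"
   "wdeg (%x. int (wtP x)) w = wdeg (%x. int (wtP x)) w'" by auto
  thus ?thesis using f unfolding i wthom_def by force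
 qed
 thus ?thesis unfolding wthom_def by blast
qed

lemma mc_Pol:
 assumes \<pi>: "!!m. \<pi> m \<in> PW m" and 0: "ALL m<2. \<pi> m = 0"
 shows "mc \<pi> m \<in> Pol_wt FF n m (n+3)"
proof -
 have w: "\<beta> (\<pi> m) \<in> wthom wtP m" for m using \<pi>[of m] by (simp add: Pol_wt_eq)
 have "\<beta> (mc \<pi> m) w = 0" if "(SUM x<-w. wtP x) ~= m" for w
 proof -
  have "dP (\<beta> (\<pi> m)) w = 0" using dP_wthom[OF w[of m]] that by (auto simp: wthom_def)
  moreover have "half (\<beta> (\<pi> m1)) (\<beta> (\<pi> m2)) w = 0" if p: "(m1, m2) \<in> pairs2 m" for m1 m2
  proof -
   obtain k where k: "m2 = Suc k" "m = m1+k" using p by (cases m2) auto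
   show ?thesis using half_wthom[OF w[of m1] w[of m2, unfolded k(1)]] \<open>(SUM x<-w. wtP x) ~= m\<close> unfolding k(2) k(1) wthom_def by blast
  qed
  ultimately show ?thesis unfolding mc_wt(2)[OF \<pi> 0] by (auto intro!: sum.neutral)
 qed
 hence "\<beta> (mc \<pi> m) \<in> wthom wtP m" unfolding wthom_def by blast
 thus ?thesis using mc_wt(1)[OF \<pi> 0] by (simp add: Pol_wt_eq)
qed

lemma hom_sum_mem: "(!!s. s \<in> S ==> g s \<in> gH m l e) ==> sum g S \<in> gH m l e"
 by (induction S rule: infinite_finite_induct) (auto intro: hom_zero[OF gspace_Tens] hom_add[OF gspace_Tens])

text \<open>
 Of the sign in front of the differential, (-1)^{n+1} comes from the shift of Pol(A, n) by n + 1 and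
 (-1)^{mn+l} from \<open>mat_dif\<close>.
\<close>

lemma fam_mc:
 assumes \<pi>: "!!m. \<pi> m \<in> PW m" and 0: "ALL m<2. \<pi> m = 0"
 defines "\<psi> \<equiv> %m l. Phimap m l (\<pi> m)"
 shows "fam \<psi> m l \<in> gH m l (ed m l+1)" (is ?P1)
  "z \<in> words B m ==> y \<in> words B l ==> mat (fam \<psi> m l) z y = sgnf z y*\<beta> (mc \<pi> m) (sw z y)"
proof -
 have e: "n+2 - int m*n - int l = ed m l" for m l by (simp add: algebra_simps)
 have L: "\<psi> m l \<in> gH m l (ed m l)" for m l
  unfolding \<psi>_def e[symmetric] by (rule mat_Phimap(1)[OF \<pi>])
 have st: "star V n m1 l1 m2 l2 (ed m2 l2) (\<psi> m1 l1) (\<psi> m2 l2) \<in> gH m l (ed m l+1)"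
  if m: "(m1, m2) \<in> pairs2 m" and l: "(l1, l2) \<in> pairs l" for m1 m2 l1 l2
 proof (cases "l1 = 0")
  case True
  thus ?thesis by (simp add: star_def hom_zero[OF gspace_Tens])
 next
  case False
  have m': "m1+m2 - 1 = m" "l1+l2 - 1 = l" "m2 > 0" "l1 > 0" using m l False by auto
  have mi: "int m = int m1+int m2 - 1" "int l = int l1+int l2 - 1" using m' by auto
  have X: "ed m1 l1+(ed m2 l2) = ed m l+1"
   unfolding mi by (simp add: algebra_simps)
  from star(1)[OF L[of m1 l1] L[of m2 l2] m'(4,3)] show ?thesis unfolding m'(1,2) X .
 qed
 show ?P1
  unfolding fam_def
 proof (intro hom_add[OF gspace_Tens] hom_scale[OF gspace_Tens] dif_hom(1)[OF L] hom_sum_mem, goal_cases)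
  case (1 p)
  note p = 1(1)
  obtain m1 m2 where mm: "p = (m1, m2)" by (cases p)
  have "scl (homl V m l) c (star V n m1 l1 m2 l2 (ed m2 l2) (\<psi> m1 l1) (\<psi> m2 l2)) \<in> gH m l (ed m l+1)"
   if "(l1, l2) \<in> pairs l" for l1 l2 c
   by (rule hom_scale[OF gspace_Tens st[OF p[unfolded mm] that]])
  thus ?case
   unfolding mm by (auto intro!: hom_sum_mem)
 qed
 assume z: "z \<in> words B m" and y: "y \<in> words B l"
 have 1: "sg ((int m - 1)*n+int l - 1)*mat (dif (homl V m l) (ed m l) (\<psi> m l)) z y
   = sgnf z y*(eps (n+1)*dP (\<beta> (\<pi> m)) (sw z y))"
 proof -
  have "eps (n+1+(int m*n+int l)) = (eps ((int m - 1)*n+int l - 1) :: 'k)" by (rule eps_cong) auto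
  thus ?thesis unfolding mult.left_commute[of "sgnf z y"] mat_dif[OF \<pi> z y] eps_mult_left \<psi>_def sg_eps by simp
 qed
 have 2: "(SUM (l1, l2):pairs l. sg ((ed m1 l1)*((int m2 - 1)*n+int l2 - 1))*sg (n*(int m2 - 1)*(int l1 - 1))
   *mat (star V n m1 l1 m2 l2 (ed m2 l2) (\<psi> m1 l1) (\<psi> m2 l2)) z y)
  = sgnf z y*half (\<beta> (\<pi> m1)) (\<beta> (\<pi> m2)) (sw z y)" (is "(SUM (l1, l2):pairs l. ?F l1 l2) = _") if p: "(m1, m2) \<in> pairs2 m" for m1 m2
 proof -
  have m: "m2 > 0" "m1+m2 = m+1" using p by auto
  have "(SUM (l1, l2):pairs l. ?F l1 l2) = (SUM a<=Suc l. ?F a (Suc l - a))" using sum_pairs[of ?F "l+1"] by simp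
  also have "... = ?F 0 (Suc l)+(SUM q<=l. ?F (Suc q) (Suc l - Suc q))" by (subst sum.atMost_Suc_shift) (simp only: diff_zero)
  also have "?F 0 (Suc l) = 0" by (simp add: star_def mat_lin)
  also have "0+(SUM q<=l. ?F (Suc q) (Suc l - Suc q)) = sgnf z y*half (\<beta> (\<pi> m1)) (\<beta> (\<pi> m2)) (sw z y)"
   unfolding half_star[OF \<pi> \<pi> m z y] by (simp only: add_0 diff_Suc_Suc) (simp only: Suc_eq_plus1 sg_eps eps_mult \<psi>_def)
  finally show ?thesis .
 qed
 have "mat (fam \<psi> m l) z y = sg ((int m - 1)*n+int l - 1)*mat (dif (homl V m l) (ed m l) (\<psi> m l)) z y
  +(SUM (m1, m2):pairs2 m. SUM (l1, l2):pairs l. sg ((ed m1 l1)*((int m2 - 1)*n+int l2 - 1))*sg (n*(int m2 - 1)*(int l1 - 1))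
   *mat (star V n m1 l1 m2 l2 (ed m2 l2) (\<psi> m1 l1) (\<psi> m2 l2)) z y)"
  unfolding fam_def by (simp only: mat_lin case_prod_unfold)
 also have "... = sgnf z y*(eps (n+1)*dP (\<beta> (\<pi> m)) (sw z y))
  +(SUM (m1, m2):pairs2 m. sgnf z y*half (\<beta> (\<pi> m1)) (\<beta> (\<pi> m2)) (sw z y))"
  unfolding 1
 proof (intro arg_cong2[of _ _ _ _ "(+)"] sum.cong refl, goal_cases)
  case (1 p)
  note p = 1(1)
  obtain m1 m2 where mm: "p = (m1, m2)" by (cases p)
  show ?case
   unfolding mm prod.case by (rule 2[OF p[unfolded mm]])
 qed
 finally show "mat (fam \<psi> m l) z y = sgnf z y*\<beta> (mc \<pi> m) (sw z y)"
  unfolding mc_wt(2)[OF \<pi> 0] by (simp only: distrib_left sum_distrib_left case_prod_unfold)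
qed

text \<open>
 A matrix vanishes iff the map does, and a symmetric function vanishes iff it does so at all sorted
 words.
\<close>

lemma mc_iff_fam:
 assumes \<pi>: "!!m. \<pi> m \<in> PW m" and 0: "ALL m<2. \<pi> m = 0"
 shows "mc \<pi> m = 0 \<longleftrightarrow> (ALL l. fam (%m l. Phimap m l (\<pi> m)) m l = 0)"
proof
 assume "mc \<pi> m = 0"
 hence "mat (fam (%m l. Phimap m l (\<pi> m)) m l) z y = mat 0 z y" if "z \<in> words B m" "y \<in> words B l" for l z y
  using fam_mc(2)[OF \<pi> 0 that] by (simp add: mat_lin)
 thus "ALL l. fam (%m l. Phimap m l (\<pi> m)) m l = 0"
  using hom_eqI[OF fam_mc(1)[OF \<pi> 0] hom_zero[OF gspace_Tens]] by blast
next
 assume F: "ALL l. fam (%m l. Phimap m l (\<pi> m)) m l = 0"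
 note M = mc_Pol[OF \<pi> 0, of m]
 have g: "mc \<pi> m \<in> grade PP (n+3)" using M by (simp add: Pol_wt_eq)
 have "\<beta> (mc \<pi> m) = (%w. 0)"
 proof (rule sorted_eqI[OF PP_gradeE(3)[OF g] Symf_zero])
  fix z y assume zy: "set z <= B" "set y <= B"
  show "\<beta> (mc \<pi> m) (sw z y) = 0"
  proof (cases "length z = m")
   case True
   hence w: "z \<in> words B m" "y \<in> words B (length y)" using zy by (simp_all add: words_def)
   have h: "0 = sgnf z y*\<beta> (mc \<pi> m) (sw z y)"
    using fam_mc(2)[OF \<pi> 0 w] unfolding F[rule_format] mat_lin .
   have "\<beta> (mc \<pi> m) (sw z y) = sgnf z y*(sgnf z y*\<beta> (mc \<pi> m) (sw z y))" unfolding sgnf_self_left ..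
   thus ?thesis unfolding h[symmetric] by simp
  qed (rule Pol_sorted_zero[OF M])
 qed
 thus "mc \<pi> m = 0" using PP_eqI[OF g PP_0] by (simp add: fun_eq_iff)
qed

lemma poisson_structures_iff:
 "\<pi> \<in> poisson_structures FF n \<longleftrightarrow> (ALL m. \<pi> m \<in> PW m) & (ALL m<2. \<pi> m = 0) & (ALL m>=2. mc \<pi> m = 0)"
proof -
 have "mc \<pi> m = 0" if \<pi>: "ALL m. \<pi> m \<in> PW m" and 0: "ALL m<2. \<pi> m = 0" and m: "m < 2" for m
 proof -
  have p: "pairs2 m = {}" using m by auto
  have z: "\<beta> (\<pi> m) = (%w. 0)" using 0 m by (simp add: fun_eq_iff)
  have "\<beta> (mc \<pi> m) w = \<beta> 0 w" for w
   using mc_wt(2)[of \<pi> m w] \<pi> 0 unfolding p z by (simp add: dC_zero)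
  hence "\<beta> (mc \<pi> m) = \<beta> 0" by (rule ext)
  thus ?thesis using PP_eqI[OF mc_wt(1) PP_0] \<pi> 0 by blast
 qed
 thus ?thesis unfolding poisson_structures_def mc_def[symmetric] mem_Collect_eq by (metis not_le)
qed

lemma poisson_families_iff:
 "\<psi> \<in> poisson_families V n \<longleftrightarrow> (ALL m<2. ALL l. \<psi> m l = 0)
   & (ALL m>=2. ALL l. \<psi> m l \<in> hom_sym V n m l (ed m l))
   & (ALL m>=2. finite {l. \<psi> m l ~= 0}) & (ALL m>=2. ALL l. fam \<psi> m l = 0)"
 unfolding poisson_families_def fam_def by simp

lemma Phi_bij: "bij_betw (%\<pi> m l. Phi V n m l (\<pi> m)) (poisson_structures FF n) (poisson_families V n)"
proof -
 have Z: "Phimap m l 0 = 0" for m l using Phimap_lin(1)[of m l 0 0] by simp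
 have Z': "0 \<in> Pol_wt FF n m i" for m i by (simp add: Pol_wt_eq PP_0 wthom_def)
 have e: "n+2 - int m*n - int l = ed m l" for m l by (simp add: algebra_simps)
 let ?T = "%\<pi> m l. Phimap m l (\<pi> m)"
 have T: "(%m l. Phi V n m l (\<pi> m)) = ?T \<pi>" if "\<pi> \<in> poisson_structures FF n" for \<pi>
 proof -
  have "Phi V n m l (\<pi> m) = Phimap m l (\<pi> m)" for m l using that Phi_Phimap poisson_structures_iff by blast
  thus ?thesis by simp
 qed
 have "bij_betw ?T (poisson_structures FF n) (poisson_families V n)"
  unfolding bij_betw_def
 proof (intro conjI inj_onI equalityI subsetI)
  fix \<pi> \<pi>' assume a: "\<pi> \<in> poisson_structures FF n" "\<pi>' \<in> poisson_structures FF n" "?T \<pi> = ?T \<pi>'"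
  have "\<pi> m = \<pi>' m" for m
   by (rule Phimap_inj[of _ m "n+2"]) (use a in \<open>simp_all add: poisson_structures_iff fun_eq_iff\<close>)
  thus "\<pi> = \<pi>'" by (rule ext)
 next
  fix \<psi> assume "\<psi> \<in> ?T ` poisson_structures FF n"
  then obtain \<pi> where \<psi>: "\<psi> = ?T \<pi>" and \<pi>: "\<pi> \<in> poisson_structures FF n" by blast
  have p: "\<pi> m \<in> PW m" and 0: "ALL m<2. \<pi> m = 0" and m: "m >= 2 ==> mc \<pi> m = 0" for m
   using \<pi> unfolding poisson_structures_iff by blast+
  show "\<psi> \<in> poisson_families V n"
   unfolding poisson_families_iff
  proof (intro conjI allI impI)
   fix m l :: nat assume "m < 2"
   thus "\<psi> m l = 0" using 0 Z by (simp add: \<psi>)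
  next
   fix m l
   show "\<psi> m l \<in> hom_sym V n m l (ed m l)"
    unfolding \<psi> e[symmetric] by (rule Phimap_hom_sym[OF p])
  next
   fix m show "finite {l. \<psi> m l ~= 0}" unfolding \<psi> by (rule Phimap_finite[OF p])
  next
   fix m l :: nat assume "m >= 2"
   thus "fam \<psi> m l = 0" using mc_iff_fam[OF p 0, of m] m unfolding \<psi> by blast
  qed
 next
  fix \<psi> assume "\<psi> \<in> poisson_families V n"
  hence \<psi>: "m < 2 ==> \<psi> m l = 0" "m >= 2 ==> \<psi> m l \<in> hom_sym V n m l (ed m l)"
   "m >= 2 ==> finite {l. \<psi> m l ~= 0}" "m >= 2 ==> fam \<psi> m l = 0" for m l
   unfolding poisson_families_iff by blast+
  have "EX P. P \<in> PW m & (ALL l. Phimap m l P = \<psi> m l) & (m < 2 --> P = 0)" for m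
  proof (cases "m < 2")
   case True
   thus ?thesis using \<psi>(1) Z Z' by auto
  next
   case False
   thus ?thesis using Phimap_surj[of "\<psi> m" m "n+2"] \<psi>(2,3) unfolding e by (metis not_le)
  qed
  then obtain \<pi> where \<pi>: "\<pi> m \<in> PW m" "!!l. Phimap m l (\<pi> m) = \<psi> m l" and \<pi>0: "ALL m<2. \<pi> m = 0" for m
   by metis
  have T: "?T \<pi> = \<psi>" using \<pi>(2) by (simp add: fun_eq_iff)
  have "mc \<pi> m = 0" if "m >= 2" for m
   using mc_iff_fam[OF \<pi>(1) \<pi>0, of m] \<psi>(4)[OF that] unfolding T by blast
  hence "\<pi> \<in> poisson_structures FF n" using \<pi>(1) \<pi>0 by (simp add: poisson_structures_iff)
  thus "\<psi> \<in> ?T ` poisson_structures FF n" using T by blast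
 qed
 thus ?thesis using bij_betw_cong[of "poisson_structures FF n" "%\<pi> m l. Phi V n m l (\<pi> m)" ?T] T by blast
qed

end

theorem corollary3p9:
 fixes \<gg> :: "('k::field_char_0, 'v::ab_group_add) cplx" and n :: int
 assumes "cochain_complex \<gg>" and "bounded_cplx \<gg>" and "degreewise_finite_dim \<gg>"
 shows "bij_betw (%\<pi> m l. Phi \<gg> n m l (\<pi> m))
      (poisson_structures (free_cdga \<gg>) n) (poisson_families \<gg> n)"
proof -
 interpret fin_cplx \<gg> n using assms by unfold_locales
 show ?thesis by (rule Phi_bij)
qed

end
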